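(* Let $(G,\psi)$ be a vertex-weighted digraph on $[\ell]$ with $\psi(i)=[a_i,b_i]$, and let $v\in[\ell]$. Assume Condition (Z) holds: there exists an integer $n_0\ge 0$ with $n_0+2\le|\psi(v)|\le n_0+3$ and $n_0+1\le|\psi(i)|\le n_0+3$ for all $i\in[\ell]\setminus\{v\}$. (1) Assume $v$ is a coking in $G$, let $(G',\psi')$ be obtained by the coking elimination operation w.r.t. $v$, and assume $0\in\psi(i)$ for all $i\in[\ell]$ and $[a_i,b_i-1]\subseteq\psi(v)$ for all $i\ne v$. Then $\mathbf{c}\mathcal{A}(G,\psi)$ is free if and only if $\mathbf{c}\mathcal{A}(G',\psi')$ is free. (2) Assume $v$ is a king in $G$, let $(G'',\psi'')$ be obtained by the king elimination operation w.r.t. $v$, and assume $0\in\psi(i)$ for all $i\in[\ell]$ and $[a_i+1,b_i]\subseteq\psi(v)$ for all $i\ne v$. Then $\mathbf{c}\mathcal{A}(G,\psi)$ is free if and only if $\mathbf{c}\mathcal{A}(G'',\psi'')$ is free.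
   Context: For integers $a\le b$, $[a,b]=\{n\in\mathbb{Z}: a\le n\le b\}$ (empty if $a>b$), $[\ell]=[1,\ell]$. A vertex-weighted digraph $(G,\psi)$ on $[\ell]$: $G$ a digraph on vertex set $[\ell]$ with edge set $E_G\subseteq\{(i,j):i\ne j\}$, and $\psi(i)=[a_i,b_i]$ integer intervals with $a_i\le b_i$. The cone $\mathbf{c}\mathcal{A}(G,\psi)$ is the central arrangement in $\mathbb{R}^{\ell+1}$ (coordinates $x_1,\dots,x_\ell,z$) consisting of $z=0$, $x_i-x_j=0$ ($1\le i<j\le\ell$), $x_i-x_j=z$ ($(i,j)\in E_G$), and $x_i=cz$ ($c\in\psi(i)$, $i\in[\ell]$). A vertex $v$ is a coking (resp. king) if $(u,v)\in E_G$ (resp. $(v,u)\in E_G$) for all $u\ne v$. Coking elimination w.r.t. coking $v$: $E_{G'}=E_G\setminus\{(i,v):i\ne v\}$, $\psi'(i)=[a_i-1,b_i]$ for $i\ne v$, $\psi'(v)=\psi(v)$. King elimination w.r.t. king $v$: $E_{G''}=E_G\setminus\{(v,i):i\ne v\}$, $\psi''(i)=[a_i,b_i+1]$ for $i\ne v$, $\psi''(v)=\psi(v)$. A central arrangement $\mathcal{A}$ in $\mathbb{R}^n$ is free if $D(\mathcal{A})=\{\theta\in\mathrm{Der}_{\mathbb{R}}(S):\theta(\alpha_H)\in\alpha_HS\ \forall H\in\mathcal{A}\}$ is a free module over $S=\mathbb{R}[x_1,\dots,x_n]$, where $H=\ker\alpha_H$. *)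

theory Defs
  imports "HOL-Analysis.Analysis" "HOL-Library.Poly_Mapping" "HOL-Library.Function_Algebras"
begin

text \<open>
  For a finite type \<open>'v\<close> of variables, \<open>'v rpoly\<close> is the polynomial ring
  \<open>S = \<real>[x\<^sub>v : v \<in> 'v]\<close>: finitely supported functions from exponent vectors to coefficients, with
  the convolution product.
\<close>

type_synonym 'v rpoly = "('v \<Rightarrow>\<^sub>0 nat) \<Rightarrow>\<^sub>0 real"

definition pvar :: "'v \<Rightarrow> 'v rpoly" where
  "pvar v = Poly_Mapping.single (Poly_Mapping.single v 1) 1"

definition pconst :: "real \<Rightarrow> 'v rpoly" where
  "pconst c = Poly_Mapping.single 0 c"

definition derivation :: "('v rpoly \<Rightarrow> 'v rpoly) \<Rightarrow> bool" where
  "derivation \<theta> \<longleftrightarrow>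
     (\<forall>p q. \<theta> (p + q) = \<theta> p + \<theta> q) \<and>
     (\<forall>c p. \<theta> (pconst c * p) = pconst c * \<theta> p) \<and>
     (\<forall>p q. \<theta> (p * q) = p * \<theta> q + q * \<theta> p)"

text \<open>
  All maps \<open>S \<Rightarrow> S\<close> form an \<open>S\<close>-module under pointwise operations, of which \<open>Der\<^sub>\<real>(S)\<close> is a submodule.
\<close>

definition pscale :: "'v rpoly \<Rightarrow> ('v rpoly \<Rightarrow> 'v rpoly) \<Rightarrow> 'v rpoly \<Rightarrow> 'v rpoly" where
  "pscale p \<theta> = (\<lambda>q. p * \<theta> q)"

global_interpretation poly_fun: module "pscale :: 'v rpoly \<Rightarrow> _"
  defines poly_span = poly_fun.span
    and poly_dependent = poly_fun.dependent
  by unfold_locales (simp_all add: pscale_def fun_eq_iff algebra_simps)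

definition free_submodule :: "('v rpoly \<Rightarrow> 'v rpoly) set \<Rightarrow> bool" where
  "free_submodule M \<longleftrightarrow> (\<exists>B. \<not> poly_dependent B \<and> poly_span B = M)"

definition central_arrangement :: "(real ^ 'v::finite) set set \<Rightarrow> bool" where
  "central_arrangement \<A> \<longleftrightarrow> finite \<A> \<and> (\<forall>H\<in>\<A>. \<exists>c. c \<noteq> 0 \<and> H = {x. c \<bullet> x = 0})"

definition linear_form :: "real ^ 'v::finite \<Rightarrow> 'v rpoly" where
  "linear_form c = (\<Sum>i\<in>UNIV. pconst (c $ i) * pvar i)"

text \<open>
  The form \<open>\<alpha>\<^sub>H\<close> is determined by \<open>H\<close> up to a nonzero scalar, which does not affect the condition
  \<open>\<theta>(\<alpha>\<^sub>H) \<in> \<alpha>\<^sub>H S\<close>; the condition is therefore required for every defining form of \<open>H\<close>.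
\<close>

definition log_derivations :: "(real ^ 'v::finite) set set \<Rightarrow> ('v rpoly \<Rightarrow> 'v rpoly) set" where
  "log_derivations \<A> = {\<theta>. derivation \<theta> \<and>
     (\<forall>H\<in>\<A>. \<forall>c. H = {x. c \<bullet> x = 0} \<longrightarrow> linear_form c dvd \<theta> (linear_form c))}"

lemma subspace_log_derivations: "poly_fun.subspace (log_derivations \<A>)"
  by (auto simp: poly_fun.subspace_def log_derivations_def derivation_def pscale_def algebra_simps)

definition free_arrangement :: "(real ^ 'v::finite) set set \<Rightarrow> bool" where
  "free_arrangement \<A> \<longleftrightarrow> central_arrangement \<A> \<and> free_submodule (log_derivations \<A>)"

text \<open>
  The vertex set \<open>[\<ell>]\<close> is rendered as an arbitrary finite type \<open>'n\<close>, with \<open>\<ell> = CARD('n)\<close>.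
  The vertex \<open>i\<close> carries the integer interval \<open>\<psi>(i) = [lo i, hi i]\<close>.
\<close>

record 'n wdigraph =
  edges :: "('n \<times> 'n) set"
  lo :: "'n \<Rightarrow> int"
  hi :: "'n \<Rightarrow> int"

definition weight :: "'n wdigraph \<Rightarrow> 'n \<Rightarrow> int set" where
  "weight G i = {lo G i..hi G i}"

definition vertex_weighted_digraph :: "'n wdigraph \<Rightarrow> bool" where
  "vertex_weighted_digraph G \<longleftrightarrow>
     edges G \<subseteq> {(i, j). i \<noteq> j} \<and> (\<forall>i. lo G i \<le> hi G i)"

definition coking :: "'n wdigraph \<Rightarrow> 'n \<Rightarrow> bool" where
  "coking G v \<longleftrightarrow> (\<forall>u. u \<noteq> v \<longrightarrow> (u, v) \<in> edges G)"

definition king :: "'n wdigraph \<Rightarrow> 'n \<Rightarrow> bool" where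
  "king G v \<longleftrightarrow> (\<forall>u. u \<noteq> v \<longrightarrow> (v, u) \<in> edges G)"

definition coking_elimination :: "'n \<Rightarrow> 'n wdigraph \<Rightarrow> 'n wdigraph" where
  "coking_elimination v G =
     \<lparr> edges = edges G - {(i, v) | i. i \<noteq> v},
       lo = (\<lambda>i. if i = v then lo G i else lo G i - 1),
       hi = hi G \<rparr>"

definition king_elimination :: "'n \<Rightarrow> 'n wdigraph \<Rightarrow> 'n wdigraph" where
  "king_elimination v G =
     \<lparr> edges = edges G - {(v, i) | i. i \<noteq> v},
       lo = lo G,
       hi = (\<lambda>i. if i = v then hi G i else hi G i + 1) \<rparr>"

definition condition_Z :: "'n wdigraph \<Rightarrow> 'n \<Rightarrow> bool" where
  "condition_Z G v \<longleftrightarrow> (\<exists>n\<^sub>0::nat.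
     n\<^sub>0 + 2 \<le> card (weight G v) \<and> card (weight G v) \<le> n\<^sub>0 + 3 \<and>
     (\<forall>i. i \<noteq> v \<longrightarrow> n\<^sub>0 + 1 \<le> card (weight G i) \<and> card (weight G i) \<le> n\<^sub>0 + 3))"

text \<open>
  The ambient space \<open>\<real>\<^sup>\<ell>\<^sup>+\<^sup>1\<close> is \<open>real ^ 'n option\<close>: the coordinate \<open>Some i\<close> is \<open>x\<^sub>i\<close>, and \<open>None\<close> is \<open>z\<close>.
\<close>

definition cone_arrangement :: "'n::finite wdigraph \<Rightarrow> (real ^ 'n option) set set" where
  "cone_arrangement G =
     {{p. p $ None = 0}} \<union>
     {{p. p $ Some i - p $ Some j = 0} | i j. i \<noteq> j} \<union>
     {{p. p $ Some i - p $ Some j = p $ None} | i j. (i, j) \<in> edges G} \<union>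
     {{p. p $ Some i = of_int c * p $ None} | i c. c \<in> weight G i}"

lemma central_arrangement_cone_arrangement:
  assumes "vertex_weighted_digraph G"
  shows "central_arrangement (cone_arrangement G)"
proof -
  have ne: "i \<noteq> j" if "(i, j) \<in> edges G" for i j
    using assms that by (auto simp: vertex_weighted_digraph_def)
  have "finite (cone_arrangement G)"
  proof -
    have "finite {{p :: real ^ 'a option. p $ Some i - p $ Some j = 0} | i j. i \<noteq> j}"
      by (rule finite_subset[of _ "(\<lambda>(i, j). {p. p $ Some i - p $ Some j = 0}) ` UNIV"]) auto
    moreover have "finite {{p :: real ^ 'a option. p $ Some i - p $ Some j = p $ None} | i j.
        (i, j) \<in> edges G}"
      by (rule finite_subset[of _ "(\<lambda>(i, j). {p. p $ Some i - p $ Some j = p $ None}) ` UNIV"]) auto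
    moreover have "finite {{p :: real ^ 'a option. p $ Some i = of_int c * p $ None} | i c.
        c \<in> weight G i}"
      by (rule finite_subset[of _ "(\<lambda>(i, c). {p. p $ Some i = of_int c * p $ None}) `
            (SIGMA i:UNIV. weight G i)"]) (auto simp: weight_def)
    ultimately show ?thesis by (simp add: cone_arrangement_def)
  qed
  moreover have "\<exists>c. c \<noteq> 0 \<and> H = {x. c \<bullet> x = 0}" if "H \<in> cone_arrangement G" for H
  proof -
    have witness: "\<exists>c. c \<noteq> 0 \<and> H = {x. c \<bullet> x = 0}"
      if "H = {x. c \<bullet> x = 0}" "c $ k \<noteq> 0" for c :: "real ^ 'a option" and k
      using that by (intro exI[of _ c]) auto
    consider "H = {p. p $ None = 0}"
      | i j where "i \<noteq> j" "H = {p. p $ Some i - p $ Some j = 0}"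
      | i j where "(i, j) \<in> edges G" "H = {p. p $ Some i - p $ Some j = p $ None}"
      | i c where "c \<in> weight G i" "H = {p. p $ Some i = of_int c * p $ None}"
      using \<open>H \<in> cone_arrangement G\<close> unfolding cone_arrangement_def Un_iff mem_Collect_eq singleton_iff
      by (elim disjE exE conjE) simp_all
    then show ?thesis
    proof cases
      case 1
      then show ?thesis
        by (intro witness[of "axis None 1" None]) (simp_all add: inner_axis')
    next
      case (2 i j)
      then show ?thesis
        by (intro witness[of "axis (Some i) 1 - axis (Some j) 1" "Some i"])
           (simp add: inner_diff_left inner_axis', simp add: axis_def)
    next
      case (3 i j)
      then show ?thesis using ne[OF 3(1)]
        by (intro witness[of "axis (Some i) 1 - axis (Some j) 1 - axis None 1" "Some i"])
           (simp add: inner_diff_left inner_axis', simp add: axis_def)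
    next
      case (4 i c)
      then show ?thesis
        by (intro witness[of "axis (Some i) 1 - of_int c *\<^sub>R axis None 1" "Some i"])
           (simp add: inner_diff_left inner_axis', simp add: axis_def)
    qed
  qed
  ultimately show ?thesis by (simp add: central_arrangement_def)
qed

end

theory Submission
  imports Defs "HOL-Computational_Algebra.Polynomial"
begin

text \<open>
  Adding a vertex \<open>0\<close> and splitting off the Euler field, freeness of the cone becomes freeness of a
  module of tuples \<open>f\<close> of polynomials, indexed by the vertices, with \<open>f\<^sub>a = f\<^sub>b\<close> on the hyperplanes
  \<open>x\<^sub>a - x\<^sub>b = c z\<close>, \<open>l a b \<le> c \<le> - l b a\<close>.  Since these modules are graded of known rank, freeness only
  says that the fibre at the origin has at most that dimension.

  Lowering \<open>l w b\<close> by one for all \<open>b\<close> preserves freeness: the backward difference quotient in \<open>x\<^sub>w\<close> is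
  a bijection between the two modules, and it does not commute with multiplication by \<open>x\<^sub>w\<close> only up to
  the inclusion, so that Euler's identity bounds the fibre.  Conversely, restricting to \<open>z = 0\<close> leads
  to multiarrangements of type A, where the difference quotient becomes the derivative; there freeness of
  the multiplicity \<open>n\<^sub>a + n\<^sub>b + \<epsilon>\<^sub>a\<^sub>b\<close> with \<open>|\<epsilon>| \<le> 1\<close> does not depend on \<open>n\<close>, as one sees by integrating
  logarithmic forms and rescaling \<open>n\<close>; the determinant of the integrals is nonzero by Rolle's theorem.

  The arrangements of \<open>G\<close> and of its elimination both arise by one such shift from a common
  arrangement, shifted at \<open>v\<close> in the one case and at the vertex \<open>0\<close> in the other.
\<close>

section \<open>Polynomial functions\<close>

text \<open>The difference quotient maps the module of the larger arrangement onto that of the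
  smaller one, so freeness passes upwards directly but not downwards. Descent rests on two facts: a
  free arrangement restricts onto its multirestriction, and the difference quotient restricts to the
  derivative. So the smaller arrangement inherits surjectivity, and only freeness of its
  multirestriction is left. Derivatives, too, only raise the weights \<open>n\<close>; but rescaling
  divides them by a common factor \<open>K\<close>, and a large multiple \<open>K n'\<close>
  dominates any given \<open>n\<close>. Climbing from \<open>n\<close> to \<open>K n'\<close> and
  then rescaling therefore also leads down.

  The common arrangement is that of \<open>G\<close> without the edges into \<open>v\<close> and
  without the hyperplane of the lowest weight of \<open>v\<close>. Condition (Z) provides
  multiplicities \<open>n_a + n_b + \<epsilon>\<close> with weight n0 + 1 at the vertex 0 and 1
  elsewhere: between n0 + 1 and n0 + 3 at the pairs (0, i), where the lower bound n0 + 2 for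
  \<open>v\<close> makes up for the removed hyperplane. The interval inclusions and the membership
  of 0 become triangle inequalities, by which antidifferences normalised at different vertices can
  be matched.\<close>

inductive_set polyfun :: "(('w \<Rightarrow> real) \<Rightarrow> real) set" where
  const: "(\<lambda>x. c) \<in> polyfun"
| coord: "(\<lambda>x. x i) \<in> polyfun"
| add: "p \<in> polyfun \<Longrightarrow> q \<in> polyfun \<Longrightarrow> (\<lambda>x. p x + q x) \<in> polyfun"
| mult: "p \<in> polyfun \<Longrightarrow> q \<in> polyfun \<Longrightarrow> (\<lambda>x. p x * q x) \<in> polyfun"

lemma polyfun_uminus: "p \<in> polyfun \<Longrightarrow> (\<lambda>x. - p x) \<in> polyfun"
  using polyfun.mult[OF polyfun.const[of "-1"]] by simp

lemma polyfun_diff: "p \<in> polyfun \<Longrightarrow> q \<in> polyfun \<Longrightarrow> (\<lambda>x. p x - q x) \<in> polyfun"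
  using polyfun.add[OF _ polyfun_uminus, of p q] by simp

lemma polyfun_power: "p \<in> polyfun \<Longrightarrow> (\<lambda>x. p x ^ n) \<in> polyfun"
  by (induction n) (simp_all add: polyfun.const polyfun.mult)

lemma polyfun_divide_const: "p \<in> polyfun \<Longrightarrow> (\<lambda>x. p x / c) \<in> polyfun"
  using polyfun.mult[OF _ polyfun.const[of "1 / c"], of p] by simp

lemma polyfun_sum:
  "(\<And>i. i \<in> I \<Longrightarrow> p i \<in> polyfun) \<Longrightarrow> (\<lambda>x. \<Sum>i\<in>I. p i x) \<in> polyfun"
  by (induction I rule: infinite_finite_induct) (simp_all add: polyfun.const polyfun.add)

lemma polyfun_prod:
  "(\<And>i. i \<in> I \<Longrightarrow> p i \<in> polyfun) \<Longrightarrow> (\<lambda>x. \<Prod>i\<in>I. p i x) \<in> polyfun"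
  by (induction I rule: infinite_finite_induct) (simp_all add: polyfun.const polyfun.mult)

lemma polyfun_if:
  "(b \<Longrightarrow> p \<in> polyfun) \<Longrightarrow> (\<not> b \<Longrightarrow> q \<in> polyfun) \<Longrightarrow> (\<lambda>x. if b then p x else q x) \<in> polyfun"
  by (cases b) simp_all

lemmas polyfun_intros =
  polyfun.const polyfun.coord polyfun.add polyfun.mult polyfun_uminus polyfun_diff polyfun_power
  polyfun_divide_const polyfun_sum polyfun_prod polyfun_if

lemma polyfun_compose:
  assumes "p \<in> polyfun" "\<And>i. q i \<in> polyfun"
  shows "(\<lambda>y. p (\<lambda>i. q i y)) \<in> polyfun"
  using assms(1)
proof induction
  case (coord i)
  then show ?case using assms(2)[of i] by simp
qed (simp_all add: polyfun.const polyfun.add polyfun.mult)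

lemma polyfun_compose_upd:
  assumes "p \<in> polyfun" "q \<in> polyfun"
  shows "(\<lambda>x. p (x(i := q x))) \<in> polyfun"
proof -
  have "(\<lambda>x. p (\<lambda>j. if j = i then q x else x j)) \<in> polyfun"
    using assms by (intro polyfun_compose[where p = p and q = "\<lambda>j x. if j = i then q x else x j"] polyfun_intros)
  then show ?thesis by (simp add: fun_upd_def)
qed

text \<open>The restriction of a polynomial function to the line \<open>t \<mapsto> A y + t B y\<close>, as a
  univariate polynomial depending on the parameter \<open>y\<close>.\<close>

definition along ::
    "('w \<Rightarrow> ('u \<Rightarrow> real) \<Rightarrow> real) \<Rightarrow> ('w \<Rightarrow> ('u \<Rightarrow> real) \<Rightarrow> real) \<Rightarrow>
     (('w \<Rightarrow> real) \<Rightarrow> real) \<Rightarrow> ('u \<Rightarrow> real) \<Rightarrow> real poly" where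
  "along A B p y = (THE P. \<forall>t. poly P t = p (\<lambda>j. A j y + t * B j y))"

lemma along_eqI:
  assumes "\<And>t. poly P t = p (\<lambda>j. A j y + t * B j y)"
  shows "along A B p y = P"
  unfolding along_def
proof (rule the_equality)
  show "\<forall>t. poly P t = p (\<lambda>j. A j y + t * B j y)" using assms by simp
  fix P' assume "\<forall>t. poly P' t = p (\<lambda>j. A j y + t * B j y)"
  then have "poly P' = poly P" using assms by auto
  then show "P' = P" by (simp add: poly_eq_poly_eq_iff)
qed

lemma poly_along:
  assumes "p \<in> polyfun"
  shows "poly (along A B p y) t = p (\<lambda>j. A j y + t * B j y)"
proof -
  have "\<exists>P. \<forall>t. poly P t = p (\<lambda>j. A j y + t * B j y)"
    using assms
  proof induction
    case (const c)
    show ?case by (rule exI[of _ "[:c:]"]) simp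
  next
    case (coord i)
    show ?case by (rule exI[of _ "[:A i y, B i y:]"]) simp
  next
    case (add p q)
    then show ?case by (metis poly_add)
  next
    case (mult p q)
    then show ?case by (metis poly_mult)
  qed
  then obtain P where "\<forall>t. poly P t = p (\<lambda>j. A j y + t * B j y)" by blast
  then show ?thesis using along_eqI[of P p A y B] by auto
qed

lemma along_const: "along A B (\<lambda>x. c) y = [:c:]"
  by (rule along_eqI) simp

lemma along_coord: "along A B (\<lambda>x. x i) y = [:A i y, B i y:]"
  by (rule along_eqI) simp

lemma along_add:
  "p \<in> polyfun \<Longrightarrow> q \<in> polyfun \<Longrightarrow> along A B (\<lambda>x. p x + q x) y = along A B p y + along A B q y"
  by (rule along_eqI) (simp add: poly_along)

lemma along_mult:
  "p \<in> polyfun \<Longrightarrow> q \<in> polyfun \<Longrightarrow> along A B (\<lambda>x. p x * q x) y = along A B p y * along A B q y"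
  by (rule along_eqI) (simp add: poly_along)

text \<open>Hence homogeneous components and Taylor coefficients in one variable, both defined as
  coefficients along a line, are again polynomial functions.\<close>

lemma polyfun_coeff_along:
  assumes "p \<in> polyfun" "\<And>j. A j \<in> polyfun" "\<And>j. B j \<in> polyfun"
  shows "(\<lambda>y. coeff (along A B p y) d) \<in> polyfun"
  using assms(1)
proof (induction arbitrary: d)
  case (const c)
  then show ?case by (cases d) (auto simp: along_const polyfun.const)
next
  case (coord i)
  then show ?case
    using assms(2,3)
    by (cases d; cases "d - 1") (auto simp: along_coord coeff_pCons polyfun.const)
next
  case (add p q)
  then show ?case by (simp add: along_add polyfun.add)
next
  case (mult p q)
  then show ?case by (simp add: along_mult coeff_mult polyfun_sum polyfun.mult)
qed

text \<open>The bound is uniform in the base point, so decompositions into components are sums over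
  one fixed finite range.\<close>

lemma degree_along_bounded:
  assumes "p \<in> polyfun"
  shows "\<exists>D. \<forall>y. degree (along A B p y) \<le> D"
  using assms
proof induction
  case (const c)
  then show ?case by (auto simp: along_const)
next
  case (coord i)
  have "degree (along A B (\<lambda>x. x i) y) \<le> 1" for y by (auto simp: along_coord)
  then show ?case by blast
next
  case (add p q)
  then obtain D E where "\<forall>y. degree (along A B p y) \<le> D" "\<forall>y. degree (along A B q y) \<le> E" by blast
  then have "\<forall>y. degree (along A B (\<lambda>x. p x + q x) y) \<le> max D E"
    using add by (auto simp: along_add intro!: degree_add_le intro: order_trans max.coboundedI1 max.coboundedI2)
  then show ?case by blast
next
  case (mult p q)
  then obtain D E where *: "\<forall>y. degree (along A B p y) \<le> D" "\<forall>y. degree (along A B q y) \<le> E" by blast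
  have "degree (along A B (\<lambda>x. p x * q x) y) \<le> D + E" for y
    using mult.hyps * degree_mult_le[of "along A B p y" "along A B q y"]
    by (simp add: along_mult) (meson add_mono order_trans)
  then show ?case by blast
qed

section \<open>Absence of zero divisors, and reduction to generic points\<close>

text \<open>Restrict both factors to the line from \<open>a\<close> to \<open>x\<close>: the product
  of the univariate polynomials is zero and the first is nonzero at parameter 0, so the second is
  zero, in particular at parameter 1, which is \<open>x\<close>.\<close>

lemma polyfun_mult_eq_0:
  assumes "p \<in> polyfun" "q \<in> polyfun" "\<And>x. p x * q x = 0" "p a \<noteq> 0"
  shows "q x = 0"
proof -
  define P where "P r = along (\<lambda>i (y :: 'a \<Rightarrow> real). a i) (\<lambda>i y. x i - a i) r (\<lambda>_. 0)" for r
  have ev: "poly (P r) t = r (\<lambda>j. a j + t * (x j - a j))" if "r \<in> polyfun" for r t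
    using that by (simp add: P_def poly_along)
  have "poly (P p * P q) t = 0" for t
    using assms by (simp add: ev)
  then have "P p * P q = 0" by (simp add: poly_all_0_iff_0[symmetric])
  moreover have "poly (P p) 0 \<noteq> 0" using assms by (simp add: ev)
  ultimately have "P q = 0" by auto
  then have "poly (P q) 1 = 0" by simp
  then show ?thesis using assms by (simp add: ev)
qed

text \<open>Density of the locus where \<open>P\<close> is nonzero, in algebraic form:
  \<open>P * q\<close> vanishes everywhere. Later arguments use it to work at generic points
  only.\<close>

lemma polyfun_generic_zero:
  assumes "P \<in> polyfun" "q \<in> polyfun" "P a \<noteq> 0" "\<And>x. P x \<noteq> 0 \<Longrightarrow> q x = 0"
  shows "q x = 0"
proof -
  have "P y * q y = 0" for y using assms(4)[of y] by (cases "P y = 0") simp_all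
  then show ?thesis using polyfun_mult_eq_0[of P q a x] assms by blast
qed

lemma polyfun_generic_eq:
  assumes "P \<in> polyfun" "p \<in> polyfun" "q \<in> polyfun" "P a \<noteq> 0" "\<And>x. P x \<noteq> 0 \<Longrightarrow> p x = q x"
  shows "p x = q x"
  using polyfun_generic_zero[of P "\<lambda>x. p x - q x" a x] polyfun_diff[of p q] assms by simp

lemma polyfun_mult_cancel:
  assumes "P \<in> polyfun" "p \<in> polyfun" "q \<in> polyfun" "P a \<noteq> 0" "\<And>x. P x * p x = P x * q x"
  shows "p x = q x"
  using polyfun_generic_eq[of P p q a x] assms by (metis mult_cancel_left)

lemma polyfun_prod_nonzero:
  assumes "finite I" "\<And>i. i \<in> I \<Longrightarrow> p i \<in> polyfun" "\<And>i. i \<in> I \<Longrightarrow> \<exists>x. p i x \<noteq> 0"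
  shows "\<exists>x. (\<Prod>i\<in>I. p i x) \<noteq> 0"
  using assms
proof (induction I rule: finite_induct)
  case empty
  then show ?case by simp
next
  case (insert i I)
  then obtain x y where "p i x \<noteq> 0" "(\<Prod>i\<in>I. p i y) \<noteq> 0" by blast
  moreover have "(\<lambda>x. \<Prod>i\<in>I. p i x) \<in> polyfun" using insert by (auto intro: polyfun_prod)
  ultimately have "\<exists>x. p i x * (\<Prod>i\<in>I. p i x) \<noteq> 0"
    using polyfun_mult_eq_0[of "p i" "\<lambda>x. \<Prod>i\<in>I. p i x" x y] insert.prems(1) by blast
  then show ?case using insert by simp
qed

subsection \<open>Homogeneous components\<close>

definition hcomp :: "nat \<Rightarrow> (('w \<Rightarrow> real) \<Rightarrow> real) \<Rightarrow> ('w \<Rightarrow> real) \<Rightarrow> real" where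
  "hcomp d p x = coeff (along (\<lambda>j y. 0) (\<lambda>j y. y j) p x) d"

text \<open>The zero function is homogeneous of every degree. The value \<open>t = 0\<close> is
  included, which with \<open>0 ^ 0 = 1\<close> makes degree 0 consist of the constants.\<close>

definition hom :: "nat \<Rightarrow> (('w \<Rightarrow> real) \<Rightarrow> real) \<Rightarrow> bool" where
  "hom d p \<longleftrightarrow> p \<in> polyfun \<and> (\<forall>t x. p (\<lambda>i. t * x i) = t ^ d * p x)"

lemma hom_polyfun: "hom d p \<Longrightarrow> p \<in> polyfun"
  by (simp add: hom_def)

lemma polyfun_hcomp: "p \<in> polyfun \<Longrightarrow> hcomp d p \<in> polyfun"
  unfolding hcomp_def by (rule polyfun_coeff_along) (simp_all add: polyfun.const polyfun.coord)

lemma sum_hcomp: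
  assumes "p \<in> polyfun"
  obtains D where "\<And>x. p x = (\<Sum>d\<le>D. hcomp d p x)" "\<And>d x. d > D \<Longrightarrow> hcomp d p x = 0"
proof -
  let ?A = "along (\<lambda>j y. 0) (\<lambda>j y. y j) p"
  obtain D where D: "\<And>x. degree (?A x) \<le> D"
    using degree_along_bounded[OF assms] by blast
  have "p x = (\<Sum>d\<le>D. hcomp d p x)" for x
  proof -
    have "p x = poly (?A x) 1" by (simp add: poly_along[OF assms])
    also have "\<dots> = (\<Sum>d\<le>degree (?A x). coeff (?A x) d)" by (simp add: poly_altdef)
    also have "\<dots> = (\<Sum>d\<le>D. coeff (?A x) d)"
      using D[of x] by (intro sum.mono_neutral_left) (auto simp: coeff_eq_0)
    finally show ?thesis by (simp add: hcomp_def)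
  qed
  moreover have "hcomp d p x = 0" if "d > D" for d x
    using that D[of x] by (auto simp: hcomp_def intro: coeff_eq_0)
  ultimately show ?thesis using that by blast
qed

lemma hcomp_add:
  "p \<in> polyfun \<Longrightarrow> q \<in> polyfun \<Longrightarrow> hcomp d (\<lambda>x. p x + q x) x = hcomp d p x + hcomp d q x"
  by (simp add: hcomp_def along_add)

lemma hcomp_cmult: "p \<in> polyfun \<Longrightarrow> hcomp d (\<lambda>x. c * p x) x = c * hcomp d p x"
  by (simp add: hcomp_def along_mult along_const polyfun.const)

lemma hcomp_const: "hcomp d (\<lambda>x. c) x = (if d = 0 then c else 0)"
  by (cases d) (auto simp: hcomp_def along_const)

lemma hcomp_sum:
  "(\<And>i. i \<in> I \<Longrightarrow> p i \<in> polyfun) \<Longrightarrow> hcomp d (\<lambda>x. \<Sum>i\<in>I. p i x) x = (\<Sum>i\<in>I. hcomp d (p i) x)"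
proof (induction I rule: infinite_finite_induct)
  case (insert i I)
  then show ?case
    using hcomp_add[of "p i" "\<lambda>x. \<Sum>i\<in>I. p i x" d x] by (simp add: polyfun_sum)
qed (auto simp: hcomp_const)

lemma hcomp_coord_mult:
  "p \<in> polyfun \<Longrightarrow> hcomp d (\<lambda>x. x i * p x) x = (case d of 0 \<Rightarrow> 0 | Suc e \<Rightarrow> x i * hcomp e p x)"
  by (auto simp: hcomp_def along_mult along_coord polyfun.coord coeff_pCons split: nat.splits)

lemma hom_hcomp:
  assumes "p \<in> polyfun"
  shows "hom d (hcomp d p)"
proof -
  have "hcomp d p (\<lambda>i. t * x i) = t ^ d * hcomp d p x" for t x
    using assms
  proof (induction arbitrary: d)
    case (const c)
    then show ?case by (simp add: hcomp_const)
  next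
    case (coord i)
    then show ?case by (auto simp: hcomp_def along_coord coeff_pCons split: nat.splits)
  next
    case (add p q)
    then show ?case by (simp add: hcomp_add algebra_simps)
  next
    case (mult p q)
    have "hcomp d (\<lambda>x. p x * q x) y = (\<Sum>i\<le>d. hcomp i p y * hcomp (d - i) q y)" for y
      using mult.hyps by (simp add: hcomp_def along_mult coeff_mult)
    moreover have "t ^ i * t ^ (d - i) = t ^ d" if "i \<le> d" for i
      using that by (simp add: power_add[symmetric])
    ultimately show ?case
      using mult.IH
      by (simp add: sum_distrib_left mult.commute mult.left_commute cong: sum.cong)
         (smt (verit, best) atMost_iff mult.assoc mult.left_commute sum.cong)
  qed
  then show ?thesis using assms by (simp add: hom_def polyfun_hcomp)
qed

lemma hcomp_hom:
  assumes "hom e p"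
  shows "hcomp d p x = (if d = e then p x else 0)"
proof -
  have "along (\<lambda>j y. 0) (\<lambda>j y. y j) p x = monom (p x) e"
    using assms by (intro along_eqI) (simp add: hom_def poly_monom mult.commute)
  then show ?thesis by (simp add: hcomp_def)
qed

lemma hom_0_const: "hom 0 p \<Longrightarrow> p x = p (\<lambda>_. 0)"
proof -
  assume "hom 0 p"
  then have "p (\<lambda>i. 0 * x i) = 0 ^ 0 * p x" unfolding hom_def by blast
  then show ?thesis by simp
qed

lemma hom_mult: "hom d p \<Longrightarrow> hom e q \<Longrightarrow> hom (d + e) (\<lambda>x. p x * q x)"
  unfolding hom_def by (simp add: polyfun.mult power_add)

lemma hom_coord: "hom 1 (\<lambda>x. x i)"
  by (simp add: hom_def polyfun.coord)

lemma hom_coord_power: "hom n (\<lambda>x. x i ^ n)"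
  by (simp add: hom_def power_mult_distrib polyfun_power polyfun.coord)

lemma hom_add: "hom d p \<Longrightarrow> hom d q \<Longrightarrow> hom d (\<lambda>x. p x + q x)"
  unfolding hom_def by (simp add: polyfun.add distrib_left)

lemma hom_cmult: "hom d p \<Longrightarrow> hom d (\<lambda>x. c * p x)"
  unfolding hom_def by (simp add: polyfun.mult polyfun.const mult.left_commute)

lemma hom_zero: "hom d (\<lambda>x. 0)"
  by (simp add: hom_def polyfun.const)

lemma hom_sum: "(\<And>i. i \<in> I \<Longrightarrow> hom d (p i)) \<Longrightarrow> hom d (\<lambda>x. \<Sum>i\<in>I. p i x)"
  by (induction I rule: infinite_finite_induct) (auto intro: hom_add hom_zero)

lemma hom_cancel:
  assumes "hom (d + e) (\<lambda>x. p x * q x)" "hom d p" "q \<in> polyfun" "p a \<noteq> 0"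
  shows "hom e q"
proof -
  have "q (\<lambda>i. t * x i) = t ^ e * q x" if "t \<noteq> 0" for t x
  proof -
    have "(\<lambda>x. q (\<lambda>i. t * x i)) \<in> polyfun"
      using assms(3) by (intro polyfun_compose[where p = q and q = "\<lambda>i x. t * x i"] polyfun_intros)
    moreover have "p x * q (\<lambda>i. t * x i) = p x * (t ^ e * q x)" for x
    proof -
      have "p (\<lambda>i. t * x i) * q (\<lambda>i. t * x i) = t ^ (d + e) * (p x * q x)"
        using assms(1) unfolding hom_def by blast
      moreover have "p (\<lambda>i. t * x i) = t ^ d * p x" using assms(2) unfolding hom_def by blast
      ultimately show ?thesis using that by (simp add: power_add)
    qed
    ultimately show ?thesis
      using polyfun_mult_cancel[of p "\<lambda>x. q (\<lambda>i. t * x i)" "\<lambda>x. t ^ e * q x" a x]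
        hom_polyfun[OF assms(2)] polyfun.mult[OF polyfun.const assms(3)] assms(4) by blast
  qed note * = this
  \<comment> \<open>Cancellation leaves out \<open>t = 0\<close>. For fixed \<open>x\<close> both
    sides are polynomial in \<open>t\<close>, written as functions of one variable indexed by
    \<open>unit\<close>, and they agree for \<open>t \<noteq> 0\<close>.\<close>
  have "q (\<lambda>i. t * x i) = t ^ e * q x" for t x
  proof -
    let ?u = "\<lambda>y :: unit \<Rightarrow> real. y ()"
    have "(\<lambda>y. q (\<lambda>i. ?u y * x i)) \<in> polyfun"
      using assms(3) by (intro polyfun_compose[where p = q and q = "\<lambda>i y. ?u y * x i"] polyfun_intros)
    moreover have "(\<lambda>y. ?u y ^ e * q x) \<in> polyfun" by (intro polyfun_intros)
    ultimately have "q (\<lambda>i. ?u y * x i) = ?u y ^ e * q x" for y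
      using polyfun_generic_eq[of ?u "\<lambda>y. q (\<lambda>i. ?u y * x i)" "\<lambda>y. ?u y ^ e * q x" "\<lambda>_. 1" y]
        * polyfun.coord[of "()"] by simp
    from this[of "\<lambda>_. t"] show ?thesis by simp
  qed
  then show ?thesis using assms(3) by (simp add: hom_def)
qed

subsection \<open>Division\<close>

text \<open>The divided difference in the coordinate \<open>i\<close>. That it is polynomial jointly
  in \<open>x\<close> and \<open>t\<close> is expressed by substituting an arbitrary polynomial
  function for \<open>t\<close>, which avoids a type with one more variable.\<close>

lemma polyfun_factor:
  assumes "p \<in> polyfun"
  shows "\<exists>h. (\<forall>x t. p x - p (x(i := t)) = (x i - t) * h x t) \<and>
             (\<forall>q\<in>polyfun. (\<lambda>x. h x (q x)) \<in> polyfun)"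
  using assms
proof induction
  case (const c)
  show ?case by (rule exI[of _ "\<lambda>x t. 0"]) (simp add: polyfun.const)
next
  case (coord j)
  show ?case by (rule exI[of _ "\<lambda>x t. if j = i then 1 else 0"]) (auto intro: polyfun_intros)
next
  case (add p q)
  then obtain h k where
    *: "\<forall>x t. p x - p (x(i := t)) = (x i - t) * h x t" "\<forall>q\<in>polyfun. (\<lambda>x. h x (q x)) \<in> polyfun"
    "\<forall>x t. q x - q (x(i := t)) = (x i - t) * k x t" "\<forall>q\<in>polyfun. (\<lambda>x. k x (q x)) \<in> polyfun"
    by blast
  have "(p x + q x) - (p (x(i := t)) + q (x(i := t))) = (x i - t) * (h x t + k x t)" for x t
    unfolding distrib_left *(1)[rule_format, symmetric] *(3)[rule_format, symmetric] by (rule add_diff_add)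
  moreover have "(\<lambda>x. h x (r x) + k x (r x)) \<in> polyfun" if "r \<in> polyfun" for r
    using * that by (intro polyfun.add) simp_all
  ultimately show ?case
    by (intro exI[of _ "\<lambda>x t. h x t + k x t"]) blast
next
  case (mult p q)
  then obtain h k where
    *: "\<forall>x t. p x - p (x(i := t)) = (x i - t) * h x t" "\<forall>q\<in>polyfun. (\<lambda>x. h x (q x)) \<in> polyfun"
    "\<forall>x t. q x - q (x(i := t)) = (x i - t) * k x t" "\<forall>q\<in>polyfun. (\<lambda>x. k x (q x)) \<in> polyfun"
    by blast
  have "p x * q x - p (x(i := t)) * q (x(i := t)) =
      (p x - p (x(i := t))) * q x + p (x(i := t)) * (q x - q (x(i := t)))" for x t
    by (simp add: algebra_simps)
  then have "p x * q x - p (x(i := t)) * q (x(i := t)) =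
      (x i - t) * (h x t * q x + p (x(i := t)) * k x t)" for x t
    using * by (simp add: algebra_simps)
  moreover have "(\<lambda>x. h x (r x) * q x + p (x(i := r x)) * k x (r x)) \<in> polyfun" if "r \<in> polyfun" for r
    using * that mult.hyps polyfun_compose_upd[OF mult.hyps(1) that, of i]
    by (intro polyfun.add polyfun.mult) simp_all
  ultimately show ?case
    by (intro exI[of _ "\<lambda>x t. h x t * q x + p (x(i := t)) * k x t"]) blast
qed

lemma polyfun_division:
  assumes "p \<in> polyfun" "q \<in> polyfun" "\<And>x. p (x(i := q x)) = 0"
  obtains h where "h \<in> polyfun" "\<And>x. p x = (x i - q x) * h x"
proof -
  obtain h where "\<forall>x t. p x - p (x(i := t)) = (x i - t) * h x t"
      "\<forall>q\<in>polyfun. (\<lambda>x. h x (q x)) \<in> polyfun"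
    using polyfun_factor[OF assms(1)] by blast
  then have *: "p x - p (x(i := q x)) = (x i - q x) * h x (q x)" and "(\<lambda>x. h x (q x)) \<in> polyfun" for x
    using assms(2) by blast+
  have "p x = (x i - q x) * h x (q x)" for x
    using *[of x] unfolding assms(3) by simp
  with \<open>(\<lambda>x. h x (q x)) \<in> polyfun\<close> show ?thesis using that by blast
qed

text \<open>The form \<open>x i - q x\<close> is prime and, as \<open>P\<close> is nonzero somewhere
  on its zero set, does not divide \<open>P\<close>. So its powers can be divided out of
  \<open>h\<close> one at a time, by evaluating on the zero set.\<close>

lemma polyfun_divisible_coprime:
  assumes P: "P \<in> polyfun" "P (a(i := q a)) \<noteq> 0" and q: "q \<in> polyfun" "\<And>x t. q (x(i := t)) = q x"
    and "h \<in> polyfun" "k \<in> polyfun" "\<And>x. P x * h x = (x i - q x) ^ n * k x"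
  shows "\<exists>h'\<in>polyfun. \<forall>x. h x = (x i - q x) ^ n * h' x"
  using assms(5-)
proof (induction n arbitrary: h k)
  case 0
  then show ?case by auto
next
  case (Suc n)
  have "(\<lambda>x. h (x(i := q x))) \<in> polyfun" "(\<lambda>x. P (x(i := q x))) \<in> polyfun"
    by (fact polyfun_compose_upd[OF Suc.prems(1) q(1)], fact polyfun_compose_upd[OF P(1) q(1)])
  moreover have "P (x(i := q x)) * h (x(i := q x)) = 0" for x
    using Suc.prems(3)[of "x(i := q x)"] q(2)[of x "q x"]
    by (metis diff_self fun_upd_same mult_zero_left power_0_Suc)
  ultimately have "h (x(i := q x)) = 0" for x
    using polyfun_mult_eq_0[of "\<lambda>x. P (x(i := q x))" "\<lambda>x. h (x(i := q x))" a] P by blast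
  then obtain h1 where h1: "h1 \<in> polyfun" "\<And>x. h x = (x i - q x) * h1 x"
    using polyfun_division[OF Suc.prems(1) q(1)] by blast
  have "(x i - q x) * (P x * h1 x) = (x i - q x) * ((x i - q x) ^ n * k x)" for x
    using Suc.prems(3)[of x] h1(2)[of x] by (simp add: algebra_simps)
  moreover have "(a(i := q a + 1)) i - q (a(i := q a + 1)) \<noteq> 0" using q by simp
  moreover have "(\<lambda>x. x i - q x) \<in> polyfun" "(\<lambda>x. P x * h1 x) \<in> polyfun"
      "(\<lambda>x. (x i - q x) ^ n * k x) \<in> polyfun"
    using Suc.prems P q h1 by (intro polyfun_intros; simp)+
  ultimately have "P x * h1 x = (x i - q x) ^ n * k x" for x
    using polyfun_mult_cancel[of "\<lambda>x. x i - q x" "\<lambda>x. P x * h1 x" "\<lambda>x. (x i - q x) ^ n * k x"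
        "a(i := q a + 1)" x] by blast
  then obtain h' where "h' \<in> polyfun" "\<forall>x. h1 x = (x i - q x) ^ n * h' x"
    using Suc.IH[OF h1(1) Suc.prems(2)] by blast
  then show ?case using h1 by (auto simp: algebra_simps intro!: bexI[of _ h'])
qed

text \<open>Taylor expansion in \<open>x i\<close> around \<open>q x\<close>, with coefficients free
  of \<open>x i\<close>. It reduces integration and summation in \<open>x i\<close> to
  powers.\<close>

lemma polyfun_expansion:
  assumes "p \<in> polyfun" "q \<in> polyfun" "\<And>x t. q (x(i := t)) = q x"
  obtains K r where "\<And>k. r k \<in> polyfun" "\<And>k x t. r k (x(i := t)) = r k x"
    "\<And>x. p x = (\<Sum>k\<le>(K::nat). r k x * (x i - q x) ^ k)"
proof -
  let ?A = "\<lambda>j y. if j = i then q y else y j" and ?B = "\<lambda>j (y :: 'a \<Rightarrow> real). if j = i then 1 else (0::real)"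
  define r where "r k x = coeff (along ?A ?B p x) k" for k x
  obtain K where K: "\<And>y. degree (along ?A ?B p y) \<le> K"
    using degree_along_bounded[OF assms(1)] by blast
  have "r k \<in> polyfun" for k
    unfolding r_def using assms by (intro polyfun_coeff_along) (auto intro: polyfun_intros)
  moreover have "r k (x(i := t)) = r k x" for k x t
  proof -
    have "(\<lambda>j. ?A j (x(i := t)) + s * ?B j (x(i := t))) = (\<lambda>j. ?A j x + s * ?B j x)" for s
      by (simp add: assms(3) fun_eq_iff)
    then have "along ?A ?B p (x(i := t)) = along ?A ?B p x"
      unfolding along_def by simp
    then show ?thesis by (simp add: r_def)
  qed
  moreover have "p x = (\<Sum>k\<le>K. r k x * (x i - q x) ^ k)" for x
  proof -
    have "(\<lambda>j. ?A j x + (x i - q x) * ?B j x) = x" by auto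
    then have "p x = poly (along ?A ?B p x) (x i - q x)" by (simp add: poly_along[OF assms(1)])
    also have "\<dots> = (\<Sum>k\<le>K. r k x * (x i - q x) ^ k)"
      unfolding poly_altdef r_def using K[of x]
      by (intro sum.mono_neutral_left) (auto simp: coeff_eq_0)
    finally show ?thesis .
  qed
  ultimately show ?thesis using that by blast
qed

lemma polyfun_coord_ideal:
  fixes p :: "('w::finite \<Rightarrow> real) \<Rightarrow> real"
  assumes "p \<in> polyfun"
  shows "\<exists>h. (\<forall>i. h i \<in> polyfun) \<and>
    (\<forall>x. p x = p (\<lambda>i. if i \<in> I then 0 else x i) + (\<Sum>i\<in>I. x i * h i x))"
  using assms
proof induction
  case (const c)
  show ?case by (rule exI[of _ "\<lambda>i x. 0"]) (simp add: polyfun.const)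
next
  case (coord j)
  show ?case
  proof (intro exI conjI allI)
    show "(\<lambda>x. if i = j then 1 else 0) \<in> polyfun" for i :: 'w by (rule polyfun.const)
    show "x j = (if j \<in> I then 0 else x j) + (\<Sum>i\<in>I. x i * (if i = j then 1 else 0))" for x :: "'w \<Rightarrow> real"
    proof -
      have "(\<Sum>i\<in>I. x i * (if i = j then 1 else 0)) = (\<Sum>i\<in>I. if i = j then x j else 0)"
        by (rule sum.cong) auto
      then show ?thesis by simp
    qed
  qed
next
  case (add p q)
  then obtain h k where h: "\<forall>i. h i \<in> polyfun"
      "\<forall>x. p x = p (\<lambda>i. if i \<in> I then 0 else x i) + (\<Sum>i\<in>I. x i * h i x)"
    and k: "\<forall>i. k i \<in> polyfun"
      "\<forall>x. q x = q (\<lambda>i. if i \<in> I then 0 else x i) + (\<Sum>i\<in>I. x i * k i x)" by blast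
  show ?case
  proof (intro exI conjI allI)
    show "(\<lambda>x. h i x + k i x) \<in> polyfun" for i using h(1) k(1) by (simp add: polyfun.add)
    show "p x + q x = p (\<lambda>i. if i \<in> I then 0 else x i) + q (\<lambda>i. if i \<in> I then 0 else x i) +
        (\<Sum>i\<in>I. x i * (h i x + k i x))" for x
      using h(2)[rule_format, of x] k(2)[rule_format, of x] by (simp add: distrib_left sum.distrib)
  qed
next
  case (mult p q)
  then obtain h k where h: "\<forall>i. h i \<in> polyfun"
      "\<forall>x. p x = p (\<lambda>i. if i \<in> I then 0 else x i) + (\<Sum>i\<in>I. x i * h i x)"
    and k: "\<forall>i. k i \<in> polyfun"
      "\<forall>x. q x = q (\<lambda>i. if i \<in> I then 0 else x i) + (\<Sum>i\<in>I. x i * k i x)" by blast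
  let ?p0 = "\<lambda>x. p (\<lambda>i. if i \<in> I then 0 else x i)" and ?q0 = "\<lambda>x. q (\<lambda>i. if i \<in> I then 0 else x i)"
  have p0: "?p0 \<in> polyfun"
    using mult.hyps(1) by (rule polyfun_compose[where q = "\<lambda>i x. if i \<in> I then 0 else x i"]) (intro polyfun_intros)
  show ?case
  proof (intro exI conjI allI)
    show "(\<lambda>x. h i x * q x + ?p0 x * k i x) \<in> polyfun" for i
      using h(1) k(1) mult.hyps p0 by (simp add: polyfun.add polyfun.mult)
    fix x
    have "(\<Sum>i\<in>I. x i * (h i x * q x + ?p0 x * k i x)) =
        (\<Sum>i\<in>I. (x i * h i x) * q x) + (\<Sum>i\<in>I. ?p0 x * (x i * k i x))"
      unfolding sum.distrib[symmetric] by (rule sum.cong[OF refl]) (simp only: ring_distribs mult_ac)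
    also have "\<dots> = (\<Sum>i\<in>I. x i * h i x) * q x + ?p0 x * (\<Sum>i\<in>I. x i * k i x)"
      by (simp only: sum_distrib_left sum_distrib_right)
    also have "\<dots> = (p x - ?p0 x) * q x + ?p0 x * (q x - ?q0 x)"
    proof -
      have "(\<Sum>i\<in>I. x i * h i x) = p x - ?p0 x" "(\<Sum>i\<in>I. x i * k i x) = q x - ?q0 x"
        using h(2)[rule_format, of x] k(2)[rule_format, of x] by linarith+
      then show ?thesis by (simp only:)
    qed
    finally show "p x * q x = ?p0 x * ?q0 x + (\<Sum>i\<in>I. x i * (h i x * q x + ?p0 x * k i x))"
      by (simp only: ring_distribs mult_ac)
  qed
qed

section \<open>Linear dependence by counting\<close>

text \<open>Gaussian elimination without division. The domain is a subset \<open>P\<close> of a ring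
  because polynomial functions sit in the ring of all functions, which has zero divisors.\<close>

lemma domain_dependent:
  fixes v :: "'i \<Rightarrow> 'j \<Rightarrow> 'b::comm_ring_1"
  assumes P: "1 \<in> P" "0 \<in> P" "\<And>x y. x \<in> P \<Longrightarrow> y \<in> P \<Longrightarrow> x * y \<in> P" "\<And>x y. x \<in> P \<Longrightarrow> y \<in> P \<Longrightarrow> x + y \<in> P"
      "\<And>x. x \<in> P \<Longrightarrow> - x \<in> P" "\<And>x y. x \<in> P \<Longrightarrow> y \<in> P \<Longrightarrow> x * y = 0 \<Longrightarrow> x = 0 \<or> y = 0"
    and "finite J" "finite I" "card J < card I" "\<And>i j. i \<in> I \<Longrightarrow> j \<in> J \<Longrightarrow> v i j \<in> P"
  shows "\<exists>c. (\<forall>i\<in>I. c i \<in> P) \<and> (\<exists>i\<in>I. c i \<noteq> 0) \<and> (\<forall>j\<in>J. (\<Sum>i\<in>I. c i * v i j) = 0)"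
  using assms(7-)
proof (induction J arbitrary: I v rule: finite_induct)
  case empty
  then obtain i where "i \<in> I" by fastforce
  then show ?case using P by (intro exI[of _ "\<lambda>_. 1"]) auto
next
  case (insert j J)
  show ?case
  proof (cases "\<forall>i\<in>I. v i j = 0")
    case True
    have "\<exists>c. (\<forall>i\<in>I. c i \<in> P) \<and> (\<exists>i\<in>I. c i \<noteq> 0) \<and> (\<forall>j\<in>J. (\<Sum>i\<in>I. c i * v i j) = 0)"
      using insert by (intro insert.IH) auto
    then show ?thesis using True by auto
  next
    case False
    then obtain k where k: "k \<in> I" "v k j \<noteq> 0" by blast
    \<comment> \<open>Cross-multiplication with the pivot \<open>v k j\<close> clears the column
      \<open>j\<close> and needs no inverse.\<close>
    let ?I = "I - {k}" and ?v = "\<lambda>i l. v k j * v i l - v i j * v k l"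
    have diff: "x - y \<in> P" if "x \<in> P" "y \<in> P" for x y
      using P(4)[OF that(1) P(5)[OF that(2)]] by simp
    have psum: "(\<Sum>i\<in>K. f i) \<in> P" if "\<And>i. i \<in> K \<Longrightarrow> f i \<in> P" for K :: "'i set" and f
      using that by (induction K rule: infinite_finite_induct) (auto intro: P(1-5))
    have "\<exists>c. (\<forall>i\<in>?I. c i \<in> P) \<and> (\<exists>i\<in>?I. c i \<noteq> 0) \<and> (\<forall>l\<in>J. (\<Sum>i\<in>?I. c i * ?v i l) = 0)"
      using insert k by (intro insert.IH) (auto intro!: P(1-5) diff)
    then obtain c where c: "\<forall>i\<in>?I. c i \<in> P" "\<exists>i\<in>?I. c i \<noteq> 0" "\<forall>l\<in>J. (\<Sum>i\<in>?I. c i * ?v i l) = 0"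
      by blast
    \<comment> \<open>The coefficient at the pivot row is the one that makes the relation hold in
      the column \<open>j\<close>.\<close>
    define d where "d i = (if i = k then - (\<Sum>i\<in>?I. c i * v i j) else c i * v k j)" for i
    have d: "(\<Sum>i\<in>I. d i * v i l) = (\<Sum>i\<in>?I. c i * ?v i l)" for l
    proof -
      have "(\<Sum>i\<in>I. d i * v i l) = d k * v k l + (\<Sum>i\<in>?I. d i * v i l)"
        using k insert.prems by (simp add: sum.remove)
      also have "(\<Sum>i\<in>?I. d i * v i l) = (\<Sum>i\<in>?I. c i * v k j * v i l)"
        by (intro sum.cong) (auto simp: d_def)
      finally have "(\<Sum>i\<in>I. d i * v i l) = - (\<Sum>i\<in>?I. c i * v i j) * v k l + (\<Sum>i\<in>?I. c i * v k j * v i l)"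
        by (simp only: d_def if_True simp_thms)
      then show ?thesis
        by (simp add: sum_distrib_right sum_subtractf right_diff_distrib mult.assoc)
    qed
    have "d i \<in> P" if "i \<in> I" for i
      using that c k insert.prems unfolding d_def by (auto intro!: P(3,5) psum)
    moreover have "\<exists>i\<in>I. d i \<noteq> 0"
    proof -
      obtain i where "i \<in> ?I" "c i \<noteq> 0" using c by blast
      then have "d i \<noteq> 0" using P(6)[of "c i" "v k j"] c k insert.prems by (auto simp: d_def)
      then show ?thesis using \<open>i \<in> ?I\<close> by blast
    qed
    moreover have "(\<Sum>i\<in>I. d i * v i l) = 0" if "l \<in> insert j J" for l
      using that c(3) by (auto simp: d mult.commute)
    ultimately show ?thesis by blast
  qed
qed

lemma real_dependent:
  fixes v :: "'i \<Rightarrow> 'j \<Rightarrow> real"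
  assumes "finite J" "finite I" "card J < card I"
  shows "\<exists>c. (\<exists>i\<in>I. c i \<noteq> 0) \<and> (\<forall>j\<in>J. (\<Sum>i\<in>I. c i * v i j) = 0)"
  using domain_dependent[of UNIV J I v] assms by auto

section \<open>Graded modules of polynomial vectors\<close>

text \<open>Vectors of polynomial functions are added pointwise.  Closure under the dilations
  \<open>f \<mapsto> f(t \<cdot>)\<close> is equivalent to closure under passing to homogeneous components.\<close>

definition vsmul :: "('b \<Rightarrow> real) \<Rightarrow> ('a \<Rightarrow> 'b \<Rightarrow> real) \<Rightarrow> 'a \<Rightarrow> 'b \<Rightarrow> real" (infixr "\<odot>" 75) where
  "p \<odot> f = (\<lambda>a x. p x * f a x)"

lemma vsmul_apply [simp]: "(p \<odot> f) a x = p x * f a x"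
  by (simp add: vsmul_def)

lemma vsum_apply [simp]: "(\<Sum>i\<in>I. g i :: 'a \<Rightarrow> 'b \<Rightarrow> real) a x = (\<Sum>i\<in>I. g i a x)"
  by (induction I rule: infinite_finite_induct) auto

definition graded_module :: "('a \<Rightarrow> ('w \<Rightarrow> real) \<Rightarrow> real) set \<Rightarrow> bool" where
  "graded_module N \<longleftrightarrow> (\<forall>f\<in>N. \<forall>a. f a \<in> polyfun) \<and> 0 \<in> N \<and> (\<forall>f\<in>N. \<forall>g\<in>N. f + g \<in> N) \<and>
     (\<forall>p\<in>polyfun. \<forall>f\<in>N. p \<odot> f \<in> N) \<and> (\<forall>f\<in>N. \<forall>t. (\<lambda>a x. f a (\<lambda>i. t * x i)) \<in> N)"

lemma
  assumes "graded_module N"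
  shows gm_polyfun: "f \<in> N \<Longrightarrow> f a \<in> polyfun"
    and gm_zero: "0 \<in> N"
    and gm_add: "f \<in> N \<Longrightarrow> g \<in> N \<Longrightarrow> f + g \<in> N"
    and gm_smul: "p \<in> polyfun \<Longrightarrow> f \<in> N \<Longrightarrow> p \<odot> f \<in> N"
    and gm_dilate: "f \<in> N \<Longrightarrow> (\<lambda>a x. f a (\<lambda>i. t * x i)) \<in> N"
  using assms by (auto simp: graded_module_def)

lemma gm_cmul: "graded_module N \<Longrightarrow> f \<in> N \<Longrightarrow> (\<lambda>_. c) \<odot> f \<in> N"
  by (rule gm_smul) (auto intro: polyfun.const)

lemma gm_coordmul: "graded_module N \<Longrightarrow> f \<in> N \<Longrightarrow> (\<lambda>x. x i) \<odot> f \<in> N"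
  by (rule gm_smul) (auto intro: polyfun.coord)

lemma gm_diff: "graded_module N \<Longrightarrow> f \<in> N \<Longrightarrow> g \<in> N \<Longrightarrow> f - g \<in> N"
proof -
  assume N: "graded_module N" "f \<in> N" "g \<in> N"
  have "f - g = f + (\<lambda>_. -1) \<odot> g" by (intro ext) simp
  then show ?thesis by (simp only:) (rule gm_add[OF N(1,2) gm_cmul[OF N(1,3)]])
qed

lemma gm_sum: "graded_module N \<Longrightarrow> (\<And>i. i \<in> I \<Longrightarrow> f i \<in> N) \<Longrightarrow> (\<Sum>i\<in>I. f i) \<in> N"
  by (induction I rule: infinite_finite_induct) (auto intro: gm_zero gm_add)

definition homv :: "nat \<Rightarrow> ('a \<Rightarrow> ('w \<Rightarrow> real) \<Rightarrow> real) \<Rightarrow> bool" where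
  "homv d f \<longleftrightarrow> (\<forall>a. hom d (f a))"

definition vcomp :: "nat \<Rightarrow> ('a \<Rightarrow> ('w \<Rightarrow> real) \<Rightarrow> real) \<Rightarrow> 'a \<Rightarrow> ('w \<Rightarrow> real) \<Rightarrow> real" where
  "vcomp d f a = hcomp d (f a)"

text \<open>Dilation by 2 multiplies the degree \<open>d\<close> part by \<open>2 ^ d\<close>.
  Subtracting \<open>2 ^ Suc D\<close> times \<open>f\<close> from the dilated \<open>f\<close>
  removes the top part and multiplies the others by nonzero constants, so induction on
  \<open>D\<close> isolates each part.\<close>

lemma gm_components:
  assumes N: "graded_module N" and "f \<in> N" "f = (\<Sum>d\<le>D. F d)" "\<And>d. homv d (F d)"
  shows "d \<le> D \<Longrightarrow> F d \<in> N"
  using assms(2-)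
proof (induction D arbitrary: f F d)
  case 0
  then show ?case by simp
next
  case (Suc D)
  define G where "G d = (\<lambda>_. 2 ^ d - 2 ^ Suc D) \<odot> F d" for d
  have "(\<lambda>a x. f a (\<lambda>i. 2 * x i)) - (\<lambda>_. 2 ^ Suc D) \<odot> f \<in> N"
    using N Suc.prems by (intro gm_diff gm_dilate gm_cmul)
  moreover have "(\<lambda>a x. f a (\<lambda>i. 2 * x i)) - (\<lambda>_. 2 ^ Suc D) \<odot> f = (\<Sum>d\<le>D. G d)"
  proof (intro ext)
    fix a x
    have "F d a (\<lambda>i. 2 * x i) = 2 ^ d * F d a x" for d
      using Suc.prems(4) unfolding homv_def hom_def by blast
    then show "((\<lambda>a x. f a (\<lambda>i. 2 * x i)) - (\<lambda>_. 2 ^ Suc D) \<odot> f) a x = (\<Sum>d\<le>D. G d) a x"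
      by (simp add: Suc.prems(3) G_def sum_distrib_left algebra_simps sum_subtractf)
  qed
  moreover have "homv d (G d)" for d
    using Suc.prems(4) by (simp add: homv_def G_def vsmul_def hom_cmult)
  ultimately have "(\<Sum>d\<le>D. G d) \<in> N" and hG: "\<And>d. homv d (G d)" by (simp_all only:)
  then have G: "G d \<in> N" if "d \<le> D" for d
    using Suc.IH[where F = G, OF that _ refl] by blast
  have F: "F d \<in> N" if "d \<le> D" for d
  proof -
    have "(2::real) ^ d < 2 ^ Suc D" using that by (intro power_strict_increasing) auto
    then have "F d = (\<lambda>_. 1 / (2 ^ d - 2 ^ Suc D)) \<odot> G d" by (simp add: G_def fun_eq_iff)
    then show ?thesis by (simp only:) (rule gm_cmul[OF N G[OF that]])
  qed
  have "F (Suc D) = f - (\<Sum>d\<le>D. F d)" using Suc.prems(3) by (simp add: fun_eq_iff)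
  then have "F (Suc D) \<in> N" using N Suc.prems(2) F by (auto intro: gm_diff gm_sum)
  then show ?case using F Suc.prems(1) by (cases "d = Suc D") auto
qed

lemma vector_components:
  fixes f :: "'a::finite \<Rightarrow> ('w \<Rightarrow> real) \<Rightarrow> real"
  assumes "\<And>a. f a \<in> polyfun"
  obtains D where "\<And>a x. f a x = (\<Sum>d\<le>D. vcomp d f a x)" "\<And>d. d > D \<Longrightarrow> vcomp d f = 0"
proof -
  have "\<exists>D. (\<forall>x. f a x = (\<Sum>d\<le>D. hcomp d (f a) x)) \<and> (\<forall>d x. d > D \<longrightarrow> hcomp d (f a) x = 0)" for a
  proof -
    obtain D where "\<And>x. f a x = (\<Sum>d\<le>D. hcomp d (f a) x)" "\<And>d x. d > D \<Longrightarrow> hcomp d (f a) x = 0"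
      using sum_hcomp[OF assms[of a]] by blast
    then show ?thesis by blast
  qed
  then obtain E where E: "\<And>a x. f a x = (\<Sum>d\<le>E a. hcomp d (f a) x)"
      "\<And>a d x. d > E a \<Longrightarrow> hcomp d (f a) x = 0" by metis
  define D where "D = Max (range E)"
  have D: "E a \<le> D" for a by (simp add: D_def)
  have "f a x = (\<Sum>d\<le>D. hcomp d (f a) x)" for a x
  proof (subst E(1), rule sum.mono_neutral_left)
    show "\<forall>d\<in>{..D} - {..E a}. hcomp d (f a) x = 0" using E(2) by auto
  qed (use D in auto)
  then have "f a x = (\<Sum>d\<le>D. vcomp d f a x)" for a x by (simp add: vcomp_def)
  moreover have "vcomp d f = 0" if "d > D" for d
  proof -
    have "E a < d" for a using D[of a] that by simp
    then show ?thesis by (simp add: fun_eq_iff vcomp_def E(2))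
  qed
  ultimately show ?thesis using that by blast
qed

lemma homv_vcomp: "(\<And>a. f a \<in> polyfun) \<Longrightarrow> homv d (vcomp d f)"
  by (simp add: homv_def vcomp_def hom_hcomp)

lemma gm_vcomp:
  fixes f :: "'a::finite \<Rightarrow> ('w \<Rightarrow> real) \<Rightarrow> real"
  assumes "graded_module N" "f \<in> N"
  shows "vcomp d f \<in> N"
proof -
  have pf: "f a \<in> polyfun" for a using assms by (rule gm_polyfun)
  obtain D where D: "\<And>a x. f a x = (\<Sum>d\<le>D. vcomp d f a x)" "\<And>d. d > D \<Longrightarrow> vcomp d f = 0"
    using vector_components[of f, OF pf] by blast
  have f: "f = (\<Sum>d\<le>D. vcomp d f)" by (intro ext) (simp only: vsum_apply D(1)[symmetric])
  show ?thesis
  proof (cases "d \<le> D")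
    case True
    then show ?thesis using gm_components[where F = "\<lambda>d. vcomp d f", OF assms f homv_vcomp[OF pf]] by blast
  next
    case False
    then show ?thesis using D(2) assms(1) by (simp add: gm_zero)
  qed
qed

lemma vcomp_add:
  "(\<And>a. f a \<in> polyfun) \<Longrightarrow> (\<And>a. g a \<in> polyfun) \<Longrightarrow> vcomp d (f + g) = vcomp d f + vcomp d g"
proof (intro ext)
  fix a x assume "\<And>a. f a \<in> polyfun" "\<And>a. g a \<in> polyfun"
  then show "vcomp d (f + g) a x = (vcomp d f + vcomp d g) a x"
    using hcomp_add[of "f a" "g a" d x] by (simp add: vcomp_def plus_fun_def[of "f a"])
qed

lemma vcomp_sum:
  assumes "\<And>i a. i \<in> I \<Longrightarrow> f i a \<in> polyfun"
  shows "vcomp d (\<Sum>i\<in>I. f i) = (\<Sum>i\<in>I. vcomp d (f i))"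
proof (intro ext)
  fix a x
  have "(\<Sum>i\<in>I. f i) a = (\<lambda>x. \<Sum>i\<in>I. f i a x)" by auto
  then show "vcomp d (\<Sum>i\<in>I. f i) a x = (\<Sum>i\<in>I. vcomp d (f i)) a x"
    using hcomp_sum[of I "\<lambda>i. f i a" d x] assms by (simp add: vcomp_def)
qed

lemma vcomp_cmul: "(\<And>a. f a \<in> polyfun) \<Longrightarrow> vcomp d ((\<lambda>_. c) \<odot> f) = (\<lambda>_. c) \<odot> vcomp d f"
  by (simp add: vcomp_def fun_eq_iff vsmul_def hcomp_cmult)

lemma vcomp_coordmul:
  "(\<And>a. f a \<in> polyfun) \<Longrightarrow>
    vcomp d ((\<lambda>x. x i) \<odot> f) = (case d of 0 \<Rightarrow> 0 | Suc e \<Rightarrow> (\<lambda>x. x i) \<odot> vcomp e f)"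
  by (auto simp: vcomp_def fun_eq_iff vsmul_def hcomp_coord_mult split: nat.splits)

lemma vcomp_homv: "homv e f \<Longrightarrow> vcomp d f = (if d = e then f else 0)"
  by (intro ext) (simp add: vcomp_def homv_def hcomp_hom[of e])

text \<open>The product of the module with the ideal of the coordinates in \<open>I\<close>. For
  \<open>I = UNIV\<close> the quotient is the fibre at the origin, for \<open>I = - {y}\<close> the
  fibre over the \<open>y\<close>-axis.\<close>

definition coordideal :: "'w set \<Rightarrow> ('a \<Rightarrow> ('w \<Rightarrow> real) \<Rightarrow> real) set \<Rightarrow> ('a \<Rightarrow> ('w \<Rightarrow> real) \<Rightarrow> real) set" where
  "coordideal I N = {\<Sum>i\<in>I. (\<lambda>x. x i) \<odot> n i | n. \<forall>i\<in>I. n i \<in> N}"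

lemma coordidealI: "(\<And>i. i \<in> I \<Longrightarrow> n i \<in> N) \<Longrightarrow> (\<Sum>i\<in>I. (\<lambda>x. x i) \<odot> n i) \<in> coordideal I N"
  by (auto simp: coordideal_def)

lemma coordidealE:
  assumes "f \<in> coordideal I N"
  obtains n where "\<And>i. i \<in> I \<Longrightarrow> n i \<in> N" "f = (\<Sum>i\<in>I. (\<lambda>x. x i) \<odot> n i)"
  using assms by (auto simp: coordideal_def)

context
  fixes N :: "('a \<Rightarrow> ('w::finite \<Rightarrow> real) \<Rightarrow> real) set"
  assumes N: "graded_module N"
begin

lemma coordideal_zero: "0 \<in> coordideal I N"
proof -
  have "(\<Sum>i\<in>I. (\<lambda>x. x i) \<odot> (0 :: 'a \<Rightarrow> ('w \<Rightarrow> real) \<Rightarrow> real)) = 0" by (simp add: fun_eq_iff)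
  moreover have "(\<Sum>i\<in>I. (\<lambda>x. x i) \<odot> (0 :: 'a \<Rightarrow> ('w \<Rightarrow> real) \<Rightarrow> real)) \<in> coordideal I N"
    by (rule coordidealI) (rule gm_zero[OF N])
  ultimately show ?thesis by simp
qed

lemma coordideal_add: "f \<in> coordideal I N \<Longrightarrow> g \<in> coordideal I N \<Longrightarrow> f + g \<in> coordideal I N"
proof (elim coordidealE)
  fix m n assume *: "\<And>i. i \<in> I \<Longrightarrow> n i \<in> N" "\<And>i. i \<in> I \<Longrightarrow> m i \<in> N"
    "f = (\<Sum>i\<in>I. (\<lambda>x. x i) \<odot> n i)" "g = (\<Sum>i\<in>I. (\<lambda>x. x i) \<odot> m i)"
  have "f + g = (\<Sum>i\<in>I. (\<lambda>x. x i) \<odot> (n i + m i))"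
    by (auto simp: * fun_eq_iff sum.distrib algebra_simps)
  then show ?thesis using * gm_add[OF N] by (auto intro!: coordidealI)
qed

lemma coordideal_smul: "p \<in> polyfun \<Longrightarrow> f \<in> coordideal I N \<Longrightarrow> p \<odot> f \<in> coordideal I N"
proof (elim coordidealE)
  fix n assume *: "\<And>i. i \<in> I \<Longrightarrow> n i \<in> N" "f = (\<Sum>i\<in>I. (\<lambda>x. x i) \<odot> n i)" "p \<in> polyfun"
  have "p \<odot> f = (\<Sum>i\<in>I. (\<lambda>x. x i) \<odot> (p \<odot> n i))"
    by (auto simp: * fun_eq_iff sum_distrib_left algebra_simps)
  then show ?thesis using * gm_smul[OF N] by (auto intro!: coordidealI)
qed

lemma coordideal_cmul: "f \<in> coordideal I N \<Longrightarrow> (\<lambda>_. c) \<odot> f \<in> coordideal I N"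
  by (rule coordideal_smul) (auto intro: polyfun.const)

lemma coordideal_diff: "f \<in> coordideal I N \<Longrightarrow> g \<in> coordideal I N \<Longrightarrow> f - g \<in> coordideal I N"
proof -
  assume *: "f \<in> coordideal I N" "g \<in> coordideal I N"
  have "f - g = f + (\<lambda>_. -1) \<odot> g" by (intro ext) simp
  then show ?thesis by (simp only:) (rule coordideal_add[OF *(1) coordideal_cmul[OF *(2)]])
qed

lemma coordideal_sum: "(\<And>k. k \<in> K \<Longrightarrow> f k \<in> coordideal I N) \<Longrightarrow> (\<Sum>k\<in>K. f k) \<in> coordideal I N"
  by (induction K rule: infinite_finite_induct) (auto intro: coordideal_zero coordideal_add)

lemma coordideal_coordmul:
  assumes "i \<in> I" "f \<in> N"
  shows "(\<lambda>x. x i) \<odot> f \<in> coordideal I N"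
proof -
  have "(\<lambda>x. x i) \<odot> f = (\<Sum>j\<in>I. (\<lambda>x. x j) \<odot> (if j = i then f else 0))"
  proof (intro ext)
    fix a x
    have "(\<Sum>j\<in>I. x j * (if j = i then f else 0) a x) = (\<Sum>j\<in>I. if j = i then x i * f a x else 0)"
      by (rule sum.cong) auto
    then show "((\<lambda>x. x i) \<odot> f) a x = (\<Sum>j\<in>I. (\<lambda>x. x j) \<odot> (if j = i then f else 0)) a x"
      using assms by simp
  qed
  also have "\<dots> \<in> coordideal I N" using assms gm_zero[OF N] by (intro coordidealI) auto
  finally show ?thesis .
qed

text \<open>The polynomials vanishing on a coordinate subspace form the ideal generated by the
  coordinates that vanish there.\<close>

lemma coordideal_ideal_smul:
  assumes "p \<in> polyfun" "\<And>x. (\<And>i. i \<in> I \<Longrightarrow> x i = 0) \<Longrightarrow> p x = 0" "f \<in> N"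
  shows "p \<odot> f \<in> coordideal I N"
proof -
  obtain h where h: "\<forall>i. h i \<in> polyfun"
      "\<forall>x. p x = p (\<lambda>i. if i \<in> I then 0 else x i) + (\<Sum>i\<in>I. x i * h i x)"
    using polyfun_coord_ideal[OF assms(1)] by blast
  moreover have "p (\<lambda>i. if i \<in> I then 0 else x i) = 0" for x by (rule assms(2)) auto
  ultimately have "p x = (\<Sum>i\<in>I. x i * h i x)" for x by simp
  then have "p \<odot> f = (\<Sum>i\<in>I. (\<lambda>x. x i) \<odot> (h i \<odot> f))"
    by (simp add: fun_eq_iff sum_distrib_right mult.assoc)
  then show ?thesis using h assms(3) gm_smul[OF N] by (auto intro!: coordidealI)
qed

end

lemma coordideal_mono: "I \<subseteq> J \<Longrightarrow> N \<subseteq> M \<Longrightarrow> graded_module M \<Longrightarrow> f \<in> coordideal I N \<Longrightarrow>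
    f \<in> coordideal J (M :: ('a \<Rightarrow> ('w::finite \<Rightarrow> real) \<Rightarrow> real) set)"
  by (elim coordidealE) (auto intro!: coordideal_sum coordideal_coordmul)

text \<open>\<open>gens_le r N\<close>: the fibre \<open>N / \<mm>N\<close> at the origin has dimension at most \<open>r\<close>.\<close>

definition gens_le :: "nat \<Rightarrow> ('a \<Rightarrow> ('w \<Rightarrow> real) \<Rightarrow> real) set \<Rightarrow> bool" where
  "gens_le r N \<longleftrightarrow> (\<forall>I :: nat set. \<forall>w. finite I \<and> card I = Suc r \<and> (\<forall>i\<in>I. w i \<in> N) \<longrightarrow>
     (\<exists>c. (\<exists>i\<in>I. c i \<noteq> 0) \<and> (\<Sum>i\<in>I. (\<lambda>_. c i) \<odot> w i) \<in> coordideal UNIV N))"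

text \<open>The bound tested on homogeneous elements only, which is what the shift lemma yields. For
  graded modules of full rank it already implies the bound for all elements.\<close>

definition gens_le_hom :: "nat \<Rightarrow> ('a \<Rightarrow> ('w \<Rightarrow> real) \<Rightarrow> real) set \<Rightarrow> bool" where
  "gens_le_hom r N \<longleftrightarrow> (\<forall>I :: nat set. \<forall>w \<delta>. finite I \<and> card I = Suc r \<and> (\<forall>i\<in>I. w i \<in> N \<and> homv (\<delta> i) (w i)) \<longrightarrow>
     (\<exists>c. (\<exists>i\<in>I. c i \<noteq> 0) \<and> (\<Sum>i\<in>I. (\<lambda>_. c i) \<odot> w i) \<in> coordideal UNIV N))"

definition hbasis ::
    "nat \<Rightarrow> ('a \<Rightarrow> ('w \<Rightarrow> real) \<Rightarrow> real) set \<Rightarrow> (nat \<Rightarrow> 'a \<Rightarrow> ('w \<Rightarrow> real) \<Rightarrow> real) \<Rightarrow> (nat \<Rightarrow> nat) \<Rightarrow> bool" where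
  "hbasis r N f d \<longleftrightarrow> (\<forall>k<r. f k \<in> N \<and> homv (d k) (f k)) \<and>
     (\<forall>g\<in>N. \<exists>q. (\<forall>k. q k \<in> polyfun) \<and> g = (\<Sum>k<r. q k \<odot> f k)) \<and>
     (\<forall>q. (\<forall>k. q k \<in> polyfun) \<and> (\<Sum>k<r. q k \<odot> f k) = 0 \<longrightarrow> (\<forall>k<r. \<forall>x. q k x = 0))"

text \<open>With \<open>F\<close> the free module on the coordinates in \<open>A\<close>, the module
  lies between \<open>p F\<close> and \<open>F\<close>. This encodes rank \<open>r\<close> without a
  dimension theory for modules.\<close>

definition full_rank :: "nat \<Rightarrow> ('a \<Rightarrow> ('w \<Rightarrow> real) \<Rightarrow> real) set \<Rightarrow> bool" where
  "full_rank r N \<longleftrightarrow> (\<exists>A p x\<^sub>0. card A = r \<and> p \<in> polyfun \<and> p x\<^sub>0 \<noteq> 0 \<and>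
     (\<forall>f\<in>N. \<forall>a. a \<notin> A \<longrightarrow> f a = 0) \<and> (\<forall>a\<in>A. (\<lambda>b x. if b = a then p x else 0) \<in> N))"

lemma gens_leI_span:
  fixes N :: "('a \<Rightarrow> ('w::finite \<Rightarrow> real) \<Rightarrow> real) set"
  assumes N: "graded_module N"
    and "\<And>g. g \<in> N \<Longrightarrow> \<exists>c. g - (\<Sum>k<r. (\<lambda>_. c k) \<odot> F k) \<in> coordideal UNIV N"
  shows "gens_le r N"
  unfolding gens_le_def
proof (intro allI impI)
  fix I :: "nat set" and w
  assume I: "finite I \<and> card I = Suc r \<and> (\<forall>i\<in>I. w i \<in> N)"
  then have "\<forall>i\<in>I. \<exists>c. w i - (\<Sum>k<r. (\<lambda>_. c k) \<odot> F k) \<in> coordideal UNIV N"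
    using assms(2) by blast
  then have "\<exists>C. \<forall>i\<in>I. w i - (\<Sum>k<r. (\<lambda>_. C i k) \<odot> F k) \<in> coordideal UNIV N" by (rule bchoice)
  then obtain C where C: "\<And>i. i \<in> I \<Longrightarrow> w i - (\<Sum>k<r. (\<lambda>_. C i k) \<odot> F k) \<in> coordideal UNIV N" by blast
  obtain c where c: "\<exists>i\<in>I. c i \<noteq> 0" "\<And>k. k < r \<Longrightarrow> (\<Sum>i\<in>I. c i * C i k) = 0"
    using real_dependent[of "{..<r}" I C] I by auto
  have "(\<Sum>i\<in>I. (\<lambda>_. c i) \<odot> w i) = (\<Sum>i\<in>I. (\<lambda>_. c i) \<odot> (w i - (\<Sum>k<r. (\<lambda>_. C i k) \<odot> F k)))"
  proof (intro ext)
    fix a x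
    have "(\<Sum>i\<in>I. c i * (\<Sum>k<r. C i k * F k a x)) = (\<Sum>k<r. (\<Sum>i\<in>I. c i * C i k) * F k a x)"
      unfolding sum_distrib_left sum_distrib_right mult.assoc by (rule sum.swap)
    then show "(\<Sum>i\<in>I. (\<lambda>_. c i) \<odot> w i) a x =
        (\<Sum>i\<in>I. (\<lambda>_. c i) \<odot> (w i - (\<Sum>k<r. (\<lambda>_. C i k) \<odot> F k))) a x"
      using c(2) by (simp add: right_diff_distrib sum_subtractf)
  qed
  also have "\<dots> \<in> coordideal UNIV N"
    using C by (intro coordideal_sum coordideal_cmul N)
  finally show "\<exists>c. (\<exists>i\<in>I. c i \<noteq> 0) \<and> (\<Sum>i\<in>I. (\<lambda>_. c i) \<odot> w i) \<in> coordideal UNIV N"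
    using c(1) by blast
qed

text \<open>Modulo the maximal ideal only the values of the coefficients at the origin count, so the
  basis spans the fibre over the reals.\<close>

lemma gens_le_hbasis:
  fixes N :: "('a \<Rightarrow> ('w::finite \<Rightarrow> real) \<Rightarrow> real) set"
  assumes N: "graded_module N" and B: "hbasis r N f d"
  shows "gens_le r N"
proof (rule gens_leI_span[OF N])
  fix g assume "g \<in> N"
  then obtain q where q: "\<And>k. q k \<in> polyfun" "g = (\<Sum>k<r. q k \<odot> f k)"
    using B unfolding hbasis_def by blast
  have "g - (\<Sum>k<r. (\<lambda>_. q k (\<lambda>_. 0)) \<odot> f k) = (\<Sum>k<r. (\<lambda>x. q k x - q k (\<lambda>_. 0)) \<odot> f k)"
    unfolding q(2) by (intro ext) (simp add: sum_subtractf left_diff_distrib)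
  also have "\<dots> \<in> coordideal UNIV N"
  proof (rule coordideal_sum[OF N])
    fix k assume "k \<in> {..<r}"
    then have fk: "f k \<in> N" using B by (simp add: hbasis_def)
    show "(\<lambda>x. q k x - q k (\<lambda>_. 0)) \<odot> f k \<in> coordideal UNIV N"
    proof (rule coordideal_ideal_smul[OF N _ _ fk])
      show "(\<lambda>x. q k x - q k (\<lambda>_. 0)) \<in> polyfun" by (rule polyfun_diff[OF q(1) polyfun.const])
      fix x :: "'w \<Rightarrow> real" assume "\<And>i. i \<in> UNIV \<Longrightarrow> x i = 0"
      then have "x = (\<lambda>_. 0)" by auto
      then show "q k x - q k (\<lambda>_. 0) = 0" by simp
    qed
  qed
  finally show "\<exists>c. g - (\<Sum>k<r. (\<lambda>_. c k) \<odot> f k) \<in> coordideal UNIV N"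
    by (intro exI[of _ "\<lambda>k. q k (\<lambda>_. 0)"])
qed

lemma gens_leD:
  fixes w :: "nat \<Rightarrow> 'a \<Rightarrow> ('w \<Rightarrow> real) \<Rightarrow> real"
  assumes "gens_le r N" "finite I" "card I = Suc r" "\<And>i. i \<in> I \<Longrightarrow> w i \<in> N"
  obtains c where "\<exists>i\<in>I. c i \<noteq> 0" "(\<Sum>i\<in>I. (\<lambda>_. c i) \<odot> w i) \<in> coordideal UNIV N"
proof -
  have "\<exists>c. (\<exists>i\<in>I. c i \<noteq> 0) \<and> (\<Sum>i\<in>I. (\<lambda>_. c i) \<odot> w i) \<in> coordideal UNIV N"
    using assms(1)[unfolded gens_le_def, rule_format, of I w] assms(2-) by blast
  then show ?thesis using that by (elim exE conjE)
qed

lemma gens_leI: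
  assumes "\<And>(I :: nat set) w. finite I \<Longrightarrow> card I = Suc r \<Longrightarrow> (\<And>i. i \<in> I \<Longrightarrow> w i \<in> N) \<Longrightarrow>
    \<exists>c. (\<exists>i\<in>I. c i \<noteq> 0) \<and> (\<Sum>i\<in>I. (\<lambda>_. c i) \<odot> w i) \<in> coordideal UNIV N"
  shows "gens_le r N"
  unfolding gens_le_def using assms by simp

lemma gens_le_hom_if_gens_le: "gens_le r N \<Longrightarrow> gens_le_hom r N"
  unfolding gens_le_def gens_le_hom_def by blast

text \<open>A maximal family of homogeneous elements that is independent in the fibre generates the
  module, by the graded Nakayama lemma. It has at most \<open>r\<close> members by the bound on the
  fibre and at least \<open>r\<close> by the rank; and \<open>r\<close> generators of a module of
  rank \<open>r\<close> satisfy no relation.\<close>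

lemma ex_hbasis:
  fixes N :: "('a::finite \<Rightarrow> ('w::finite \<Rightarrow> real) \<Rightarrow> real) set"
  assumes N: "graded_module N" and rank: "full_rank r N" and gens: "gens_le_hom r N"
  shows "\<exists>f d. hbasis r N f d"
proof -
  note pf = gm_polyfun[OF N]
  define indep where "indep n w \<longleftrightarrow> (\<forall>i<n. w i \<in> N \<and> (\<exists>d. homv d (w i))) \<and>
      (\<forall>c. (\<Sum>i<n. (\<lambda>_. c i) \<odot> w i) \<in> coordideal UNIV N \<longrightarrow> (\<forall>i<n. c i = 0))" for n :: nat and w
  have bound: "n \<le> r" if "indep n w" for n w
  proof (rule ccontr)
    assume "\<not> n \<le> r"
    then have sub: "{..r} \<subseteq> {..<n}" by auto
    have "\<forall>i\<in>{..r}. \<exists>d. w i \<in> N \<and> homv d (w i)" using that sub by (auto simp: indep_def)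
    then obtain \<delta> where "\<forall>i\<in>{..r}. w i \<in> N \<and> homv (\<delta> i) (w i)" by metis
    then obtain c where c: "\<exists>i\<in>{..r}. c i \<noteq> 0" "(\<Sum>i\<in>{..r}. (\<lambda>_. c i) \<odot> w i) \<in> coordideal UNIV N"
      using gens[unfolded gens_le_hom_def, rule_format, of "{..r}" w \<delta>] by auto
    define c' where "c' i = (if i \<le> r then c i else 0)" for i
    have "(\<Sum>i<n. (\<lambda>_. c' i) \<odot> w i) = (\<Sum>i\<in>{..r}. (\<lambda>_. c' i) \<odot> w i)"
      using sub by (intro sum.mono_neutral_right) (auto simp: c'_def fun_eq_iff)
    also have "\<dots> = (\<Sum>i\<in>{..r}. (\<lambda>_. c i) \<odot> w i)" by (intro sum.cong) (auto simp: c'_def)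
    finally have "(\<Sum>i<n. (\<lambda>_. c' i) \<odot> w i) \<in> coordideal UNIV N" using c(2) by (simp only:)
    then have "\<forall>i<n. c' i = 0" using that unfolding indep_def by (elim conjE allE[of _ c']) simp
    then show False using c(1) sub by (auto simp: c'_def)
  qed
  have "indep 0 (\<lambda>_. 0)" by (simp add: indep_def)
  then have "\<exists>n. (\<exists>w. indep n w) \<and> (\<forall>m. (\<exists>w. indep m w) \<longrightarrow> m \<le> n)"
    using ex_has_greatest_nat[of "\<lambda>n. \<exists>w. indep n w" 0 "\<lambda>n. n" "Suc r"] bound
    by (meson le_imp_less_Suc)
  then obtain n w where ind: "indep n w" and max: "\<And>m v. indep m v \<Longrightarrow> m \<le> n" by blast
  obtain \<delta> where w: "\<And>i. i < n \<Longrightarrow> w i \<in> N" "\<And>i. i < n \<Longrightarrow> homv (\<delta> i) (w i)"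
    using ind unfolding indep_def by metis
  \<comment> \<open>Maximality of the family: adjoining \<open>v\<close> creates a relation in the
    fibre, in which the coefficient of \<open>v\<close> is nonzero because the family alone is
    independent.\<close>
  have span: "\<exists>c. v - (\<Sum>i<n. (\<lambda>_. c i) \<odot> w i) \<in> coordideal UNIV N" if v: "v \<in> N" "homv e v" for v e
  proof -
    have "\<not> indep (Suc n) (w(n := v))" using max[of "Suc n"] by auto
    moreover have "\<forall>i<Suc n. (w(n := v)) i \<in> N \<and> (\<exists>d. homv d ((w(n := v)) i))"
      using w v by (auto simp: less_Suc_eq)
    ultimately obtain c where c: "(\<Sum>i<Suc n. (\<lambda>_. c i) \<odot> (w(n := v)) i) \<in> coordideal UNIV N"
        "\<exists>i<Suc n. c i \<noteq> 0"
      unfolding indep_def by blast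
    have eq: "(\<Sum>i<Suc n. (\<lambda>_. c i) \<odot> (w(n := v)) i) = (\<Sum>i<n. (\<lambda>_. c i) \<odot> w i) + (\<lambda>_. c n) \<odot> v"
      by (simp add: fun_eq_iff)
    have "c n \<noteq> 0"
    proof
      assume "c n = 0"
      then have "(\<Sum>i<n. (\<lambda>_. c i) \<odot> w i) \<in> coordideal UNIV N"
        using c(1) unfolding eq by (simp add: vsmul_def flip: zero_fun_def)
      then have "\<forall>i<n. c i = 0" using ind unfolding indep_def by (elim conjE allE[of _ c]) simp
      then show False using c(2) \<open>c n = 0\<close> by (auto simp: less_Suc_eq)
    qed
    have "v - (\<Sum>i<n. (\<lambda>_. - c i / c n) \<odot> w i) = (\<lambda>_. 1 / c n) \<odot> (\<Sum>i<Suc n. (\<lambda>_. c i) \<odot> (w(n := v)) i)"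
      unfolding eq using \<open>c n \<noteq> 0\<close>
      by (simp add: fun_eq_iff sum_distrib_left sum_negf field_simps flip: sum_divide_distrib)
    then show ?thesis
      by (intro exI[of _ "\<lambda>i. - c i / c n"]) (simp only: coordideal_cmul[OF N c(1)])
  qed
  \<comment> \<open>Graded Nakayama: taking the degree \<open>e\<close> part of the representation
    in the fibre, each \<open>m j\<close> contributes only its part of degree \<open>e - 1\<close>,
    to which the induction hypothesis applies.\<close>
  have gen_hom: "\<exists>q. (\<forall>k. q k \<in> polyfun) \<and> v = (\<Sum>k<n. q k \<odot> w k)" if "v \<in> N" "homv e v" for v e
    using that
  proof (induction e arbitrary: v rule: less_induct)
    case (less e)
    obtain c where "v - (\<Sum>i<n. (\<lambda>_. c i) \<odot> w i) \<in> coordideal UNIV N"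
      using span[OF less.prems] by blast
    then obtain m where m: "\<And>j. m j \<in> N" "v - (\<Sum>i<n. (\<lambda>_. c i) \<odot> w i) = (\<Sum>j\<in>UNIV. (\<lambda>x. x j) \<odot> m j)"
      by (elim coordidealE) auto
    have pfw: "w i a \<in> polyfun" if "i < n" for i a using w pf that by blast
    have pfm: "m j a \<in> polyfun" for j a using m pf by blast
    have pfwc: "((\<lambda>_. c i) \<odot> w i) a \<in> polyfun" if "i < n" for i a
      using pfw[OF that] by (simp add: vsmul_def polyfun_intros)
    have pfmc: "((\<lambda>x. x j) \<odot> m j) a \<in> polyfun" for j a
      using pfm by (simp add: vsmul_def polyfun_intros)
    have pfs: "(\<Sum>i<n. (\<lambda>_. c i) \<odot> w i) a \<in> polyfun" "(\<Sum>j\<in>UNIV. (\<lambda>x. x j) \<odot> m j) a \<in> polyfun" for a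
      using w m by (auto intro!: gm_polyfun[OF N] gm_sum[OF N] gm_cmul[OF N] gm_coordmul[OF N] simp del: vsum_apply)
    have "v = (\<Sum>i<n. (\<lambda>_. c i) \<odot> w i) + (\<Sum>j\<in>UNIV. (\<lambda>x. x j) \<odot> m j)"
      unfolding m(2)[symmetric] by (intro ext) simp
    then have "vcomp e v = vcomp e ((\<Sum>i<n. (\<lambda>_. c i) \<odot> w i) + (\<Sum>j\<in>UNIV. (\<lambda>x. x j) \<odot> m j))"
      by (rule arg_cong)
    also have "\<dots> = vcomp e (\<Sum>i<n. (\<lambda>_. c i) \<odot> w i) + vcomp e (\<Sum>j\<in>UNIV. (\<lambda>x. x j) \<odot> m j)"
      using pfs by (intro vcomp_add)
    also have "vcomp e (\<Sum>i<n. (\<lambda>_. c i) \<odot> w i) = (\<Sum>i<n. vcomp e ((\<lambda>_. c i) \<odot> w i))"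
      using pfwc by (intro vcomp_sum) auto
    also have "vcomp e (\<Sum>j\<in>UNIV. (\<lambda>x. x j) \<odot> m j) = (\<Sum>j\<in>UNIV. vcomp e ((\<lambda>x. x j) \<odot> m j))"
      using pfmc by (intro vcomp_sum) auto
    also have "(\<Sum>i<n. vcomp e ((\<lambda>_. c i) \<odot> w i)) = (\<Sum>i<n. (\<lambda>_. if e = \<delta> i then c i else 0) \<odot> w i)"
    proof (intro sum.cong refl)
      fix i assume "i \<in> {..<n}"
      then have "vcomp e ((\<lambda>_. c i) \<odot> w i) = (\<lambda>_. c i) \<odot> (if e = \<delta> i then w i else 0)"
        using pfw w(2)[of i] by (simp add: vcomp_cmul vcomp_homv[of "\<delta> i"])
      then show "vcomp e ((\<lambda>_. c i) \<odot> w i) = (\<lambda>_. if e = \<delta> i then c i else 0) \<odot> w i"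
        by (simp add: fun_eq_iff)
    qed
    finally have "vcomp e v = (\<Sum>i<n. (\<lambda>_. if e = \<delta> i then c i else 0) \<odot> w i) +
        (\<Sum>j\<in>UNIV. vcomp e ((\<lambda>x. x j) \<odot> m j))" .
    then have v: "v = (\<Sum>i<n. (\<lambda>_. if e = \<delta> i then c i else 0) \<odot> w i) +
        (\<Sum>j\<in>UNIV. vcomp e ((\<lambda>x. x j) \<odot> m j))"
      by (simp only: vcomp_homv[OF less.prems(2)] simp_thms if_True)
    show ?case
    proof (cases e)
      case 0
      then have "(\<Sum>j\<in>UNIV. vcomp e ((\<lambda>x. x j) \<odot> m j)) = 0"
        using pfm by (intro sum.neutral) (simp add: vcomp_coordmul)
      then have "v = (\<Sum>i<n. (\<lambda>_. if e = \<delta> i then c i else 0) \<odot> w i)" using v by (simp only: add_0_right)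
      then show ?thesis
        by (intro exI[of _ "\<lambda>i _. if e = \<delta> i then c i else 0"] conjI allI polyfun.const)
    next
      case (Suc e')
      have "\<exists>q. (\<forall>k. q k \<in> polyfun) \<and> vcomp e' (m j) = (\<Sum>k<n. q k \<odot> w k)" for j
        by (intro less.IH[of e'] gm_vcomp[OF N] homv_vcomp m pfm) (simp add: Suc)
      then have "\<exists>q. \<forall>j. (\<forall>k. q j k \<in> polyfun) \<and> vcomp e' (m j) = (\<Sum>k<n. q j k \<odot> w k)"
        by (intro choice allI)
      then obtain q where q: "\<And>j k. q j k \<in> polyfun" "\<And>j. vcomp e' (m j) = (\<Sum>k<n. q j k \<odot> w k)"
        by blast
      have vm: "vcomp e ((\<lambda>x. x j) \<odot> m j) = (\<lambda>x. x j) \<odot> (\<Sum>k<n. q j k \<odot> w k)" for j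
        using pfm q(2) by (simp add: vcomp_coordmul Suc)
      have "v = (\<Sum>k<n. (\<lambda>x. (if e = \<delta> k then c k else 0) + (\<Sum>j\<in>UNIV. x j * q j k x)) \<odot> w k)"
      proof (intro ext)
        fix a x
        have "(\<Sum>j\<in>UNIV. x j * (\<Sum>k<n. q j k x * w k a x)) = (\<Sum>k<n. (\<Sum>j\<in>UNIV. x j * q j k x) * w k a x)"
          unfolding sum_distrib_left sum_distrib_right mult.assoc by (rule sum.swap)
        then show "v a x = (\<Sum>k<n. (\<lambda>x. (if e = \<delta> k then c k else 0) + (\<Sum>j\<in>UNIV. x j * q j k x)) \<odot> w k) a x"
          using fun_cong[OF fun_cong[OF v, of a], of x] 
          by (simp add: vm sum.distrib distrib_right)
      qed
      then show ?thesis
        by (intro exI[of _ "\<lambda>k x. (if e = \<delta> k then c k else 0) + (\<Sum>j\<in>UNIV. x j * q j k x)"] conjI allI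
            polyfun.add polyfun.const polyfun_sum polyfun.mult polyfun.coord q(1))
    qed
  qed
  have gen: "\<exists>q. (\<forall>k. q k \<in> polyfun) \<and> g = (\<Sum>k<n. q k \<odot> w k)" if gN: "g \<in> N" for g
  proof -
    have pfg: "g a \<in> polyfun" for a using pf[OF gN] .
    obtain D where D: "\<And>a x. g a x = (\<Sum>d\<le>D. vcomp d g a x)" "\<And>d. d > D \<Longrightarrow> vcomp d g = 0"
      using vector_components[of g, OF pfg] by blast
    have "\<exists>q. (\<forall>k. q k \<in> polyfun) \<and> vcomp d g = (\<Sum>k<n. q k \<odot> w k)" for d
      by (rule gen_hom[OF gm_vcomp[OF N gN] homv_vcomp[OF pf[OF gN]]])
    then have "\<exists>q. \<forall>d. (\<forall>k. q d k \<in> polyfun) \<and> vcomp d g = (\<Sum>k<n. q d k \<odot> w k)"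
      by (intro choice allI)
    then obtain q where q: "\<And>d k. q d k \<in> polyfun" "\<And>d. vcomp d g = (\<Sum>k<n. q d k \<odot> w k)" by blast
    have "g = (\<Sum>k<n. (\<lambda>x. \<Sum>d\<le>D. q d k x) \<odot> w k)"
    proof (intro ext)
      fix a x
      have "g a x = (\<Sum>d\<le>D. \<Sum>k<n. q d k x * w k a x)"
        by (subst D(1)) (simp add: q(2))
      also have "\<dots> = (\<Sum>k<n. \<Sum>d\<le>D. q d k x * w k a x)" by (rule sum.swap)
      finally show "g a x = (\<Sum>k<n. (\<lambda>x. \<Sum>d\<le>D. q d k x) \<odot> w k) a x"
        by (simp add: sum_distrib_right)
    qed
    then show ?thesis by (intro exI[of _ "\<lambda>k x. \<Sum>d\<le>D. q d k x"] conjI allI polyfun_sum q(1))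
  qed
  obtain A p x\<^sub>0 where rk: "card A = r \<and> p \<in> polyfun \<and> p x\<^sub>0 \<noteq> 0 \<and>
     (\<forall>f\<in>N. \<forall>a. a \<notin> A \<longrightarrow> f a = 0) \<and> (\<forall>a\<in>A. (\<lambda>b x. if b = a then p x else 0) \<in> N)"
    using rank unfolding full_rank_def by (elim exE)
  have A: "card A = r" "p \<in> polyfun" "p x\<^sub>0 \<noteq> 0" using rk by simp_all
  have A4: "(\<lambda>b x. if b = a then p x else 0) \<in> N" if "a \<in> A" for a
    using rk[THEN conjunct2, THEN conjunct2, THEN conjunct2, THEN conjunct2] that by (rule bspec)
  define W :: "('w \<Rightarrow> real) \<Rightarrow> nat \<Rightarrow> real ^ 'a" where "W x i = (\<chi> a. w i a x)" for x i
  \<comment> \<open>Where \<open>p\<close> is nonzero, the values of the generators span all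
    coordinate vectors of \<open>A\<close>, because \<open>p\<close> times each of these lies in the
    module.\<close>
  have ax: "axis a 1 \<in> span (W x ` {..<n})" if px: "p x \<noteq> 0" and aA: "a \<in> A" for x a
  proof -
    obtain q where q: "(\<lambda>b x. if b = a then p x else 0) = (\<Sum>k<n. q k \<odot> w k)"
      using gen[OF A4[OF aA]] by (elim exE conjE)
    have "(if b = a then p x else 0) = (\<Sum>k<n. q k x * w k b x)" for b
      using fun_cong[OF fun_cong[OF q, of b], of x] by simp
    then have "axis a 1 = (\<Sum>k<n. (q k x / p x) *\<^sub>R W x k)"
      using px
      by (simp add: vec_eq_iff W_def axis_def flip: sum_divide_distrib) (metis (full_types))
    moreover have "(\<Sum>k<n. (q k x / p x) *\<^sub>R W x k) \<in> span (W x ` {..<n})"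
      by (rule span_sum, rule span_scale, rule span_base) simp
    ultimately show ?thesis by (simp only:)
  qed
  let ?E = "(\<lambda>a. axis a 1 :: real ^ 'a) ` A"
  have E: "independent ?E" "card ?E = r"
  proof -
    have "?E \<subseteq> Basis" by (auto simp: Basis_vec_def)
    then show "independent ?E" using independent_Basis independent_mono by blast
    show "card ?E = r" using A(1) by (subst card_image) (auto simp: inj_on_def axis_eq_axis)
  qed
  have rn: "r \<le> n"
  proof -
    have "card ?E \<le> card (W x\<^sub>0 ` {..<n})"
      using ax[OF A(3)] E(1) independent_span_bound[of "W x\<^sub>0 ` {..<n}" ?E] by auto
    then show ?thesis using E(2) card_image_le[of "{..<n}" "W x\<^sub>0"] by simp
  qed
  then have "n = r" using bound[OF ind] by simp
  \<comment> \<open>If a coefficient were nonzero at such a point, one generator would be redundant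
    there and \<open>n - 1\<close> vectors would span \<open>r = n\<close> dimensions.\<close>
  have free: "q k x = 0" if q: "\<forall>k. q k \<in> polyfun" "(\<Sum>k<n. q k \<odot> w k) = 0" "k < n" for q k x
  proof (rule polyfun_generic_zero[of p "q k" x\<^sub>0 x])
    fix x assume px: "p x \<noteq> 0"
    show "q k x = 0"
    proof (rule ccontr)
      assume qk: "q k x \<noteq> 0"
      have "(\<Sum>j<n. q j x * w j a x) = 0" for a
        using fun_cong[OF fun_cong[OF q(2), of a], of x] by simp
      then have "(\<Sum>j<n. q j x *\<^sub>R W x j) = 0" by (simp add: vec_eq_iff W_def)
      then have "q k x *\<^sub>R W x k + (\<Sum>j\<in>{..<n}-{k}. q j x *\<^sub>R W x j) = 0"
        using q(3) by (subst (asm) sum.remove[of _ k]) auto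
      then have "q k x *\<^sub>R W x k = (\<Sum>j\<in>{..<n}-{k}. (- q j x) *\<^sub>R W x j)"
        by (simp add: eq_neg_iff_add_eq_0 sum_negf)
      then have "W x k = (1 / q k x) *\<^sub>R (\<Sum>j\<in>{..<n}-{k}. (- q j x) *\<^sub>R W x j)"
        using qk by (metis (no_types) nonzero_divide_eq_eq scaleR_one scaleR_scaleR)
      moreover have "(1 / q k x) *\<^sub>R (\<Sum>j\<in>{..<n}-{k}. (- q j x) *\<^sub>R W x j) \<in> span (W x ` ({..<n}-{k}))"
        by (rule span_scale, rule span_sum, rule span_scale, rule span_base) simp
      ultimately have Wk: "W x k \<in> span (W x ` ({..<n}-{k}))" by (simp only:)
      have "W x ` {..<n} \<subseteq> span (W x ` ({..<n}-{k}))"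
      proof
        fix u assume "u \<in> W x ` {..<n}"
        then obtain j where "j < n" "u = W x j" by auto
        then show "u \<in> span (W x ` ({..<n}-{k}))" using Wk by (cases "j = k") (auto intro: span_base)
      qed
      then have "span (W x ` {..<n}) \<subseteq> span (W x ` ({..<n}-{k}))" by (simp add: span_minimal)
      then have "?E \<subseteq> span (W x ` ({..<n}-{k}))" using ax[OF px] by auto
      then have "card ?E \<le> card (W x ` ({..<n}-{k}))"
        using E(1) independent_span_bound[of "W x ` ({..<n}-{k})" ?E] by simp
      also have "\<dots> \<le> card ({..<n}-{k})" by (intro card_image_le) auto
      also have "\<dots> < n" using q(3) by simp
      finally show False using E(2) \<open>n = r\<close> by simp
    qed
  qed (use q A in auto)
  have "hbasis r N w \<delta>"
    unfolding hbasis_def \<open>n = r\<close>[symmetric]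
  proof (intro conjI allI impI ballI)
    show "\<exists>q. (\<forall>k. q k \<in> polyfun) \<and> g = (\<Sum>k<n. q k \<odot> w k)" if "g \<in> N" for g
      using gen[OF that] .
    show "q k x = 0" if "(\<forall>k. q k \<in> polyfun) \<and> (\<Sum>k<n. q k \<odot> w k) = 0" "k < n" for q k x
      using free[OF that(1)[THEN conjunct1] that(1)[THEN conjunct2] that(2)] .
  qed (use w in simp_all)
  then show ?thesis by blast
qed

lemma gens_le_hom_imp_gens_le:
  fixes N :: "('a::finite \<Rightarrow> ('w::finite \<Rightarrow> real) \<Rightarrow> real) set"
  assumes "graded_module N" "full_rank r N" "gens_le_hom r N"
  shows "gens_le r N"
  using ex_hbasis[OF assms] gens_le_hbasis[OF assms(1)] by blast

text \<open>The element \<open>e\<close> spans a free summand complementary to the kernel of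
  \<open>s\<close>, so the fibre dimensions differ by one. It is applied to the constant vector with
  entries 1 and to the Euler field.\<close>

lemma gens_le_split:
  fixes N :: "('a \<Rightarrow> ('w::finite \<Rightarrow> real) \<Rightarrow> real) set"
  assumes N: "graded_module N" and e: "e \<in> N"
    and s: "\<And>f. f \<in> N \<Longrightarrow> s f \<in> polyfun" "\<And>f g. f \<in> N \<Longrightarrow> g \<in> N \<Longrightarrow> s (f + g) = s f + s g"
      "\<And>p f. p \<in> polyfun \<Longrightarrow> f \<in> N \<Longrightarrow> s (p \<odot> f) = p * s f" "s e = 1"
    and N': "N' = {f \<in> N. s f = 0}"
  shows "gens_le (Suc r) N \<longleftrightarrow> gens_le r N'"
proof -
  have s0: "s 0 = 0" using s(3)[OF polyfun.const[of 0] e]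
    by (simp add: vsmul_def fun_eq_iff flip: zero_fun_def)
  have ssum: "s (\<Sum>i\<in>I. f i) = (\<Sum>i\<in>I. s (f i))" if "\<And>i. i \<in> I \<Longrightarrow> f i \<in> N" for I :: "'i set" and f
    using that
  proof (induction I rule: infinite_finite_induct)
    case (insert i I)
    have "s (f i + (\<Sum>i\<in>I. f i)) = s (f i) + s (\<Sum>i\<in>I. f i)"
      using insert.prems by (intro s(2) gm_sum[OF N]) simp_all
    moreover have "s (\<Sum>i\<in>I. f i) = (\<Sum>i\<in>I. s (f i))" using insert.prems by (intro insert.IH) simp
    ultimately show ?case by (simp only: sum.insert[OF insert.hyps])
  qed (simp_all add: s0 del: vsum_apply)
  have ssum': "s (\<Sum>i\<in>I. p i \<odot> f i) x = (\<Sum>i\<in>I. p i x * s (f i) x)"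
    if "\<And>i. i \<in> I \<Longrightarrow> f i \<in> N" "\<And>i. i \<in> I \<Longrightarrow> p i \<in> polyfun" for I :: "'i set" and p f x
  proof -
    have "s (\<Sum>i\<in>I. p i \<odot> f i) = (\<Sum>i\<in>I. p i * s (f i))"
      using that by (subst ssum) (auto simp: s(3) gm_smul[OF N] intro!: sum.cong)
    moreover have "(\<Sum>i\<in>I. p i * s (f i)) x = (\<Sum>i\<in>I. p i x * s (f i) x)"
      by (induction I rule: infinite_finite_induct) auto
    ultimately show ?thesis by simp
  qed
  \<comment> \<open>The projection to the kernel of \<open>s\<close> along \<open>e\<close>.\<close>
  define \<pi> where "\<pi> f = f - s f \<odot> e" for f
  have \<pi>: "\<pi> f \<in> N'" if "f \<in> N" for f
  proof -
    have se: "s f \<odot> e \<in> N" using that s(1) by (intro gm_smul[OF N] e)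
    have mem: "\<pi> f \<in> N" unfolding \<pi>_def using that se by (intro gm_diff[OF N])
    have "s f = s (\<pi> f + s f \<odot> e)" by (simp add: \<pi>_def)
    also have "\<dots> = s (\<pi> f) + s f * 1" using mem se that s e by simp
    finally show ?thesis using mem by (simp add: N')
  qed
  have sub: "f \<in> N" "s f = 0" if "f \<in> N'" for f using that by (auto simp: N')
  show ?thesis
  proof
    assume L: "gens_le (Suc r) N"
    show "gens_le r N'"
      unfolding gens_le_def
    proof (intro allI impI)
      fix I :: "nat set" and w assume I: "finite I \<and> card I = Suc r \<and> (\<forall>i\<in>I. w i \<in> N')"
      \<comment> \<open>\<open>e\<close> is adjoined under a fresh index. Applying \<open>s\<close>
        to the resulting relation puts its coefficient \<open>c k\<close> into the maximal ideal, so
        this constant is 0.\<close>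
      obtain k where k: "k \<notin> I" using I ex_new_if_finite infinite_UNIV_nat by blast
      let ?w = "w(k := e)"
      have wN: "?w i \<in> N" if "i \<in> insert k I" for i using I that e sub by auto
      obtain c where c: "\<exists>i\<in>insert k I. c i \<noteq> 0" "(\<Sum>i\<in>insert k I. (\<lambda>_. c i) \<odot> ?w i) \<in> coordideal UNIV N"
        by (rule gens_leD[OF L, of "insert k I" ?w]) (use I k wN in auto)
      obtain n where n: "\<And>j. n j \<in> N" "(\<Sum>i\<in>insert k I. (\<lambda>_. c i) \<odot> ?w i) = (\<Sum>j\<in>UNIV. (\<lambda>x. x j) \<odot> n j)"
        using c(2) by (elim coordidealE) auto
      have "s (\<Sum>i\<in>insert k I. (\<lambda>_. c i) \<odot> ?w i) x = c k" for x
      proof -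
        have "s (\<Sum>i\<in>insert k I. (\<lambda>_. c i) \<odot> ?w i) x = (\<Sum>i\<in>insert k I. c i * s (?w i) x)"
          using wN by (intro ssum') (auto intro: polyfun.const)
        also have "\<dots> = c k + (\<Sum>i\<in>I. c i * s (?w i) x)" using I k s(4) by simp
        also have "(\<Sum>i\<in>I. c i * s (?w i) x) = 0" using I k sub by (intro sum.neutral) auto
        finally show ?thesis by (simp only: add_0_right)
      qed
      moreover have "s (\<Sum>j\<in>UNIV. (\<lambda>x. x j) \<odot> n j) x = (\<Sum>j\<in>UNIV. x j * s (n j) x)" for x
        using n by (intro ssum') (auto intro: polyfun.coord)
      ultimately have ck: "c k = (\<Sum>j\<in>UNIV. x j * s (n j) x)" for x using n(2) by (simp only:)
      have ck0: "c k = 0" using ck[of "\<lambda>_. 0"] by simp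
      have "(\<Sum>i\<in>I. (\<lambda>_. c i) \<odot> w i) = (\<Sum>i\<in>insert k I. (\<lambda>_. c i) \<odot> ?w i)"
      proof (intro ext)
        fix a x
        have "(\<Sum>i\<in>I. c i * w i a x) = (\<Sum>i\<in>I. c i * ?w i a x)" using k by (intro sum.cong) auto
        then show "(\<Sum>i\<in>I. (\<lambda>_. c i) \<odot> w i) a x = (\<Sum>i\<in>insert k I. (\<lambda>_. c i) \<odot> ?w i) a x"
          using k I ck0 by simp
      qed
      also have "\<dots> = (\<Sum>j\<in>UNIV. (\<lambda>x. x j) \<odot> \<pi> (n j))"
      proof (subst n(2), intro ext)
        fix a x
        have "(\<Sum>j\<in>UNIV. x j * (s (n j) x * e a x)) = (\<Sum>j\<in>UNIV. x j * s (n j) x) * e a x"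
          by (simp add: sum_distrib_right mult.assoc)
        also have "\<dots> = 0" using ck[of x] ck0 by simp
        finally show "(\<Sum>j\<in>UNIV. (\<lambda>x. x j) \<odot> n j) a x = (\<Sum>j\<in>UNIV. (\<lambda>x. x j) \<odot> \<pi> (n j)) a x"
          by (simp add: \<pi>_def right_diff_distrib sum_subtractf)
      qed
      also have "\<dots> \<in> coordideal UNIV N'" by (rule coordidealI) (rule \<pi>[OF n(1)])
      finally have "(\<Sum>i\<in>I. (\<lambda>_. c i) \<odot> w i) \<in> coordideal UNIV N'" .
      moreover have "\<exists>i\<in>I. c i \<noteq> 0" using c(1) ck0 by auto
      ultimately show "\<exists>c. (\<exists>i\<in>I. c i \<noteq> 0) \<and> (\<Sum>i\<in>I. (\<lambda>_. c i) \<odot> w i) \<in> coordideal UNIV N'"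
        by (intro exI[of _ c]) (simp only: simp_thms)
    qed
  next
    assume R: "gens_le r N'"
    have special: "\<exists>c. (\<exists>i\<in>I. c i \<noteq> 0) \<and> (\<Sum>i\<in>I. (\<lambda>_. c i) \<odot> w i) \<in> coordideal UNIV N"
      if I: "finite I" "card I = Suc r" "\<And>i. i \<in> I \<Longrightarrow> w i \<in> N" "\<And>i. i \<in> I \<Longrightarrow> s (w i) (\<lambda>_. 0) = 0"
      for I :: "nat set" and w
    proof -
      obtain c where c: "\<exists>i\<in>I. c i \<noteq> 0" "(\<Sum>i\<in>I. (\<lambda>_. c i) \<odot> \<pi> (w i)) \<in> coordideal UNIV N'"
        by (rule gens_leD[OF R, of I "\<lambda>i. \<pi> (w i)"]) (use I \<pi> in auto)
      have "(\<Sum>i\<in>I. (\<lambda>_. c i) \<odot> w i) = (\<Sum>i\<in>I. (\<lambda>_. c i) \<odot> \<pi> (w i)) + (\<lambda>x. \<Sum>i\<in>I. c i * s (w i) x) \<odot> e"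
        by (simp add: fun_eq_iff \<pi>_def right_diff_distrib sum_subtractf sum_distrib_right mult.assoc)
      moreover have "(\<Sum>i\<in>I. (\<lambda>_. c i) \<odot> \<pi> (w i)) \<in> coordideal UNIV N"
        using coordideal_mono[OF subset_refl _ N c(2)] sub by blast
      moreover have "(\<lambda>x. \<Sum>i\<in>I. c i * s (w i) x) \<odot> e \<in> coordideal UNIV N"
      proof (rule coordideal_ideal_smul[OF N _ _ e])
        show "(\<lambda>x. \<Sum>i\<in>I. c i * s (w i) x) \<in> polyfun"
          using I s(1) by (intro polyfun_intros) auto
        fix x :: "'w \<Rightarrow> real" assume "\<And>i. i \<in> UNIV \<Longrightarrow> x i = 0"
        then have "x = (\<lambda>_. 0)" by auto
        then show "(\<Sum>i\<in>I. c i * s (w i) x) = 0" using I(4) by simp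
      qed
      ultimately show ?thesis
        using c(1) by (intro exI[of _ c]) (simp only: coordideal_add[OF N] simp_thms)
    qed
    show "gens_le (Suc r) N"
      unfolding gens_le_def
    proof (intro allI impI)
      fix I :: "nat set" and w assume I: "finite I \<and> card I = Suc (Suc r) \<and> (\<forall>i\<in>I. w i \<in> N)"
      show "\<exists>c. (\<exists>i\<in>I. c i \<noteq> 0) \<and> (\<Sum>i\<in>I. (\<lambda>_. c i) \<odot> w i) \<in> coordideal UNIV N"
      proof -
        \<comment> \<open>A pivot with \<open>s (w k)\<close> nonzero at the origin, if there is
          one; it is used to make the other values vanish there. If there is none, all values are 0
          and \<open>t\<close> is 0 as well, since division by 0 gives 0.\<close>
        obtain k where k: "k \<in> I" "(\<exists>i\<in>I. s (w i) (\<lambda>_. 0) \<noteq> 0) \<longrightarrow> s (w k) (\<lambda>_. 0) \<noteq> 0"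
          using I by (metis card.empty ex_in_conv nat.distinct(1))
        define t where "t i = s (w i) (\<lambda>_. 0) / s (w k) (\<lambda>_. 0)" for i
        define u where "u i = w i + (\<lambda>_. - t i) \<odot> w k" for i
        have uN: "u i \<in> N" if "i \<in> I" for i
          unfolding u_def using I k that by (intro gm_add[OF N] gm_cmul[OF N]) auto
        have su: "s (u i) (\<lambda>_. 0) = 0" if "i \<in> I" for i
        proof -
          have "s (u i) = s (w i) + (\<lambda>_. - t i) * s (w k)"
            unfolding u_def using I k that by (simp add: s(2,3) gm_cmul[OF N] polyfun.const)
          then show ?thesis using k that by (auto simp: t_def)
        qed
        obtain c where c: "\<exists>i\<in>I-{k}. c i \<noteq> 0" "(\<Sum>i\<in>I-{k}. (\<lambda>_. c i) \<odot> u i) \<in> coordideal UNIV N"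
          using special[of "I - {k}" u] I k uN su by (elim exE conjE) auto
        define d where "d i = (if i = k then - (\<Sum>i\<in>I-{k}. c i * t i) else c i)" for i
        have "(\<Sum>i\<in>I. (\<lambda>_. d i) \<odot> w i) = (\<Sum>i\<in>I-{k}. (\<lambda>_. c i) \<odot> u i)"
        proof (intro ext)
          fix a x
          have "(\<Sum>i\<in>I. d i * w i a x) = d k * w k a x + (\<Sum>i\<in>I-{k}. d i * w i a x)"
            using I k by (intro sum.remove) auto
          also have "(\<Sum>i\<in>I-{k}. d i * w i a x) = (\<Sum>i\<in>I-{k}. c i * w i a x)"
            by (intro sum.cong) (auto simp: d_def)
          also have "d k = - (\<Sum>i\<in>I-{k}. c i * t i)" by (simp add: d_def)
          finally show "(\<Sum>i\<in>I. (\<lambda>_. d i) \<odot> w i) a x = (\<Sum>i\<in>I-{k}. (\<lambda>_. c i) \<odot> u i) a x"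
            by (simp add: u_def sum_distrib_right right_diff_distrib sum_subtractf mult.assoc)
        qed
        moreover have "\<exists>i\<in>I. d i \<noteq> 0" using c(1) by (auto simp: d_def)
        ultimately show ?thesis using c(2) by (intro exI[of _ d]) (simp only: simp_thms)
      qed
    qed
  qed
qed

lemma coordidealE':
  assumes "f \<in> coordideal I N"
  obtains n where "\<forall>i\<in>I. n i \<in> N" "f = (\<Sum>i\<in>I. (\<lambda>x. x i) \<odot> n i)"
  using assms unfolding coordideal_def by blast

text \<open>Restriction to the coordinate hyperplane \<open>x\<^sub>v = 0\<close>, whose remaining coordinates are
  relabelled by \<open>\<tau>\<close>.\<close>

definition extend0 :: "'w \<Rightarrow> ('u \<Rightarrow> 'w) \<Rightarrow> ('u \<Rightarrow> real) \<Rightarrow> 'w \<Rightarrow> real" where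
  "extend0 v \<tau> x = (\<lambda>c. if c = v then 0 else x (inv \<tau> c))"

definition restrict0 ::
    "'w \<Rightarrow> ('u \<Rightarrow> 'w) \<Rightarrow> ('a \<Rightarrow> ('w \<Rightarrow> real) \<Rightarrow> real) \<Rightarrow> 'a \<Rightarrow> ('u \<Rightarrow> real) \<Rightarrow> real" where
  "restrict0 v \<tau> f = (\<lambda>a x. f a (extend0 v \<tau> x))"

lemma restrict0_apply [simp]: "restrict0 v \<tau> f a x = f a (extend0 v \<tau> x)"
  by (simp add: restrict0_def)

lemma extend0_same [simp]: "extend0 v \<tau> x v = 0"
  by (simp add: extend0_def)

lemma extend0_other: "inj \<tau> \<Longrightarrow> range \<tau> = - {v} \<Longrightarrow> extend0 v \<tau> x (\<tau> u) = x u"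
  by (auto simp: extend0_def)

lemma polyfun_extend0: "p \<in> polyfun \<Longrightarrow> (\<lambda>x. p (extend0 v \<tau> x)) \<in> polyfun"
  unfolding extend0_def
  by (rule polyfun_compose[where q = "\<lambda>c x. if c = v then 0 else x (inv \<tau> c)"]) (assumption, intro polyfun_intros)

lemma extend0_comp: "range \<tau> = - {v} \<Longrightarrow> inj \<tau> \<Longrightarrow> extend0 v \<tau> (\<lambda>u. x (\<tau> u)) = x(v := 0)"
  by (auto simp: extend0_def fun_eq_iff) (metis ComplI f_inv_into_f singletonD)

lemma sum_coords_split:
  fixes g :: "'w::finite \<Rightarrow> real" and \<tau> :: "'u::finite \<Rightarrow> 'w"
  assumes "inj \<tau>" "range \<tau> = - {v}"
  shows "(\<Sum>j\<in>UNIV. g j) = g v + (\<Sum>u\<in>UNIV. g (\<tau> u))"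
proof -
  have "(\<Sum>j\<in>UNIV. g j) = g v + (\<Sum>j\<in>UNIV - {v}. g j)" by (rule sum.remove) auto
  also have "UNIV - {v} = range \<tau>" using assms by auto
  also have "(\<Sum>j\<in>range \<tau>. g j) = (\<Sum>u\<in>UNIV. g (\<tau> u))" using assms(1) by (simp add: sum.reindex)
  finally show ?thesis .
qed

lemma vector_division:
  assumes "\<And>a. f a \<in> polyfun" "\<And>a x. f a (x(v := 0)) = 0"
  obtains h where "\<And>a. h a \<in> polyfun" "\<And>a x. f a x = x v * h a x"
proof -
  have "\<exists>h. h \<in> polyfun \<and> (\<forall>x. f a x = x v * h x)" for a
  proof -
    show ?thesis
      by (rule polyfun_division[OF assms(1)[of a] polyfun.const[of 0] assms(2)[of a]]) auto
  qed
  then show ?thesis using that by metis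
qed

text \<open>A surjection over the restriction of the ring induces a surjection of the fibres at the
  origin.\<close>

lemma gens_le_restrict_imp:
  fixes N :: "('a \<Rightarrow> ('w::finite \<Rightarrow> real) \<Rightarrow> real) set" and M :: "('a \<Rightarrow> ('u::finite \<Rightarrow> real) \<Rightarrow> real) set"
  assumes \<tau>: "inj \<tau>" "range \<tau> = - {v}"
    and res: "\<And>f. f \<in> N \<Longrightarrow> restrict0 v \<tau> f \<in> M"
    and surj: "\<And>g. g \<in> M \<Longrightarrow> \<exists>f\<in>N. restrict0 v \<tau> f = g"
    and "gens_le r N"
  shows "gens_le r M"
proof (rule gens_leI)
  fix I :: "nat set" and w assume I: "finite I" "card I = Suc r" "\<And>i. i \<in> I \<Longrightarrow> w i \<in> M"
  then have "\<forall>i\<in>I. \<exists>f. f \<in> N \<and> restrict0 v \<tau> f = w i" using surj by blast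
  then have "\<exists>W. \<forall>i\<in>I. W i \<in> N \<and> restrict0 v \<tau> (W i) = w i" by (rule bchoice)
  then obtain W where W: "\<And>i. i \<in> I \<Longrightarrow> W i \<in> N" "\<And>i. i \<in> I \<Longrightarrow> restrict0 v \<tau> (W i) = w i" by blast
  obtain c where c: "\<exists>i\<in>I. c i \<noteq> 0" "(\<Sum>i\<in>I. (\<lambda>_. c i) \<odot> W i) \<in> coordideal UNIV N"
    by (rule gens_leD[OF assms(5) I(1,2) W(1)])
  obtain n where n0: "\<forall>j\<in>UNIV. n j \<in> N"
      "(\<Sum>i\<in>I. (\<lambda>_. c i) \<odot> W i) = (\<Sum>j\<in>UNIV. (\<lambda>x. x j) \<odot> n j)"
    by (rule coordidealE'[OF c(2)])
  note n = n0(1)[THEN bspec] n0(2)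
  have "(\<Sum>i\<in>I. (\<lambda>_. c i) \<odot> w i) = (\<Sum>u\<in>UNIV. (\<lambda>x. x u) \<odot> restrict0 v \<tau> (n (\<tau> u)))"
  proof (intro ext)
    fix a x
    have "w i a x = W i a (extend0 v \<tau> x)" if "i \<in> I" for i
      using W(2)[OF that] by (metis restrict0_apply)
    then have "(\<Sum>i\<in>I. (\<lambda>_. c i) \<odot> w i) a x = (\<Sum>i\<in>I. (\<lambda>_. c i) \<odot> W i) a (extend0 v \<tau> x)" by simp
    also have "\<dots> = (\<Sum>j\<in>UNIV. extend0 v \<tau> x j * n j a (extend0 v \<tau> x))"
      unfolding n(2) by simp
    also have "\<dots> = (\<Sum>u\<in>UNIV. x u * n (\<tau> u) a (extend0 v \<tau> x))"
      by (subst sum_coords_split[OF \<tau>]) (simp add: extend0_other[OF \<tau>])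
    finally show "(\<Sum>i\<in>I. (\<lambda>_. c i) \<odot> w i) a x = (\<Sum>u\<in>UNIV. (\<lambda>x. x u) \<odot> restrict0 v \<tau> (n (\<tau> u))) a x"
      by simp
  qed
  also have "\<dots> \<in> coordideal UNIV M" by (rule coordidealI) (rule res[OF n(1)[OF UNIV_I]])
  finally show "\<exists>c. (\<exists>i\<in>I. c i \<noteq> 0) \<and> (\<Sum>i\<in>I. (\<lambda>_. c i) \<odot> w i) \<in> coordideal UNIV M"
    using c(1) by (intro exI[of _ c] conjI)
qed

text \<open>By saturation, the kernel of the restriction is \<open>x v\<close> times the module,
  which is zero in the fibre. So the two fibres coincide.\<close>

lemma gens_le_restrict_conv:
  fixes N :: "('a \<Rightarrow> ('w::finite \<Rightarrow> real) \<Rightarrow> real) set" and M :: "('a \<Rightarrow> ('u::finite \<Rightarrow> real) \<Rightarrow> real) set"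
  assumes \<tau>: "inj \<tau>" "range \<tau> = - {v}"
    and res: "\<And>f. f \<in> N \<Longrightarrow> restrict0 v \<tau> f \<in> M"
    and surj: "\<And>g. g \<in> M \<Longrightarrow> \<exists>f\<in>N. restrict0 v \<tau> f = g"
    and N: "graded_module N" and sat: "\<And>h. (\<And>a. h a \<in> polyfun) \<Longrightarrow> (\<lambda>x. x v) \<odot> h \<in> N \<Longrightarrow> h \<in> N"
    and M: "gens_le r M"
  shows "gens_le r N"
proof (rule gens_leI)
  fix I :: "nat set" and w assume I: "finite I" "card I = Suc r" "\<And>i. i \<in> I \<Longrightarrow> w i \<in> N"
  obtain c where c: "\<exists>i\<in>I. c i \<noteq> 0" "(\<Sum>i\<in>I. (\<lambda>_. c i) \<odot> restrict0 v \<tau> (w i)) \<in> coordideal UNIV M"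
    by (rule gens_leD[OF M I(1,2), of "\<lambda>i. restrict0 v \<tau> (w i)"]) (use res I(3) in auto)
  obtain m where m0: "\<forall>u\<in>UNIV. m u \<in> M"
      "(\<Sum>i\<in>I. (\<lambda>_. c i) \<odot> restrict0 v \<tau> (w i)) = (\<Sum>u\<in>UNIV. (\<lambda>x. x u) \<odot> m u)"
    by (rule coordidealE'[OF c(2)])
  note m = m0(1)[THEN bspec] m0(2)
  have "\<forall>u. \<exists>f. f \<in> N \<and> restrict0 v \<tau> f = m u" using m(1) surj by blast
  then have "\<exists>n. \<forall>u. n u \<in> N \<and> restrict0 v \<tau> (n u) = m u" by (rule choice)
  then obtain n where n: "\<And>u. n u \<in> N" "\<And>u. restrict0 v \<tau> (n u) = m u" by blast
  \<comment> \<open>The relation in the restricted module is lifted term by term; the error vanishes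
    on \<open>x v = 0\<close> and is therefore divisible by \<open>x v\<close> inside the
    module.\<close>
  define D where "D = (\<Sum>i\<in>I. (\<lambda>_. c i) \<odot> w i) - (\<Sum>u\<in>UNIV. (\<lambda>x. x (\<tau> u)) \<odot> n u)"
  have S: "(\<Sum>i\<in>I. (\<lambda>_. c i) \<odot> w i) \<in> N" by (rule gm_sum[OF N], rule gm_cmul[OF N]) (rule I(3))
  have S': "(\<Sum>u\<in>UNIV. (\<lambda>x. x (\<tau> u)) \<odot> n u) \<in> N"
    by (rule gm_sum[OF N], rule gm_coordmul[OF N]) (rule n(1))
  have DN: "D \<in> N" unfolding D_def by (rule gm_diff[OF N S S'])
  have "D a (extend0 v \<tau> y) = 0" for a y
  proof -
    have "m u a y = n u a (extend0 v \<tau> y)" for u using n(2)[of u] by (metis restrict0_apply)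
    moreover have "(\<Sum>i\<in>I. c i * w i a (extend0 v \<tau> y)) = (\<Sum>u\<in>UNIV. y u * m u a y)"
      using fun_cong[OF fun_cong[OF m(2), of a], of y] by simp
    ultimately show ?thesis by (simp add: D_def extend0_other[OF \<tau>])
  qed
  then have "D a (x(v := 0)) = 0" for a x
    using extend0_comp[OF \<tau>(2,1), of x] by metis
  then obtain h where h: "\<And>a. h a \<in> polyfun" "\<And>a x. D a x = x v * h a x"
    using vector_division[of D v] gm_polyfun[OF N DN] by blast
  have Dh: "D = (\<lambda>x. x v) \<odot> h" using h(2) by (simp add: fun_eq_iff)
  then have hN: "h \<in> N" using sat[OF h(1)] DN by (simp only:)
  have "(\<Sum>i\<in>I. (\<lambda>_. c i) \<odot> w i) = D + (\<Sum>u\<in>UNIV. (\<lambda>x. x (\<tau> u)) \<odot> n u)"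
    unfolding D_def by (intro ext) simp
  also have "\<dots> \<in> coordideal UNIV N"
    unfolding Dh
    by (rule coordideal_add[OF N coordideal_coordmul[OF N UNIV_I hN]], rule coordideal_sum[OF N],
        rule coordideal_coordmul[OF N UNIV_I n(1)])
  finally show "\<exists>c. (\<exists>i\<in>I. c i \<noteq> 0) \<and> (\<Sum>i\<in>I. (\<lambda>_. c i) \<odot> w i) \<in> coordideal UNIV N"
    using c(1) by (intro exI[of _ c] conjI)
qed

section \<open>The shift lemma\<close>

lemma hcomp_mult_hom:
  assumes "p \<in> polyfun" "hom e q"
  shows "hcomp d (\<lambda>x. p x * q x) x = (if e \<le> d then hcomp (d - e) p x * q x else 0)"
proof -
  let ?A = "along (\<lambda>j y. 0) (\<lambda>j y. y j)"
  have "?A q x = monom (q x) e"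
    using assms by (intro along_eqI) (simp add: hom_def poly_monom mult.commute)
  then show ?thesis
    using hom_polyfun[OF assms(2)] assms(1)
    by (auto simp: hcomp_def along_mult coeff_monom_mult mult.commute)
qed

text \<open>If \<open>N = T\<^sup>-\<^sup>1 M\<close> for an operator \<open>T\<close> of degree \<open>-1\<close> which is linear over the coordinates other
  than \<open>y\<close> and satisfies \<open>[T, y] = 1\<close> modulo them, then multiplication by \<open>y\<close> is injective on
  the fibre of \<open>N\<close> over the \<open>y\<close>-axis as soon as this holds for \<open>M\<close>.\<close>

lemma shift_lemma:
  fixes N M :: "('a::finite \<Rightarrow> ('w::finite \<Rightarrow> real) \<Rightarrow> real) set"
  assumes N: "graded_module N" and M: "graded_module M" and sub: "N \<subseteq> M" and B: "hbasis r M f d"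
    and T: "\<And>g. g \<in> N \<Longrightarrow> T g \<in> M" "\<And>g. g \<in> N \<Longrightarrow> T g = 0 \<Longrightarrow> g = 0" "\<And>h. h \<in> M \<Longrightarrow> \<exists>g\<in>N. T g = h"
      "\<And>g h. g \<in> N \<Longrightarrow> h \<in> N \<Longrightarrow> T (g + h) = T g + T h"
      "\<And>c g. g \<in> N \<Longrightarrow> T ((\<lambda>_. c) \<odot> g) = (\<lambda>_. c) \<odot> T g"
      "\<And>i g. g \<in> N \<Longrightarrow> i \<noteq> y \<Longrightarrow> T ((\<lambda>x. x i) \<odot> g) = (\<lambda>x. x i) \<odot> T g"
      "\<And>g. g \<in> N \<Longrightarrow> T ((\<lambda>x. x y) \<odot> g) - (\<lambda>x. x y) \<odot> T g - g \<in> coordideal (- {y}) M"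
      "\<And>g e. g \<in> N \<Longrightarrow> homv (Suc e) g \<Longrightarrow> homv e (T g)"
  shows "gens_le_hom r N"
proof -
  have fM: "f k \<in> M" "homv (d k) (f k)" if "k < r" for k using B that by (auto simp: hbasis_def)
  have Bgen: "\<exists>q. (\<forall>k. q k \<in> polyfun) \<and> g = (\<Sum>k<r. q k \<odot> f k)" if "g \<in> M" for g
    using B[unfolded hbasis_def, THEN conjunct2, THEN conjunct1] that by (rule bspec)
  have Bfree: "q k x = 0" if "\<And>k. q k \<in> polyfun" "(\<Sum>k<r. q k \<odot> f k) = 0" "k < r" for q k x
    using B[unfolded hbasis_def, THEN conjunct2, THEN conjunct2, rule_format, of q k x] that by simp
  have Tsum: "T (\<Sum>i\<in>I. g i) = (\<Sum>i\<in>I. T (g i))" if "\<And>i. i \<in> I \<Longrightarrow> g i \<in> N" for I :: "'i set" and g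
    using that
  proof (induction I rule: infinite_finite_induct)
    case (insert i I)
    have "T (g i + (\<Sum>i\<in>I. g i)) = T (g i) + T (\<Sum>i\<in>I. g i)"
      using insert.prems by (intro T(4) gm_sum[OF N]) simp_all
    moreover have "T (\<Sum>i\<in>I. g i) = (\<Sum>i\<in>I. T (g i))" using insert.prems by (intro insert.IH) simp
    ultimately show ?case by (simp only: sum.insert[OF insert.hyps])
  next
    case empty
    have "T ((\<lambda>_. 0) \<odot> 0) = (\<lambda>_. 0) \<odot> T 0" by (rule T(5)[OF gm_zero[OF N]])
    moreover have "(\<lambda>_. 0) \<odot> h = 0" for h :: "'a \<Rightarrow> ('w \<Rightarrow> real) \<Rightarrow> real" by (simp add: fun_eq_iff)
    ultimately show ?case by (simp only: sum.empty)
  next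
    case (infinite I)
    have "T ((\<lambda>_. 0) \<odot> 0) = (\<lambda>_. 0) \<odot> T 0" by (rule T(5)[OF gm_zero[OF N]])
    moreover have "(\<lambda>_. 0) \<odot> h = 0" for h :: "'a \<Rightarrow> ('w \<Rightarrow> real) \<Rightarrow> real" by (simp add: fun_eq_iff)
    ultimately show ?case by (simp only: sum.infinite[OF infinite.hyps])
  qed
  \<comment> \<open>Multiplication by \<open>y\<close> is injective on the fibre of \<open>M\<close>
    over the \<open>y\<close>-axis, because with a basis this fibre is a free module over
    polynomials in \<open>y\<close>.\<close>
  have yM: "m \<in> coordideal (- {y}) M" if m: "m \<in> M" and ym: "(\<lambda>x. x y) \<odot> m \<in> coordideal (- {y}) M" for m
  proof -
    obtain q where q: "\<forall>k. q k \<in> polyfun" "m = (\<Sum>k<r. q k \<odot> f k)" using Bgen[OF m] by (elim exE conjE)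
    obtain n where n0: "\<forall>j\<in>- {y}. n j \<in> M"
      "(\<lambda>x. x y) \<odot> m = (\<Sum>j\<in>-{y}. (\<lambda>x. x j) \<odot> n j)"
    by (rule coordidealE'[OF ym])
  note n = n0(1)[THEN bspec] n0(2)
    have "\<forall>j\<in>-{y}. \<exists>p. (\<forall>k. p k \<in> polyfun) \<and> n j = (\<Sum>k<r. p k \<odot> f k)"
      by (rule ballI) (rule Bgen[OF n(1)])
    then have "\<exists>p. \<forall>j\<in>-{y}. (\<forall>k. p j k \<in> polyfun) \<and> n j = (\<Sum>k<r. p j k \<odot> f k)" by (rule bchoice)
    then obtain p where p0: "\<forall>j\<in>-{y}. (\<forall>k. p j k \<in> polyfun) \<and> n j = (\<Sum>k<r. p j k \<odot> f k)" by (elim exE)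
    have p1: "p j k \<in> polyfun" if "j \<in> - {y}" for j k
      using p0[THEN bspec, OF that, THEN conjunct1] by (rule spec)
    have p2: "n j = (\<Sum>k<r. p j k \<odot> f k)" if "j \<in> - {y}" for j
      using p0[THEN bspec, OF that, THEN conjunct2] .
    define s where "s k x = x y * q k x - (\<Sum>j\<in>-{y}. x j * p j k x)" for k x
    have sp: "s k \<in> polyfun" for k
      unfolding s_def using q(1) p1 by (intro polyfun_intros) auto
    have "(\<Sum>k<r. s k \<odot> f k) = 0"
    proof (intro ext)
      fix a x
      have "(\<Sum>k<r. (\<Sum>j\<in>-{y}. x j * p j k x) * f k a x) = (\<Sum>j\<in>-{y}. x j * (\<Sum>k<r. p j k x * f k a x))"
        unfolding sum_distrib_left sum_distrib_right mult.assoc by (rule sum.swap)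
      also have "\<dots> = (\<Sum>j\<in>-{y}. x j * n j a x)"
        by (rule sum.cong[OF refl]) (simp only: p2 vsum_apply vsmul_apply)
      also have "\<dots> = x y * m a x" using fun_cong[OF fun_cong[OF n(2), of a], of x] by simp
      finally show "(\<Sum>k<r. s k \<odot> f k) a x = 0 a x"
        by (simp add: s_def left_diff_distrib sum_subtractf q(2) sum_distrib_left mult.assoc)
    qed
    then have s0: "s k x = 0" if "k < r" for k x using Bfree[of s k x] sp that by blast
    have "q k \<odot> f k \<in> coordideal (- {y}) M" if k: "k < r" for k
    proof (rule coordideal_ideal_smul[OF M _ _ fM(1)[OF k]])
      show "q k \<in> polyfun" using q(1) by blast
      fix x :: "'w \<Rightarrow> real" assume x: "\<And>i. i \<in> - {y} \<Longrightarrow> x i = 0"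
      let ?q = "\<lambda>t :: unit \<Rightarrow> real. q k (\<lambda>i. if i = y then t () else 0)"
      have "?q \<in> polyfun"
        by (rule polyfun_compose[where q = "\<lambda>i t. if i = y then t () else 0"]) (use q in \<open>auto intro: polyfun_intros\<close>)
      moreover have "t () * ?q t = 0" for t
        using s0[OF k, of "\<lambda>i. if i = y then t () else 0"] by (simp add: s_def)
      ultimately have "?q t = 0" for t
        using polyfun_mult_eq_0[of "\<lambda>t. t ()" ?q "\<lambda>_. 1" t] polyfun.coord[of "()"] by simp
      from this[of "\<lambda>_. x y"] have "q k (\<lambda>i. if i = y then x y else 0) = 0" by simp
      moreover have "(\<lambda>i. if i = y then x y else 0) = x" using x by auto
      ultimately show "q k x = 0" by simp
    qed
    then show ?thesis unfolding q(2) by (intro coordideal_sum[OF M]) simp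
  qed
  \<comment> \<open>\<open>T\<close> is bijective and linear over the other coordinates, so
    membership in their ideal can be pulled back along it.\<close>
  have TR: "n \<in> coordideal (- {y}) N" if n: "n \<in> N" and Tn: "T n \<in> coordideal (- {y}) M" for n
  proof -
    obtain m where m0: "\<forall>j\<in>- {y}. m j \<in> M"
      "T n = (\<Sum>j\<in>-{y}. (\<lambda>x. x j) \<odot> m j)"
    by (rule coordidealE'[OF Tn])
  note m = m0(1)[THEN bspec] m0(2)
    have "\<forall>j\<in>-{y}. \<exists>g. g \<in> N \<and> T g = m j" using m(1) T(3) by blast
    then have "\<exists>g. \<forall>j\<in>-{y}. g j \<in> N \<and> T (g j) = m j" by (rule bchoice)
    then obtain g where g0: "\<forall>j\<in>-{y}. g j \<in> N \<and> T (g j) = m j" by (elim exE)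
    note g = g0[THEN bspec, THEN conjunct1] g0[THEN bspec, THEN conjunct2]
    let ?G = "\<Sum>j\<in>-{y}. (\<lambda>x. x j) \<odot> g j"
    have GN: "?G \<in> N" by (rule gm_sum[OF N], rule gm_coordmul[OF N]) (rule g(1))
    have "T ?G = (\<Sum>j\<in>-{y}. T ((\<lambda>x. x j) \<odot> g j))"
      by (rule Tsum, rule gm_coordmul[OF N]) (rule g(1))
    also have "\<dots> = T n" unfolding m(2) using g T(6) by (intro sum.cong) auto
    finally have TG: "T ?G = T n" .
    have neg: "(\<lambda>_. -1) \<odot> ?G \<in> N" by (rule gm_cmul[OF N GN])
    have "T (n + (\<lambda>_. -1) \<odot> ?G) = T n + (\<lambda>_. -1) \<odot> T n"
      by (simp only: T(4)[OF n neg] T(5)[OF GN] TG)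
    also have "\<dots> = 0" by (intro ext) simp
    finally have e0: "n + (\<lambda>_. -1) \<odot> ?G = 0" by (rule T(2)[OF gm_add[OF N n neg]])
    have "n = ?G"
    proof (intro ext)
      fix a x show "n a x = ?G a x" using fun_cong[OF fun_cong[OF e0, of a], of x] by simp
    qed
    moreover have "?G \<in> coordideal (- {y}) N" by (rule coordidealI) (rule g(1))
    ultimately show ?thesis by (simp only:)
  qed
  \<comment> \<open>Modulo the other coordinates \<open>T(y n) = y T(n) + n\<close>. The left side
    is zero there by hypothesis and \<open>n\<close> by \<open>yM\<close>, as \<open>N\<close> is
    contained in \<open>M\<close>; so \<open>y T(n)\<close> is zero, hence \<open>T(n)\<close> by
    \<open>yM\<close> again, and \<open>TR\<close> brings this back to \<open>n\<close>.\<close>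
  have yN: "n \<in> coordideal (- {y}) N" if n: "n \<in> N" and yn: "(\<lambda>x. x y) \<odot> n \<in> coordideal (- {y}) N" for n
  proof -
    have ynM: "(\<lambda>x. x y) \<odot> n \<in> coordideal (- {y}) M" by (rule coordideal_mono[OF subset_refl sub M yn])
    have nM: "n \<in> coordideal (- {y}) M" using yM[OF _ ynM] n sub by blast
    obtain m where m0: "\<forall>j\<in>- {y}. m j \<in> N"
      "(\<lambda>x. x y) \<odot> n = (\<Sum>j\<in>-{y}. (\<lambda>x. x j) \<odot> m j)"
    by (rule coordidealE'[OF yn])
  note m = m0(1)[THEN bspec] m0(2)
    have "T ((\<lambda>x. x y) \<odot> n) = (\<Sum>j\<in>-{y}. T ((\<lambda>x. x j) \<odot> m j))"
      unfolding m(2) by (rule Tsum, rule gm_coordmul[OF N]) (rule m(1))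
    also have "\<dots> = (\<Sum>j\<in>-{y}. (\<lambda>x. x j) \<odot> T (m j))" using m(1) T(6) by (intro sum.cong) auto
    also have "\<dots> \<in> coordideal (- {y}) M" by (rule coordidealI) (rule T(1)[OF m(1)])
    finally have "T ((\<lambda>x. x y) \<odot> n) \<in> coordideal (- {y}) M" .
    then have "T ((\<lambda>x. x y) \<odot> n) - (T ((\<lambda>x. x y) \<odot> n) - (\<lambda>x. x y) \<odot> T n - n) - n \<in> coordideal (- {y}) M"
      by (intro coordideal_diff[OF M] T(7)[OF n] nM)
    moreover have "T ((\<lambda>x. x y) \<odot> n) - (T ((\<lambda>x. x y) \<odot> n) - (\<lambda>x. x y) \<odot> T n - n) - n = (\<lambda>x. x y) \<odot> T n"
      by (intro ext) simp
    ultimately have "(\<lambda>x. x y) \<odot> T n \<in> coordideal (- {y}) M" by (simp only:)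
    then show ?thesis using TR[OF n yM[OF T(1)[OF n]]] by blast
  qed
  have pow: "(\<lambda>x. x y ^ k) \<odot> n \<in> N" if "n \<in> N" for n k
    by (rule gm_smul[OF N polyfun_power[OF polyfun.coord] that])
  have yNk: "n \<in> coordideal (- {y}) N" if "n \<in> N" "(\<lambda>x. x y ^ k) \<odot> n \<in> coordideal (- {y}) N" for n k
    using that(2)
  proof (induction k)
    case 0
    have "(\<lambda>x. x y ^ 0) \<odot> n = n" by (intro ext) simp
    then show ?case using 0 by (simp only:)
  next
    case (Suc k)
    have "(\<lambda>x. x y ^ Suc k) \<odot> n = (\<lambda>x. x y) \<odot> ((\<lambda>x. x y ^ k) \<odot> n)" by (intro ext) simp
    then have "(\<lambda>x. x y) \<odot> ((\<lambda>x. x y ^ k) \<odot> n) \<in> coordideal (- {y}) N" using Suc.prems by (simp only:)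
    then show ?case using yN[OF pow[OF that(1)]] Suc.IH by blast
  qed
  \<comment> \<open>By homogeneity the coefficient of \<open>f k\<close> on the
    \<open>y\<close>-axis is a constant times \<open>y ^ (D - d k)\<close>. For
    \<open>d k > D\<close> the constant is 0, so the truncated exponent does no harm.\<close>
  have fibre: "\<exists>C. h - (\<Sum>k<r. (\<lambda>x. C k * x y ^ (D - d k)) \<odot> f k) \<in> coordideal (- {y}) M"
    if h: "h \<in> M" "homv D h" for h D
  proof -
    obtain q where q: "\<forall>k. q k \<in> polyfun" "h = (\<Sum>k<r. q k \<odot> f k)" using Bgen[OF h(1)] by (elim exE conjE)
    define p where "p k = (if d k \<le> D then hcomp (D - d k) (q k) else (\<lambda>_. 0))" for k
    have pp: "p k \<in> polyfun" for k using q(1) by (auto simp: p_def intro: polyfun_hcomp polyfun.const)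
    have hp: "h a x = (\<Sum>k<r. p k x * f k a x)" for a x
    proof -
      have ha: "h a = (\<lambda>x. \<Sum>k<r. q k x * f k a x)" by (simp add: q(2) fun_eq_iff)
      have "h a x = hcomp D (h a) x" using h(2) by (simp add: homv_def hcomp_hom[of D])
      also have "\<dots> = (\<Sum>k<r. hcomp D (\<lambda>x. q k x * f k a x) x)"
        unfolding ha using q(1) gm_polyfun[OF M fM(1)] by (intro hcomp_sum polyfun.mult) auto
      also have "\<dots> = (\<Sum>k<r. p k x * f k a x)"
      proof (intro sum.cong refl)
        fix k assume "k \<in> {..<r}"
        then have "hom (d k) (f k a)" using fM(2) by (simp add: homv_def)
        then show "hcomp D (\<lambda>x. q k x * f k a x) x = p k x * f k a x"
          using hcomp_mult_hom[of "q k" "d k" "f k a" D x] q(1) by (simp add: p_def)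
      qed
      finally show ?thesis .
    qed
    define C where "C k = p k (\<lambda>i. if i = y then 1 else 0)" for k
    have ax: "p k x = C k * x y ^ (D - d k)" if "\<And>i. i \<in> - {y} \<Longrightarrow> x i = 0" for k x
    proof -
      have x: "x = (\<lambda>i. x y * (if i = y then 1 else 0))" using that by auto
      have "hom (D - d k) (p k)" using q(1) by (auto simp: p_def intro: hom_hcomp hom_zero)
      then have "p k (\<lambda>i. x y * (if i = y then 1 else 0)) = x y ^ (D - d k) * C k"
        unfolding hom_def C_def
        by (elim conjE allE[where x = "x y"] allE[where x = "\<lambda>i. if i = y then 1 else 0"])
      moreover have "p k x = p k (\<lambda>i. x y * (if i = y then 1 else 0))" using x by (rule arg_cong)
      ultimately show ?thesis by (simp only: mult.commute)
    qed
    have "h - (\<Sum>k<r. (\<lambda>x. C k * x y ^ (D - d k)) \<odot> f k) = (\<Sum>k<r. (\<lambda>x. p k x - C k * x y ^ (D - d k)) \<odot> f k)"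
      by (intro ext) (simp add: hp sum_subtractf left_diff_distrib)
    also have "\<dots> \<in> coordideal (- {y}) M"
    proof (rule coordideal_sum[OF M])
      fix k assume "k \<in> {..<r}"
      then show "(\<lambda>x. p k x - C k * x y ^ (D - d k)) \<odot> f k \<in> coordideal (- {y}) M"
        using ax pp by (intro coordideal_ideal_smul[OF M] polyfun_intros fM(1)) auto
    qed
    finally show ?thesis by (intro exI[of _ C])
  qed
  show ?thesis
    unfolding gens_le_hom_def
  proof (intro allI impI)
    fix I :: "nat set" and w \<delta>
    assume I: "finite I \<and> card I = Suc r \<and> (\<forall>i\<in>I. w i \<in> N \<and> homv (\<delta> i) (w i))"
    \<comment> \<open>A common degree above all \<open>\<delta> i\<close>, reached by multiplying
      with powers of \<open>y\<close>. It is positive, so that \<open>T\<close> lowers it to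
      \<open>D - 1\<close>.\<close>
    define D where "D = Suc (Max (\<delta> ` I))"
    have I0: "I \<noteq> {}" using I by auto
    have \<delta>: "\<delta> i < D" if "i \<in> I" for i using that I by (simp add: D_def less_Suc_eq_le)
    define u where "u i = (\<lambda>x. x y ^ (D - \<delta> i)) \<odot> w i" for i
    have uN: "u i \<in> N" if "i \<in> I" for i unfolding u_def using I that by (intro pow) auto
    have uh: "homv (D - 1) (T (u i))" if "i \<in> I" for i
    proof (rule T(8)[OF uN[OF that]])
      have "hom (D - \<delta> i + \<delta> i) (\<lambda>x. x y ^ (D - \<delta> i) * w i a x)" for a
        using I that by (intro hom_mult hom_coord_power) (auto simp: homv_def)
      then show "homv (Suc (D - 1)) (u i)"
        using \<delta>[OF that] by (simp add: homv_def u_def vsmul_def D_def)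
    qed
    have "\<forall>i\<in>I. \<exists>C. T (u i) - (\<Sum>k<r. (\<lambda>x. C k * x y ^ (D - 1 - d k)) \<odot> f k) \<in> coordideal (- {y}) M"
    proof
      fix i assume i: "i \<in> I"
      show "\<exists>C. T (u i) - (\<Sum>k<r. (\<lambda>x. C k * x y ^ (D - 1 - d k)) \<odot> f k) \<in> coordideal (- {y}) M"
        by (rule fibre[OF T(1)[OF uN[OF i]] uh[OF i]])
    qed
    then have "\<exists>C. \<forall>i\<in>I. T (u i) - (\<Sum>k<r. (\<lambda>x. C i k * x y ^ (D - 1 - d k)) \<odot> f k) \<in> coordideal (- {y}) M"
      by (rule bchoice)
    then obtain C where
      C0: "\<forall>i\<in>I. T (u i) - (\<Sum>k<r. (\<lambda>x. C i k * x y ^ (D - 1 - d k)) \<odot> f k) \<in> coordideal (- {y}) M" by (elim exE)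
    note C = C0[THEN bspec]
    obtain c where c: "\<exists>i\<in>I. c i \<noteq> 0" "\<And>k. k < r \<Longrightarrow> (\<Sum>i\<in>I. c i * C i k) = 0"
      using real_dependent[of "{..<r}" I C] I by auto
    let ?U = "\<Sum>i\<in>I. (\<lambda>_. c i) \<odot> u i"
    have UN: "?U \<in> N" by (rule gm_sum[OF N], rule gm_cmul[OF N]) (rule uN)
    have "T ?U = (\<Sum>i\<in>I. T ((\<lambda>_. c i) \<odot> u i))" by (rule Tsum, rule gm_cmul[OF N]) (rule uN)
    also have "\<dots> = (\<Sum>i\<in>I. (\<lambda>_. c i) \<odot> T (u i))" using uN T(5) by (intro sum.cong) auto
    also have "\<dots> = (\<Sum>i\<in>I. (\<lambda>_. c i) \<odot> (T (u i) - (\<Sum>k<r. (\<lambda>x. C i k * x y ^ (D - 1 - d k)) \<odot> f k)))"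
    proof (intro ext)
      fix a x
      have "(\<Sum>i\<in>I. c i * (\<Sum>k<r. C i k * (x y ^ (D - 1 - d k) * f k a x))) =
          (\<Sum>k<r. (\<Sum>i\<in>I. c i * C i k) * (x y ^ (D - 1 - d k) * f k a x))"
        unfolding sum_distrib_left sum_distrib_right mult.assoc by (rule sum.swap)
      then show "(\<Sum>i\<in>I. (\<lambda>_. c i) \<odot> T (u i)) a x =
          (\<Sum>i\<in>I. (\<lambda>_. c i) \<odot> (T (u i) - (\<Sum>k<r. (\<lambda>x. C i k * x y ^ (D - 1 - d k)) \<odot> f k))) a x"
        using c(2) by (simp add: right_diff_distrib sum_subtractf mult.assoc)
    qed
    also have "\<dots> \<in> coordideal (- {y}) M"
      by (rule coordideal_sum[OF M], rule coordideal_cmul[OF M]) (rule C)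
    finally have U: "?U \<in> coordideal (- {y}) N" using TR[OF UN] by blast
    define I' where "I' = {i \<in> I. c i \<noteq> 0}"
    have I': "finite I'" "I' \<noteq> {}" using I c(1) by (auto simp: I'_def)
    \<comment> \<open>The largest power of \<open>y\<close> dividing all terms with nonzero
      coefficient. By \<open>yNk\<close> it may be cancelled, after which some term no longer
      contains \<open>y\<close>.\<close>
    define j where "j = Min ((\<lambda>i. D - \<delta> i) ` I')"
    have j: "j \<le> D - \<delta> i" if "i \<in> I'" for i using that I' by (simp add: j_def)
    obtain i0 where i0: "i0 \<in> I'" "D - \<delta> i0 = j"
    proof -
      have "j \<in> (\<lambda>i. D - \<delta> i) ` I'" unfolding j_def using I' by (intro Min_in) auto
      then show ?thesis using that by auto
    qed
    define V where "V = (\<Sum>i\<in>I'. (\<lambda>x. c i * x y ^ (D - \<delta> i - j)) \<odot> w i)"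
    have wN: "w i \<in> N" if "i \<in> I'" for i using that I by (auto simp: I'_def)
    have VN: "V \<in> N" unfolding V_def using wN by (intro gm_sum[OF N] gm_smul[OF N] polyfun_intros)
    have "?U = (\<lambda>x. x y ^ j) \<odot> V"
    proof (intro ext)
      fix a x
      have "?U a x = (\<Sum>i\<in>I'. c i * (x y ^ (D - \<delta> i) * w i a x))"
        using I by (simp add: u_def I'_def) (intro sum.mono_neutral_right, auto)
      also have "\<dots> = (\<Sum>i\<in>I'. x y ^ j * (c i * x y ^ (D - \<delta> i - j) * w i a x))"
      proof (intro sum.cong refl)
        fix i assume "i \<in> I'"
        then have "j + (D - \<delta> i - j) = D - \<delta> i" using j by (intro le_add_diff_inverse)
        then have "x y ^ (D - \<delta> i) = x y ^ j * x y ^ (D - \<delta> i - j)" by (metis power_add)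
        then show "c i * (x y ^ (D - \<delta> i) * w i a x) = x y ^ j * (c i * x y ^ (D - \<delta> i - j) * w i a x)"
          by simp
      qed
      finally show "?U a x = ((\<lambda>x. x y ^ j) \<odot> V) a x" by (simp add: V_def sum_distrib_left)
    qed
    then have "V \<in> coordideal (- {y}) N" using yNk[OF VN, of j] U by (simp only:)
    then have VI: "V \<in> coordideal UNIV N" using coordideal_mono[OF subset_UNIV subset_refl N] by blast
    \<comment> \<open>These terms keep a constant coefficient; the others still contain
      \<open>y\<close> and drop out in the fibre at the origin.\<close>
    define J where "J = {i \<in> I'. D - \<delta> i = j}"
    define X where "X = (\<Sum>i\<in>I'-J. (\<lambda>x. c i * x y ^ (D - \<delta> i - j - 1)) \<odot> w i)"
    have XN: "X \<in> N" unfolding X_def using wN by (intro gm_sum[OF N] gm_smul[OF N] polyfun_intros) auto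
    have VX: "V - (\<lambda>x. x y) \<odot> X = (\<Sum>i\<in>I. (\<lambda>_. if i \<in> J then c i else 0) \<odot> w i)"
    proof (intro ext)
      fix a x
      have sJ: "J \<subseteq> I'" "J \<subseteq> I" by (auto simp: J_def I'_def)
      have "V a x = (\<Sum>i\<in>I'-J. c i * x y ^ (D - \<delta> i - j) * w i a x) + (\<Sum>i\<in>J. c i * x y ^ (D - \<delta> i - j) * w i a x)"
        unfolding V_def using sum.subset_diff[OF sJ(1) I'(1)] by simp
      moreover have "(\<Sum>i\<in>J. c i * x y ^ (D - \<delta> i - j) * w i a x) = (\<Sum>i\<in>J. c i * w i a x)"
        by (intro sum.cong) (auto simp: J_def)
      moreover have "(\<Sum>i\<in>I'-J. c i * x y ^ (D - \<delta> i - j) * w i a x) = x y * X a x"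
        unfolding X_def vsum_apply sum_distrib_left
      proof (intro sum.cong refl)
        fix i assume "i \<in> I' - J"
        then have "D - \<delta> i - j = Suc (D - \<delta> i - j - 1)" using j[of i] by (auto simp: J_def)
        then have "x y ^ (D - \<delta> i - j) = x y * x y ^ (D - \<delta> i - j - 1)" by (metis power_Suc)
        then show "c i * x y ^ (D - \<delta> i - j) * w i a x =
            x y * ((\<lambda>x. c i * x y ^ (D - \<delta> i - j - 1)) \<odot> w i) a x" by simp
      qed
      moreover have "(\<Sum>i\<in>I. (if i \<in> J then c i else 0) * w i a x) = (\<Sum>i\<in>J. c i * w i a x)"
      proof -
        have "(\<Sum>i\<in>I. (if i \<in> J then c i else 0) * w i a x) = (\<Sum>i\<in>J. (if i \<in> J then c i else 0) * w i a x)"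
          using sJ I by (intro sum.mono_neutral_right) auto
        then show ?thesis by simp
      qed
      ultimately show "(V - (\<lambda>x. x y) \<odot> X) a x = (\<Sum>i\<in>I. (\<lambda>_. if i \<in> J then c i else 0) \<odot> w i) a x" by simp
    qed
    have "V - (\<lambda>x. x y) \<odot> X \<in> coordideal UNIV N"
      by (rule coordideal_diff[OF N VI coordideal_coordmul[OF N UNIV_I XN]])
    then have "(\<Sum>i\<in>I. (\<lambda>_. if i \<in> J then c i else 0) \<odot> w i) \<in> coordideal UNIV N" by (simp only: VX)
    moreover have "\<exists>i\<in>I. (if i \<in> J then c i else 0) \<noteq> 0"
      using i0 by (intro bexI[of _ i0]) (auto simp: J_def I'_def)
    ultimately show "\<exists>c. (\<exists>i\<in>I. c i \<noteq> 0) \<and> (\<Sum>i\<in>I. (\<lambda>_. c i) \<odot> w i) \<in> coordideal UNIV N"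
      by (intro exI[of _ "\<lambda>i. if i \<in> J then c i else 0"] conjI)
  qed
qed

section \<open>Deformations of the braid arrangement and their multirestrictions\<close>

text \<open>The vertex set is a finite type.  The deformation with data \<open>l\<close> consists of \<open>z = 0\<close> and the
  hyperplanes \<open>x\<^sub>a - x\<^sub>b = c z\<close> with \<open>l a b \<le> c \<le> - l b a\<close>; the coordinate \<open>None\<close> is \<open>z\<close>.  The module
  \<open>aff l\<close> consists of the vector fields killing \<open>z\<close>, with \<open>f a\<close> the coefficient at \<open>x\<^sub>a\<close>.\<close>

definition aff :: "('a \<Rightarrow> 'a \<Rightarrow> int) \<Rightarrow> ('a \<Rightarrow> ('a option \<Rightarrow> real) \<Rightarrow> real) set" where
  "aff l = {f. (\<forall>a. f a \<in> polyfun) \<and> (\<forall>a b c x. a \<noteq> b \<longrightarrow> l a b \<le> c \<longrightarrow> c \<le> - l b a \<longrightarrow>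
     x (Some a) - x (Some b) = of_int c * x None \<longrightarrow> f a x = f b x)}"

text \<open>A gauge: vectors are taken modulo the one with all entries 1, by normalising the entry
  at \<open>w\<close> to 0. Since this is possible at every vertex, the base vertex can be changed
  through \<open>gens_le_affg\<close>.\<close>

definition affg :: "'a \<Rightarrow> ('a \<Rightarrow> 'a \<Rightarrow> int) \<Rightarrow> ('a \<Rightarrow> ('a option \<Rightarrow> real) \<Rightarrow> real) set" where
  "affg w l = {f \<in> aff l. f w = 0}"

text \<open>The logarithmic derivations of the braid arrangement with multiplicity
  \<open>m\<close>.\<close>

definition mul :: "('a \<Rightarrow> 'a \<Rightarrow> nat) \<Rightarrow> ('a \<Rightarrow> ('a \<Rightarrow> real) \<Rightarrow> real) set" where
  "mul m = {f. (\<forall>a. f a \<in> polyfun) \<and>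
     (\<forall>a b. a \<noteq> b \<longrightarrow> (\<exists>h\<in>polyfun. \<forall>x. f a x - f b x = (x a - x b) ^ m a b * h x))}"

definition mulg :: "'a \<Rightarrow> ('a \<Rightarrow> 'a \<Rightarrow> nat) \<Rightarrow> ('a \<Rightarrow> ('a \<Rightarrow> real) \<Rightarrow> real) set" where
  "mulg w m = {f \<in> mul m. f w = 0}"

text \<open>The number of parallel hyperplanes for the pair, which is its multiplicity in the
  restriction to \<open>z = 0\<close>. For an empty interval the truncation gives 0.\<close>

definition mult_of :: "('a \<Rightarrow> 'a \<Rightarrow> int) \<Rightarrow> 'a \<Rightarrow> 'a \<Rightarrow> nat" where
  "mult_of l a b = nat (1 - l a b - l b a)"

lemma affD: "f \<in> aff l \<Longrightarrow> a \<noteq> b \<Longrightarrow> l a b \<le> c \<Longrightarrow> c \<le> - l b a \<Longrightarrow>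
    x (Some a) - x (Some b) = of_int c * x None \<Longrightarrow> f a x = f b x"
  unfolding aff_def by blast

lemma mulD: "f \<in> mul m \<Longrightarrow> a \<noteq> b \<Longrightarrow> \<exists>h\<in>polyfun. \<forall>x. f a x - f b x = (x a - x b) ^ m a b * h x"
  unfolding mul_def by blast

lemma polyfun_apply_add: "p \<in> polyfun \<Longrightarrow> q \<in> polyfun \<Longrightarrow> p + q \<in> polyfun"
  using polyfun.add[of p q] by (simp add: plus_fun_def)

lemma polyfun_vsmul: "p \<in> polyfun \<Longrightarrow> f a \<in> polyfun \<Longrightarrow> (p \<odot> f) a \<in> polyfun"
  using polyfun.mult[of p "f a"] by (simp add: vsmul_def)

lemma polyfun_dilate: "p \<in> polyfun \<Longrightarrow> (\<lambda>x. p (\<lambda>i. t * x i)) \<in> polyfun"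
  by (rule polyfun_compose[where q = "\<lambda>i x. t * x i"]) (auto intro: polyfun.mult polyfun.const polyfun.coord)

lemma polyfun_zero: "0 \<in> polyfun"
  using polyfun.const[of 0] by (simp add: zero_fun_def)

lemma graded_module_aff: "graded_module (aff l)"
  unfolding graded_module_def
proof (intro conjI ballI allI)
  show "0 \<in> aff l" by (auto simp: aff_def polyfun_zero)
  fix f g :: "'a \<Rightarrow> ('a option \<Rightarrow> real) \<Rightarrow> real" and p :: "('a option \<Rightarrow> real) \<Rightarrow> real" and t
  assume f: "f \<in> aff l"
  then show fp: "f a \<in> polyfun" for a by (auto simp: aff_def)
  note fD = affD[OF f]
  show "f + g \<in> aff l" if g: "g \<in> aff l"
  proof -
    have "g a \<in> polyfun" for a using g by (auto simp: aff_def)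
    then show ?thesis using fp fD affD[OF g] by (auto simp: aff_def intro!: polyfun_apply_add arg_cong2[where f = plus])
  qed
  show "p \<odot> f \<in> aff l" if "p \<in> polyfun"
    using that fp fD by (auto simp: aff_def intro!: polyfun_vsmul)
  have "f a (\<lambda>i. t * x i) = f b (\<lambda>i. t * x i)"
    if "a \<noteq> b" "l a b \<le> c" "c \<le> - l b a" "x (Some a) - x (Some b) = of_int c * x None" for a b c and x :: "'a option \<Rightarrow> real"
    using that by (intro fD[of a b c]) (auto simp: right_diff_distrib[symmetric])
  then show "(\<lambda>a x. f a (\<lambda>i. t * x i)) \<in> aff l"
    using fp by (auto simp: aff_def intro!: polyfun_dilate)
qed

lemma graded_module_mul: "graded_module (mul m)"
  unfolding graded_module_def
proof (intro conjI ballI allI)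
  show "0 \<in> mul m" by (auto simp: mul_def polyfun_zero intro!: bexI[of _ "\<lambda>_. 0"] polyfun.const)
  fix f g :: "'a \<Rightarrow> ('a \<Rightarrow> real) \<Rightarrow> real" and p :: "('a \<Rightarrow> real) \<Rightarrow> real" and t
  assume f: "f \<in> mul m"
  then show fp: "f a \<in> polyfun" for a by (auto simp: mul_def)
  show "f + g \<in> mul m" if g: "g \<in> mul m"
  proof -
    have gp: "g a \<in> polyfun" for a using g by (auto simp: mul_def)
    have "\<exists>h\<in>polyfun. \<forall>x. (f + g) a x - (f + g) b x = (x a - x b) ^ m a b * h x" if ab: "a \<noteq> b" for a b
    proof -
      obtain h k where "h \<in> polyfun" "k \<in> polyfun" "\<forall>x. f a x - f b x = (x a - x b) ^ m a b * h x"
          "\<forall>x. g a x - g b x = (x a - x b) ^ m a b * k x"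
        using mulD[OF f ab] mulD[OF g ab] by blast
      then show ?thesis
        by (intro bexI[of _ "\<lambda>x. h x + k x"] polyfun.add) (auto simp: distrib_left algebra_simps)
    qed
    then show ?thesis using fp gp by (auto simp: mul_def intro!: polyfun_apply_add)
  qed
  show "p \<odot> f \<in> mul m" if p: "p \<in> polyfun"
  proof -
    have "\<exists>h\<in>polyfun. \<forall>x. (p \<odot> f) a x - (p \<odot> f) b x = (x a - x b) ^ m a b * h x" if ab: "a \<noteq> b" for a b
    proof -
      obtain h where "h \<in> polyfun" "\<forall>x. f a x - f b x = (x a - x b) ^ m a b * h x"
        using mulD[OF f ab] by blast
      then show ?thesis using p
        by (intro bexI[of _ "\<lambda>x. p x * h x"] polyfun.mult) (auto simp: right_diff_distrib[symmetric])
    qed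
    then show ?thesis using p fp by (auto simp: mul_def intro!: polyfun_vsmul)
  qed
  have "\<exists>h\<in>polyfun. \<forall>x. f a (\<lambda>i. t * x i) - f b (\<lambda>i. t * x i) = (x a - x b) ^ m a b * h x" if ab: "a \<noteq> b" for a b
  proof -
    obtain h where "h \<in> polyfun" "\<forall>x. f a x - f b x = (x a - x b) ^ m a b * h x"
      using mulD[OF f ab] by blast
    then show ?thesis
      by (intro bexI[of _ "\<lambda>x. t ^ m a b * h (\<lambda>i. t * x i)"] polyfun.mult polyfun.const polyfun_dilate)
         (auto simp: right_diff_distrib[symmetric] power_mult_distrib)
  qed
  then show "(\<lambda>a x. f a (\<lambda>i. t * x i)) \<in> mul m" using fp by (auto simp: mul_def intro!: polyfun_dilate)
qed

lemma graded_module_gauge: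
  assumes "graded_module N"
  shows "graded_module {f \<in> N. f w = 0}"
  using assms unfolding graded_module_def by (auto simp: fun_eq_iff)

lemma graded_module_affg: "graded_module (affg w l)"
  unfolding affg_def by (rule graded_module_gauge[OF graded_module_aff])

lemma graded_module_mulg: "graded_module (mulg w m)"
  unfolding mulg_def by (rule graded_module_gauge[OF graded_module_mul])

lemma gens_le_gauge:
  fixes N :: "('a \<Rightarrow> ('w::finite \<Rightarrow> real) \<Rightarrow> real) set"
  assumes "graded_module N" "(\<lambda>a x. 1) \<in> N"
  shows "gens_le (Suc r) N \<longleftrightarrow> gens_le r {f \<in> N. f w = 0}"
  using assms
  by (intro gens_le_split[where s = "\<lambda>f. f w" and e = "\<lambda>a x. 1"])
     (auto simp: fun_eq_iff intro: gm_polyfun)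

lemma gens_le_affg: "gens_le (Suc r) (aff l) \<longleftrightarrow> gens_le r (affg (w::'a::finite) l)"
  unfolding affg_def
  by (rule gens_le_gauge[OF graded_module_aff]) (auto simp: aff_def polyfun.const)

lemma gens_le_mulg: "gens_le (Suc r) (mul m) \<longleftrightarrow> gens_le r (mulg (w::'a::finite) m)"
  unfolding mulg_def
  by (rule gens_le_gauge[OF graded_module_mul])
     (auto simp: mul_def polyfun.const intro!: bexI[of _ "\<lambda>_. 0"])

definition lin :: "'a \<Rightarrow> 'a \<Rightarrow> int \<Rightarrow> ('a option \<Rightarrow> real) \<Rightarrow> real" where
  "lin a b c x = x (Some a) - x (Some b) - of_int c * x None"

lemma polyfun_lin: "lin a b c \<in> polyfun"
  unfolding lin_def by (intro polyfun_intros)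

text \<open>\<open>Q\<close> is the product of all defining forms; multiplied by it, every
  coordinate vector satisfies all conditions.\<close>

lemma full_rank_affg: "full_rank (CARD('a) - 1) (affg (w::'a::finite) l)"
proof -
  let ?P = "SIGMA p:{p :: 'a \<times> 'a. fst p \<noteq> snd p}. {l (fst p) (snd p)..- l (snd p) (fst p)}"
  define Q where "Q x = (\<Prod>q\<in>?P. lin (fst (fst q)) (snd (fst q)) (snd q) x)" for x
  have fin: "finite ?P" by (intro finite_SigmaI) auto
  have Qp: "Q \<in> polyfun" unfolding Q_def by (intro polyfun_prod polyfun_lin)
  have "\<exists>x. Q x \<noteq> 0"
    unfolding Q_def
  proof (rule polyfun_prod_nonzero[OF fin polyfun_lin])
    fix q assume "q \<in> ?P"
    then show "\<exists>x. lin (fst (fst q)) (snd (fst q)) (snd q) x \<noteq> 0"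
      by (intro exI[of _ "\<lambda>i. if i = Some (fst (fst q)) then 1 else 0"]) (auto simp: lin_def)
  qed
  moreover have Q0: "Q x = 0"
    if "a \<noteq> b" "l a b \<le> c" "c \<le> - l b a" "x (Some a) - x (Some b) = of_int c * x None" for a b c x
    unfolding Q_def
  proof (rule prod_zero[OF fin])
    show "\<exists>q\<in>?P. lin (fst (fst q)) (snd (fst q)) (snd q) x = 0"
      using that by (intro bexI[of _ "((a, b), c)"]) (auto simp: lin_def)
  qed
  have "(\<lambda>b x. if b = a then Q x else 0) \<in> affg w l" if "a \<in> - {w}" for a
    using that Qp Q0 by (auto simp: affg_def aff_def fun_eq_iff intro!: polyfun_if polyfun.const)
  moreover have "card (- {w}) = CARD('a) - 1" by (simp add: Compl_eq_Diff_UNIV)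
  ultimately show ?thesis
    unfolding full_rank_def using Qp by (intro exI[of _ "- {w}"] exI[of _ Q]) (auto simp: affg_def)
qed

lemma full_rank_mulg: "full_rank (CARD('a) - 1) (mulg (w::'a::finite) m)"
proof -
  let ?P = "{p :: 'a \<times> 'a. fst p \<noteq> snd p}"
  define u where "u p x = (x (fst p) - x (snd p)) ^ m (fst p) (snd p)" for p :: "'a \<times> 'a" and x :: "'a \<Rightarrow> real"
  define Q where "Q x = (\<Prod>p\<in>?P. u p x)" for x
  have up: "u p \<in> polyfun" for p unfolding u_def by (intro polyfun_intros)
  have Qp: "Q \<in> polyfun" unfolding Q_def by (intro polyfun_prod up)
  have "\<exists>x. Q x \<noteq> 0"
    unfolding Q_def
  proof (rule polyfun_prod_nonzero[OF _ up])
    fix q assume "q \<in> ?P"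
    then show "\<exists>x. u q x \<noteq> 0"
      by (intro exI[of _ "\<lambda>i. if i = fst q then 1 else 0"]) (auto simp: u_def)
  qed simp
  moreover have "(\<lambda>b x. if b = a then Q x else 0) \<in> mulg w m" if "a \<in> - {w}" for a
  proof -
    have "\<exists>h\<in>polyfun. \<forall>x. (if c = a then Q x else 0) - (if d = a then Q x else 0) = (x c - x d) ^ m c d * h x"
      if "c \<noteq> d" for c d
    proof -
      define R where "R x = (\<Prod>p\<in>?P-{(c, d)}. u p x)" for x
      have R: "R \<in> polyfun" unfolding R_def by (intro polyfun_prod up)
      have "Q x = (x c - x d) ^ m c d * R x" for x
        unfolding Q_def R_def using that by (subst prod.remove[of _ "(c, d)"]) (auto simp: u_def)
      then show ?thesis using R that
        by (intro bexI[of _ "\<lambda>x. if c = a then R x else if d = a then - R x else 0"])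
           (auto intro!: polyfun_if polyfun_uminus polyfun.const)
    qed
    then show ?thesis
      using that Qp by (auto simp: mulg_def mul_def fun_eq_iff intro!: polyfun_if polyfun.const)
  qed
  moreover have "card (- {w}) = CARD('a) - 1" by (simp add: Compl_eq_Diff_UNIV)
  ultimately show ?thesis
    unfolding full_rank_def using Qp by (intro exI[of _ "- {w}"] exI[of _ Q]) (auto simp: mulg_def)
qed

text \<open>The substitution of \<open>- z\<close> for \<open>z\<close> replaces each constant
  \<open>c\<close> by \<open>- c\<close> and so exchanges \<open>l a b\<close> with
  \<open>l b a\<close>.\<close>

lemma gens_le_aff_transpose_imp:
  fixes l :: "'a::finite \<Rightarrow> 'a \<Rightarrow> int"
  assumes "gens_le r (aff (\<lambda>a b. l b a))"
  shows "gens_le r (aff l)"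
proof (rule gens_leI)
  define Z :: "('a \<Rightarrow> ('a option \<Rightarrow> real) \<Rightarrow> real) \<Rightarrow> 'a \<Rightarrow> ('a option \<Rightarrow> real) \<Rightarrow> real"
    where "Z f = (\<lambda>a x. f a (x(None := - x None)))" for f
  have Z: "Z f \<in> aff (\<lambda>a b. l b a)" if "f \<in> aff l" for f and l :: "'a \<Rightarrow> 'a \<Rightarrow> int"
  proof -
    have "(\<lambda>x. f a (x(None := - x None))) \<in> polyfun" for a
      using that by (intro polyfun_compose_upd polyfun_intros) (auto simp: aff_def)
    moreover have "f a (x(None := - x None)) = f b (x(None := - x None))"
      if "a \<noteq> b" "l b a \<le> c" "c \<le> - l a b" "x (Some a) - x (Some b) = of_int c * x None" for a b c x
      using that by (intro affD[OF \<open>f \<in> aff l\<close>, of a b "- c"]) auto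
    ultimately show ?thesis by (auto simp: aff_def Z_def)
  qed
  have ZZ: "Z f a (x(None := - x None)) = f a x" for f a x by (simp add: Z_def)
  fix I :: "nat set" and w assume I: "finite I" "card I = Suc r" "\<And>i. i \<in> I \<Longrightarrow> w i \<in> aff l"
  obtain c where c: "\<exists>i\<in>I. c i \<noteq> 0" "(\<Sum>i\<in>I. (\<lambda>_. c i) \<odot> Z (w i)) \<in> coordideal UNIV (aff (\<lambda>a b. l b a))"
    by (rule gens_leD[OF assms I(1,2), of "\<lambda>i. Z (w i)"]) (use Z I(3) in auto)
  obtain n where n0: "\<forall>j\<in>UNIV. n j \<in> aff (\<lambda>a b. l b a)"
      "(\<Sum>i\<in>I. (\<lambda>_. c i) \<odot> Z (w i)) = (\<Sum>j\<in>UNIV. (\<lambda>x. x j) \<odot> n j)"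
    by (rule coordidealE'[OF c(2)])
  have nN: "Z (n j) \<in> aff l" for j using Z[of "n j" "\<lambda>a b. l b a"] n0(1) by simp
  have "(\<Sum>i\<in>I. (\<lambda>_. c i) \<odot> w i) = (\<Sum>j\<in>UNIV. (\<lambda>x. x j) \<odot> ((\<lambda>_. if j = None then -1 else 1) \<odot> Z (n j)))"
  proof (intro ext)
    fix a and x :: "'a option \<Rightarrow> real"
    let ?x = "x(None := - x None)"
    have "(\<Sum>i\<in>I. (\<lambda>_. c i) \<odot> Z (w i)) a ?x = (\<Sum>j\<in>UNIV. (\<lambda>x. x j) \<odot> n j) a ?x"
      by (simp only: n0(2))
    then have "(\<Sum>i\<in>I. c i * w i a x) = (\<Sum>j\<in>UNIV. ?x j * n j a ?x)"
      by (simp only: vsum_apply vsmul_apply ZZ)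
    also have "\<dots> = (\<Sum>j\<in>UNIV. x j * ((if j = None then -1 else 1) * Z (n j) a x))"
      by (intro sum.cong) (auto simp: Z_def)
    finally show "(\<Sum>i\<in>I. (\<lambda>_. c i) \<odot> w i) a x =
        (\<Sum>j\<in>UNIV. (\<lambda>x. x j) \<odot> ((\<lambda>_. if j = None then -1 else 1) \<odot> Z (n j))) a x"
      by (simp only: vsum_apply vsmul_apply)
  qed
  also have "\<dots> \<in> coordideal UNIV (aff l)"
    by (rule coordidealI, rule gm_cmul[OF graded_module_aff]) (rule nN)
  finally show "\<exists>c. (\<exists>i\<in>I. c i \<noteq> 0) \<and> (\<Sum>i\<in>I. (\<lambda>_. c i) \<odot> w i) \<in> coordideal UNIV (aff l)"
    using c(1) by (intro exI[of _ c] conjI)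
qed

lemma gens_le_aff_transpose:
  "gens_le r (aff (\<lambda>a b. l b a)) \<longleftrightarrow> gens_le r (aff (l :: 'a::finite \<Rightarrow> 'a \<Rightarrow> int))"
  using gens_le_aff_transpose_imp[of r l] gens_le_aff_transpose_imp[of r "\<lambda>a b. l b a"] by auto

subsection \<open>Restriction to the hyperplane at infinity\<close>

text \<open>The forms for different \<open>c\<close> are pairwise coprime, so they can be divided
  out one after the other.\<close>

lemma lin_division:
  assumes "p \<in> polyfun" "a \<noteq> b" "finite C"
    and "\<And>c x. c \<in> C \<Longrightarrow> x (Some a) - x (Some b) = of_int c * x None \<Longrightarrow> p x = 0"
  shows "\<exists>h\<in>polyfun. \<forall>x. p x = (\<Prod>c\<in>C. lin a b c x) * h x"
  using assms(3,4)
proof (induction C rule: finite_induct)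
  case empty
  then show ?case using assms(1) by auto
next
  case (insert c C)
  then obtain h where h: "h \<in> polyfun" "\<forall>x. p x = (\<Prod>c\<in>C. lin a b c x) * h x" by auto
  let ?q = "\<lambda>x. x (Some b) + of_int c * x None"
  have qp: "?q \<in> polyfun" by (intro polyfun_intros)
  have hq: "(\<lambda>x. h (x(Some a := ?q x))) \<in> polyfun" by (rule polyfun_compose_upd[OF h(1) qp])
  have "h (x(Some a := ?q x)) = 0" for x
  \<comment> \<open>On the hyperplane of \<open>c\<close> the form of \<open>c'\<close> equals
    \<open>(c - c') z\<close>, which is nonzero as soon as \<open>z\<close> is.\<close>
  proof (rule polyfun_generic_zero[OF polyfun.coord[of None] hq, of "\<lambda>_. 1"])
    fix x :: "'a option \<Rightarrow> real" assume z: "x None \<noteq> 0"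
    have "p (x(Some a := ?q x)) = 0" using assms(2) by (intro insert.prems[of c]) auto
    moreover have "lin a b c' (x(Some a := ?q x)) \<noteq> 0" if "c' \<in> C" for c'
    proof -
      have "lin a b c' (x(Some a := ?q x)) = of_int (c - c') * x None"
        using assms(2) by (simp add: lin_def algebra_simps)
      moreover have "c \<noteq> c'" using that insert.hyps by auto
      ultimately show ?thesis using z by simp
    qed
    ultimately show "h (x(Some a := ?q x)) = 0"
      using h(2)[rule_format, of "x(Some a := ?q x)"] insert.hyps(1) by auto
  qed simp
  then obtain k where k: "k \<in> polyfun" "\<And>x. h x = (x (Some a) - ?q x) * k x"
    using polyfun_division[OF h(1) qp, of "Some a"] by blast
  have "p x = (\<Prod>c\<in>insert c C. lin a b c x) * k x" for x
    using h(2)[rule_format, of x] k(2)[of x] insert.hyps by (simp add: lin_def algebra_simps)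
  then show ?case using k(1) by blast
qed

abbreviation at_infinity0 :: "('a \<Rightarrow> ('a option \<Rightarrow> real) \<Rightarrow> real) \<Rightarrow> 'a \<Rightarrow> ('a \<Rightarrow> real) \<Rightarrow> real" where
  "at_infinity0 \<equiv> restrict0 None Some"

lemma extend0_Some [simp]: "extend0 None Some x (Some a) = x a"
  by (simp add: extend0_def)

lemma range_Some: "range Some = - {None}"
  by (auto simp: notin_range_Some)

text \<open>On \<open>z = 0\<close> all forms of a parallel class become \<open>x a - x b\<close>,
  so their product turns into a power of it.\<close>

lemma at_infinity0_affg:
  fixes l :: "'a::finite \<Rightarrow> 'a \<Rightarrow> int"
  assumes f: "f \<in> affg w l"
  shows "at_infinity0 f \<in> mulg w (mult_of l)"
proof -
  have fa: "f \<in> aff l" "f w = 0" using f by (auto simp: affg_def)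
  have fp: "f a \<in> polyfun" for a using fa by (auto simp: aff_def)
  have "\<exists>h\<in>polyfun. \<forall>x. at_infinity0 f a x - at_infinity0 f b x = (x a - x b) ^ mult_of l a b * h x"
    if ab: "a \<noteq> b" for a b
  proof -
    let ?C = "{l a b..- l b a}"
    obtain h where h: "h \<in> polyfun" "\<forall>x. f a x - f b x = (\<Prod>c\<in>?C. lin a b c x) * h x"
      using lin_division[OF polyfun_diff[OF fp fp] ab, of ?C a b] affD[OF fa(1) ab] by auto
    have "card ?C = mult_of l a b" by (simp add: mult_of_def)
    moreover have "lin a b c (extend0 None Some x) = x a - x b" for c x by (simp add: lin_def)
    ultimately have "at_infinity0 f a x - at_infinity0 f b x = (x a - x b) ^ mult_of l a b * h (extend0 None Some x)" for x
      using h(2)[rule_format, of "extend0 None Some x"] by simp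
    then show ?thesis by (intro bexI[OF _ polyfun_extend0[OF h(1)]] allI)
  qed
  moreover have "at_infinity0 f a \<in> polyfun" for a
    using polyfun_extend0[OF fp[of a]] by (simp add: restrict0_def)
  ultimately show ?thesis using fa(2) by (auto simp: mulg_def mul_def fun_eq_iff)
qed

text \<open>None of the hyperplanes in question lies in \<open>z = 0\<close>, so an equation that
  holds on their points with \<open>z \<noteq> 0\<close> holds on all of them.\<close>

lemma affg_saturated:
  assumes "\<And>a. h a \<in> polyfun" "(\<lambda>x. x None) \<odot> h \<in> affg w l"
  shows "h \<in> affg w l"
proof -
  have zh: "(\<lambda>x. x None) \<odot> h \<in> aff l" "\<And>x. x None * h w x = 0"
    using assms(2) by (auto simp: affg_def fun_eq_iff)
  have "h a x = h b x" if ab: "a \<noteq> b" "l a b \<le> c" "c \<le> - l b a" "x (Some a) - x (Some b) = of_int c * x None" for a b c x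
  proof -
    let ?q = "\<lambda>x. x (Some b) + of_int c * x None"
    have qp: "?q \<in> polyfun" by (intro polyfun_intros)
    have "h a (x(Some a := ?q x)) = h b (x(Some a := ?q x))" for x
    proof (rule polyfun_generic_eq[OF polyfun.coord[of None] polyfun_compose_upd[OF assms(1) qp]
          polyfun_compose_upd[OF assms(1) qp], of "\<lambda>_. 1"])
      fix x :: "'a option \<Rightarrow> real" assume "x None \<noteq> 0"
      then show "h a (x(Some a := ?q x)) = h b (x(Some a := ?q x))"
        using affD[OF zh(1) ab(1-3), of "x(Some a := ?q x)"] ab(1) by simp
    qed simp
    moreover have "x(Some a := ?q x) = x" using ab(4) by (simp add: fun_upd_idem_iff)
    ultimately show ?thesis by metis
  qed
  moreover have "h w x = 0" for x
    using polyfun_mult_eq_0[OF polyfun.coord[of None] assms(1) zh(2), of "\<lambda>_. 1"] by simp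
  ultimately show ?thesis using assms(1) by (auto simp: affg_def aff_def fun_eq_iff)
qed

text \<open>Multiplied by the factors of all pairs but one, \<open>f\<close> can be lifted by hand.
  Expanded in the restricted basis, which stays independent, these lifts have comparable
  coefficients, and coprimality of the factors removes them pair by pair until \<open>f\<close>
  itself is a combination of restricted basis elements.\<close>

lemma at_infinity0_surj:
  fixes l :: "'a::finite \<Rightarrow> 'a \<Rightarrow> int"
  assumes B: "hbasis r (affg w l) g d" and f: "f \<in> mulg w (mult_of l)"
  shows "\<exists>F\<in>affg w l. at_infinity0 F = f"
proof -
  note gm = graded_module_affg[of w l]
  have fm: "f \<in> mul (mult_of l)" "\<And>x. f w x = 0" using f by (auto simp: mulg_def)
  have fp: "f a \<in> polyfun" for a using fm by (auto simp: mul_def)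
  have gN: "g k \<in> affg w l" if "k < r" for k using B that by (auto simp: hbasis_def)
  have Bgen: "\<exists>q. (\<forall>k. q k \<in> polyfun) \<and> h = (\<Sum>k<r. q k \<odot> g k)" if "h \<in> affg w l" for h
    using B[unfolded hbasis_def, THEN conjunct2, THEN conjunct1] that by (rule bspec)
  have Bfree: "q k x = 0" if "\<And>k. q k \<in> polyfun" "(\<Sum>k<r. q k \<odot> g k) = 0" "k < r" for q k x
    using B[unfolded hbasis_def, THEN conjunct2, THEN conjunct2, rule_format, of q k x] that by simp
  let ?e = "extend0 None Some"
  let ?i = "\<lambda>(x :: 'a option \<Rightarrow> real) a. x (Some a)"
  have ie: "?i (?e x) = x" for x :: "'a \<Rightarrow> real" by auto
  have lift: "(\<lambda>x. p (?i x)) \<in> polyfun" if "p \<in> polyfun" for p :: "('a \<Rightarrow> real) \<Rightarrow> real"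
    using that by (rule polyfun_compose[where q = "\<lambda>a x. x (Some a)"]) (rule polyfun.coord)
  \<comment> \<open>Lifted to the affine module, a relation among the restricted basis elements is
    divisible by \<open>z\<close>, with a quotient in the module. Expanding the quotient in the
    basis shows that the coefficients are divisible by \<open>z\<close> as well.\<close>
  have free: "q k x = 0" if q: "\<And>k. q k \<in> polyfun" "\<And>a x. (\<Sum>k<r. q k x * g k a (?e x)) = 0" "k < r" for q k x
  proof -
    define h where "h = (\<Sum>k<r. (\<lambda>x. q k (?i x)) \<odot> g k)"
    have hN: "h \<in> affg w l"
      unfolding h_def by (rule gm_sum[OF gm], rule gm_smul[OF gm lift[OF q(1)]]) (use gN in auto)
    have "h a (x(None := 0)) = 0" for a x
    proof -
      have "x(None := 0) = ?e (?i x)" by (auto simp: fun_eq_iff extend0_def)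
      then show ?thesis using q(2)[of "?i x" a] by (simp add: h_def ie)
    qed
    then obtain h' where h': "\<And>a. h' a \<in> polyfun" "\<And>a x. h a x = x None * h' a x"
      using vector_division[of h None] gm_polyfun[OF gm hN] by blast
    have hh: "h = (\<lambda>x. x None) \<odot> h'" using h'(2) by (simp add: fun_eq_iff)
    have h'N: "h' \<in> affg w l" using affg_saturated[OF h'(1)] hN hh by (simp only:)
    obtain s where s: "\<forall>k. s k \<in> polyfun" "h' = (\<Sum>k<r. s k \<odot> g k)" using Bgen[OF h'N] by (elim exE conjE)
    have "(\<Sum>k<r. (\<lambda>x. q k (?i x) - x None * s k x) \<odot> g k) = 0"
    proof (intro ext)
      fix a x
      have "(\<Sum>k<r. q k (?i x) * g k a x) = x None * (\<Sum>k<r. s k x * g k a x)"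
        using h'(2)[of a x] by (simp add: h_def s(2))
      then show "(\<Sum>k<r. (\<lambda>x. q k (?i x) - x None * s k x) \<odot> g k) a x = 0 a x"
        by (simp add: left_diff_distrib sum_subtractf sum_distrib_left mult.assoc)
    qed
    then have "q k (?i (?e x)) - ?e x None * s k (?e x) = 0"
      using Bfree[of "\<lambda>k x. q k (?i x) - x None * s k x" k "?e x"] s(1) q lift
      by (simp add: polyfun_diff polyfun.mult polyfun.coord)
    then show ?thesis by (simp add: ie)
  qed
  define m where "m = mult_of l"
  define C where "C p = {l (fst p) (snd p)..- l (snd p) (fst p)}" for p :: "'a \<times> 'a"
  define L where "L p x = (\<Prod>c\<in>C p. lin (fst p) (snd p) c x)" for p x
  define u where "u p x = (x (fst p) - x (snd p)) ^ m (fst p) (snd p)" for p :: "'a \<times> 'a" and x :: "'a \<Rightarrow> real"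
  have Lp: "L p \<in> polyfun" for p unfolding L_def by (intro polyfun_prod polyfun_lin)
  have up: "u p \<in> polyfun" for p unfolding u_def by (intro polyfun_intros)
  have Lu: "L p (?e x) = u p x" for p x
    by (simp add: L_def u_def lin_def C_def m_def mult_of_def algebra_simps)
  have L0: "L p x = 0"
    if "l a b \<le> c" "c \<le> - l b a" "x (Some a) - x (Some b) = of_int c * x None" "p = (a, b) \<or> p = (b, a)" for a b c x p
  proof -
    have "(if p = (a, b) then c else - c) \<in> C p \<and> lin (fst p) (snd p) (if p = (a, b) then c else - c) x = 0"
      using that by (auto simp: C_def lin_def)
    then show ?thesis unfolding L_def C_def by (intro prod_zero) auto
  qed
  \<comment> \<open>The factor takes care of all pairs in \<open>X\<close>, so \<open>F\<close> has
    to satisfy the conditions of the remaining pairs only.\<close>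
  have mem: "(\<lambda>x. \<Prod>p\<in>X. L p x) \<odot> F \<in> affg w l"
    if "finite X" and Fp: "\<And>a. F a \<in> polyfun" and F0: "\<And>x. F w x = 0"
      and Fc: "\<And>a b c x. a \<noteq> b \<Longrightarrow> l a b \<le> c \<Longrightarrow> c \<le> - l b a \<Longrightarrow> x (Some a) - x (Some b) = of_int c * x None \<Longrightarrow>
        (a, b) \<notin> X \<Longrightarrow> (b, a) \<notin> X \<Longrightarrow> F a x = F b x" for X F
  proof -
    have "(\<Prod>p\<in>X. L p x) * F a x = (\<Prod>p\<in>X. L p x) * F b x"
      if "a \<noteq> b" "l a b \<le> c" "c \<le> - l b a" "x (Some a) - x (Some b) = of_int c * x None" for a b c x
    proof (cases "(a, b) \<in> X \<or> (b, a) \<in> X")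
      case True
      then have "(\<Prod>p\<in>X. L p x) = 0"
        using L0[OF that(2-4)] \<open>finite X\<close> by (intro prod_zero) auto
      then show ?thesis by simp
    next
      case False
      then show ?thesis using Fc[OF that] by simp
    qed
    moreover have "((\<lambda>x. \<Prod>p\<in>X. L p x) \<odot> F) a \<in> polyfun" for a
      by (intro polyfun_vsmul polyfun_prod Lp Fp)
    ultimately show ?thesis using F0 by (auto simp: affg_def aff_def fun_eq_iff)
  qed
  obtain idx :: "'a \<Rightarrow> nat" where idx: "inj idx"
    using finite_imp_inj_to_nat_seg[of "UNIV :: 'a set"] by blast
  define P where "P = {(a, b). idx a < idx b}"
  have fP: "finite X" for X :: "('a \<times> 'a) set" by simp
  have pair: "(\<exists>s. (\<forall>k. s k \<in> polyfun) \<and> (\<forall>a x. (\<Prod>p\<in>P-{p0}. u p x) * f a x = (\<Sum>k<r. s k x * g k a (?e x))))"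
    if p0: "p0 \<in> P" for p0
  proof -
    \<comment> \<open>The entry at \<open>a\<close> will be changed; an endpoint other than
      \<open>w\<close> is taken in order to keep the gauge.\<close>
    obtain a b where ab: "p0 = (a, b) \<or> p0 = (b, a)" "a \<noteq> b" "a \<noteq> w"
      using p0 by (cases p0; cases "fst p0 = w") (auto simp: P_def)
    obtain h where h: "h \<in> polyfun" "\<forall>x. f a x - f b x = (x a - x b) ^ mult_of l a b * h x"
      using mulD[OF fm(1) ab(2)] by blast
    \<comment> \<open>In \<open>f a - f b = (x a - x b) ^ m * h\<close> the power is replaced by the
      product of affine forms. This meets the condition of the pair exactly and is unchanged on
      \<open>z = 0\<close>.\<close>
    define F where "F c x = (if c = a then f b (?i x) + L (a, b) x * h (?i x) else f c (?i x))" for c x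
    have Fp: "F c \<in> polyfun" for c
      unfolding F_def by (intro polyfun_if polyfun.add polyfun.mult lift fp Lp h(1))
    have "F c x = F e x" if "c \<noteq> e" "l c e \<le> k" "k \<le> - l e c" "x (Some c) - x (Some e) = of_int k * x None"
      "(c, e) \<notin> P - {p0}" "(e, c) \<notin> P - {p0}" for c e k x
    proof -
      have "idx c \<noteq> idx e" using idx that(1) by (auto dest: injD)
      then have "(c, e) = p0 \<or> (e, c) = p0" using that(5,6) by (auto simp: P_def)
      then have ce: "(a, b) = (c, e) \<or> (a, b) = (e, c)" using ab(1) by auto
      then have "L (a, b) x = 0" using L0[OF that(2-4), of "(a, b)"] by simp
      then show ?thesis using ce ab(2) by (auto simp: F_def)
    qed
    then have FN: "(\<lambda>x. \<Prod>p\<in>P-{p0}. L p x) \<odot> F \<in> affg w l"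
      using Fp ab(3) fm(2) by (intro mem fP) (auto simp: F_def)
    obtain q where q: "\<forall>k. q k \<in> polyfun" "(\<lambda>x. \<Prod>p\<in>P-{p0}. L p x) \<odot> F = (\<Sum>k<r. q k \<odot> g k)"
      using Bgen[OF FN] by (elim exE conjE)
    have "(\<Prod>p\<in>P-{p0}. u p x) * f c x = (\<Sum>k<r. q k (?e x) * g k c (?e x))" for c x
    proof -
      have "F c (?e x) = f c x"
        using h(2)[rule_format, of x] Lu[of "(a, b)" x] by (simp add: F_def ie u_def m_def)
      then show ?thesis
        using fun_cong[OF fun_cong[OF q(2), of c], of "?e x"] by (simp add: Lu)
    qed
    moreover have "(\<lambda>x. q k (?e x)) \<in> polyfun" for k using q(1) by (intro polyfun_extend0) blast
    ultimately show ?thesis by (intro exI[of _ "\<lambda>k x. q k (?e x)"]) blast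
  qed
  \<comment> \<open>\<open>T\<close> collects the pairs whose factors have been removed; for
    \<open>T = P\<close> nothing but \<open>f\<close> is left.\<close>
  have "\<exists>t. (\<forall>k. t k \<in> polyfun) \<and> (\<forall>a x. (\<Prod>p\<in>P-T. u p x) * f a x = (\<Sum>k<r. t k x * g k a (?e x)))"
    if "T \<subseteq> P" for T
    using fP[of T] that
  proof (induction T rule: finite_induct)
    case empty
    have FN: "(\<lambda>x. \<Prod>p\<in>P. L p x) \<odot> (\<lambda>c x. f c (?i x)) \<in> affg w l"
    proof (intro mem fP)
      fix a b c and x :: "'a option \<Rightarrow> real" assume "a \<noteq> b" "(a, b) \<notin> P" "(b, a) \<notin> P"
      then have "idx a = idx b" by (auto simp: P_def)
      then show "f a (?i x) = f b (?i x)" using idx \<open>a \<noteq> b\<close> by (auto dest: injD)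
    qed (use fm(2) lift[OF fp] in auto)
    obtain q where q: "\<forall>k. q k \<in> polyfun" "(\<lambda>x. \<Prod>p\<in>P. L p x) \<odot> (\<lambda>c x. f c (?i x)) = (\<Sum>k<r. q k \<odot> g k)"
      using Bgen[OF FN] by (elim exE conjE)
    have "(\<Prod>p\<in>P. u p x) * f c x = (\<Sum>k<r. q k (?e x) * g k c (?e x))" for c x
      using fun_cong[OF fun_cong[OF q(2), of c], of "?e x"] by (simp add: Lu ie)
    moreover have "(\<lambda>x. q k (?e x)) \<in> polyfun" for k using q(1) by (intro polyfun_extend0) blast
    ultimately show ?case by (intro exI[of _ "\<lambda>k x. q k (?e x)"]) simp
  next
    case (insert p0 T)
    then have p0: "p0 \<in> P" "p0 \<notin> T" "T \<subseteq> P" by auto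
    obtain t where t: "\<forall>k. t k \<in> polyfun" "\<forall>a x. (\<Prod>p\<in>P-T. u p x) * f a x = (\<Sum>k<r. t k x * g k a (?e x))"
      using insert by blast
    obtain s where s: "\<forall>k. s k \<in> polyfun" "\<forall>a x. (\<Prod>p\<in>P-{p0}. u p x) * f a x = (\<Sum>k<r. s k x * g k a (?e x))"
      using pair[OF p0(1)] by blast
    define A where "A x = (\<Prod>p\<in>P-insert p0 T. u p x)" for x
    define A' where "A' x = (\<Prod>p\<in>T. u p x)" for x
    have Ap: "A \<in> polyfun" "A' \<in> polyfun" unfolding A_def A'_def by (intro polyfun_prod up)+
    have e1: "(\<Prod>p\<in>P-T. u p x) = u p0 x * A x" for x
    proof -
      have "P - T = insert p0 (P - insert p0 T)" using p0 by auto
      then show ?thesis by (simp add: A_def)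
    qed
    have e2: "(\<Prod>p\<in>P-{p0}. u p x) = A' x * A x" for x
    proof -
      have "P - {p0} = T \<union> (P - insert p0 T)" using p0 by auto
      then show ?thesis by (simp add: A_def A'_def) (subst prod.union_disjoint, auto)
    qed
    \<comment> \<open>The representation with the factors off \<open>T\<close> and the one with the
      factors off \<open>p0\<close> coincide after multiplication by the missing factors, so
      independence identifies the coefficients. As \<open>A'\<close> is coprime to
      \<open>u p0\<close>, the latter divides each \<open>t k\<close>.\<close>
    have "A' x * t k x = u p0 x * s k x" if k: "k < r" for k x
    proof -
      have "A' x * t k x - u p0 x * s k x = 0"
      proof (rule free[of "\<lambda>k x. A' x * t k x - u p0 x * s k x"])
        show "(\<lambda>x. A' x * t k x - u p0 x * s k x) \<in> polyfun" for k
          using t(1) s(1) by (intro polyfun_diff polyfun.mult Ap up) auto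
        fix a x
        have "A' x * (u p0 x * A x * f a x) = (\<Sum>k<r. A' x * t k x * g k a (?e x))"
          using t(2)[rule_format, of x a] by (simp add: e1 sum_distrib_left mult.assoc)
        moreover have "u p0 x * (A' x * A x * f a x) = (\<Sum>k<r. u p0 x * s k x * g k a (?e x))"
          using s(2)[rule_format, of x a] by (simp add: e2 sum_distrib_left mult.assoc)
        ultimately show "(\<Sum>k<r. (A' x * t k x - u p0 x * s k x) * g k a (?e x)) = 0"
          by (simp add: left_diff_distrib sum_subtractf mult.left_commute mult.assoc)
      qed (rule k)
      then show ?thesis by simp
    qed
    moreover obtain a b where ab: "p0 = (a, b)" by (cases p0)
    then have lt: "idx a < idx b" using p0(1) by (auto simp: P_def)
    \<comment> \<open>A point with equal coordinates at \<open>a\<close> and \<open>b\<close> and no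
      other coincidence, where the factors of the other pairs are nonzero.\<close>
    moreover define pt where "pt c = (if c = a then real (idx b) else real (idx c))" for c
    have "A' (pt(a := pt b)) \<noteq> 0"
    proof -
      have "u p (pt(a := pt b)) \<noteq> 0" if "p \<in> T" for p
      proof -
        obtain c e where c1: "p = (c, e)" by (cases p)
        have c2: "idx c < idx e" using subsetD[OF p0(3) that] by (simp add: P_def c1)
        note ce = c1 c2
        have "(c, e) \<noteq> (a, b)" using that p0(2) ab ce by auto
        moreover have "idx c = idx e \<longleftrightarrow> c = e" for c e using idx by (auto dest: injD)
        moreover note ce
        ultimately show ?thesis using lt by (auto simp: u_def pt_def)
      qed
      then show ?thesis by (simp add: A'_def)
    qed
    moreover have "b \<noteq> a" using lt by auto
    ultimately have "\<exists>t'\<in>polyfun. \<forall>x. t k x = u p0 x * t' x" if "k < r" for k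
      using polyfun_divisible_coprime[of A' pt a "\<lambda>x. x b" "t k" "s k" "m a b"] Ap t(1) s(1) that
      by (auto simp: u_def ab polyfun.coord)
    then have "\<forall>k\<in>{..<r}. \<exists>t'. t' \<in> polyfun \<and> (\<forall>x. t k x = u p0 x * t' x)" by blast
    then have "\<exists>t'. \<forall>k\<in>{..<r}. t' k \<in> polyfun \<and> (\<forall>x. t k x = u p0 x * t' k x)" by (rule bchoice)
    then obtain t' where t': "\<And>k. k < r \<Longrightarrow> t' k \<in> polyfun" "\<And>k x. k < r \<Longrightarrow> t k x = u p0 x * t' k x" by auto
    define t'' where "t'' k = (if k < r then t' k else (\<lambda>_. 0))" for k
    have tp: "t'' k \<in> polyfun" for k using t'(1) by (auto simp: t''_def polyfun.const)
    have gp: "(\<lambda>x. g k a (?e x)) \<in> polyfun" if "k < r" for k a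
      using gm_polyfun[OF gm gN[OF that]] by (intro polyfun_extend0)
    have "A x * f c x = (\<Sum>k<r. t'' k x * g k c (?e x))" for c x
    proof (rule polyfun_mult_cancel[of "u p0" "\<lambda>x. A x * f c x" "\<lambda>x. \<Sum>k<r. t'' k x * g k c (?e x)" "\<lambda>c. real (idx c)" x])
      show "u p0 (\<lambda>c. real (idx c)) \<noteq> 0" using lt by (simp add: u_def ab)
      show "(\<lambda>x. \<Sum>k<r. t'' k x * g k c (?e x)) \<in> polyfun" using tp gp by (intro polyfun_sum polyfun.mult) auto
      fix x
      have "u p0 x * (A x * f c x) = (\<Sum>k<r. t k x * g k c (?e x))"
        using t(2)[rule_format, of x c] by (simp add: e1 mult.assoc)
      also have "\<dots> = (\<Sum>k<r. u p0 x * (t'' k x * g k c (?e x)))"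
        by (rule sum.cong[OF refl]) (simp add: t''_def t'(2) mult.assoc)
      finally show "u p0 x * (A x * f c x) = u p0 x * (\<Sum>k<r. t'' k x * g k c (?e x))"
        by (simp add: sum_distrib_left)
    qed (use up Ap fp in \<open>auto intro: polyfun.mult\<close>)
    then show ?case using tp unfolding A_def by blast
  qed
  from this[of P] obtain t where t: "\<forall>k. t k \<in> polyfun" "\<forall>a x. f a x = (\<Sum>k<r. t k x * g k a (?e x))" by auto
  let ?F = "\<Sum>k<r. (\<lambda>x. t k (?i x)) \<odot> g k"
  have "?F \<in> affg w l"
    by (rule gm_sum[OF gm], rule gm_smul[OF gm lift]) (use t(1) gN in auto)
  moreover have "at_infinity0 ?F = f"
  proof (intro ext)
    fix a x
    show "at_infinity0 ?F a x = f a x" by (simp add: t(2)[rule_format, of a x] ie)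
  qed
  ultimately show ?thesis by blast
qed

section \<open>Shifting the affine arrangement\<close>

definition slice :: "'w \<Rightarrow> (('w \<Rightarrow> real) \<Rightarrow> real) \<Rightarrow> ('w \<Rightarrow> real) \<Rightarrow> real poly" where
  "slice i p x = along (\<lambda>j y. if j = i then 0 else y j) (\<lambda>j y. if j = i then 1 else 0) p x"

lemma poly_slice: "p \<in> polyfun \<Longrightarrow> poly (slice i p x) t = p (x(i := t))"
proof -
  assume "p \<in> polyfun"
  moreover have "(\<lambda>j. (if j = i then 0 else x j) + t * (if j = i then 1 else 0)) = x(i := t)" by auto
  ultimately show ?thesis by (simp add: slice_def poly_along)
qed

lemma slice_upd: "p \<in> polyfun \<Longrightarrow> slice i p (x(i := t)) = slice i p x"
  by (simp add: poly_eq_poly_eq_iff[symmetric] fun_eq_iff poly_slice)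

text \<open>A univariate polynomial with a nonzero period takes each of its values infinitely often
  and is therefore constant.\<close>

lemma polyfun_periodic:
  assumes "p \<in> polyfun" "z \<noteq> 0" "\<And>t. p (x(i := t)) = p (x(i := t - z))"
  shows "p (x(i := t)) = p (x(i := s))"
proof -
  let ?P = "slice i p x"
  have step: "poly ?P (s - real n * z) = poly ?P s" for n
  proof (induction n)
    case (Suc n)
    have st: "poly ?P (s - real n * z) = poly ?P (s - real n * z - z)"
      using assms(3)[of "s - real n * z"] by (simp only: poly_slice[OF assms(1)])
    have e: "s - real (Suc n) * z = s - real n * z - z" by (simp add: algebra_simps)
    show ?case unfolding e using Suc st by simp
  qed simp
  have "infinite (range (\<lambda>n. s - real n * z))"
    using assms(2) by (intro range_inj_infinite) (auto simp: inj_def)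
  moreover have "range (\<lambda>n. s - real n * z) \<subseteq> {t. poly (?P - [:poly ?P s:]) t = 0}"
    using step by auto
  ultimately have "?P - [:poly ?P s:] = 0"
    using poly_roots_finite[of "?P - [:poly ?P s:]"] finite_subset by blast
  then have "poly (?P - [:poly ?P s:]) t = 0" by simp
  then show ?thesis by (simp add: poly_slice[OF assms(1)])
qed

text \<open>The backward difference quotient \<open>(p(x) - p(x\<^sub>i - z)) / z\<close>.\<close>

definition nab :: "'a option \<Rightarrow> (('a option \<Rightarrow> real) \<Rightarrow> real) \<Rightarrow> ('a option \<Rightarrow> real) \<Rightarrow> real" where
  "nab i p = (SOME q. q \<in> polyfun \<and> (\<forall>x. x None * q x = p x - p (x(i := x i - x None))))"

lemma nab:
  assumes "p \<in> polyfun"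
  shows "nab i p \<in> polyfun" "x None * nab i p x = p x - p (x(i := x i - x None))"
proof -
  obtain h where h: "\<forall>x t. p x - p (x(i := t)) = (x i - t) * h x t"
      "\<forall>q\<in>polyfun. (\<lambda>x. h x (q x)) \<in> polyfun"
    using polyfun_factor[OF assms] by blast
  have "(\<lambda>x. h x (x i - x None)) \<in> polyfun" by (rule bspec[OF h(2) polyfun_diff[OF polyfun.coord polyfun.coord]])
  moreover have "\<forall>x. x None * h x (x i - x None) = p x - p (x(i := x i - x None))" using h(1) by simp
  ultimately have "\<exists>q. q \<in> polyfun \<and> (\<forall>x. x None * q x = p x - p (x(i := x i - x None)))"
    by (intro exI[of _ "\<lambda>x. h x (x i - x None)"] conjI)
  then have "nab i p \<in> polyfun \<and> (\<forall>x. x None * nab i p x = p x - p (x(i := x i - x None)))"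
    unfolding nab_def by (rule someI_ex)
  then show "nab i p \<in> polyfun" "x None * nab i p x = p x - p (x(i := x i - x None))" by blast+
qed

lemma nab_unique:
  assumes "p \<in> polyfun" "q \<in> polyfun" "\<And>x. x None * q x = p x - p (x(i := x i - x None))"
  shows "nab i p = q"
proof
  fix x
  show "nab i p x = q x"
    using polyfun_mult_cancel[OF polyfun.coord[of None] nab(1)[OF assms(1), of i] assms(2), of "\<lambda>_. 1" x]
      assms(3) nab(2)[OF assms(1), of _ i] by simp
qed

lemma hom_nab:
  assumes "hom (Suc e) p"
  shows "hom e (nab i p)"
proof (rule hom_cancel[of 1 e "\<lambda>x. x None" "nab i p" "\<lambda>_. 1"])
  have p: "p \<in> polyfun" by (rule hom_polyfun[OF assms])
  have "(\<lambda>x. p (x(i := x i - x None))) \<in> polyfun"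
    by (rule polyfun_compose_upd[OF p]) (intro polyfun_intros)
  moreover have "p ((\<lambda>j. t * x j)(i := t * x i - t * x None)) = t ^ Suc e * p (x(i := x i - x None))" for t x
  proof -
    have "(\<lambda>j. t * x j)(i := t * x i - t * x None) = (\<lambda>j. t * (x(i := x i - x None)) j)"
      by (auto simp: fun_eq_iff algebra_simps)
    then show ?thesis using assms unfolding hom_def by metis
  qed
  ultimately have "hom (Suc e) (\<lambda>x. p (x(i := x i - x None)))" by (simp add: hom_def)
  then have "hom (Suc e) (\<lambda>x. p x + - 1 * p (x(i := x i - x None)))"
    by (intro hom_add assms hom_cmult)
  then show "hom (1 + e) (\<lambda>x. x None * nab i p x)" by (simp add: nab(2)[OF p])
qed (auto simp: hom_coord[simplified] nab(1) hom_polyfun[OF assms])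

text \<open>Homogenised power sums: by the binomial theorem the difference of
  \<open>x_w ^ (k + 1)\<close> is \<open>(k + 1) z x_w ^ k\<close> up to lower powers of
  \<open>x_w\<close>, whose antidifferences are known by induction.\<close>

lemma antidifference_power:
  "\<exists>b\<in>polyfun. \<forall>x. b x - b (x(Some w := x (Some w) - x None)) = x None * x (Some w) ^ k"
proof (induction k rule: less_induct)
  case (less k)
  then have "\<forall>j\<in>{..<k}. \<exists>b. b \<in> polyfun \<and>
      (\<forall>x. b x - b (x(Some w := x (Some w) - x None)) = x None * x (Some w) ^ j)" by blast
  then have "\<exists>b. \<forall>j\<in>{..<k}. b j \<in> polyfun \<and>
      (\<forall>x. b j x - b j (x(Some w := x (Some w) - x None)) = x None * x (Some w) ^ j)" by (rule bchoice)
  then obtain b where b: "\<And>j. j < k \<Longrightarrow> b j \<in> polyfun"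
    "\<And>j x. j < k \<Longrightarrow> b j x - b j (x(Some w := x (Some w) - x None)) = x None * x (Some w) ^ j" by auto
  define c where "c j = real (Suc k choose j) * (-1) ^ (Suc k - j)" for j
  define B where "B x = (x (Some w) ^ Suc k + (\<Sum>j<k. c j * x None ^ (k - j) * b j x)) / real (Suc k)" for x
  have "B \<in> polyfun" unfolding B_def using b(1) by (intro polyfun_intros) auto
  moreover have "B x - B (x(Some w := x (Some w) - x None)) = x None * x (Some w) ^ k" for x
  proof -
    let ?X = "x (Some w)" and ?z = "x None" and ?y = "x(Some w := x (Some w) - x None)"
    have "(?X - ?z) ^ Suc k = (\<Sum>j\<le>Suc k. real (Suc k choose j) * ?X ^ j * (- ?z) ^ (Suc k - j))"
      using binomial_ring[of ?X "- ?z" "Suc k"] by simp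
    also have "\<dots> = (\<Sum>j\<le>Suc k. c j * ?z ^ (Suc k - j) * ?X ^ j)"
      unfolding c_def by (intro sum.cong refl) (simp add: power_minus[of ?z] mult_ac)
    also have "\<dots> = ?X ^ Suc k + c k * ?z * ?X ^ k + (\<Sum>j<k. c j * ?z ^ (Suc k - j) * ?X ^ j)"
      by (simp add: lessThan_Suc_atMost[symmetric] c_def)
    finally have "(?X - ?z) ^ Suc k = ?X ^ Suc k + c k * ?z * ?X ^ k + (\<Sum>j<k. c j * ?z ^ (Suc k - j) * ?X ^ j)" .
    moreover have ck: "c k = - real (Suc k)" by (simp add: c_def)
    ultimately have e1: "?X ^ Suc k - (?X - ?z) ^ Suc k = real (Suc k) * ?z * ?X ^ k - (\<Sum>j<k. c j * ?z ^ (Suc k - j) * ?X ^ j)"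
      by (simp del: power_Suc of_nat_Suc)
    have "(\<Sum>j<k. c j * ?z ^ (k - j) * b j x) - (\<Sum>j<k. c j * ?z ^ (k - j) * b j ?y) =
        (\<Sum>j<k. c j * ?z ^ (k - j) * (b j x - b j ?y))"
      by (simp add: sum_subtractf right_diff_distrib)
    also have "\<dots> = (\<Sum>j<k. c j * ?z ^ (Suc k - j) * ?X ^ j)"
      by (intro sum.cong refl) (simp add: b(2) Suc_diff_le mult_ac)
    finally have e2: "(\<Sum>j<k. c j * ?z ^ (k - j) * b j x) - (\<Sum>j<k. c j * ?z ^ (k - j) * b j ?y) =
        (\<Sum>j<k. c j * ?z ^ (Suc k - j) * ?X ^ j)" .
    have "B x - B ?y = ((?X ^ Suc k - (?X - ?z) ^ Suc k) +
        ((\<Sum>j<k. c j * ?z ^ (k - j) * b j x) - (\<Sum>j<k. c j * ?z ^ (k - j) * b j ?y))) / real (Suc k)"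
      unfolding B_def by (simp add: diff_divide_distrib[symmetric] del: power_Suc)
    also have "\<dots> = ?z * ?X ^ k" unfolding e1 e2 by (simp add: field_simps)
    finally show ?thesis .
  qed
  ultimately show ?case by blast
qed

lemma antidifference:
  assumes "p \<in> polyfun"
  shows "\<exists>G\<in>polyfun. \<forall>x. G x - G (x(Some w := x (Some w) - x None)) = x None * p x"
proof -
  obtain K r where r: "\<And>k. r k \<in> polyfun" "\<And>k x t. r k (x(Some w := t)) = r k x"
      "\<And>x. p x = (\<Sum>k\<le>(K::nat). r k x * (x (Some w) - 0) ^ k)"
    by (rule polyfun_expansion[OF assms polyfun.const[of 0], of "Some w"]) auto
  have "\<forall>k. \<exists>b. b \<in> polyfun \<and> (\<forall>x. b x - b (x(Some w := x (Some w) - x None)) = x None * x (Some w) ^ k)"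
    using antidifference_power[of w] by blast
  then have "\<exists>b. \<forall>k. b k \<in> polyfun \<and> (\<forall>x. b k x - b k (x(Some w := x (Some w) - x None)) = x None * x (Some w) ^ k)"
    by (rule choice)
  then obtain b where b: "\<And>k. b k \<in> polyfun"
    "\<And>k x. b k x - b k (x(Some w := x (Some w) - x None)) = x None * x (Some w) ^ k" by blast
  define G where "G x = (\<Sum>k\<le>K. r k x * b k x)" for x
  have "G \<in> polyfun" unfolding G_def using r b by (intro polyfun_intros)
  moreover have "G x - G (x(Some w := x (Some w) - x None)) = x None * p x" for x
  proof -
    have "G x - G (x(Some w := x (Some w) - x None)) =
        (\<Sum>k\<le>K. r k x * (b k x - b k (x(Some w := x (Some w) - x None))))"
      by (simp add: G_def r(2) sum_subtractf right_diff_distrib)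
    also have "\<dots> = x None * p x" by (simp add: b(2) r(3) sum_distrib_left mult.left_commute)
    finally show ?thesis .
  qed
  ultimately show ?thesis by blast
qed

section \<open>The difference quotient as a bijection between the two affine modules\<close>

text \<open>Each interval of a pair at \<open>w\<close> gains one value at its end. If
  \<open>l w b + l b w = 1\<close>, it was empty and becomes a single point.\<close>

definition shift_at :: "'a \<Rightarrow> ('a \<Rightarrow> 'a \<Rightarrow> int) \<Rightarrow> 'a \<Rightarrow> 'a \<Rightarrow> int" where
  "shift_at w l a b = (if a = w then l a b - 1 else l a b)"

definition nabv :: "'a \<Rightarrow> ('a \<Rightarrow> ('a option \<Rightarrow> real) \<Rightarrow> real) \<Rightarrow> 'a \<Rightarrow> ('a option \<Rightarrow> real) \<Rightarrow> real" where
  "nabv w g a = nab (Some w) (g a)"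

text \<open>Replacing \<open>x_w\<close> by \<open>x_w - z\<close> moves a point from one hyperplane
  at \<open>w\<close> to the neighbouring parallel one, and the extended interval contains both. So
  the undivided difference lies in the module, and saturation permits the division by
  \<open>z\<close>.\<close>

lemma nabv_mem:
  fixes w :: "'a::finite"
  assumes g: "g \<in> affg w (shift_at w l)"
  shows "nabv w g \<in> affg w l"
proof (rule affg_saturated)
  have ga: "g \<in> aff (shift_at w l)" "g w = 0" using g by (auto simp: affg_def)
  have gp: "g a \<in> polyfun" for a using ga by (auto simp: aff_def)
  show "nabv w g a \<in> polyfun" for a using nab(1)[OF gp] by (simp add: nabv_def)
  let ?y = "\<lambda>x. x(Some w := x (Some w) - x None)"
  have gD: "g a x = g b x" if "a \<noteq> b" "shift_at w l a b \<le> c" "c \<le> - shift_at w l b a"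
    "x (Some a) - x (Some b) = of_int c * x None" for a b c x using affD[OF ga(1) that] .
  have g0: "g w x = 0" for x using ga(2) by simp
  have "g a x - g a (?y x) = g b x - g b (?y x)"
    if ab: "a \<noteq> b" "l a b \<le> c" "c \<le> - l b a" "x (Some a) - x (Some b) = of_int c * x None" for a b c x
  proof -
    consider "a = w" | "b = w" | "a \<noteq> w" "b \<noteq> w" by blast
    then show ?thesis
    proof cases
      case 1
      have "g a x = g b x" using ab 1 by (intro gD[of a b c]) (auto simp: shift_at_def)
      moreover have "g a (?y x) = g b (?y x)"
        using ab 1 by (intro gD[of a b "c - 1"]) (auto simp: shift_at_def algebra_simps)
      ultimately show ?thesis by simp
    next
      case 2
      have "g a x = g b x" using ab 2 by (intro gD[of a b c]) (auto simp: shift_at_def)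
      moreover have "g a (?y x) = g b (?y x)"
        using ab 2 by (intro gD[of a b "c + 1"]) (auto simp: shift_at_def algebra_simps)
      ultimately show ?thesis by simp
    next
      case 3
      have "g a x = g b x" using ab 3 by (intro gD[of a b c]) (auto simp: shift_at_def)
      moreover have "g a (?y x) = g b (?y x)" using ab 3 by (intro gD[of a b c]) (auto simp: shift_at_def)
      ultimately show ?thesis by simp
    qed
  qed
  moreover have "x None * nabv w g a x = g a x - g a (?y x)" for a x by (simp add: nabv_def nab(2)[OF gp])
  moreover have "((\<lambda>x. x None) \<odot> nabv w g) a \<in> polyfun" for a
    by (intro polyfun_vsmul polyfun.coord) (simp add: nabv_def nab(1)[OF gp])
  ultimately show "(\<lambda>x. x None) \<odot> nabv w g \<in> affg w l"
    using g0 by (auto simp: affg_def aff_def fun_eq_iff)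
qed

lemma nabv_inj:
  fixes w :: "'a::finite"
  assumes g: "g \<in> affg w (shift_at w l)" and "\<And>a. a \<noteq> w \<Longrightarrow> l w a + l a w \<le> 1" and "nabv w g = 0"
  shows "g = 0"
proof (intro ext)
  fix a x
  have ga: "g \<in> aff (shift_at w l)" "\<And>x. g w x = 0" using g by (auto simp: affg_def)
  have gp: "g a \<in> polyfun" using ga by (auto simp: aff_def)
  have per: "g a x = g a (x(Some w := x (Some w) - x None))" for x
    using nab(2)[OF gp, of x "Some w"] fun_cong[OF fun_cong[OF assms(3), of a], of x] by (simp add: nabv_def)
  have "g a x = 0" if "a \<noteq> w" for x
  proof (rule polyfun_generic_zero[OF polyfun.coord[of None] gp, of "\<lambda>_. 1"])
    fix x :: "'a option \<Rightarrow> real" assume z: "x None \<noteq> 0"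
    let ?s = "x (Some a) + of_int (l w a - 1) * x None"
    have "g a (x(Some w := x (Some w))) = g a (x(Some w := ?s))"
    proof (rule polyfun_periodic[OF gp z])
      fix t show "g a (x(Some w := t)) = g a (x(Some w := t - x None))" using per[of "x(Some w := t)"] by simp
    qed
    \<comment> \<open>This is the added hyperplane. The bound \<open>l w a + l a w \<le> 1\<close>
      is what ensures that the extended interval is nonempty and contains it.\<close>
    also have "\<dots> = g w (x(Some w := ?s))"
      using that assms(2)[OF that] by (intro affD[OF ga(1), of a w "1 - l w a"]) (auto simp: shift_at_def algebra_simps)
    finally show "g a x = 0" using ga(2) by simp
  qed simp
  then show "g a x = 0 a x" using ga(2) by (cases "a = w") auto
qed

text \<open>Each \<open>f a\<close> has an antidifference in \<open>x_w\<close>, made unique by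
  requiring it to vanish on the added hyperplane of the pair \<open>(w, a)\<close>. It then vanishes
  on all hyperplanes of this pair by telescoping. For a pair off \<open>w\<close>, the
  antidifferences differ by a constant in \<open>x_w\<close>, and \<open>tri\<close> allows their
  two normalisation points to be compared.\<close>

lemma nabv_surj:
  fixes w :: "'a::finite"
  assumes f: "f \<in> affg w l"
    and tri: "\<And>a b. a \<noteq> w \<Longrightarrow> b \<noteq> w \<Longrightarrow> a \<noteq> b \<Longrightarrow> l a w + l w b \<le> l a b + 1"
  shows "\<exists>g\<in>affg w (shift_at w l). nabv w g = f"
proof -
  have fa: "f \<in> aff l" "\<And>x. f w x = 0" using f by (auto simp: affg_def)
  have fp: "f a \<in> polyfun" for a using fa by (auto simp: aff_def)
  have "\<forall>a. \<exists>G. G \<in> polyfun \<and> (\<forall>x. G x - G (x(Some w := x (Some w) - x None)) = x None * f a x)"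
    using antidifference[OF fp] by blast
  then have "\<exists>G. \<forall>a. G a \<in> polyfun \<and> (\<forall>x. G a x - G a (x(Some w := x (Some w) - x None)) = x None * f a x)"
    by (rule choice)
  then obtain G where G: "\<And>a. G a \<in> polyfun"
    "\<And>a x. G a x - G a (x(Some w := x (Some w) - x None)) = x None * f a x" by blast
  let ?s = "\<lambda>a (x :: 'a option \<Rightarrow> real). x (Some a) + of_int (l w a - 1) * x None"
  have sp: "?s a \<in> polyfun" for a by (intro polyfun_intros)
  define g where "g a x = (if a = w then 0 else G a x - G a (x(Some w := ?s a x)))" for a x
  have gp: "g a \<in> polyfun" for a
    unfolding g_def by (intro polyfun_if polyfun.const polyfun_diff G(1) polyfun_compose_upd[OF G(1) sp])
  have tele: "G a (x(Some w := s + real n * x None)) - G a (x(Some w := s)) =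
      x None * (\<Sum>k=1..n. f a (x(Some w := s + real k * x None)))" for a x s n
  proof (induction n)
    case (Suc n)
    have "G a (x(Some w := s + real (Suc n) * x None)) - G a (x(Some w := s + real n * x None)) =
        x None * f a (x(Some w := s + real (Suc n) * x None))"
      using G(2)[of a "x(Some w := s + real (Suc n) * x None)"] by (simp add: algebra_simps)
    moreover have s: "(\<Sum>k=1..Suc n. F k) = (\<Sum>k=1..n. F k) + F (Suc n)" for F :: "nat \<Rightarrow> real" by simp
    ultimately show ?case unfolding s distrib_left using Suc by linarith
  qed simp
  \<comment> \<open>The terms of the telescoping sum lie on hyperplanes of the unshifted
    arrangement, where \<open>f a = f w = 0\<close>. The sum starts one step above \<open>i\<close>,
    which is why \<open>i = l w a - 1\<close> is allowed.\<close>
  have zero: "G a (x(Some w := x (Some a) + of_int j * x None)) = G a (x(Some w := x (Some a) + of_int i * x None))"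
    if "a \<noteq> w" "l w a \<le> i + 1" "i \<le> j" "j \<le> - l a w" for a x i j
  proof -
    have "f a (x(Some w := x (Some a) + of_int i * x None + real k * x None)) = 0" if k: "k \<in> {1..nat (j - i)}" for k
    proof -
      have "f a (x(Some w := x (Some a) + of_int i * x None + real k * x None)) =
          f w (x(Some w := x (Some a) + of_int i * x None + real k * x None))"
        using k \<open>a \<noteq> w\<close> \<open>l w a \<le> i + 1\<close> \<open>i \<le> j\<close> \<open>j \<le> - l a w\<close>
        by (intro affD[OF fa(1), of a w "- i - int k"]) (auto simp: algebra_simps)
      then show ?thesis using fa(2) by simp
    qed
    then have "G a (x(Some w := x (Some a) + of_int i * x None + real (nat (j - i)) * x None)) =
        G a (x(Some w := x (Some a) + of_int i * x None))"
      using tele[of a x "x (Some a) + of_int i * x None" "nat (j - i)"] by simp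
    moreover have "x (Some a) + of_int i * x None + real (nat (j - i)) * x None = x (Some a) + of_int j * x None"
      using that(3) by (simp add: algebra_simps)
    ultimately show ?thesis by simp
  qed
  have gw: "g b x = 0" if "b \<noteq> w" "l w b - 1 \<le> c" "c \<le> - l b w" "x (Some w) = x (Some b) + of_int c * x None" for b c x
  proof -
    have "x(Some w := x (Some b) + of_int c * x None) = x" using that(4) by (simp add: fun_upd_idem_iff)
    then show ?thesis
      using zero[of b "l w b - 1" c x] that by (simp add: g_def)
  qed
  have main: "g a x = g b x" if ab: "a \<noteq> b" "shift_at w l a b \<le> c" "c \<le> - shift_at w l b a"
    "x (Some a) - x (Some b) = of_int c * x None" and z: "x None \<noteq> 0" for a b c x
  proof -
    consider "a = w" | "b = w" | "a \<noteq> w" "b \<noteq> w" by blast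
    then show ?thesis
    proof cases
      case 1
      then have "g b x = 0" using ab by (intro gw[of b c]) (auto simp: shift_at_def algebra_simps)
      then show ?thesis using 1 by (simp add: g_def)
    next
      case 2
      then have "g a x = 0" using ab by (intro gw[of a "- c"]) (auto simp: shift_at_def algebra_simps)
      then show ?thesis using 2 by (simp add: g_def)
    next
      case 3
      have lc: "l a b \<le> c" "c \<le> - l b a" using ab 3 by (auto simp: shift_at_def)
      have ff: "f a (x(Some w := t)) = f b (x(Some w := t))" for t
        using ab 3 lc by (intro affD[OF fa(1), of a b c]) auto
      define D where "D y = G a y - G b y" for y
      have Dp: "D \<in> polyfun" unfolding D_def by (intro polyfun_diff G(1))
      have "D (x(Some w := t)) = D (x(Some w := t - x None))" for t
        using G(2)[of a "x(Some w := t)"] G(2)[of b "x(Some w := t)"] ff[of t] by (simp add: D_def)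
      then have Dc: "D (x(Some w := t)) = D (x(Some w := s))" for t s
        by (rule polyfun_periodic[OF Dp z])
      have xa: "x (Some a) = x (Some b) + of_int c * x None" using ab(4) by simp
      have Dx: "D x = D (x(Some w := t))" for t using Dc[of "x (Some w)" t] by simp
      \<comment> \<open>Of the two normalisation points, the one further up is still in the range
        where the antidifference of the other vertex is known to be constant; the upper end of this
        range is where \<open>tri\<close> enters.\<close>
      have "G b (x(Some w := ?s b x)) = G b (x(Some w := ?s a x))"
      proof (cases "l w b \<le> c + l w a")
        case True
        have "?s a x = x (Some b) + of_int (c + l w a - 1) * x None" using xa by (simp add: algebra_simps)
        moreover have "c + l w a - 1 \<le> - l b w" using tri[of b a] 3 ab(1) lc by auto
        ultimately show ?thesis using zero[of b "l w b - 1" "c + l w a - 1" x] 3 True by simp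
      next
        case False
        have "?s b x = x (Some a) + of_int (l w b - 1 - c) * x None" using xa by (simp add: algebra_simps)
        moreover have "l w b - 1 - c \<le> - l a w" using tri[of a b] 3 ab(1) lc by auto
        ultimately have "G a (x(Some w := ?s b x)) = G a (x(Some w := ?s a x))"
          using zero[of a "l w a - 1" "l w b - 1 - c" x] 3 False by simp
        then show ?thesis using Dc[of "?s a x" "?s b x"] by (simp add: D_def)
      qed
      then have "g a x - g b x = 0" using 3 Dx[of "?s a x"] by (simp add: g_def D_def)
      then show ?thesis by simp
    qed
  qed
  \<comment> \<open>\<open>main\<close> needs \<open>z \<noteq> 0\<close>. Multiplication by
    \<open>z\<close> makes the remaining points trivial, and saturation removes the factor
    again.\<close>
  have "(\<lambda>x. x None) \<odot> g \<in> affg w (shift_at w l)"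
  proof -
    have "x None * g a x = x None * g b x" if "a \<noteq> b" "shift_at w l a b \<le> c" "c \<le> - shift_at w l b a"
      "x (Some a) - x (Some b) = of_int c * x None" for a b c x
      using main[OF that] by (cases "x None = 0") auto
    moreover have "((\<lambda>x. x None) \<odot> g) a \<in> polyfun" for a by (intro polyfun_vsmul polyfun.coord gp)
    ultimately show ?thesis by (auto simp: affg_def aff_def fun_eq_iff g_def)
  qed
  then have gN: "g \<in> affg w (shift_at w l)" by (rule affg_saturated[OF gp])
  have "nabv w g a = f a" for a
    unfolding nabv_def
  proof (rule nab_unique[OF gp fp])
    fix x
    have "x(Some w := x (Some w) - x None, Some w := ?s a x) = x(Some w := ?s a x)" by simp
    then show "x None * f a x = g a x - g a (x(Some w := x (Some w) - x None))"
      using G(2)[of a x] fa(2)[of x] by (auto simp: g_def)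
  qed
  then have "nabv w g = f" by (intro ext) simp
  with gN show ?thesis by blast
qed

theorem gens_le_shift_aff:
  fixes w :: "'a::finite"
  assumes "gens_le (CARD('a) - 1) (affg w l)"
    and "\<And>a. a \<noteq> w \<Longrightarrow> l w a + l a w \<le> 1"
    and "\<And>a b. a \<noteq> w \<Longrightarrow> b \<noteq> w \<Longrightarrow> a \<noteq> b \<Longrightarrow> l a w + l w b \<le> l a b + 1"
  shows "gens_le (CARD('a) - 1) (affg w (shift_at w l))"
proof (rule gens_le_hom_imp_gens_le[OF graded_module_affg full_rank_affg])
  let ?N = "affg w (shift_at w l)" and ?M = "affg w l"
  obtain f d where B: "hbasis (CARD('a) - 1) ?M f d"
    using ex_hbasis[OF graded_module_affg full_rank_affg gens_le_hom_if_gens_le[OF assms(1)]] by blast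
  have gp: "g a \<in> polyfun" if "g \<in> ?N" for g a using gm_polyfun[OF graded_module_affg that] .
  show "gens_le_hom (CARD('a) - 1) ?N"
  proof (rule shift_lemma[OF graded_module_affg graded_module_affg _ B, where T = "nabv w" and y = "Some w"])
    show "?N \<subseteq> ?M"
    proof
      fix g assume g: "g \<in> ?N"
      then have ga: "g \<in> aff (shift_at w l)" "g w = 0" by (auto simp: affg_def)
      have "g a x = g b x" if "a \<noteq> b" "l a b \<le> c" "c \<le> - l b a" "x (Some a) - x (Some b) = of_int c * x None" for a b c x
        using that by (intro affD[OF ga(1), of a b c]) (auto simp: shift_at_def)
      then show "g \<in> ?M" using ga gp[OF g] by (auto simp: affg_def aff_def)
    qed
    fix g assume g: "g \<in> ?N"
    note p = gp[OF g]
    show "nabv w g \<in> ?M" by (rule nabv_mem[OF g])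
    show "g = 0" if "nabv w g = 0" using nabv_inj[OF g assms(2) that] .
    show "nabv w (g + h) = nabv w g + nabv w h" if h: "h \<in> ?N" for h
    proof (rule ext)
      fix a
      have "nab (Some w) (g a + h a) = nab (Some w) (g a) + nab (Some w) (h a)"
        using nab[OF p[of a]] nab[OF gp[OF h, of a]]
        by (intro nab_unique polyfun_apply_add p gp[OF h]) (auto simp: distrib_left)
      then show "nabv w (g + h) a = (nabv w g + nabv w h) a" by (simp add: nabv_def)
    qed
    show "nabv w ((\<lambda>_. c) \<odot> g) = (\<lambda>_. c) \<odot> nabv w g" for c
    proof (rule ext)
      fix a
      have "nab (Some w) (((\<lambda>_. c) \<odot> g) a) = ((\<lambda>_. c) \<odot> nabv w g) a"
        using nab[OF p[of a]]
        by (intro nab_unique polyfun_vsmul polyfun.const p) (auto simp: nabv_def right_diff_distrib[symmetric] mult.left_commute)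
      then show "nabv w ((\<lambda>_. c) \<odot> g) a = ((\<lambda>_. c) \<odot> nabv w g) a" by (simp add: nabv_def)
    qed
    show "nabv w ((\<lambda>x. x i) \<odot> g) = (\<lambda>x. x i) \<odot> nabv w g" if "i \<noteq> Some w" for i
    proof (rule ext)
      fix a
      have "nab (Some w) (((\<lambda>x. x i) \<odot> g) a) = ((\<lambda>x. x i) \<odot> nabv w g) a"
        using nab[OF p[of a]] that
        by (intro nab_unique polyfun_vsmul polyfun.coord p) (auto simp: nabv_def right_diff_distrib[symmetric] mult.left_commute)
      then show "nabv w ((\<lambda>x. x i) \<odot> g) a = ((\<lambda>x. x i) \<odot> nabv w g) a" by (simp add: nabv_def)
    qed
    \<comment> \<open>The commutator with multiplication by \<open>x_w\<close> is
      \<open>g - z nabv w g\<close>; it is the identity modulo the other coordinates because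
      \<open>z\<close> is one of them.\<close>
    have "nabv w ((\<lambda>x. x (Some w)) \<odot> g) = (\<lambda>x. x (Some w)) \<odot> nabv w g + g - (\<lambda>x. x None) \<odot> nabv w g"
    proof (rule ext)
      fix a
      have "x None * (x (Some w) * nab (Some w) (g a) x + g a x - x None * nab (Some w) (g a) x) =
          x (Some w) * g a x - (x (Some w) - x None) * g a (x(Some w := x (Some w) - x None))" for x
      proof -
        have e: "g a (x(Some w := x (Some w) - x None)) = g a x - x None * nab (Some w) (g a) x"
          using nab(2)[OF p[of a], of x "Some w"] by simp
        show ?thesis unfolding e by (simp add: algebra_simps)
      qed
      moreover have "((\<lambda>x. x (Some w)) \<odot> nabv w g + g - (\<lambda>x. x None) \<odot> nabv w g) a =
          (\<lambda>x. x (Some w) * nab (Some w) (g a) x + g a x - x None * nab (Some w) (g a) x)"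
        by (simp add: fun_eq_iff nabv_def)
      moreover have "(\<lambda>x. x (Some w) * nab (Some w) (g a) x + g a x - x None * nab (Some w) (g a) x) \<in> polyfun"
        using nab(1)[OF p] p by (intro polyfun_diff polyfun.add polyfun.mult polyfun.coord)
      ultimately have "nab (Some w) (((\<lambda>x. x (Some w)) \<odot> g) a) =
          ((\<lambda>x. x (Some w)) \<odot> nabv w g + g - (\<lambda>x. x None) \<odot> nabv w g) a"
        by (intro nab_unique polyfun_vsmul polyfun.coord p) simp_all
      then show "nabv w ((\<lambda>x. x (Some w)) \<odot> g) a =
          ((\<lambda>x. x (Some w)) \<odot> nabv w g + g - (\<lambda>x. x None) \<odot> nabv w g) a" by (simp add: nabv_def)
    qed
    then have "nabv w ((\<lambda>x. x (Some w)) \<odot> g) - (\<lambda>x. x (Some w)) \<odot> nabv w g - g =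
        (\<lambda>x. x None) \<odot> ((\<lambda>_. -1) \<odot> nabv w g)"
      by (simp add: fun_eq_iff)
    also have "\<dots> \<in> coordideal (- {Some w}) ?M"
      by (intro coordideal_coordmul[OF graded_module_affg] gm_cmul[OF graded_module_affg] nabv_mem[OF g]) auto
    finally show "nabv w ((\<lambda>x. x (Some w)) \<odot> g) - (\<lambda>x. x (Some w)) \<odot> nabv w g - g \<in> coordideal (- {Some w}) ?M" .
    show "homv e (nabv w g)" if "homv (Suc e) g" for e
      using that by (simp add: homv_def nabv_def hom_nab)
  next
    show "\<exists>g\<in>?N. nabv w g = h" if "h \<in> ?M" for h using nabv_surj[OF that assms(3)] .
  qed
qed

declare fun_upd_apply [simp del] fun_upd_same [simp] fun_upd_other [simp]

section \<open>Shifting the multiarrangement\<close>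

definition pd :: "'w \<Rightarrow> (('w \<Rightarrow> real) \<Rightarrow> real) \<Rightarrow> ('w \<Rightarrow> real) \<Rightarrow> real" where
  "pd i p x = poly (pderiv (slice i p x)) (x i)"

lemma slice_eqI:
  assumes "\<And>t. poly P t = p (x(i := t))"
  shows "slice i p x = P"
  unfolding slice_def
proof (rule along_eqI)
  fix t
  have "(\<lambda>j. (if j = i then 0 else x j) + t * (if j = i then 1 else 0)) = x(i := t)" by (auto simp: fun_upd_apply)
  then show "poly P t = p (\<lambda>j. (if j = i then 0 else x j) + t * (if j = i then 1 else 0))"
    using assms by simp
qed

lemma pd_eqI:
  assumes "\<And>t. poly P t = p (x(i := t))"
  shows "pd i p x = poly (pderiv P) (x i)"
  by (simp add: pd_def slice_eqI[OF assms])

lemma pd_indep: "(\<And>x t. p (x(i := t)) = p x) \<Longrightarrow> pd i p x = 0"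
  using pd_eqI[of "[:p x:]" p x i] by (simp add: pderiv_pCons)

lemma pd_const [simp]: "pd i (\<lambda>x. c) x = 0"
  by (rule pd_indep) simp

lemma pd_coord [simp]: "pd i (\<lambda>x. x j) x = (if j = i then 1 else 0)"
  using pd_eqI[of "[:0, 1:]" "\<lambda>x. x j" x i] pd_indep[of "\<lambda>x. x j" i x]
  by (cases "j = i") (auto simp: pderiv_pCons)

lemma pd_add: "p \<in> polyfun \<Longrightarrow> q \<in> polyfun \<Longrightarrow> pd i (\<lambda>x. p x + q x) x = pd i p x + pd i q x"
  using pd_eqI[of "slice i p x + slice i q x" "\<lambda>x. p x + q x" x i]
  by (simp add: poly_slice pderiv_add pd_def)

lemma pd_mult:
  "p \<in> polyfun \<Longrightarrow> q \<in> polyfun \<Longrightarrow> pd i (\<lambda>x. p x * q x) x = pd i p x * q x + p x * pd i q x"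
  using pd_eqI[of "slice i p x * slice i q x" "\<lambda>x. p x * q x" x i]
  by (simp add: poly_slice pderiv_mult pd_def)

lemma pd_cmult: "p \<in> polyfun \<Longrightarrow> pd i (\<lambda>x. c * p x) x = c * pd i p x"
  using pd_mult[OF polyfun.const[of c], of p i x] by simp

lemma pd_mult_indep:
  "p \<in> polyfun \<Longrightarrow> q \<in> polyfun \<Longrightarrow> (\<And>x t. p (x(i := t)) = p x) \<Longrightarrow>
    pd i (\<lambda>x. p x * q x) x = p x * pd i q x"
  using pd_mult[of p q i x] pd_indep[of p i x] by simp

lemma pd_diff: "p \<in> polyfun \<Longrightarrow> q \<in> polyfun \<Longrightarrow> pd i (\<lambda>x. p x - q x) x = pd i p x - pd i q x"
  using pd_add[OF _ polyfun_uminus, of p q i x] pd_cmult[of q i "-1" x] by simp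

lemma pd_sum:
  assumes "finite I" "\<And>k. k \<in> I \<Longrightarrow> p k \<in> polyfun"
  shows "pd i (\<lambda>x. \<Sum>k\<in>I. p k x) x = (\<Sum>k\<in>I. pd i (p k) x)"
  using assms
proof (induction I rule: finite_induct)
  case (insert k I)
  have "pd i (\<lambda>x. p k x + (\<Sum>k\<in>I. p k x)) x = pd i (p k) x + pd i (\<lambda>x. \<Sum>k\<in>I. p k x) x"
    using insert by (intro pd_add polyfun_sum) auto
  then show ?case using insert by simp
qed simp

lemma polyfun_pd: "p \<in> polyfun \<Longrightarrow> pd i p \<in> polyfun"
proof (induction rule: polyfun.induct)
  case (const c)
  have "pd i (\<lambda>x. c) = (\<lambda>x. 0)" by (rule ext) simp
  then show ?case by (simp add: polyfun.const)
next
  case (coord j)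
  have "pd i (\<lambda>x. x j) = (\<lambda>x. if j = i then 1 else 0)" by (rule ext) simp
  then show ?case by (simp add: polyfun.const)
next
  case (add p q)
  have "pd i (\<lambda>x. p x + q x) = (\<lambda>x. pd i p x + pd i q x)" using add by (intro ext pd_add)
  then show ?case using add by (simp add: polyfun.add)
next
  case (mult p q)
  have "pd i (\<lambda>x. p x * q x) = (\<lambda>x. pd i p x * q x + p x * pd i q x)" using mult by (intro ext pd_mult)
  then show ?case using mult by (simp add: polyfun.add polyfun.mult)
qed

lemma pd_power:
  assumes "p \<in> polyfun"
  shows "pd i (\<lambda>x. p x ^ Suc n) x = real (Suc n) * p x ^ n * pd i p x"
proof (induction n)
  case (Suc n)
  have "pd i (\<lambda>x. p x * p x ^ Suc n) x = pd i p x * p x ^ Suc n + p x * pd i (\<lambda>x. p x ^ Suc n) x"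
    by (intro pd_mult assms polyfun_power)
  then show ?case unfolding Suc by (simp add: algebra_simps)
qed simp

lemma pd_commute: "p \<in> polyfun \<Longrightarrow> pd i (pd j p) x = pd j (pd i p) x"
proof (induction arbitrary: x rule: polyfun.induct)
  case (const c)
  have "pd k (\<lambda>x. c) = (\<lambda>x. 0)" for k by (rule ext) simp
  then show ?case by simp
next
  case (coord k)
  have "pd i (\<lambda>x. x k) = (\<lambda>x. if k = i then 1 else 0)" for i by (rule ext) simp
  then show ?case by simp
next
  case (add p q)
  have "pd i (\<lambda>x. p x + q x) = (\<lambda>x. pd i p x + pd i q x)" for i using add by (intro ext pd_add)
  then show ?case using add by (simp add: pd_add polyfun_pd)
next
  case (mult p q)
  have "pd i (\<lambda>x. p x * q x) = (\<lambda>x. pd i p x * q x + p x * pd i q x)" for i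
    using mult by (intro ext pd_mult)
  then show ?case using mult by (simp add: pd_add pd_mult polyfun_pd polyfun.mult)
qed

lemma polyfun_upd_coord: "p \<in> polyfun \<Longrightarrow> (\<lambda>x. p (x(w := x a))) \<in> polyfun"
  by (rule polyfun_compose_upd[OF _ polyfun.coord])

lemma pd_chain:
  assumes "p \<in> polyfun" "a \<noteq> w"
  shows "pd a (\<lambda>x. p (x(w := x a))) x = pd w p (x(w := x a)) + pd a p (x(w := x a))"
  using assms(1)
proof (induction rule: polyfun.induct)
  case (coord j)
  have "(\<lambda>x. (x(w := x a)) j) = (\<lambda>x. x (if j = w then a else j))" by (auto simp: fun_upd_apply)
  then show ?case using assms(2) by (simp only: pd_coord) auto
next
  case (add p q)
  have "pd a (\<lambda>x. p (x(w := x a)) + q (x(w := x a))) x =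
      pd a (\<lambda>x. p (x(w := x a))) x + pd a (\<lambda>x. q (x(w := x a))) x"
    using add by (intro pd_add polyfun_upd_coord)
  then show ?case using add by (simp add: pd_add)
next
  case (mult p q)
  have "pd a (\<lambda>x. p (x(w := x a)) * q (x(w := x a))) x =
      pd a (\<lambda>x. p (x(w := x a))) x * q (x(w := x a)) + p (x(w := x a)) * pd a (\<lambda>x. q (x(w := x a))) x"
    using mult by (intro pd_mult polyfun_upd_coord)
  then show ?case using mult by (simp add: pd_mult algebra_simps)
qed simp

lemma pd_zero_indep:
  assumes "p \<in> polyfun" "\<And>x. pd i p x = 0"
  shows "p (x(i := t)) = p x"
proof -
  have "poly (pderiv (slice i p x)) t = 0" for t
    using assms(2)[of "x(i := t)"] by (simp add: pd_def slice_upd[OF assms(1)])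
  then have "pderiv (slice i p x) = 0" using poly_all_0_iff_0[of "pderiv (slice i p x)"] by simp
  then obtain h where "slice i p x = [:h:]" using pderiv_iszero by blast
  then have "p (x(i := t)) = h" for t using poly_slice[OF assms(1), of i x t] by simp
  from this[of t] this[of "x i"] show ?thesis by simp
qed

lemma hom_pd:
  assumes "hom (Suc e) p"
  shows "hom e (pd i p)"
proof (rule hom_cancel[of 1 e "\<lambda>x. x i" "pd i p" "\<lambda>_. 1"])
  have p: "p \<in> polyfun" by (rule hom_polyfun[OF assms])
  have h: "t * pd i p (\<lambda>j. t * x j) = t ^ Suc e * pd i p x" for t x
  proof -
    let ?P = "slice i p (\<lambda>j. t * x j)"
    have "pcompose ?P [:0, t:] = smult (t ^ Suc e) (slice i p x)"
    proof (rule poly_eq_poly_eq_iff[THEN iffD1], rule ext)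
      fix s
      have "(\<lambda>j. t * x j)(i := t * s) = (\<lambda>j. t * (x(i := s)) j)" by (auto simp: fun_upd_apply)
      then show "poly (pcompose ?P [:0, t:]) s = poly (smult (t ^ Suc e) (slice i p x)) s"
        using assms unfolding hom_def by (simp add: poly_pcompose poly_slice[OF p] mult.commute)
    qed
    then have "poly (pderiv (pcompose ?P [:0, t:])) (x i) = poly (pderiv (smult (t ^ Suc e) (slice i p x))) (x i)"
      by simp
    then show ?thesis
      by (simp add: pderiv_pcompose poly_pcompose pderiv_pCons pderiv_smult pd_def mult.commute)
  qed
  have "(t * x i) * pd i p (\<lambda>j. t * x j) = t ^ (1 + e) * (x i * pd i p x)" for t x
  proof -
    have "(t * x i) * pd i p (\<lambda>j. t * x j) = x i * (t * pd i p (\<lambda>j. t * x j))" by (simp only: mult_ac)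
    also have "\<dots> = t ^ (1 + e) * (x i * pd i p x)" unfolding h by (simp only: mult_ac plus_1_eq_Suc)
    finally show ?thesis .
  qed
  then show "hom (1 + e) (\<lambda>x. x i * pd i p x)"
    unfolding hom_def by (intro conjI allI polyfun.mult polyfun.coord polyfun_pd p)
qed (auto simp: hom_coord[simplified] polyfun_pd hom_polyfun[OF assms])

text \<open>Expand \<open>h\<close> in powers of \<open>x w - x a\<close> and integrate termwise;
  each term gains one order of vanishing.\<close>

lemma antiderivative:
  assumes "h \<in> polyfun" "a \<noteq> w"
  shows "\<exists>k\<in>polyfun. \<forall>x. pd w (\<lambda>x. (x w - x a) ^ Suc n * k x) x = (x w - x a) ^ n * h x"
proof -
  obtain K r where r: "\<And>k. r k \<in> polyfun" "\<And>k x t. r k (x(w := t)) = r k x"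
      "\<And>x. h x = (\<Sum>k\<le>(K::nat). r k x * (x w - x a) ^ k)"
    by (rule polyfun_expansion[OF assms(1) polyfun.coord[of a], of w]) (use assms(2) in auto)
  define k where "k x = (\<Sum>k\<le>K. r k x * (x w - x a) ^ k / real (Suc (n + k)))" for x
  have kp: "k \<in> polyfun" unfolding k_def using r(1) by (intro polyfun_intros)
  have up: "(\<lambda>x. x w - x a) \<in> polyfun" by (intro polyfun_intros)
  have t: "pd w (\<lambda>x. r k x * (inverse (real (Suc (n + k))) * (x w - x a) ^ Suc (n + k))) x =
      r k x * (x w - x a) ^ (n + k)" for k x
  proof -
    have "pd w (\<lambda>x. r k x * (inverse (real (Suc (n + k))) * (x w - x a) ^ Suc (n + k))) x =
        r k x * (inverse (real (Suc (n + k))) * pd w (\<lambda>x. (x w - x a) ^ Suc (n + k)) x)"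
      using pd_mult_indep[OF r(1)[of k], of "\<lambda>x. inverse (real (Suc (n + k))) * (x w - x a) ^ Suc (n + k)" w x]
        r(2) pd_cmult[OF polyfun_power[OF up], of w _ "Suc (n + k)" x]
      by (simp add: polyfun_intros del: power_Suc of_nat_Suc)
    moreover have "pd w (\<lambda>x. x w - x a) x = 1" for x
      using pd_diff[OF polyfun.coord[of w] polyfun.coord[of a], of w x] assms(2) by simp
    ultimately show ?thesis
      by (simp add: pd_power[OF up] del: power_Suc of_nat_Suc)
  qed
  have "pd w (\<lambda>x. (x w - x a) ^ Suc n * k x) x = (x w - x a) ^ n * h x" for x
  proof -
    have "(\<lambda>x. (x w - x a) ^ Suc n * k x) =
        (\<lambda>x. \<Sum>k\<le>K. r k x * (inverse (real (Suc (n + k))) * (x w - x a) ^ Suc (n + k)))"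
      unfolding k_def sum_distrib_left
      by (intro ext sum.cong refl) (simp add: power_add divide_inverse mult_ac)
    then have "pd w (\<lambda>x. (x w - x a) ^ Suc n * k x) x = (\<Sum>k\<le>K. r k x * (x w - x a) ^ (n + k))"
      using pd_sum[of "{..K}" "\<lambda>k x. r k x * (inverse (real (Suc (n + k))) * (x w - x a) ^ Suc (n + k))" w x]
        r(1) up by (simp add: t polyfun_intros del: power_Suc of_nat_Suc)
    also have "\<dots> = (x w - x a) ^ n * h x"
      unfolding r(3) sum_distrib_left by (intro sum.cong refl) (simp add: power_add mult_ac)
    finally show ?thesis .
  qed
  with kp show ?thesis by blast
qed

text \<open>Integration raises the order of vanishing by one as soon as the constant of integration
  is zero, which the last hypothesis ensures.\<close>

lemma divisible_if_pd_divisible: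
  assumes "e \<in> polyfun" "a \<noteq> b" "k \<in> polyfun" "\<And>x. pd a e x = (x a - x b) ^ n * k x"
    "\<And>x. e (x(a := x b)) = 0"
  shows "\<exists>k'\<in>polyfun. \<forall>x. e x = (x a - x b) ^ Suc n * k' x"
proof -
  obtain k' where k': "k' \<in> polyfun"
      "\<forall>x. pd a (\<lambda>x. (x a - x b) ^ Suc n * k' x) x = (x a - x b) ^ n * k x"
    using antiderivative[OF assms(3), of b a n] assms(2) by blast
  define D where "D x = e x - (x a - x b) ^ Suc n * k' x" for x
  have qp: "(\<lambda>x. (x a - x b) ^ Suc n * k' x) \<in> polyfun" by (intro polyfun_intros k')
  have Dp: "D \<in> polyfun" unfolding D_def by (intro polyfun_diff assms(1) qp)
  have "pd a D x = 0" for x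
    unfolding D_def using pd_diff[OF assms(1) qp, of a x] k'(2) assms(4) by simp
  then have "D (x(a := x b)) = D x" for x by (rule pd_zero_indep[OF Dp])
  moreover have "D (x(a := x b)) = 0" for x using assms(2,5) by (simp add: D_def)
  ultimately have "\<forall>x. e x = (x a - x b) ^ Suc n * k' x" by (simp add: D_def)
  with k'(1) show ?thesis by blast
qed

lemma pd_divisible:
  assumes "h \<in> polyfun" "\<And>x. p x = (x a - x b) ^ Suc n * h x"
  shows "\<exists>k\<in>polyfun. \<forall>x. pd i p x = (x a - x b) ^ n * k x"
proof -
  have up: "(\<lambda>x. x a - x b) \<in> polyfun" by (intro polyfun_intros)
  let ?k = "\<lambda>x. real (Suc n) * pd i (\<lambda>x. x a - x b) x * h x + (x a - x b) * pd i h x"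
  have "p = (\<lambda>x. (x a - x b) ^ Suc n * h x)" using assms(2) by (rule ext)
  then have "pd i p x = (x a - x b) ^ n * ?k x" for x
    using pd_mult[OF polyfun_power[OF up, of "Suc n"] assms(1), of i x] pd_power[OF up, of i n x]
    by (simp add: algebra_simps)
  moreover have "?k \<in> polyfun"
    by (intro polyfun.add polyfun.mult polyfun.const up polyfun_pd assms(1))
  ultimately show ?thesis by (intro bexI[of _ ?k] allI)
qed

text \<open>\<open>gb (x(w := x a))\<close> is the integral of \<open>fb\<close> in
  \<open>x w\<close> from \<open>x b\<close> to \<open>x a\<close>. If \<open>fa = fb\<close>, the
  integrand vanishes to orders \<alpha> and \<beta> at the two ends and the integral to order
  \<alpha> + \<beta> + 1; in general both agree modulo the power \<open>M\<close>. Differentiating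
  everything in \<open>x a\<close> lowers \<alpha> and \<open>M\<close> by one and preserves the
  shape of the hypotheses, so induction on \<alpha> applies.\<close>

lemma pair_divisible:
  assumes "a \<noteq> w" "b \<noteq> w" "a \<noteq> b"
    and "fa \<in> polyfun" "fb \<in> polyfun" "ha \<in> polyfun" "hb \<in> polyfun" "H \<in> polyfun" "gb \<in> polyfun" "kb \<in> polyfun"
    and "\<And>x. fa x = (x w - x a) ^ \<alpha> * ha x" "\<And>x. fb x = (x w - x b) ^ \<beta> * hb x"
    and "\<And>x. fa x - fb x = (x a - x b) ^ M * H x"
    and "\<And>x. pd w gb x = fb x" "\<And>x. gb x = (x w - x b) ^ Suc \<beta> * kb x" "M \<le> \<alpha> + \<beta> + 1"
  shows "\<exists>k\<in>polyfun. \<forall>x. gb (x(w := x a)) = (x a - x b) ^ M * k x"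
  using assms(4-)
proof (induction \<alpha> arbitrary: M fa fb ha hb H gb kb)
  case 0
  \<comment> \<open>With \<alpha> = 0 the exponent is at most \<beta> + 1, the order to which
    \<open>gb\<close> itself vanishes on \<open>x w = x b\<close>.\<close>
  have "gb (x(w := x a)) = (x a - x b) ^ M * ((x a - x b) ^ (Suc \<beta> - M) * kb (x(w := x a)))" for x
  proof -
    have "gb (x(w := x a)) = (x a - x b) ^ Suc \<beta> * kb (x(w := x a))"
      using 0(12)[of "x(w := x a)"] assms(2) by simp
    also have "Suc \<beta> = M + (Suc \<beta> - M)" using 0(13) by simp
    finally show ?thesis by (simp add: power_add mult.assoc)
  qed
  moreover have "(\<lambda>x. (x a - x b) ^ (Suc \<beta> - M) * kb (x(w := x a))) \<in> polyfun"
    by (intro polyfun.mult polyfun_power polyfun_diff polyfun.coord polyfun_upd_coord 0)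
  ultimately show ?case by (intro bexI[of _ "\<lambda>x. (x a - x b) ^ (Suc \<beta> - M) * kb (x(w := x a))"] allI)
next
  case (Suc \<alpha>)
  note fp = Suc.prems(1-7) and fa = Suc.prems(8) and fb = Suc.prems(9) and fab = Suc.prems(10)
    and pg = Suc.prems(11) and gb = Suc.prems(12) and M = Suc.prems(13)
  show ?case
  proof (cases M)
    case 0
    have "(\<lambda>x. gb (x(w := x a))) \<in> polyfun" by (rule polyfun_upd_coord[OF fp(6)])
    then show ?thesis using 0 by (intro bexI[of _ "\<lambda>x. gb (x(w := x a))"]) auto
  next
    case M': (Suc M')
    have ub: "(\<lambda>x. (x w - x b) ^ n) \<in> polyfun" for n by (intro polyfun_intros)
    obtain ha' where ha': "ha' \<in> polyfun" "\<forall>x. pd a fa x = (x w - x a) ^ \<alpha> * ha' x"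
      using pd_divisible[OF fp(3) fa] by blast
    obtain H' where H': "H' \<in> polyfun" "\<forall>x. pd a (\<lambda>x. fa x - fb x) x = (x a - x b) ^ M' * H' x"
      using pd_divisible[OF fp(5) fab[unfolded M']] by blast
    have fb_eq: "fb = (\<lambda>x. (x w - x b) ^ \<beta> * hb x)" using fb by (rule ext)
    have gb_eq: "gb = (\<lambda>x. (x w - x b) ^ Suc \<beta> * kb x)" using gb by (rule ext)
    have pfb: "pd a fb x = (x w - x b) ^ \<beta> * pd a hb x" for x
      unfolding fb_eq by (rule pd_mult_indep[OF ub fp(4)]) (use assms in auto)
    have pgb: "pd a gb x = (x w - x b) ^ Suc \<beta> * pd a kb x" for x
      unfolding gb_eq by (rule pd_mult_indep[OF ub fp(7)]) (use assms in \<open>auto simp del: power_Suc\<close>)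
    have pg_eq: "pd w gb = fb" using pg by (rule ext)
    have "\<exists>k\<in>polyfun. \<forall>x. pd a gb (x(w := x a)) = (x a - x b) ^ M' * k x"
    proof (rule Suc.IH[OF polyfun_pd[OF fp(1), of a] polyfun_pd[OF fp(2), of a] ha'(1) polyfun_pd[OF fp(4), of a]
          H'(1) polyfun_pd[OF fp(6), of a] polyfun_pd[OF fp(7), of a] ha'(2)[rule_format] pfb _ _ pgb])
      show "pd a fa x - pd a fb x = (x a - x b) ^ M' * H' x" for x
        using H'(2) pd_diff[OF fp(1,2), of a x] by simp
      show "pd w (pd a gb) x = pd a fb x" for x
        using pd_commute[OF fp(6), of w a x] pg_eq by simp
      show "M' \<le> \<alpha> + \<beta> + 1" using M M' by simp
    qed
    then obtain k where k: "k \<in> polyfun" "\<forall>x. pd a gb (x(w := x a)) = (x a - x b) ^ M' * k x" by blast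
    have "\<exists>k'\<in>polyfun. \<forall>x. (\<lambda>x. gb (x(w := x a))) x = (x a - x b) ^ Suc M' * k' x"
    proof (rule divisible_if_pd_divisible[OF polyfun_upd_coord[OF fp(6)] assms(3),
          where k = "\<lambda>x. k x - (x a - x b) * H (x(w := x a))"])
      show "(\<lambda>x. k x - (x a - x b) * H (x(w := x a))) \<in> polyfun"
        by (intro polyfun_diff polyfun.mult polyfun.coord polyfun_upd_coord k(1) fp(5))
      fix x
      \<comment> \<open>The boundary term of the differentiated integral: \<open>fa\<close> has
        positive order on \<open>x w = x a\<close> and vanishes there, which leaves only the error
        of \<open>fa - fb\<close>.\<close>
      have "fb (x(w := x a)) = - ((x a - x b) ^ Suc M' * H (x(w := x a)))"
        using fab[of "x(w := x a)"] fa[of "x(w := x a)"] assms M' by simp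
      then show "pd a (\<lambda>x. gb (x(w := x a))) x = (x a - x b) ^ M' * (k x - (x a - x b) * H (x(w := x a)))"
        using pd_chain[OF fp(6) assms(1), of x] pg k(2) by (simp add: algebra_simps)
      show "gb ((x(a := x b))(w := (x(a := x b)) a)) = 0"
        using gb assms by simp
    qed
    then show ?thesis using M' by simp
  qed
qed

section \<open>The partial derivative as a bijection between modules of multiarrangements\<close>

definition raise :: "'a \<Rightarrow> ('a \<Rightarrow> 'a \<Rightarrow> nat) \<Rightarrow> 'a \<Rightarrow> 'a \<Rightarrow> nat" where
  "raise w m a b = (if a = w \<or> b = w then Suc (m a b) else m a b)"

definition pdv :: "'a \<Rightarrow> ('a \<Rightarrow> ('a \<Rightarrow> real) \<Rightarrow> real) \<Rightarrow> 'a \<Rightarrow> ('a \<Rightarrow> real) \<Rightarrow> real" where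
  "pdv w g a = pd w (g a)"

lemma mulgD:
  assumes "f \<in> mulg w m"
  shows "f a \<in> polyfun" "f w x = 0"
    "a \<noteq> b \<Longrightarrow> \<exists>h\<in>polyfun. \<forall>x. f a x - f b x = (x a - x b) ^ m a b * h x"
  using assms by (auto simp: mulg_def mul_def)

lemma mulgI:
  assumes "\<And>a. f a \<in> polyfun" "\<And>x. f w x = 0"
    "\<And>a b. a \<noteq> b \<Longrightarrow> \<exists>h\<in>polyfun. \<forall>x. f a x - f b x = (x a - x b) ^ m a b * h x"
  shows "f \<in> mulg w m"
  using assms by (auto simp: mulg_def mul_def fun_eq_iff)

lemma pdv_mem:
  assumes g: "g \<in> mulg w (raise w m)"
  shows "pdv w g \<in> mulg w m"
proof (rule mulgI)
  note gD = mulgD[OF g]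
  show "pdv w g a \<in> polyfun" for a by (simp add: pdv_def polyfun_pd gD)
  have "g w = (\<lambda>x. 0)" using gD(2) by (rule ext)
  then show "pdv w g w x = 0" for x by (simp add: pdv_def)
  fix a b :: 'a assume "a \<noteq> b"
  obtain h where h: "h \<in> polyfun" "\<forall>x. g a x - g b x = (x a - x b) ^ raise w m a b * h x"
    using gD(3)[OF \<open>a \<noteq> b\<close>] by blast
  have e: "pdv w g a x - pdv w g b x = pd w (\<lambda>x. g a x - g b x) x" for x
    by (simp add: pdv_def pd_diff gD(1))
  show "\<exists>h\<in>polyfun. \<forall>x. pdv w g a x - pdv w g b x = (x a - x b) ^ m a b * h x"
  proof (cases "a = w \<or> b = w")
    case True
    then show ?thesis unfolding e using pd_divisible[OF h(1), of "\<lambda>x. g a x - g b x" a b "m a b" w] h(2)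
      by (auto simp: raise_def)
  next
    case False
    have "(\<lambda>x. g a x - g b x) = (\<lambda>x. (x a - x b) ^ m a b * h x)"
      using h(2) False by (auto simp: raise_def)
    moreover have "pd w (\<lambda>x. (x a - x b) ^ m a b * h x) x = (x a - x b) ^ m a b * pd w h x" for x
      by (rule pd_mult_indep) (use False h(1) in \<open>auto intro!: polyfun_intros\<close>)
    ultimately have "\<forall>x. pd w (\<lambda>x. g a x - g b x) x = (x a - x b) ^ m a b * pd w h x" by simp
    then show ?thesis unfolding e using polyfun_pd[OF h(1)] by blast
  qed
qed

lemma pdv_inj:
  assumes g: "g \<in> mulg w (raise w m)" and "pdv w g = 0"
  shows "g = 0"
proof (intro ext)
  fix a x
  note gD = mulgD[OF g]
  show "g a x = 0 a x"
  proof (cases "a = w")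
    case False
    have "pd w (g a) x = 0" for x using fun_cong[OF fun_cong[OF assms(2), of a], of x] by (simp add: pdv_def)
    then have "g a (x(w := x a)) = g a x" by (rule pd_zero_indep[OF gD(1)])
    moreover obtain h where h: "\<forall>x. g a x - g w x = (x a - x w) ^ raise w m a w * h x"
      using gD(3)[OF False] by blast
    have "g a (x(w := x a)) = 0"
      using h[rule_format, of "x(w := x a)"] gD(2)[of "x(w := x a)"] False by (simp add: raise_def)
    ultimately show ?thesis by simp
  qed (simp add: gD)
qed

text \<open>\<open>g a\<close> is the integral of \<open>f a\<close> from \<open>x_a\<close> to
  \<open>x_w\<close>, which raises the order on \<open>x w = x a\<close> by one. For a pair off
  \<open>w\<close> the order along \<open>x a = x b\<close> has to survive the integration; this is
  \<open>pair_divisible\<close>, and \<open>range\<close> is its bound on the exponent.\<close>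

lemma pdv_surj:
  assumes f: "f \<in> mulg w m" and sym: "\<And>a b. m a b = m b a"
    and range: "\<And>a b. a \<noteq> w \<Longrightarrow> b \<noteq> w \<Longrightarrow> a \<noteq> b \<Longrightarrow> m a b \<le> m w a + m w b + 1"
  shows "\<exists>g\<in>mulg w (raise w m). pdv w g = f"
proof -
  note fD = mulgD[OF f]
  have "\<forall>a\<in>- {w}. \<exists>hk. fst hk \<in> polyfun \<and> snd hk \<in> polyfun \<and> (\<forall>x. f a x = (x w - x a) ^ m w a * fst hk x) \<and>
      (\<forall>x. pd w (\<lambda>x. (x w - x a) ^ Suc (m w a) * snd hk x) x = f a x)"
  proof
    fix a assume a: "a \<in> - {w}"
    obtain h where h: "h \<in> polyfun" "\<forall>x. f w x - f a x = (x w - x a) ^ m w a * h x"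
      using fD(3)[of w a] a by auto
    have h': "(\<lambda>x. - h x) \<in> polyfun" by (rule polyfun_uminus[OF h(1)])
    obtain k where k: "k \<in> polyfun" "\<forall>x. pd w (\<lambda>x. (x w - x a) ^ Suc (m w a) * k x) x = (x w - x a) ^ m w a * - h x"
      using antiderivative[OF h', of a w "m w a"] a by auto
    have "\<forall>x. f a x = (x w - x a) ^ m w a * - h x" using h(2)[rule_format] fD(2)
      by (metis (no_types) diff_0 minus_minus mult_minus_right)
    then show "\<exists>hk. fst hk \<in> polyfun \<and> snd hk \<in> polyfun \<and> (\<forall>x. f a x = (x w - x a) ^ m w a * fst hk x) \<and>
      (\<forall>x. pd w (\<lambda>x. (x w - x a) ^ Suc (m w a) * snd hk x) x = f a x)"
      using h' k by (intro exI[of _ "(\<lambda>x. - h x, k)"]) (simp del: power_Suc)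
  qed
  then have "\<exists>hk. \<forall>a\<in>- {w}. fst (hk a) \<in> polyfun \<and> snd (hk a) \<in> polyfun \<and>
      (\<forall>x. f a x = (x w - x a) ^ m w a * fst (hk a) x) \<and>
      (\<forall>x. pd w (\<lambda>x. (x w - x a) ^ Suc (m w a) * snd (hk a) x) x = f a x)" by (rule bchoice)
  then obtain hk where hk: "\<forall>a\<in>- {w}. fst (hk a) \<in> polyfun \<and> snd (hk a) \<in> polyfun \<and>
      (\<forall>x. f a x = (x w - x a) ^ m w a * fst (hk a) x) \<and>
      (\<forall>x. pd w (\<lambda>x. (x w - x a) ^ Suc (m w a) * snd (hk a) x) x = f a x)" by (elim exE)
  define h where "h a = fst (hk a)" for a
  define k where "k a = snd (hk a)" for a
  have h: "h a \<in> polyfun" "f a x = (x w - x a) ^ m w a * h a x" if "a \<noteq> w" for a x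
    using bspec[OF hk, of a] that by (auto simp: h_def)
  have k: "k a \<in> polyfun" "pd w (\<lambda>x. (x w - x a) ^ Suc (m w a) * k a x) x = f a x" if "a \<noteq> w" for a x
    using bspec[OF hk, of a] that by (auto simp: k_def)
  define g where "g a = (if a = w then (\<lambda>x. 0) else (\<lambda>x. (x w - x a) ^ Suc (m w a) * k a x))" for a
  have gp: "g a \<in> polyfun" for a
    using k(1)[of a] by (cases "a = w") (auto simp: g_def polyfun.const intro!: polyfun.mult polyfun_power polyfun_diff polyfun.coord simp del: power_Suc)
  have gf: "pd w (g a) x = f a x" for a x
    by (cases "a = w") (simp_all add: g_def k fD del: power_Suc)
  have g0: "g a (x(w := x a)) = 0" for a x by (auto simp: g_def)
  have "g \<in> mulg w (raise w m)"
  proof (rule mulgI)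
    fix a b :: 'a assume ab: "a \<noteq> b"
    consider "a = w" | "b = w" | "a \<noteq> w" "b \<noteq> w" by blast
    then show "\<exists>h\<in>polyfun. \<forall>x. g a x - g b x = (x a - x b) ^ raise w m a b * h x"
    proof cases
      case 1
      then show ?thesis using ab k(1)[of b]
        by (intro bexI[of _ "\<lambda>x. - k b x"]) (auto simp: g_def raise_def polyfun_uminus)
    next
      case 2
      have "(x w - x a) ^ Suc (m w a) * k a x = (x a - x w) ^ Suc (m w a) * ((-1) ^ Suc (m w a) * k a x)" for x
      proof -
        have "(x w - x a) ^ Suc (m w a) = (-1 * (x a - x w)) ^ Suc (m w a)" by simp
        then show ?thesis unfolding power_mult_distrib by (simp only: mult_ac)
      qed
      moreover have "(\<lambda>x. (-1) ^ Suc (m w a) * k a x) \<in> polyfun"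
        using k(1)[of a] 2 ab by (intro polyfun.mult polyfun.const) auto
      ultimately show ?thesis using ab 2 sym[of w a]
        by (intro bexI[of _ "\<lambda>x. (-1) ^ Suc (m w a) * k a x"]) (auto simp: g_def raise_def simp del: power_Suc)
    next
      case 3
      obtain H where H: "H \<in> polyfun" "\<forall>x. f a x - f b x = (x a - x b) ^ m a b * H x"
        using fD(3)[OF ab] by blast
      \<comment> \<open>\<open>K\<close> is the integral of the cofactor \<open>H\<close> from
        \<open>x_a\<close>. Subtracting its multiple from \<open>g a - g b\<close> leaves a function
        free of \<open>x w\<close>, which may be evaluated at \<open>x w = x a\<close>; there
        \<open>g a\<close> and \<open>K\<close> vanish and \<open>pair_divisible\<close> controls
        \<open>g b\<close>.\<close>
      obtain K0 where K0: "K0 \<in> polyfun" "\<forall>x. pd w (\<lambda>x. (x w - x a) ^ Suc 0 * K0 x) x = (x w - x a) ^ 0 * H x"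
        using antiderivative[OF H(1) 3(1), of 0] by blast
      define K where "K x = (x w - x a) * K0 x" for x
      have Kp: "K \<in> polyfun" unfolding K_def by (intro polyfun_intros K0(1))
      have pK: "pd w K x = H x" for x using K0(2) unfolding K_def by simp
      have up: "(\<lambda>x. (x a - x b) ^ m a b) \<in> polyfun" by (intro polyfun_intros)
      have "\<exists>kk\<in>polyfun. \<forall>x. g b (x(w := x a)) = (x a - x b) ^ m a b * kk x"
        by (rule pair_divisible[OF 3 ab fD(1) fD(1) h(1)[OF 3(1)] h(1)[OF 3(2)] H(1) gp k(1)[OF 3(2)]
              h(2)[OF 3(1)] h(2)[OF 3(2)] H(2)[rule_format] gf _ range[OF 3 ab, folded add.assoc]])
           (simp add: g_def 3)
      then obtain kk where kk: "kk \<in> polyfun" "\<forall>x. g b (x(w := x a)) = (x a - x b) ^ m a b * kk x" by blast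
      define D where "D x = (g a x - g b x) - (x a - x b) ^ m a b * K x" for x
      have Dp: "D \<in> polyfun" unfolding D_def by (intro polyfun_diff polyfun.mult gp up Kp)
      have "pd w D x = 0" for x
      proof -
        have "pd w D x = pd w (\<lambda>x. g a x - g b x) x - pd w (\<lambda>x. (x a - x b) ^ m a b * K x) x"
          unfolding D_def by (intro pd_diff polyfun_diff polyfun.mult gp up Kp)
        also have "pd w (\<lambda>x. (x a - x b) ^ m a b * K x) x = (x a - x b) ^ m a b * pd w K x"
          by (rule pd_mult_indep[OF up Kp]) (use 3 in auto)
        finally show ?thesis using H(2) by (simp add: pd_diff gp gf pK)
      qed
      then have "D (x(w := x a)) = D x" for x by (rule pd_zero_indep[OF Dp])
      moreover have "D (x(w := x a)) = - ((x a - x b) ^ m a b * (kk x + K (x(w := x a))))" for x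
        using 3 kk(2) g0[of a x] by (simp add: D_def algebra_simps)
      ultimately have e1: "D x = - ((x a - x b) ^ m a b * (kk x + K (x(w := x a))))" for x by simp
      have e2: "g a x - g b x = D x + (x a - x b) ^ m a b * K x" for x by (simp add: D_def)
      have "g a x - g b x = (x a - x b) ^ m a b * (K x - (kk x + K (x(w := x a))))" for x
        unfolding e2[of x] e1[of x] right_diff_distrib by simp
      moreover have "(\<lambda>x. K x - (kk x + K (x(w := x a)))) \<in> polyfun"
        by (intro polyfun_diff polyfun.add Kp kk(1) polyfun_upd_coord)
      ultimately show ?thesis using 3 by (intro bexI[of _ "\<lambda>x. K x - (kk x + K (x(w := x a)))"]) (auto simp: raise_def)
    qed
  qed (auto simp: gp, simp add: g_def)
  moreover have "pdv w g = f" using gf by (simp add: pdv_def fun_eq_iff)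
  ultimately show ?thesis by blast
qed

theorem gens_le_raise:
  fixes w :: "'a::finite"
  assumes "gens_le (CARD('a) - 1) (mulg w m)"
    and sym: "\<And>a b. m a b = m b a"
    and range: "\<And>a b. a \<noteq> w \<Longrightarrow> b \<noteq> w \<Longrightarrow> a \<noteq> b \<Longrightarrow> m a b \<le> m w a + m w b + 1"
  shows "gens_le (CARD('a) - 1) (mulg w (raise w m))"
proof (rule gens_le_hom_imp_gens_le[OF graded_module_mulg full_rank_mulg])
  let ?N = "mulg w (raise w m)" and ?M = "mulg w m"
  obtain f d where B: "hbasis (CARD('a) - 1) ?M f d"
    using ex_hbasis[OF graded_module_mulg full_rank_mulg gens_le_hom_if_gens_le[OF assms(1)]] by blast
  show "gens_le_hom (CARD('a) - 1) ?N"
  proof (rule shift_lemma[OF graded_module_mulg graded_module_mulg _ B, where T = "pdv w" and y = w])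
    show "?N \<subseteq> ?M"
    proof (intro subsetI mulgI)
      fix g a b assume g: "g \<in> ?N" and ab: "a \<noteq> (b::'a)"
      obtain h where h: "h \<in> polyfun" "\<forall>x. g a x - g b x = (x a - x b) ^ raise w m a b * h x"
        using mulgD(3)[OF g ab] by blast
      have "raise w m a b = m a b + (raise w m a b - m a b)" by (simp add: raise_def)
      then have "(x a - x b) ^ raise w m a b = (x a - x b) ^ m a b * (x a - x b) ^ (raise w m a b - m a b)"
        for x :: "'a \<Rightarrow> real" using power_add[of "x a - x b" "m a b" "raise w m a b - m a b"] by presburger
      then have "\<forall>x. g a x - g b x = (x a - x b) ^ m a b * ((x a - x b) ^ (raise w m a b - m a b) * h x)"
        using h(2) by (simp only: mult.assoc) simp
      moreover have "(\<lambda>x. (x a - x b) ^ (raise w m a b - m a b) * h x) \<in> polyfun"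
        by (intro polyfun_intros h(1))
      ultimately show "\<exists>h\<in>polyfun. \<forall>x. g a x - g b x = (x a - x b) ^ m a b * h x"
        by (intro bexI[of _ "\<lambda>x. (x a - x b) ^ (raise w m a b - m a b) * h x"])
    qed (auto simp: mulgD)
    fix g assume g: "g \<in> ?N"
    note p = mulgD(1)[OF g]
    show "pdv w g \<in> ?M" by (rule pdv_mem[OF g])
    show "g = 0" if "pdv w g = 0" using pdv_inj[OF g that] .
    show "pdv w (g + h) = pdv w g + pdv w h" if h: "h \<in> ?N" for h
      using pd_add[OF p mulgD(1)[OF h]] by (simp add: pdv_def fun_eq_iff plus_fun_def)
    show "pdv w ((\<lambda>_. c) \<odot> g) = (\<lambda>_. c) \<odot> pdv w g" for c
      using pd_cmult[OF p] by (simp add: pdv_def fun_eq_iff vsmul_def)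
    show "pdv w ((\<lambda>x. x i) \<odot> g) = (\<lambda>x. x i) \<odot> pdv w g" if "i \<noteq> w" for i
      using pd_mult[OF polyfun.coord[of i] p, of w] that by (simp add: pdv_def fun_eq_iff vsmul_def)
    \<comment> \<open>The product rule: for the derivative the commutator with \<open>x w\<close> is
      exactly the identity.\<close>
    have "pdv w ((\<lambda>x. x w) \<odot> g) - (\<lambda>x. x w) \<odot> pdv w g - g = 0"
      using pd_mult[OF polyfun.coord[of w] p, of w] by (simp add: pdv_def fun_eq_iff vsmul_def)
    then show "pdv w ((\<lambda>x. x w) \<odot> g) - (\<lambda>x. x w) \<odot> pdv w g - g \<in> coordideal (- {w}) ?M"
      using coordideal_zero[OF graded_module_mulg] by simp
    show "homv e (pdv w g)" if "homv (Suc e) g" for e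
      using that by (simp add: homv_def pdv_def hom_pd)
  next
    show "\<exists>g\<in>?N. pdv w g = h" if "h \<in> ?M" for h using pdv_surj[OF that sym range] .
  qed
qed

section \<open>Rescaling multiplicities\<close>

subsection \<open>Products of differences and determinants\<close>

lemma hom_one: "hom 0 (\<lambda>x. c)"
  by (simp add: hom_def polyfun.const)

lemma hom_prod:
  "finite I \<Longrightarrow> (\<And>i. i \<in> I \<Longrightarrow> hom (d i) (p i)) \<Longrightarrow> hom (\<Sum>i\<in>I. d i) (\<lambda>x. \<Prod>i\<in>I. p i x)"
  by (induction I rule: finite_induct) (simp_all add: hom_one hom_mult)

lemma hom_diff_power: "hom n (\<lambda>x. (x a - x b) ^ n)"
proof -
  have "(t * x a - t * x b) ^ n = t ^ n * (x a - x b) ^ n" for t :: real and x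
    by (simp add: right_diff_distrib[symmetric] power_mult_distrib)
  moreover have "(\<lambda>x. (x a - x b) ^ n) \<in> polyfun" by (intro polyfun_intros)
  ultimately show ?thesis by (simp add: hom_def)
qed

text \<open>One of the two orientations for each pair of vertices, so that every hyperplane is
  counted once. The vertex type carries no order, hence the choice.\<close>

definition pairs :: "('a::finite \<times> 'a) set" where
  "pairs = (SOME P. \<forall>a b. ((a, b) \<in> P \<longrightarrow> a \<noteq> b) \<and> (a \<noteq> b \<longrightarrow> ((a, b) \<in> P \<longleftrightarrow> (b, a) \<notin> P)))"

lemma ex_inj_real: "\<exists>i :: 'a::finite \<Rightarrow> real. inj i"
proof -
  obtain f :: "'a \<Rightarrow> nat" where "inj f"
    using finite_imp_inj_to_nat_seg[of "UNIV :: 'a set"] by auto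
  then have "inj (\<lambda>a. real (f a))" by (auto simp: inj_def)
  then show ?thesis by blast
qed

lemma
  shows pairs_neq: "(a, b) \<in> pairs \<Longrightarrow> a \<noteq> b"
    and pairs_swap: "a \<noteq> b \<Longrightarrow> (a, b) \<in> pairs \<longleftrightarrow> (b, a) \<notin> pairs"
proof -
  obtain i :: "'a \<Rightarrow> real" where i: "inj i" using ex_inj_real by blast
  let ?Q = "\<lambda>P :: ('a \<times> 'a) set. \<forall>a b. ((a, b) \<in> P \<longrightarrow> a \<noteq> b) \<and> (a \<noteq> b \<longrightarrow> ((a, b) \<in> P \<longleftrightarrow> (b, a) \<notin> P))"
  have "?Q {(a, b). i a < i b}" using injD[OF i] by (auto simp: not_less_iff_gr_or_eq)
  then have "?Q pairs" unfolding pairs_def by (rule someI[of ?Q])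
  then show "(a, b) \<in> pairs \<Longrightarrow> a \<noteq> b" "a \<noteq> b \<Longrightarrow> (a, b) \<in> pairs \<longleftrightarrow> (b, a) \<notin> pairs" by blast+
qed

definition vand :: "('a \<times> 'a) set \<Rightarrow> ('a \<times> 'a \<Rightarrow> nat) \<Rightarrow> ('a \<Rightarrow> real) \<Rightarrow> real" where
  "vand P N x = (\<Prod>q\<in>P. (x (fst q) - x (snd q)) ^ N q)"

lemma polyfun_vand: "vand P N \<in> polyfun"
  unfolding vand_def by (intro polyfun_prod polyfun_power polyfun_diff polyfun.coord)

lemma vand_nonzero_inj:
  fixes P :: "('a::finite \<times> 'a) set"
  assumes "inj x" "P \<subseteq> pairs"
  shows "vand P N x \<noteq> 0"
proof -
  have "x (fst q) - x (snd q) \<noteq> 0" if "q \<in> P" for q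
    using pairs_neq[of "fst q" "snd q"] subsetD[OF assms(2) that] injD[OF assms(1)] by auto
  then show ?thesis by (simp add: vand_def)
qed

lemma vand_nonzero_upd:
  fixes P :: "('a::finite \<times> 'a) set"
  assumes "P \<subseteq> pairs" "a \<noteq> b" "(a, b) \<notin> P" "(b, a) \<notin> P"
  shows "\<exists>x. vand P N (x(a := x b)) \<noteq> 0"
proof -
  obtain i :: "'a \<Rightarrow> real" where i: "inj i" using ex_inj_real by blast
  have "(i(a := i b)) (fst q) - (i(a := i b)) (snd q) \<noteq> 0" if q: "q \<in> P" for q
  proof -
    have "fst q \<noteq> snd q" using pairs_neq[of "fst q" "snd q"] subsetD[OF assms(1) q] by simp
    moreover have "\<not> (fst q = a \<and> snd q = b)" "\<not> (fst q = b \<and> snd q = a)"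
      using q assms(3,4) by (metis prod.collapse)+
    moreover have "i c = i e \<longleftrightarrow> c = e" for c e using injD[OF i] by blast
    ultimately show ?thesis by (auto simp: fun_upd_apply)
  qed
  then show ?thesis by (intro exI[of _ i]) (simp add: vand_def)
qed

lemma vand_split:
  fixes P :: "('a::finite \<times> 'a) set"
  assumes "P \<subseteq> pairs" "(a, b) \<in> P \<or> (b, a) \<in> P" "N (a, b) = M" "N (b, a) = M"
  obtains V x\<^sub>0 where "V \<in> polyfun" "V (x\<^sub>0(a := x\<^sub>0 b)) \<noteq> 0" "\<And>x. vand P N x = (x a - x b) ^ M * V x"
proof -
  obtain c e where ce: "(c, e) \<in> P" "(c = a \<and> e = b) \<or> (c = b \<and> e = a)" using assms(2) by blast
  have ab: "a \<noteq> b" using ce pairs_neq[of c e] assms(1) by auto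
  let ?P = "P - {(c, e)}" and ?s = "if c = a then 1 else (-1) ^ M :: real"
  have "(a, b) \<notin> ?P" "(b, a) \<notin> ?P" using ce pairs_swap[OF ab] assms(1) by auto
  then obtain x\<^sub>0 where "vand ?P N (x\<^sub>0(a := x\<^sub>0 b)) \<noteq> 0"
    using vand_nonzero_upd[of ?P a b N] assms(1) ab by blast
  moreover have "vand P N x = (x a - x b) ^ M * (?s * vand ?P N x)" for x
  proof -
    have "vand P N x = (x c - x e) ^ M * vand ?P N x"
      unfolding vand_def using prod.remove[of P "(c, e)" "\<lambda>q. (x (fst q) - x (snd q)) ^ N q"] ce assms(3,4) by auto
    moreover have "(x b - x a) ^ M = (x a - x b) ^ M * (-1) ^ M"
      by (simp add: power_mult_distrib[symmetric])
    ultimately show ?thesis using ce ab by auto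
  qed
  moreover have "(\<lambda>x. ?s * vand ?P N x) \<in> polyfun" by (intro polyfun.mult polyfun.const polyfun_vand)
  ultimately show ?thesis using that[of "\<lambda>x. ?s * vand ?P N x" x\<^sub>0] by simp
qed

text \<open>The differences of different pairs are pairwise coprime, so divisibility by each power
  gives divisibility by the product.\<close>

lemma vand_divides:
  fixes P :: "('a::finite \<times> 'a) set"
  assumes "P \<subseteq> pairs" "p \<in> polyfun"
    "\<And>a b. (a, b) \<in> P \<Longrightarrow> \<exists>k\<in>polyfun. \<forall>x. p x = (x a - x b) ^ N (a, b) * k x"
  shows "\<exists>h\<in>polyfun. \<forall>x. p x = vand P N x * h x"
proof -
  have "finite P" by simp
  then show ?thesis using assms(1,3)
  proof (induction P rule: finite_induct)
    case empty
    then show ?case using assms(2) by (intro bexI[of _ p]) (auto simp: vand_def)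
  next
    case (insert q P)
    obtain a b where q: "q = (a, b)" by (cases q)
    have ab: "a \<noteq> b" using pairs_neq[of a b] insert q by auto
    have "\<exists>h\<in>polyfun. \<forall>x. p x = vand P N x * h x" using insert by auto
    then obtain h where h: "h \<in> polyfun" "\<forall>x. p x = vand P N x * h x" by blast
    obtain k where k: "k \<in> polyfun" "\<forall>x. p x = (x a - x b) ^ N (a, b) * k x"
      using insert.prems(2)[of a b] q by auto
    have "(b, a) \<notin> P" using pairs_swap[OF ab] insert.prems(1) q by auto
    then obtain x\<^sub>0 where "vand P N (x\<^sub>0(a := x\<^sub>0 b)) \<noteq> 0"
      using vand_nonzero_upd[of P a b N] insert q ab by auto
    then have "\<exists>h'\<in>polyfun. \<forall>x. h x = (x a - x b) ^ N (a, b) * h' x"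
      by (rule polyfun_divisible_coprime[OF polyfun_vand _ polyfun.coord _ h(1) k(1)])
         (use ab h k in \<open>auto simp del: fun_upd_apply\<close>)
    then obtain h' where h': "h' \<in> polyfun" "\<forall>x. h x = (x a - x b) ^ N (a, b) * h' x" by blast
    then show ?case using insert q h(2) by (intro bexI[of _ h']) (auto simp: vand_def)
  qed
qed

lemma hom_vand:
  fixes P :: "('a::finite \<times> 'a) set"
  shows "hom (\<Sum>q\<in>P. N q) (vand P N)"
  unfolding vand_def by (intro hom_prod hom_diff_power) simp

text \<open>Each vertex lies in \<open>CARD('a) - 1\<close> pairs. The equality says that the
  determinant in \<open>det_gg\<close> and the product dividing it have the same degree.\<close>

lemma sum_pairs:
  fixes n :: "'a::finite \<Rightarrow> nat"
  shows "(\<Sum>q\<in>pairs. n (fst q) + n (snd q)) = (CARD('a) - 1) * (\<Sum>a\<in>UNIV. n a)"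
proof -
  let ?P = "pairs :: ('a \<times> 'a) set" and ?S = "(pairs :: ('a \<times> 'a) set)\<inverse>"
  have dis: "(b, a) \<notin> ?P" if "(a, b) \<in> ?P" for a b
    using pairs_swap[OF pairs_neq[OF that]] that by simp
  have tot: "(a, b) \<in> ?P \<or> (b, a) \<in> ?P" if "a \<noteq> b" for a b using pairs_swap[OF that] by blast
  have "(\<Sum>q\<in>?S. n (fst q)) = (\<Sum>q\<in>?P. n (snd q))"
    by (rule sum.reindex_bij_witness[of _ prod.swap prod.swap]) auto
  then have "(\<Sum>q\<in>?P. n (fst q) + n (snd q)) = (\<Sum>q\<in>?P. n (fst q)) + (\<Sum>q\<in>?S. n (fst q))"
    by (simp add: sum.distrib)
  also have "\<dots> = (\<Sum>q\<in>?P \<union> ?S. n (fst q))"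
  proof (rule sum.union_disjoint[symmetric])
    show "?P \<inter> ?S = {}" using dis by blast
  qed simp_all
  also have "?P \<union> ?S = Sigma UNIV (\<lambda>a. - {a})"
  proof (rule set_eqI)
    fix q :: "'a \<times> 'a"
    obtain a b where q: "q = (a, b)" by (cases q)
    show "q \<in> ?P \<union> ?S \<longleftrightarrow> q \<in> Sigma UNIV (\<lambda>a. - {a})"
      unfolding q using pairs_neq[of a b] pairs_neq[of b a] tot[of a b] by auto
  qed
  also have "(\<Sum>q\<in>Sigma UNIV (\<lambda>a. - {a}). n (fst q)) = (\<Sum>a\<in>UNIV. \<Sum>b\<in>- {a}. n a)"
    by (subst sum.Sigma) (auto intro!: sum.cong)
  also have "\<dots> = (CARD('a) - 1) * (\<Sum>a\<in>UNIV. n a)"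
    by (simp add: sum_distrib_left Compl_eq_Diff_UNIV card_Diff_singleton)
  finally show ?thesis .
qed

lemma polyfun_det:
  fixes M :: "'a::finite \<Rightarrow> 'a \<Rightarrow> ('w \<Rightarrow> real) \<Rightarrow> real"
  assumes "\<And>i j. M i j \<in> polyfun"
  shows "(\<lambda>x. det (\<chi> i j. M i j x)) \<in> polyfun"
  unfolding det_def vec_lambda_beta
  by (intro polyfun_sum polyfun.mult polyfun.const polyfun_prod assms)

lemma hom_det:
  fixes M :: "'a::finite \<Rightarrow> 'a \<Rightarrow> ('w \<Rightarrow> real) \<Rightarrow> real"
  assumes "\<And>i j. hom (d i) (M i j)"
  shows "hom (\<Sum>i\<in>UNIV. d i) (\<lambda>x. det (\<chi> i j. M i j x))"
  unfolding det_def vec_lambda_beta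
  by (intro hom_sum hom_cmult hom_prod assms) simp

lemma det_row_divisible:
  fixes M :: "'a::finite \<Rightarrow> 'a \<Rightarrow> ('w \<Rightarrow> real) \<Rightarrow> real"
  assumes M: "\<And>i j. M i j \<in> polyfun" and ab: "a \<noteq> b" and H: "\<And>j. H j \<in> polyfun"
    and row: "\<And>j x. M a j x - s * M b j x = u x * H j x"
  shows "\<exists>h\<in>polyfun. \<forall>x. det (\<chi> i j. M i j x) = u x * h x"
proof -
  define M' where "M' i j = (if i = a then H j else M i j)" for i j
  have "det (\<chi> i j. M i j x) = u x * det (\<chi> i j. M' i j x)" for x
  proof -
    let ?A = "\<chi> i j. M i j x"
    have "det ?A = det (\<chi> k. if k = a then row a ?A + (- s) *s row b ?A else row k ?A)"
      using det_row_operation[OF ab, of ?A "- s"] by simp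
    also have "(\<chi> k. if k = a then row a ?A + (- s) *s row b ?A else row k ?A) =
        (\<chi> k. if k = a then u x *s (\<chi> j. H j x) else (\<chi> j. M k j x))"
      using row by (simp add: vec_eq_iff row_def)
    also have "det \<dots> = u x * det (\<chi> k. if k = a then (\<chi> j. H j x) else (\<chi> j. M k j x))"
      by (rule det_row_mul)
    also have "(\<chi> k. if k = a then (\<chi> j. H j x) else (\<chi> j. M k j x)) = (\<chi> i j. M' i j x)"
      by (simp add: vec_eq_iff M'_def)
    finally show ?thesis .
  qed
  moreover have "(\<lambda>x. det (\<chi> i j. M' i j x)) \<in> polyfun"
    by (rule polyfun_det) (simp add: M'_def M H)
  ultimately show ?thesis by (intro bexI[of _ "\<lambda>x. det (\<chi> i j. M' i j x)"] allI)
qed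

text \<open>Subtracting row \<open>b\<close> from row \<open>a\<close> produces a divisible row. Row
  \<open>w\<close> is different: the values of \<open>Z\<close> there are 0 and are replaced by
  \<open>c\<close>, so if one of \<open>a\<close>, \<open>b\<close> is \<open>w\<close>, the other
  row is itself divisible.\<close>

lemma det_pair_divisible:
  fixes Z :: "'a::finite \<Rightarrow> 'a \<Rightarrow> ('a \<Rightarrow> real) \<Rightarrow> real"
  assumes Z: "\<And>j i. Z j i \<in> polyfun" "\<And>j x. Z j w x = 0" and c: "\<And>j. c j \<in> polyfun" and ab: "a \<noteq> b"
    and div: "\<And>j. \<exists>h\<in>polyfun. \<forall>x. Z j a x - Z j b x = (x a - x b) ^ N * h x"
  shows "\<exists>h\<in>polyfun. \<forall>x. det (\<chi> i j. if i = w then c j x else Z j i x) = (x a - x b) ^ N * h x"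
proof -
  have "\<forall>j. \<exists>h. h \<in> polyfun \<and> (\<forall>x. Z j a x - Z j b x = (x a - x b) ^ N * h x)" using div by blast
  then have "\<exists>h. \<forall>j. h j \<in> polyfun \<and> (\<forall>x. Z j a x - Z j b x = (x a - x b) ^ N * h j x)" by (rule choice)
  then obtain h where h: "\<And>j. h j \<in> polyfun" "\<And>j x. Z j a x - Z j b x = (x a - x b) ^ N * h j x" by blast
  define M where "M i j x = (if i = w then c j x else Z j i x)" for i j x
  have M: "M i j \<in> polyfun" for i j unfolding M_def by (cases "i = w") (simp_all add: Z c)
  have "\<exists>h\<in>polyfun. \<forall>x. det (\<chi> i j. M i j x) = (x a - x b) ^ N * h x"
  proof (cases "a = w")
    case True
    show ?thesis
    proof (rule det_row_divisible[where a = b and b = a and H = "\<lambda>j x. - h j x" and s = 0, OF M])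
      show "(\<lambda>x. - h j x) \<in> polyfun" for j by (rule polyfun_uminus[OF h(1)])
      show "M b j x - 0 * M a j x = (x a - x b) ^ N * - h j x" for j x
        using h(2)[of j x] Z(2)[of j x] True ab by (simp add: M_def)
    qed (use ab in simp)
  next
    case False
    have "M a j x - (if b = w then 0 else 1) * M b j x = (x a - x b) ^ N * h j x" for j x
      using h(2)[of j x] Z(2)[of j x] False by (cases "b = w") (auto simp: M_def)
    then show ?thesis by (rule det_row_divisible[where H = h, OF M ab h(1)])
  qed
  then show ?thesis by (simp add: M_def)
qed

subsection \<open>Rolle's theorem\<close>

lemma monic_prod_roots:
  "finite T \<Longrightarrow> degree (\<Prod>y\<in>T. [:- y, 1 :: real:]) = card T \<and> coeff (\<Prod>y\<in>T. [:- y, 1 :: real:]) (card T) = 1"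
proof (induction T rule: finite_induct)
  case (insert y T)
  let ?q = "\<Prod>y\<in>T. [:- y, 1 :: real:]"
  have "?q \<noteq> 0" using insert.IH by auto
  then have d: "degree ([:- y, 1:] * ?q) = Suc (card T)" using insert.IH by (simp add: degree_mult_eq del: mult_pCons_left)
  have "coeff ([:- y, 1:] * ?q) (degree [:- y, 1:] + degree ?q) = 1"
    unfolding coeff_mult_degree_sum using insert.IH by simp
  then show ?case using insert d by (simp del: mult_pCons_left)
qed simp

text \<open>The numerator \<open>p\<close> of the sum of the fractions \<open>s y / (t - y)\<close>
  has degree below \<open>card S - 1\<close>, because the coefficient in that degree is the sum of
  the \<open>s y\<close>. A zero in each gap of \<open>S\<close> gives \<open>card S - 1\<close>
  roots, so \<open>p = 0\<close>; and the value of \<open>p\<close> at \<open>y\<close> is a nonzero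
  multiple of \<open>s y\<close>.\<close>

lemma rolle_coefficients:
  fixes S :: "real set"
  assumes S: "finite S" and zero: "(\<Sum>y\<in>S. s y) = 0"
    and roots: "\<And>a b. a \<in> S \<Longrightarrow> b \<in> S \<Longrightarrow> a < b \<Longrightarrow> \<exists>\<xi>. a < \<xi> \<and> \<xi> < b \<and> (\<xi> \<notin> S \<longrightarrow> (\<Sum>y\<in>S. s y / (\<xi> - y)) = 0)"
    and y: "y \<in> S"
  shows "s y = 0"
proof -
  define q where "q y = (\<Prod>z\<in>S - {y}. [:- z, 1 :: real:])" for y
  define p where "p = (\<Sum>y\<in>S. smult (s y) (q y))"
  have q: "degree (q y) = card S - 1" "coeff (q y) (card S - 1) = 1" if "y \<in> S" for y
    using monic_prod_roots[of "S - {y}"] S that by (auto simp: q_def)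
  have deg: "degree p \<le> card S - 1"
    unfolding p_def using q by (auto intro!: degree_sum_le S order.trans[OF degree_smult_le])
  have top: "coeff p (card S - 1) = 0" using q zero by (simp add: p_def coeff_sum)
  have pq: "poly (q y) t = (\<Prod>z\<in>S - {y}. t - z)" for y t by (simp add: q_def poly_prod)
  have pp: "poly p t = (\<Prod>z\<in>S. t - z) * (\<Sum>y\<in>S. s y / (t - y))" if "t \<notin> S" for t
  proof -
    have "s y * poly (q y) t = (\<Prod>z\<in>S. t - z) * (s y / (t - y))" if "y \<in> S" for y
      using prod.remove[OF S that, of "\<lambda>z. t - z"] \<open>t \<notin> S\<close> that by (auto simp: pq)
    then show ?thesis by (simp add: p_def poly_sum sum_distrib_left)
  qed
  have "p = 0"
  proof (rule ccontr)
    assume "p \<noteq> 0"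
    then have lt: "degree p < card S - 1"
      using deg top leading_coeff_0_iff[of p] by (cases "degree p = card S - 1") auto
    have ne: "S \<noteq> {}" using y by auto
    let ?T = "S - {Max S}"
    \<comment> \<open>Zeros are taken between consecutive elements only, so that they cannot lie in
      \<open>S\<close> and are different from each other.\<close>
    define nxt where "nxt a = Min {z \<in> S. a < z}" for a
    have nxt: "nxt a \<in> S" "a < nxt a" "\<And>z. z \<in> S \<Longrightarrow> a < z \<Longrightarrow> nxt a \<le> z" if "a \<in> ?T" for a
    proof -
      have "a < Max S" using that Max_ge[OF S, of a] by auto
      then have "{z \<in> S. a < z} \<noteq> {}" using Max_in[OF S ne] by auto
      then have "nxt a \<in> {z \<in> S. a < z}" unfolding nxt_def using S by (intro Min_in) auto
      then show "nxt a \<in> S" "a < nxt a" by auto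
      show "nxt a \<le> z" if "z \<in> S" "a < z" for z unfolding nxt_def using S that by (intro Min_le) auto
    qed
    have "\<forall>a\<in>?T. \<exists>\<xi>. a < \<xi> \<and> \<xi> < nxt a \<and> (\<xi> \<notin> S \<longrightarrow> (\<Sum>y\<in>S. s y / (\<xi> - y)) = 0)"
    proof
      fix a assume a: "a \<in> ?T"
      show "\<exists>\<xi>. a < \<xi> \<and> \<xi> < nxt a \<and> (\<xi> \<notin> S \<longrightarrow> (\<Sum>y\<in>S. s y / (\<xi> - y)) = 0)"
        by (rule roots[OF _ nxt(1)[OF a] nxt(2)[OF a]]) (use a in simp)
    qed
    then have "\<exists>\<xi>. \<forall>a\<in>?T. a < \<xi> a \<and> \<xi> a < nxt a \<and> (\<xi> a \<notin> S \<longrightarrow> (\<Sum>y\<in>S. s y / (\<xi> a - y)) = 0)"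
      by (rule bchoice)
    then obtain \<xi> where \<xi>0: "\<forall>a\<in>?T. a < \<xi> a \<and> \<xi> a < nxt a \<and> (\<xi> a \<notin> S \<longrightarrow> (\<Sum>y\<in>S. s y / (\<xi> a - y)) = 0)"
      by (elim exE)
    have \<xi>: "a < \<xi> a" "\<xi> a < nxt a" "\<xi> a \<notin> S \<Longrightarrow> (\<Sum>y\<in>S. s y / (\<xi> a - y)) = 0" if "a \<in> ?T" for a
      using bspec[OF \<xi>0 that] by auto
    have \<xi>S: "\<xi> a \<notin> S" if "a \<in> ?T" for a using \<xi>(1,2)[OF that] nxt(3)[OF that, of "\<xi> a"] by auto
    have "poly p (\<xi> a) = 0" if "a \<in> ?T" for a using pp[OF \<xi>S[OF that]] \<xi>(3)[OF that \<xi>S[OF that]] by simp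
    then have sub: "\<xi> ` ?T \<subseteq> {x. poly p x = 0}" by auto
    have mono: "\<xi> a < \<xi> b" if "a \<in> ?T" "b \<in> ?T" "a < b" for a b
      using \<xi>(2)[OF that(1)] nxt(3)[OF that(1), of b] \<xi>(1)[OF that(2)] that by auto
    have "inj_on \<xi> ?T"
    proof (rule inj_onI, rule ccontr)
      fix a b assume "a \<in> ?T" "b \<in> ?T" "\<xi> a = \<xi> b" "a \<noteq> b"
      then show False using mono[of a b] mono[of b a] by (cases "a < b") auto
    qed
    then have "card ?T = card (\<xi> ` ?T)" by (simp add: card_image)
    also have "\<dots> \<le> card {x. poly p x = 0}" by (rule card_mono[OF poly_roots_finite[OF \<open>p \<noteq> 0\<close>] sub])
    also have "\<dots> \<le> degree p" by (rule card_poly_roots_bound[OF \<open>p \<noteq> 0\<close>])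
    finally show False using lt S Max_in[OF S ne] by simp
  qed
  then have "0 = poly p y" by simp
  also have "\<dots> = s y * (\<Prod>z\<in>S - {y}. y - z)"
  proof -
    have "(\<Sum>y'\<in>S - {y}. s y' * poly (q y') y) = 0"
      using S y by (intro sum.neutral ballI) (auto simp: pq intro!: prod_zero)
    then show ?thesis using sum.remove[OF S y, of "\<lambda>y'. s y' * poly (q y') y"]
      by (simp add: p_def poly_sum pq)
  qed
  finally show ?thesis using S by auto
qed

subsection \<open>Integrals between the coordinates\<close>

text \<open>The variable \<open>None\<close> plays the role of the integration variable.\<close>

lemma pd_dilate:
  assumes "p \<in> polyfun"
  shows "pd i (\<lambda>x. p (\<lambda>j. s * x j)) x = s * pd i p (\<lambda>j. s * x j)"
  using assms
proof (induction rule: polyfun.induct)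
  case (coord j)
  then show ?case using pd_cmult[OF polyfun.coord[of j], of i s x] by simp
next
  case (add p q)
  have "pd i (\<lambda>x. p (\<lambda>j. s * x j) + q (\<lambda>j. s * x j)) x =
      pd i (\<lambda>x. p (\<lambda>j. s * x j)) x + pd i (\<lambda>x. q (\<lambda>j. s * x j)) x"
    using add by (intro pd_add polyfun_dilate)
  then show ?case using add by (simp add: pd_add distrib_left)
next
  case (mult p q)
  have "pd i (\<lambda>x. p (\<lambda>j. s * x j) * q (\<lambda>j. s * x j)) x =
      pd i (\<lambda>x. p (\<lambda>j. s * x j)) x * q (\<lambda>j. s * x j) + p (\<lambda>j. s * x j) * pd i (\<lambda>x. q (\<lambda>j. s * x j)) x"
    using mult by (intro pd_mult polyfun_dilate)
  then show ?case using mult by (simp add: pd_mult algebra_simps)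
qed simp

lemma pd_power': "p \<in> polyfun \<Longrightarrow> pd i (\<lambda>x. p x ^ n) x = real n * p x ^ (n - 1) * pd i p x"
  by (cases n) (simp_all only: pd_power power_0 pd_const of_nat_0 mult_zero_left diff_Suc_1)

definition primitive :: "'a \<Rightarrow> (('a option \<Rightarrow> real) \<Rightarrow> real) \<Rightarrow> ('a option \<Rightarrow> real) \<Rightarrow> real" where
  "primitive w f = (SOME E. E \<in> polyfun \<and> (\<forall>y. pd None E y = f y) \<and> (\<forall>y. E (y(None := y (Some w))) = 0))"

lemma primitive:
  assumes "f \<in> polyfun"
  shows "primitive w f \<in> polyfun" "pd None (primitive w f) y = f y" "primitive w f (y(None := y (Some w))) = 0"
proof -
  obtain k where k: "k \<in> polyfun"
      "\<forall>y. pd None (\<lambda>y. (y None - y (Some w)) ^ Suc 0 * k y) y = (y None - y (Some w)) ^ 0 * f y"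
    using antiderivative[OF assms, of "Some w" None 0] by blast
  let ?Q = "\<lambda>E. E \<in> polyfun \<and> (\<forall>y. pd None E y = f y) \<and> (\<forall>y. E (y(None := y (Some w))) = 0)"
  have "?Q (\<lambda>y. (y None - y (Some w)) * k y)"
    using k by (auto intro!: polyfun.mult polyfun_diff polyfun.coord)
  then have "?Q (primitive w f)" unfolding primitive_def by (rule someI[of ?Q])
  then show "primitive w f \<in> polyfun" "pd None (primitive w f) y = f y" "primitive w f (y(None := y (Some w))) = 0"
    by blast+
qed

lemma hom_primitive:
  assumes "hom d f"
  shows "hom (Suc d) (primitive w f)"
proof -
  have fp: "f \<in> polyfun" by (rule hom_polyfun[OF assms])
  note E = primitive[OF fp, of w]
  have "primitive w f (\<lambda>j. s * y j) = s ^ Suc d * primitive w f y" for s y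
  proof -
    \<comment> \<open>Both terms are antiderivatives of the same function in the integration
      variable and vanish at \<open>x_w\<close>, so they agree.\<close>
    define D where "D y = primitive w f (\<lambda>j. s * y j) - s ^ Suc d * primitive w f y" for y
    have dp: "(\<lambda>y. primitive w f (\<lambda>j. s * y j)) \<in> polyfun" by (rule polyfun_dilate[OF E(1)])
    have cp: "(\<lambda>y. s ^ Suc d * primitive w f y) \<in> polyfun" by (intro polyfun.mult polyfun.const E(1))
    have Dp: "D \<in> polyfun" unfolding D_def by (rule polyfun_diff[OF dp cp])
    have "pd None D y = 0" for y
    proof -
      have "pd None D y = pd None (\<lambda>y. primitive w f (\<lambda>j. s * y j)) y - pd None (\<lambda>y. s ^ Suc d * primitive w f y) y"
        unfolding D_def by (rule pd_diff[OF dp cp])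
      also have "\<dots> = s * f (\<lambda>j. s * y j) - s ^ Suc d * f y"
        by (simp only: pd_dilate[OF E(1)] pd_cmult[OF E(1)] E(2))
      also have "\<dots> = 0" using assms by (simp add: hom_def)
      finally show ?thesis .
    qed
    then have "D (y(None := y (Some w))) = D y" by (rule pd_zero_indep[OF Dp])
    moreover have "(\<lambda>j. s * (y(None := y (Some w))) j) = (\<lambda>j. s * y j)(None := (\<lambda>j. s * y j) (Some w))"
      by (auto simp: fun_upd_apply)
    then have "D (y(None := y (Some w))) = 0"
      using E(3)[of "\<lambda>j. s * y j"] E(3)[of y] by (simp add: D_def)
    ultimately show ?thesis by (simp add: D_def)
  qed
  then show ?thesis using E(1) unfolding hom_def by blast
qed

definition ev :: "'a \<Rightarrow> ('a \<Rightarrow> real) \<Rightarrow> 'a option \<Rightarrow> real" where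
  "ev a x = case_option (x a) x"

lemma ev_simps [simp]: "ev a x None = x a" "ev a x (Some b) = x b" "(ev a x)(None := t, None := s) = (ev a x)(None := s)"
  by (simp_all add: ev_def)

lemma ev_upd: "(ev a x)(None := x b) = ev b x"
  by (auto simp: ev_def fun_eq_iff fun_upd_apply split: option.split)

lemma polyfun_ev:
  assumes "p \<in> polyfun"
  shows "(\<lambda>x. p (ev a x)) \<in> polyfun"
proof -
  have "(\<lambda>y. p (\<lambda>i. (\<lambda>x. case i of None \<Rightarrow> x a | Some b \<Rightarrow> x b) y)) \<in> polyfun"
  proof (rule polyfun_compose[OF assms])
    fix i :: "'a option"
    show "(\<lambda>x. case i of None \<Rightarrow> x a | Some b \<Rightarrow> x b) \<in> polyfun" by (cases i) (simp_all add: polyfun.coord)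
  qed
  moreover have "ev a x = (\<lambda>i. case i of None \<Rightarrow> x a | Some b \<Rightarrow> x b)" for x
    by (auto simp: ev_def fun_eq_iff split: option.split)
  ultimately show ?thesis by simp
qed

lemma primitive_ev: "f \<in> polyfun \<Longrightarrow> primitive w f (ev w x) = 0"
  using primitive(3)[of f w "ev w x"] by (simp add: ev_upd)

text \<open>The integral from \<open>x_b\<close> to \<open>x_a\<close>, treated by
  \<open>pair_divisible\<close> with equal functions: then \<open>H = 0\<close>, and the largest
  exponent \<alpha> + \<beta> + 1 is available.\<close>

lemma primitive_pair:
  assumes ab: "a \<noteq> b" and R: "R \<in> polyfun"
    and f: "\<And>y. f y = (y None - y (Some a)) ^ \<alpha> * (y None - y (Some b)) ^ \<beta> * R y"
  shows "\<exists>h\<in>polyfun. \<forall>x. primitive w f (ev a x) - primitive w f (ev b x) = (x a - x b) ^ (\<alpha> + \<beta> + 1) * h x"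
proof -
  have ap: "(\<lambda>y. (y None - y (Some a)) ^ \<alpha> * R y) \<in> polyfun" and bp: "(\<lambda>y. (y None - y (Some b)) ^ \<beta> * R y) \<in> polyfun"
    by (intro polyfun_intros R)+
  have fp: "f \<in> polyfun"
  proof -
    have "f = (\<lambda>y. (y None - y (Some a)) ^ \<alpha> * (y None - y (Some b)) ^ \<beta> * R y)" using f by (rule ext)
    then show ?thesis by (simp only:) (intro polyfun_intros R)
  qed
  note E = primitive[OF fp, of w]
  define g where "g y = primitive w f y - primitive w f (y(None := y (Some b)))" for y
  have bE: "(\<lambda>y. primitive w f (y(None := y (Some b)))) \<in> polyfun" by (rule polyfun_upd_coord[OF E(1)])
  have gp: "g \<in> polyfun" unfolding g_def by (rule polyfun_diff[OF E(1) bE])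
  have pg: "pd None g y = f y" for y
  proof -
    have "pd None (\<lambda>y. primitive w f (y(None := y (Some b)))) y = 0" by (rule pd_indep) simp
    then show ?thesis unfolding g_def using pd_diff[OF E(1) bE, of None y] E(2) by simp
  qed
  have "\<exists>k\<in>polyfun. \<forall>y. g y = (y None - y (Some b)) ^ Suc \<beta> * k y"
  proof (rule divisible_if_pd_divisible[OF gp _ ap])
    show "pd None g y = (y None - y (Some b)) ^ \<beta> * ((y None - y (Some a)) ^ \<alpha> * R y)" for y
      unfolding pg f by (simp only: mult_ac)
  qed (simp_all add: g_def)
  then obtain k where k: "k \<in> polyfun" "\<forall>y. g y = (y None - y (Some b)) ^ Suc \<beta> * k y" by blast
  have "\<exists>k\<in>polyfun. \<forall>y. g (y(None := y (Some a))) = (y (Some a) - y (Some b)) ^ (\<alpha> + \<beta> + 1) * k y"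
  proof (rule pair_divisible[where fa = f and fb = f and H = "\<lambda>y. 0" and w = None and \<alpha> = \<alpha> and \<beta> = \<beta>,
        OF _ _ _ fp fp bp ap polyfun.const gp k(1) _ _ _ pg k(2)[rule_format]])
    show "f y = (y None - y (Some a)) ^ \<alpha> * ((y None - y (Some b)) ^ \<beta> * R y)"
      "f y = (y None - y (Some b)) ^ \<beta> * ((y None - y (Some a)) ^ \<alpha> * R y)" for y
      unfolding f by (simp_all only: mult_ac)
  qed (use ab in simp_all)
  then obtain h where h: "h \<in> polyfun" "\<forall>y. g (y(None := y (Some a))) = (y (Some a) - y (Some b)) ^ (\<alpha> + \<beta> + 1) * h y"
    by blast
  have "primitive w f (ev a x) - primitive w f (ev b x) = (x a - x b) ^ (\<alpha> + \<beta> + 1) * h (ev a x)" for x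
    using h(2)[rule_format, of "ev a x"] by (simp add: g_def ev_upd)
  then show ?thesis using polyfun_ev[OF h(1), of a] by (intro bexI[of _ "\<lambda>x. h (ev a x)"] allI)
qed

text \<open>With \<open>W(t) = \<Prod>\<^sub>l (t - x\<^sub>l)\<^bsup>n l\<^esup>\<close>, \<open>gg n w k a\<close> is the integral of \<open>n\<^sub>k W(t) / (t - x\<^sub>k)\<close> from \<open>x\<^sub>w\<close> to \<open>x\<^sub>a\<close>.\<close>

definition integrand :: "('a::finite \<Rightarrow> nat) \<Rightarrow> 'a \<Rightarrow> ('a option \<Rightarrow> real) \<Rightarrow> real" where
  "integrand n k y = real (n k) * (\<Prod>l\<in>UNIV. (y None - y (Some l)) ^ (n l - (if l = k then 1 else 0)))"

definition gg :: "('a::finite \<Rightarrow> nat) \<Rightarrow> 'a \<Rightarrow> 'a \<Rightarrow> 'a \<Rightarrow> ('a \<Rightarrow> real) \<Rightarrow> real" where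
  "gg n w k a x = primitive w (integrand n k) (ev a x)"

lemma polyfun_integrand: "integrand n k \<in> polyfun"
  unfolding integrand_def by (intro polyfun_intros)

lemma polyfun_gg: "gg n w k a \<in> polyfun"
  unfolding gg_def by (rule polyfun_ev[OF primitive(1)[OF polyfun_integrand]])

lemma gg_base: "gg n w k w x = 0"
  by (simp add: gg_def primitive_ev polyfun_integrand)

lemma integrand_split:
  assumes "a \<noteq> b"
  shows "integrand n k y = (y None - y (Some a)) ^ (n a - (if a = k then 1 else 0)) *
    (y None - y (Some b)) ^ (n b - (if b = k then 1 else 0)) *
    (real (n k) * (\<Prod>l\<in>UNIV - {a} - {b}. (y None - y (Some l)) ^ (n l - (if l = k then 1 else 0))))"
proof -
  let ?g = "\<lambda>l. (y None - y (Some l)) ^ (n l - (if l = k then 1 else 0))"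
  have "prod ?g UNIV = ?g a * (?g b * prod ?g (UNIV - {a} - {b}))"
    using prod.remove[of UNIV a ?g] prod.remove[of "UNIV - {a}" b ?g] assms by simp
  then show ?thesis unfolding integrand_def by (simp only: mult_ac)
qed

lemma gg_pair:
  assumes "a \<noteq> b"
  shows "\<exists>h\<in>polyfun. \<forall>x. gg n w k a x - gg n w k b x =
    (x a - x b) ^ (n a - (if a = k then 1 else 0) + (n b - (if b = k then 1 else 0)) + 1) * h x"
  unfolding gg_def by (rule primitive_pair[OF assms _ integrand_split[OF assms]]) (intro polyfun_intros)

lemma dvd_power_mono:
  assumes "h \<in> polyfun" "M \<le> N" "\<And>x. p x = (x a - x b) ^ N * h x"
  shows "\<exists>h\<in>polyfun. \<forall>x. p x = (x a - x b) ^ M * h x"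
proof -
  have "p x = (x a - x b) ^ M * ((x a - x b) ^ (N - M) * h x)" for x
    using assms(2,3) by (simp add: power_add[symmetric] mult.assoc[symmetric])
  moreover have "(\<lambda>x. (x a - x b) ^ (N - M) * h x) \<in> polyfun" by (intro polyfun_intros assms(1))
  ultimately show ?thesis by (intro bexI[of _ "\<lambda>x. (x a - x b) ^ (N - M) * h x"] allI)
qed

lemma gg_pair_le:
  assumes ab: "a \<noteq> b" and n: "\<And>a. n a \<ge> 1"
  shows "\<exists>h\<in>polyfun. \<forall>x. gg n w k a x - gg n w k b x = (x a - x b) ^ (n a + n b) * h x"
proof -
  obtain h where h: "h \<in> polyfun" "\<forall>x. gg n w k a x - gg n w k b x =
    (x a - x b) ^ (n a - (if a = k then 1 else 0) + (n b - (if b = k then 1 else 0)) + 1) * h x"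
    using gg_pair[OF ab] by blast
  show ?thesis
    by (rule dvd_power_mono[OF h(1) _ h(2)[rule_format]]) (use ab n[of a] n[of b] in auto)
qed

lemma gg_pair_other:
  assumes "a \<noteq> b" "k \<noteq> a" "k \<noteq> b"
  shows "\<exists>h\<in>polyfun. \<forall>x. gg n w k a x - gg n w k b x = (x a - x b) ^ (n a + n b + 1) * h x"
  using gg_pair[OF assms(1), of n w k] assms by simp

text \<open>With index \<open>a\<close> or \<open>b\<close> alone the integral has one order less
  than with other indices. The sum regains it: the two integrands add up to \<open>A' R\<close> for
  \<open>A = (t - x_a) ^ n a * (t - x_b) ^ n b\<close>, and integration by parts leaves
  \<open>- A R'\<close>, which has the full orders at both ends.\<close>

lemma gg_pair_sum:
  assumes ab: "a \<noteq> b" and n: "\<And>a. n a \<ge> 1"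
  shows "\<exists>h\<in>polyfun. \<forall>x. (gg n w a a x + gg n w b a x) - (gg n w a b x + gg n w b b x) =
    (x a - x b) ^ (n a + n b + 1) * h x"
proof -
  let ?a = "\<lambda>y :: 'a option \<Rightarrow> real. y None - y (Some a)" and ?b = "\<lambda>y :: 'a option \<Rightarrow> real. y None - y (Some b)"
  define A where "A y = ?a y ^ n a * ?b y ^ n b" for y :: "'a option \<Rightarrow> real"
  define R where "R y = (\<Prod>l\<in>UNIV - {a} - {b}. (y None - y (Some l)) ^ n l)" for y :: "'a option \<Rightarrow> real"
  define T where "T y = A y * pd None R y" for y
  have ap: "?a \<in> polyfun" and bp: "?b \<in> polyfun" by (intro polyfun_intros)+
  have Ap: "A \<in> polyfun" unfolding A_def by (intro polyfun_intros)
  have Rp: "R \<in> polyfun" unfolding R_def by (intro polyfun_intros)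
  have Tp: "T \<in> polyfun" unfolding T_def by (intro polyfun.mult Ap polyfun_pd Rp)
  have pA: "pd None A y = real (n a) * ?a y ^ (n a - 1) * ?b y ^ n b + real (n b) * ?a y ^ n a * ?b y ^ (n b - 1)" for y
  proof -
    have 1: "pd None ?a y = 1" "pd None ?b y = 1"
      using pd_diff[OF polyfun.coord polyfun.coord, of None None "Some a" y]
        pd_diff[OF polyfun.coord polyfun.coord, of None None "Some b" y] by simp_all
    have "pd None A y = pd None (\<lambda>y. ?a y ^ n a) y * ?b y ^ n b + ?a y ^ n a * pd None (\<lambda>y. ?b y ^ n b) y"
      unfolding A_def by (intro pd_mult polyfun_power ap bp)
    then show ?thesis by (simp only: pd_power'[OF ap] pd_power'[OF bp] 1) (simp add: mult_ac)
  qed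
  have J: "integrand n a y + integrand n b y = pd None A y * R y" for y
    unfolding integrand_split[OF ab] pA using ab by (simp add: algebra_simps R_def)
  define E where "E k = primitive w (integrand n k)" for k
  define S where "S = primitive w T"
  have E: "E k \<in> polyfun" "pd None (E k) y = integrand n k y" for k y
    using primitive[OF polyfun_integrand] by (auto simp: E_def)
  have S: "S \<in> polyfun" "pd None S y = T y" for y using primitive[OF Tp] by (auto simp: S_def)
  define D where "D y = E a y + E b y + S y - A y * R y" for y
  have Dp: "D \<in> polyfun" unfolding D_def by (intro polyfun_diff polyfun.add polyfun.mult E S Ap Rp)
  have "pd None D y = 0" for y
  proof -
    have "pd None D y = pd None (\<lambda>y. E a y + E b y + S y) y - pd None (\<lambda>y. A y * R y) y"
      unfolding D_def by (intro pd_diff polyfun.add polyfun.mult E S Ap Rp)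
    also have "pd None (\<lambda>y. E a y + E b y + S y) y = pd None (\<lambda>y. E a y + E b y) y + pd None S y"
      by (intro pd_add polyfun.add E S)
    also have "pd None (\<lambda>y. E a y + E b y) y = integrand n a y + integrand n b y" by (simp add: pd_add E)
    also have "pd None (\<lambda>y. A y * R y) y = pd None A y * R y + A y * pd None R y" by (rule pd_mult[OF Ap Rp])
    finally show ?thesis by (simp add: J S T_def)
  qed
  then have D: "D (y(None := t)) = D y" for y t by (rule pd_zero_indep[OF Dp])
  have Dab: "D (ev a x) = D (ev b x)" for x using D[of "ev a x" "x b"] by (simp add: ev_upd)
  \<comment> \<open>The boundary terms of the integration by parts vanish since both weights are
    positive.\<close>
  have A0: "A (ev a x) = 0" "A (ev b x) = 0" for x using n[of a] n[of b] by (simp_all add: A_def)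
  have "\<exists>h\<in>polyfun. \<forall>x. S (ev a x) - S (ev b x) = (x a - x b) ^ (n a + n b + 1) * h x"
    unfolding S_def by (rule primitive_pair[OF ab polyfun_pd[OF Rp, of None]]) (simp add: T_def A_def)
  then obtain h where h: "h \<in> polyfun" "\<forall>x. S (ev a x) - S (ev b x) = (x a - x b) ^ (n a + n b + 1) * h x" by blast
  have "(gg n w a a x + gg n w b a x) - (gg n w a b x + gg n w b b x) = (x a - x b) ^ (n a + n b + 1) * - h x" for x
  proof -
    have "(E a (ev a x) + E b (ev a x)) - (E a (ev b x) + E b (ev b x)) = - (S (ev a x) - S (ev b x))"
      using Dab[of x] A0[of x] by (simp add: D_def)
    then show ?thesis using h(2)[rule_format, of x] by (simp only: gg_def E_def mult_minus_right)
  qed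
  then show ?thesis using polyfun_uminus[OF h(1)] by (intro bexI[of _ "\<lambda>x. - h x"] allI)
qed

lemma hom_gg:
  assumes n: "n k \<ge> 1"
  shows "hom (\<Sum>l\<in>UNIV. n l) (gg n w k a)"
proof -
  let ?e = "\<lambda>l. n l - (if l = k then 1 else 0)"
  have "hom (\<Sum>l\<in>UNIV. ?e l) (integrand n k)"
    unfolding integrand_def by (intro hom_cmult hom_prod hom_diff_power) simp
  then have "hom (Suc (\<Sum>l\<in>UNIV. ?e l)) (primitive w (integrand n k))" by (rule hom_primitive)
  moreover have "Suc (\<Sum>l\<in>UNIV. ?e l) = (\<Sum>l\<in>UNIV. n l)"
  proof -
    have "(\<Sum>l\<in>UNIV. ?e l) = ?e k + (\<Sum>l\<in>UNIV - {k}. ?e l)" by (intro sum.remove) auto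
    moreover have "(\<Sum>l\<in>UNIV - {k}. ?e l) = (\<Sum>l\<in>UNIV - {k}. n l)" by (intro sum.cong) auto
    moreover have "(\<Sum>l\<in>UNIV. n l) = n k + (\<Sum>l\<in>UNIV - {k}. n l)" by (intro sum.remove) auto
    ultimately show ?thesis using n by simp
  qed
  ultimately have H: "hom (\<Sum>l\<in>UNIV. n l) (primitive w (integrand n k))" by simp
  have "ev a (\<lambda>i. t * x i) = (\<lambda>i. t * ev a x i)" for t x
    by (auto simp: ev_def fun_eq_iff split: option.split)
  then show ?thesis using H polyfun_gg[of n w k a] unfolding hom_def gg_def by simp
qed

lemma sum_integrand:
  fixes x :: "'a::finite \<Rightarrow> real"
  assumes n: "\<And>a. n a \<ge> 1" and t: "t \<notin> range x"
  shows "(\<Sum>k\<in>UNIV. \<psi> k * integrand n k ((ev w x)(None := t))) =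
    (\<Prod>l\<in>UNIV. (t - x l) ^ n l) * (\<Sum>y\<in>range x. (\<Sum>k | x k = y. real (n k) * \<psi> k) / (t - y))"
proof -
  have "\<psi> k * integrand n k ((ev w x)(None := t)) = (\<Prod>l\<in>UNIV. (t - x l) ^ n l) * (real (n k) * \<psi> k / (t - x k))" for k
  proof -
    let ?g = "\<lambda>l. (t - x l) ^ (n l - (if l = k then 1 else 0))"
    have "(\<Prod>l\<in>UNIV. (t - x l) ^ n l) = (t - x k) ^ n k * (\<Prod>l\<in>UNIV - {k}. (t - x l) ^ n l)"
      by (intro prod.remove) auto
    also have "(\<Prod>l\<in>UNIV - {k}. (t - x l) ^ n l) = (\<Prod>l\<in>UNIV - {k}. ?g l)" by (intro prod.cong) auto
    also have "(t - x k) ^ n k = (t - x k) * ?g k" using n[of k] by (simp add: power_Suc[symmetric] del: power_Suc)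
    also have "(t - x k) * ?g k * (\<Prod>l\<in>UNIV - {k}. ?g l) = (t - x k) * (\<Prod>l\<in>UNIV. ?g l)"
      using prod.remove[of UNIV k ?g] by (simp only: mult.assoc finite UNIV_I)
    finally have "(\<Prod>l\<in>UNIV. (t - x l) ^ n l) = (t - x k) * (\<Prod>l\<in>UNIV. ?g l)" .
    moreover have "t - x k \<noteq> 0" using t by auto
    ultimately show ?thesis by (simp add: integrand_def)
  qed
  then have "(\<Sum>k\<in>UNIV. \<psi> k * integrand n k ((ev w x)(None := t))) =
      (\<Prod>l\<in>UNIV. (t - x l) ^ n l) * (\<Sum>k\<in>UNIV. real (n k) * \<psi> k / (t - x k))"
    by (simp add: sum_distrib_left)
  also have "(\<Sum>k\<in>UNIV. real (n k) * \<psi> k / (t - x k)) =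
      (\<Sum>y\<in>range x. \<Sum>k\<in>{k \<in> UNIV. x k = y}. real (n k) * \<psi> k / (t - x k))"
    by (rule sum.group[symmetric]) auto
  also have "\<dots> = (\<Sum>y\<in>range x. (\<Sum>k | x k = y. real (n k) * \<psi> k) / (t - y))"
    by (intro sum.cong refl) (simp add: sum_divide_distrib)
  finally show ?thesis .
qed

text \<open>The combined integral is a polynomial in its upper end. If it vanishes at all nodes, the
  mean value theorem gives a zero of its derivative between any two of them, and
  \<open>rolle_coefficients\<close> applies. Nodes may coincide, so only sums over equal nodes are
  determined; the conditions for \<open>\<epsilon> a b = - 1\<close> in \<open>Psi\<close> are of
  this form.\<close>

lemma gg_zero_iff:
  fixes x :: "'a::finite \<Rightarrow> real"
  assumes n: "\<And>a. n a \<ge> 1" and zero: "(\<Sum>k\<in>UNIV. real (n k) * \<psi> k) = 0"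
  shows "(\<forall>a. (\<Sum>k\<in>UNIV. \<psi> k * gg n w k a x) = 0) \<longleftrightarrow> (\<forall>y. (\<Sum>k | x k = y. real (n k) * \<psi> k) = 0)"
proof -
  define E where "E k = primitive w (integrand n k)" for k
  have E: "E k \<in> polyfun" "pd None (E k) y = integrand n k y" for k y
    using primitive[OF polyfun_integrand] by (auto simp: E_def)
  define P where "P = (\<Sum>k\<in>UNIV. smult (\<psi> k) (slice None (E k) (ev w x)))"
  have P: "poly P t = (\<Sum>k\<in>UNIV. \<psi> k * E k ((ev w x)(None := t)))" for t
    by (simp add: P_def poly_sum poly_slice[OF E(1)])
  have Pa: "poly P (x a) = (\<Sum>k\<in>UNIV. \<psi> k * gg n w k a x)" for a
    unfolding P by (simp add: ev_upd gg_def E_def)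
  have dP: "poly (pderiv P) t = (\<Sum>k\<in>UNIV. \<psi> k * integrand n k ((ev w x)(None := t)))" for t
  proof -
    have "pderiv P = (\<Sum>k\<in>UNIV. smult (\<psi> k) (pderiv (slice None (E k) (ev w x))))"
      unfolding P_def by (simp add: higher_pderiv_sum[of 1, simplified] pderiv_smult)
    moreover have "poly (pderiv (slice None (E k) (ev w x))) t = integrand n k ((ev w x)(None := t))" for k
      using E(2)[of k "(ev w x)(None := t)"] by (simp add: pd_def slice_upd[OF E(1)])
    ultimately show ?thesis by (simp add: poly_sum)
  qed
  define s where "s y = (\<Sum>k | x k = y. real (n k) * \<psi> k)" for y
  have dPs: "poly (pderiv P) t = (\<Prod>l\<in>UNIV. (t - x l) ^ n l) * (\<Sum>y\<in>range x. s y / (t - y))" if "t \<notin> range x" for t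
    unfolding dP sum_integrand[OF n that] s_def ..
  show ?thesis
  proof
    assume L: "\<forall>a. (\<Sum>k\<in>UNIV. \<psi> k * gg n w k a x) = 0"
    have "s y = 0" if y: "y \<in> range x" for y
    proof (rule rolle_coefficients[OF _ _ _ y])
      have "(\<Sum>y\<in>range x. \<Sum>k\<in>{k \<in> UNIV. x k = y}. real (n k) * \<psi> k) = (\<Sum>k\<in>UNIV. real (n k) * \<psi> k)"
        by (rule sum.group) auto
      then show "(\<Sum>y\<in>range x. s y) = 0" using zero by (simp add: s_def)
      fix a b assume ab: "a \<in> range x" "b \<in> range x" "a < b"
      have "poly P a = 0" "poly P b = 0" using ab Pa L by auto
      moreover obtain \<xi> where \<xi>: "a < \<xi>" "\<xi> < b" "poly P b - poly P a = (b - a) * poly (pderiv P) \<xi>"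
        using poly_MVT[OF ab(3), of P] by blast
      ultimately have "poly (pderiv P) \<xi> = 0" using ab(3) by simp
      then have "(\<Sum>y\<in>range x. s y / (\<xi> - y)) = 0" if "\<xi> \<notin> range x" using dPs[OF that] that by auto
      then show "\<exists>\<xi>. a < \<xi> \<and> \<xi> < b \<and> (\<xi> \<notin> range x \<longrightarrow> (\<Sum>y\<in>range x. s y / (\<xi> - y)) = 0)"
        using \<xi> by blast
    qed simp
    moreover have "s y = 0" if "y \<notin> range x" for y
    proof -
      have "{k. x k = y} = {}" using that by auto
      then show ?thesis by (simp add: s_def)
    qed
    ultimately show "\<forall>y. (\<Sum>k | x k = y. real (n k) * \<psi> k) = 0" unfolding s_def by blast
  next
    \<comment> \<open>Conversely, the derivative is zero off the finitely many nodes, so the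
      integral is constant; its value at \<open>x_w\<close> is 0.\<close>
    assume "\<forall>y. (\<Sum>k | x k = y. real (n k) * \<psi> k) = 0"
    then have "s y = 0" for y by (simp add: s_def)
    then have "- range x \<subseteq> {t. poly (pderiv P) t = 0}" using dPs by auto
    moreover have "infinite (- range x)" by (simp add: infinite_UNIV_char_0 finite_compl)
    ultimately have "pderiv P = 0" using poly_roots_finite finite_subset by blast
    then obtain h where h: "P = [:h:]" using pderiv_iszero by blast
    have "poly P (x w) = 0" unfolding Pa by (simp add: gg_base)
    then show "\<forall>a. (\<Sum>k\<in>UNIV. \<psi> k * gg n w k a x) = 0" unfolding Pa[symmetric] by (simp add: h)
  qed
qed

text \<open>The row of integrals at \<open>w\<close> is zero; in its place stands the linear
  condition of \<open>gg_zero_iff\<close>. Subtracting rows shows that the determinant is divisible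
  by the product over all pairs, and both have the same degree by \<open>sum_pairs\<close>, so the
  quotient is a constant.\<close>

lemma det_gg:
  fixes n :: "'a::finite \<Rightarrow> nat"
  assumes n: "\<And>a. n a \<ge> 1"
  obtains c where "c \<noteq> 0" "\<And>x. det (\<chi> i j. if i = w then real (n j) else gg n w j i x) =
    c * vand pairs (\<lambda>q. n (fst q) + n (snd q)) x"
proof -
  let ?N = "\<lambda>q. n (fst q) + n (snd q)" and ?V = "vand pairs (\<lambda>q. n (fst q) + n (snd q))"
  define M where "M i j = (if i = w then (\<lambda>x. real (n j)) else gg n w j i)" for i j
  define D where "D x = det (\<chi> i j. if i = w then real (n j) else gg n w j i x)" for x
  have DM: "D x = det (\<chi> i j. M i j x)" for x
    unfolding D_def by (rule arg_cong[of _ _ det]) (simp add: vec_eq_iff M_def)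
  define d where "d i = (if i = w then 0 else \<Sum>l\<in>UNIV. n l)" for i
  have "hom (d i) (M i j)" for i j using n by (simp add: d_def M_def hom_one hom_gg)
  then have "hom (\<Sum>i\<in>UNIV. d i) D" unfolding DM by (rule hom_det)
  moreover have "(\<Sum>i\<in>UNIV. d i) = (CARD('a) - 1) * (\<Sum>l\<in>UNIV. n l)"
  proof -
    have "(\<Sum>i\<in>UNIV. d i) = d w + (\<Sum>i\<in>UNIV - {w}. d i)" by (intro sum.remove) auto
    also have "(\<Sum>i\<in>UNIV - {w}. d i) = (\<Sum>i\<in>UNIV - {w}. \<Sum>l\<in>UNIV. n l)"
      by (intro sum.cong) (auto simp: d_def)
    finally show ?thesis by (simp add: d_def card_Diff_singleton)
  qed
  ultimately have homD: "hom (\<Sum>q\<in>pairs. ?N q) D" by (simp add: sum_pairs)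
  have div: "\<exists>k\<in>polyfun. \<forall>x. D x = (x a - x b) ^ ?N (a, b) * k x" if "(a, b) \<in> pairs" for a b
    unfolding D_def fst_conv snd_conv
    by (rule det_pair_divisible[where Z = "gg n w" and c = "\<lambda>j x. real (n j)",
          OF polyfun_gg gg_base polyfun.const pairs_neq[OF that] gg_pair_le[OF pairs_neq[OF that] n]])
  obtain h where h: "h \<in> polyfun" "\<forall>x. D x = ?V x * h x"
    using vand_divides[OF subset_refl hom_polyfun[OF homD] div] by blast
  obtain i :: "'a \<Rightarrow> real" where i: "inj i" using ex_inj_real by blast
  have "D = (\<lambda>x. ?V x * h x)" using h(2) by (intro ext) simp
  then have "hom ((\<Sum>q\<in>pairs. ?N q) + 0) (\<lambda>x. ?V x * h x)" using homD by simp
  then have "hom 0 h" by (rule hom_cancel[OF _ hom_vand h(1) vand_nonzero_inj[OF i subset_refl]])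
  then have const: "h x = h (\<lambda>_. 0)" for x by (rule hom_0_const)
  \<comment> \<open>A kernel vector satisfies the linear condition and annihilates all integrals, so
    \<open>gg_zero_iff\<close> applies; at distinct coordinates each class of equal nodes is a
    single vertex, and the vector is 0.\<close>
  have "D i \<noteq> 0"
  proof
    assume D0: "D i = 0"
    let ?A = "\<chi> a j. if a = w then real (n j) else gg n w j a i"
    have "rank ?A < CARD('a)" using D0 det_eq_0_rank[of ?A] by (simp add: D_def)
    then obtain v where v: "v \<noteq> 0" "?A *v v = 0" using matrix_nonfull_linear_equations_eq[of ?A] by auto
    have comp: "(\<Sum>j\<in>UNIV. (if a = w then real (n j) else gg n w j a i) * v $ j) = 0" for a
      using v(2) by (simp add: vec_eq_iff matrix_vector_mult_def)
    have "(\<Sum>j\<in>UNIV. v $ j * gg n w j a i) = 0" for a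
      using comp[of a] by (cases "a = w") (simp_all add: gg_base mult.commute)
    moreover have s0: "(\<Sum>j\<in>UNIV. real (n j) * v $ j) = 0" using comp[of w] by simp
    ultimately have z: "(\<Sum>k | i k = y. real (n k) * v $ k) = 0" for y
      using gg_zero_iff[OF n s0, of w i] by blast
    have "v $ k = 0" for k
    proof -
      have "{l. i l = i k} = {k}" using injD[OF i] by auto
      then show ?thesis using z[of "i k"] n[of k] by simp
    qed
    then show False using v(1) by (simp add: vec_eq_iff)
  qed
  then have "h (\<lambda>_. 0) \<noteq> 0" using h(2) const[of i] by auto
  moreover have "D x = h (\<lambda>_. 0) * ?V x" for x using h(2) const[of x] by simp
  ultimately show ?thesis using that[of "h (\<lambda>_. 0)"] unfolding D_def by blast
qed

text \<open>\<open>k\<close> is the leading coefficient of the integral with index \<open>a\<close>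
  along \<open>x a = x b\<close>. If it vanished there, \<open>gg_pair_sum\<close> and
  \<open>gg_pair_other\<close> would give all integrals one order more, and the determinant would be
  divisible by a higher power of \<open>x a - x b\<close> than \<open>det_gg\<close>
  permits.\<close>

lemma gg_diag_nonzero:
  fixes n :: "'a::finite \<Rightarrow> nat"
  assumes ab: "a \<noteq> b" and n: "\<And>a. n a \<ge> 1"
    and k: "k \<in> polyfun" "\<And>x. gg n w a a x - gg n w a b x = (x a - x b) ^ (n a + n b) * k x"
  shows "\<exists>x. k (x(a := x b)) \<noteq> 0"
proof (rule ccontr)
  assume "\<not> ?thesis"
  then have k0: "k (x(a := x b)) = 0" for x by simp
  let ?M = "n a + n b" and ?N = "\<lambda>q. n (fst q) + n (snd q)"
  obtain k' where k': "k' \<in> polyfun" "\<And>x. k x = (x a - x b) * k' x"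
    by (rule polyfun_division[OF k(1) polyfun.coord k0]) blast
  have aa: "gg n w a a x - gg n w a b x = (x a - x b) ^ (?M + 1) * k' x" for x
    unfolding k(2) k'(2) by simp
  obtain s where s: "s \<in> polyfun" "\<forall>x. (gg n w a a x + gg n w b a x) - (gg n w a b x + gg n w b b x) =
      (x a - x b) ^ (?M + 1) * s x" using gg_pair_sum[where n = n and w = w, OF ab n] by blast
  have div: "\<exists>h\<in>polyfun. \<forall>x. gg n w j a x - gg n w j b x = (x a - x b) ^ (?M + 1) * h x" for j
  proof -
    consider "j = a" | "j = b" | "j \<noteq> a" "j \<noteq> b" by blast
    then show ?thesis
    proof cases
      case 1
      then show ?thesis using aa k'(1) by blast
    next
      case 2
      have "gg n w b a x - gg n w b b x = (x a - x b) ^ (?M + 1) * (s x - k' x)" for x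
        using aa[of x] s(2)[rule_format, of x] by (simp add: right_diff_distrib)
      moreover have "(\<lambda>x. s x - k' x) \<in> polyfun" by (rule polyfun_diff[OF s(1) k'(1)])
      ultimately show ?thesis unfolding 2 by (intro bexI[of _ "\<lambda>x. s x - k' x"] allI)
    qed (rule gg_pair_other[OF ab])
  qed
  obtain h where h: "h \<in> polyfun" "\<forall>x. det (\<chi> i j. if i = w then real (n j) else gg n w j i x) = (x a - x b) ^ (?M + 1) * h x"
    using det_pair_divisible[where Z = "gg n w" and c = "\<lambda>j x. real (n j)", OF polyfun_gg gg_base polyfun.const ab div] by blast
  obtain c where c: "c \<noteq> 0" "\<And>x. det (\<chi> i j. if i = w then real (n j) else gg n w j i x) = c * vand pairs ?N x"
    by (rule det_gg[where w = w and n = n, OF n]) blast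
  have "(a, b) \<in> pairs \<or> (b, a) \<in> pairs" using pairs_swap[OF ab] by blast
  then obtain V x\<^sub>0 where V: "V \<in> polyfun" "V (x\<^sub>0(a := x\<^sub>0 b)) \<noteq> 0" "\<And>x. vand pairs ?N x = (x a - x b) ^ ?M * V x"
    by (rule vand_split[OF subset_refl, where N = ?N and M = ?M]) auto
  obtain i :: "'a \<Rightarrow> real" where i: "inj i" using ex_inj_real by blast
  have "c * V x = (x a - x b) * h x" for x
  proof (rule polyfun_mult_cancel[where P = "\<lambda>x. (x a - x b) ^ ?M" and p = "\<lambda>x. c * V x"
        and q = "\<lambda>x. (x a - x b) * h x" and a = i])
    show "(i a - i b) ^ ?M \<noteq> 0" using injD[OF i] ab by auto
    show "(x a - x b) ^ ?M * (c * V x) = (x a - x b) ^ ?M * ((x a - x b) * h x)" for x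
      using trans[OF c(2)[of x, symmetric] h(2)[rule_format, of x], unfolded V(3)]
      by (simp only: power_add power_one_right mult_ac)
  qed (intro polyfun_intros V h)+
  from this[of "x\<^sub>0(a := x\<^sub>0 b)"] show False using V(2) c(1) ab by simp
qed

text \<open>Cramer's rule for the system of \<open>det_gg\<close>. The numerators inherit the
  divisibility of rows, so the quotients are polynomials.\<close>

lemma gg_solve:
  fixes n :: "'a::finite \<Rightarrow> nat"
  assumes n: "\<And>a. n a \<ge> 1" and F: "\<And>a. F a \<in> polyfun" "\<And>x. F w x = 0"
    and div: "\<And>a b. a \<noteq> b \<Longrightarrow> \<exists>h\<in>polyfun. \<forall>x. F a x - F b x = (x a - x b) ^ (n a + n b) * h x"
  shows "\<exists>\<psi>. (\<forall>k. \<psi> k \<in> polyfun) \<and> (\<forall>x. (\<Sum>k\<in>UNIV. real (n k) * \<psi> k x) = 0) \<and>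
    (\<forall>a x. (\<Sum>k\<in>UNIV. \<psi> k x * gg n w k a x) = F a x)"
proof -
  let ?N = "\<lambda>q. n (fst q) + n (snd q)" and ?V = "vand pairs (\<lambda>q. n (fst q) + n (snd q))"
  define D where "D k x = det (\<chi> i j. if i = w then (if j = k then 0 else real (n j)) else (if j = k then F i else gg n w j i) x)" for k x
  have Zp: "(if j = k then F i else gg n w j i) \<in> polyfun" for i j k by (simp add: F polyfun_gg)
  have Z0: "(if j = k then F w else gg n w j w) x = 0" for j k x by (simp add: F gg_base)
  have "\<forall>k. \<exists>h. h \<in> polyfun \<and> (\<forall>x. D k x = ?V x * h x)"
  proof
    fix k
    have "\<exists>h\<in>polyfun. \<forall>x. D k x = ?V x * h x"
    proof (rule vand_divides[OF subset_refl])
      have "(\<lambda>x. if i = w then if j = k then 0 else real (n j) else (if j = k then F i else gg n w j i) x) \<in> polyfun" for i j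
        by (cases "i = w") (simp_all add: polyfun.const Zp)
      then show "D k \<in> polyfun" unfolding D_def by (rule polyfun_det)
      fix a b :: 'a assume "(a, b) \<in> pairs"
      note ab = pairs_neq[OF this]
      have dv: "\<exists>h\<in>polyfun. \<forall>x. (if j = k then F a else gg n w j a) x - (if j = k then F b else gg n w j b) x =
          (x a - x b) ^ (n a + n b) * h x" for j
        using div[OF ab] gg_pair_le[where n = n and w = w and k = j, OF ab n] by (cases "j = k") simp_all
      have cp: "(\<lambda>x. if j = k then 0 else real (n j)) \<in> polyfun" for j by (rule polyfun.const)
      show "\<exists>h\<in>polyfun. \<forall>x. D k x = (x a - x b) ^ ?N (a, b) * h x"
        unfolding D_def fst_conv snd_conv
        by (rule det_pair_divisible[where Z = "\<lambda>j i. if j = k then F i else gg n w j i"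
              and c = "\<lambda>j x. if j = k then 0 else real (n j)", OF Zp Z0 cp ab dv])
    qed
    then show "\<exists>h. h \<in> polyfun \<and> (\<forall>x. D k x = ?V x * h x)" by blast
  qed
  then have "\<exists>h. \<forall>k. h k \<in> polyfun \<and> (\<forall>x. D k x = ?V x * h k x)" by (rule choice)
  then obtain h where h: "\<And>k. h k \<in> polyfun" "\<And>k x. D k x = ?V x * h k x" by blast
  obtain c where c: "c \<noteq> 0" "\<And>x. det (\<chi> i j. if i = w then real (n j) else gg n w j i x) = c * ?V x"
    by (rule det_gg[where w = w and n = n, OF n]) blast
  define \<psi> where "\<psi> k x = h k x / c" for k x
  have \<psi>: "\<psi> k \<in> polyfun" for k unfolding \<psi>_def by (intro polyfun_divide_const h)
  obtain i :: "'a \<Rightarrow> real" where "inj i" using ex_inj_real by blast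
  then have i: "?V i \<noteq> 0" by (rule vand_nonzero_inj[OF _ subset_refl])
  have sol: "(\<Sum>j\<in>UNIV. (if a = w then real (n j) else gg n w j a x) * \<psi> j x) = (if a = w then 0 else F a x)"
    if x: "?V x \<noteq> 0" for a x
  proof -
    let ?A = "\<chi> i j. if i = w then real (n j) else gg n w j i x"
    let ?b = "\<chi> i. if i = w then 0 else F i x"
    have "det ?A \<noteq> 0" using x c by simp
    moreover have "(\<chi> k. \<psi> k x) = (\<chi> k. det (\<chi> i j. if j = k then ?b $ i else ?A $ i $ j) / det ?A)"
    proof -
      have "det (\<chi> i j. if j = k then ?b $ i else ?A $ i $ j) = D k x" for k
        unfolding D_def by (rule arg_cong[of _ _ det]) (simp add: vec_eq_iff)
      then show ?thesis using x c by (simp add: vec_eq_iff h(2) \<psi>_def)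
    qed
    ultimately have "?A *v (\<chi> k. \<psi> k x) = ?b" using cramer by blast
    then show ?thesis by (simp add: vec_eq_iff matrix_vector_mult_def)
  qed
  have "(\<Sum>k\<in>UNIV. real (n k) * \<psi> k x) = 0" for x
    by (rule polyfun_generic_zero[OF polyfun_vand[of pairs ?N] _ i])
       (intro polyfun_sum polyfun.mult polyfun.const \<psi>, use sol[of _ w] in simp)
  moreover have "(\<Sum>k\<in>UNIV. \<psi> k x * gg n w k a x) = F a x" for a x
  proof (cases "a = w")
    case False
    show ?thesis
      by (rule polyfun_generic_eq[OF polyfun_vand[of pairs ?N] _ F(1) i])
         (intro polyfun_sum polyfun.mult polyfun_gg \<psi>, use sol[of _ a] False in \<open>simp add: mult.commute\<close>)
  qed (simp add: F gg_base)
  ultimately show ?thesis using \<psi> by blast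
qed

text \<open>Modulo \<open>(x a - x b) ^ (n a + n b + 1)\<close> only the indices \<open>a\<close>
  and \<open>b\<close> contribute. Since their integrals are opposite to each other by
  \<open>gg_pair_sum\<close>, the coefficients enter only through
  \<open>\<psi> a - \<psi> b\<close>.\<close>

lemma gg_difference:
  fixes n :: "'a::finite \<Rightarrow> nat"
  assumes ab: "a \<noteq> b" and n: "\<And>a. n a \<ge> 1" and \<psi>: "\<And>k. \<psi> k \<in> polyfun"
  shows "\<exists>r\<in>polyfun. \<forall>x. (\<Sum>k\<in>UNIV. \<psi> k x * gg n w k a x) - (\<Sum>k\<in>UNIV. \<psi> k x * gg n w k b x) =
    (x a - x b) ^ (n a + n b + 1) * r x + (\<psi> a x - \<psi> b x) * (gg n w a a x - gg n w a b x)"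
proof -
  let ?M = "n a + n b + 1"
  have "\<forall>k\<in>UNIV - {a} - {b}. \<exists>h. h \<in> polyfun \<and> (\<forall>x. gg n w k a x - gg n w k b x = (x a - x b) ^ ?M * h x)"
    using gg_pair_other[OF ab] by blast
  then have "\<exists>h. \<forall>k\<in>UNIV - {a} - {b}. h k \<in> polyfun \<and> (\<forall>x. gg n w k a x - gg n w k b x = (x a - x b) ^ ?M * h k x)"
    by (rule bchoice)
  then obtain h where h: "\<forall>k\<in>UNIV - {a} - {b}. h k \<in> polyfun \<and> (\<forall>x. gg n w k a x - gg n w k b x = (x a - x b) ^ ?M * h k x)"
    by (elim exE)
  obtain s where s: "s \<in> polyfun" "\<forall>x. (gg n w a a x + gg n w b a x) - (gg n w a b x + gg n w b b x) =
      (x a - x b) ^ ?M * s x" using gg_pair_sum[where n = n and w = w, OF ab n] by blast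
  let ?r = "\<lambda>x. (\<Sum>k\<in>UNIV - {a} - {b}. \<psi> k x * h k x) + \<psi> b x * s x"
  have "?r \<in> polyfun" using h by (intro polyfun.add polyfun_sum polyfun.mult \<psi> s) auto
  moreover have "(\<Sum>k\<in>UNIV. \<psi> k x * gg n w k a x) - (\<Sum>k\<in>UNIV. \<psi> k x * gg n w k b x) =
    (x a - x b) ^ ?M * ?r x + (\<psi> a x - \<psi> b x) * (gg n w a a x - gg n w a b x)" for x
  proof -
    define d where "d k = gg n w k a x - gg n w k b x" for k
    have "(\<Sum>k\<in>UNIV. \<psi> k x * gg n w k a x) - (\<Sum>k\<in>UNIV. \<psi> k x * gg n w k b x) = (\<Sum>k\<in>UNIV. \<psi> k x * d k)"
      by (simp add: d_def sum_subtractf right_diff_distrib)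
    also have "\<dots> = \<psi> a x * d a + (\<psi> b x * d b + (\<Sum>k\<in>UNIV - {a} - {b}. \<psi> k x * d k))"
      using sum.remove[of UNIV a "\<lambda>k. \<psi> k x * d k"] sum.remove[of "UNIV - {a}" b "\<lambda>k. \<psi> k x * d k"] ab by simp
    also have "(\<Sum>k\<in>UNIV - {a} - {b}. \<psi> k x * d k) = (\<Sum>k\<in>UNIV - {a} - {b}. (x a - x b) ^ ?M * (\<psi> k x * h k x))"
    proof (rule sum.cong[OF refl])
      fix k assume "k \<in> UNIV - {a} - {b}"
      then have "d k = (x a - x b) ^ ?M * h k x" using h by (auto simp: d_def)
      then show "\<psi> k x * d k = (x a - x b) ^ ?M * (\<psi> k x * h k x)" by simp
    qed
    also have "\<dots> = (x a - x b) ^ ?M * (\<Sum>k\<in>UNIV - {a} - {b}. \<psi> k x * h k x)" by (simp add: sum_distrib_left)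
    also have "\<psi> a x * d a + (\<psi> b x * d b + (x a - x b) ^ ?M * (\<Sum>k\<in>UNIV - {a} - {b}. \<psi> k x * h k x)) =
      (x a - x b) ^ ?M * (\<Sum>k\<in>UNIV - {a} - {b}. \<psi> k x * h k x) + \<psi> b x * (d a + d b) + (\<psi> a x - \<psi> b x) * d a"
      by (simp add: algebra_simps)
    also have "d a + d b = (x a - x b) ^ ?M * s x" using s(2)[rule_format, of x] by (simp add: d_def)
    finally show ?thesis by (simp add: d_def distrib_left mult_ac)
  qed
  ultimately show ?thesis by (intro bexI[of _ ?r] allI)
qed

subsection \<open>Scaling\<close>

text \<open>For positive weights and \<open>\<bar>\<epsilon> a b\<bar> \<le> 1\<close> the sum is at
  least 1, so nothing is truncated.\<close>

definition mm :: "('a \<Rightarrow> nat) \<Rightarrow> ('a \<Rightarrow> 'a \<Rightarrow> int) \<Rightarrow> 'a \<Rightarrow> 'a \<Rightarrow> nat" where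
  "mm n \<epsilon> a b = nat (int (n a) + int (n b) + \<epsilon> a b)"

definition neg :: "('a::finite \<Rightarrow> 'a \<Rightarrow> int) \<Rightarrow> ('a \<times> 'a) set" where
  "neg \<epsilon> = {q \<in> pairs. \<epsilon> (fst q) (snd q) = - 1}"

text \<open>A common denominator: the integrals have at least the order \<open>n a + n b\<close>,
  one too many for the pairs with \<open>\<epsilon> = - 1\<close>.\<close>

definition UU :: "('a::finite \<Rightarrow> 'a \<Rightarrow> int) \<Rightarrow> ('a \<Rightarrow> real) \<Rightarrow> real" where
  "UU \<epsilon> = vand (neg \<epsilon>) (\<lambda>_. 1)"

text \<open>The coefficient vectors \<open>\<psi>\<close> for which \<open>\<Sum>\<^sub>k \<psi>\<^sub>k gg\<^sub>k / UU\<close> is logarithmic.  The conditions are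
  homogeneous in \<open>n\<close>, so that the multiplicities for \<open>n\<close> and \<open>K n\<close> have the same coefficient vectors.\<close>

definition Psi :: "('a::finite \<Rightarrow> nat) \<Rightarrow> ('a \<Rightarrow> 'a \<Rightarrow> int) \<Rightarrow> ('a \<Rightarrow> ('a \<Rightarrow> real) \<Rightarrow> real) set" where
  "Psi n \<epsilon> = {\<psi>. (\<forall>k. \<psi> k \<in> polyfun) \<and> (\<forall>x. (\<Sum>k\<in>UNIV. real (n k) * \<psi> k x) = 0) \<and>
     (\<forall>a b x. a \<noteq> b \<longrightarrow> \<epsilon> a b = 1 \<longrightarrow> x a = x b \<longrightarrow> \<psi> a x = \<psi> b x) \<and>
     (\<forall>a b x. a \<noteq> b \<longrightarrow> \<epsilon> a b = - 1 \<longrightarrow> x a = x b \<longrightarrow> (\<forall>y. (\<Sum>k | x k = y. real (n k) * \<psi> k x) = 0))}"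

lemma PsiD:
  assumes "\<psi> \<in> Psi n \<epsilon>"
  shows "\<psi> k \<in> polyfun" "(\<Sum>k\<in>UNIV. real (n k) * \<psi> k x) = 0"
    "a \<noteq> b \<Longrightarrow> \<epsilon> a b = 1 \<Longrightarrow> x a = x b \<Longrightarrow> \<psi> a x = \<psi> b x"
    "a \<noteq> b \<Longrightarrow> \<epsilon> a b = - 1 \<Longrightarrow> x a = x b \<Longrightarrow> (\<Sum>k | x k = y. real (n k) * \<psi> k x) = 0"
proof -
  note d = assms[unfolded Psi_def mem_Collect_eq]
  show "\<psi> k \<in> polyfun" "(\<Sum>k\<in>UNIV. real (n k) * \<psi> k x) = 0"
    using conjunct1[OF d] conjunct1[OF conjunct2[OF d]] by (simp_all only:)
  show "\<psi> a x = \<psi> b x" if "a \<noteq> b" "\<epsilon> a b = 1" "x a = x b"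
    using conjunct1[OF conjunct2[OF conjunct2[OF d]], rule_format, of a b x, OF that] .
  show "(\<Sum>k | x k = y. real (n k) * \<psi> k x) = 0" if "a \<noteq> b" "\<epsilon> a b = - 1" "x a = x b"
    using conjunct2[OF conjunct2[OF conjunct2[OF d]], rule_format, of a b x y, OF that] .
qed

lemma Psi_scale:
  assumes "K \<ge> 1"
  shows "Psi (\<lambda>a. K * n a) \<epsilon> = Psi n \<epsilon>"
proof -
  have "(\<Sum>k\<in>A. real (K * n k) * \<psi> k x) = real K * (\<Sum>k\<in>A. real (n k) * \<psi> k x)"
    for A and \<psi> :: "'a \<Rightarrow> ('a \<Rightarrow> real) \<Rightarrow> real" and x
    by (simp add: sum_distrib_left mult.assoc)
  then show ?thesis using assms by (simp add: Psi_def)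
qed

lemma Psi_add:
  assumes "\<psi> \<in> Psi n \<epsilon>" "\<phi> \<in> Psi n \<epsilon>"
  shows "(\<lambda>k x. \<psi> k x + \<phi> k x) \<in> Psi n \<epsilon>"
proof -
  note a = PsiD[OF assms(1)] and b = PsiD[OF assms(2)]
  have s: "(\<Sum>k\<in>A. real (n k) * (\<psi> k x + \<phi> k x)) = (\<Sum>k\<in>A. real (n k) * \<psi> k x) + (\<Sum>k\<in>A. real (n k) * \<phi> k x)" for A x
    by (simp add: sum.distrib distrib_left)
  show ?thesis unfolding Psi_def mem_Collect_eq s
    using a b by (intro conjI allI impI polyfun.add) simp_all
qed

lemma Psi_smul:
  assumes "\<psi> \<in> Psi n \<epsilon>" "p \<in> polyfun"
  shows "(\<lambda>k x. p x * \<psi> k x) \<in> Psi n \<epsilon>"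
proof -
  note a = PsiD[OF assms(1)]
  have s: "(\<Sum>k\<in>A. real (n k) * (p x * \<psi> k x)) = p x * (\<Sum>k\<in>A. real (n k) * \<psi> k x)" for A x
    by (simp add: sum_distrib_left mult.left_commute)
  show ?thesis unfolding Psi_def mem_Collect_eq s
    using a assms(2) by (intro conjI allI impI polyfun.mult) simp_all
qed

lemma Psi_zero: "(\<lambda>k x. 0) \<in> Psi n \<epsilon>"
  by (simp add: Psi_def polyfun.const)

lemma UU_nonzero: "\<exists>x. UU (\<epsilon> :: 'a::finite \<Rightarrow> 'a \<Rightarrow> int) x \<noteq> 0"
proof -
  obtain i :: "'a \<Rightarrow> real" where "inj i" using ex_inj_real by blast
  then show ?thesis using vand_nonzero_inj[of i "neg \<epsilon>" "\<lambda>_. 1"] by (auto simp: UU_def neg_def)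
qed

lemma polyfun_UU: "UU \<epsilon> \<in> polyfun"
  unfolding UU_def by (rule polyfun_vand)

lemma UU_cancel:
  assumes "p \<in> polyfun" "q \<in> polyfun" "\<And>x. UU \<epsilon> x * p x = UU \<epsilon> x * q x"
  shows "p x = q x"
proof -
  obtain x\<^sub>0 where "UU \<epsilon> x\<^sub>0 \<noteq> 0" using UU_nonzero[of \<epsilon>] by blast
  then show ?thesis by (rule polyfun_mult_cancel[OF polyfun_UU assms(1,2)]) (rule assms(3))
qed

lemma UU_split:
  assumes "a \<noteq> b" "\<epsilon> a b = - 1" "\<epsilon> b a = - 1"
  obtains V x\<^sub>0 where "V \<in> polyfun" "V (x\<^sub>0(a := x\<^sub>0 b)) \<noteq> 0" "\<And>x. UU \<epsilon> x = (x a - x b) * V x"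
proof -
  have "(a, b) \<in> neg \<epsilon> \<or> (b, a) \<in> neg \<epsilon>" using pairs_swap[OF assms(1)] assms(2,3) by (auto simp: neg_def)
  then obtain V x\<^sub>0 where "V \<in> polyfun" "V (x\<^sub>0(a := x\<^sub>0 b)) \<noteq> 0" "\<And>x. UU \<epsilon> x = (x a - x b) ^ 1 * V x"
    unfolding UU_def by (rule vand_split[where N = "\<lambda>_. 1" and M = 1, rotated]) (auto simp: neg_def)
  then show ?thesis using that by simp
qed

lemma UU_coprime:
  assumes "a \<noteq> b" "\<epsilon> a b \<noteq> - 1" "\<epsilon> b a \<noteq> - 1"
  shows "\<exists>x. UU \<epsilon> (x(a := x b)) \<noteq> 0"
  unfolding UU_def using assms by (intro vand_nonzero_upd) (auto simp: neg_def)

text \<open>On a hyperplane with \<open>\<epsilon> = - 1\<close> the conditions of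
  \<open>Psi\<close> are those of \<open>gg_zero_iff\<close>, so the combined integrals vanish there
  and \<open>UU\<close> divides them. On one with \<open>\<epsilon> = 1\<close> the equality of
  \<open>\<psi> a\<close> and \<open>\<psi> b\<close> supplies the extra order through
  \<open>gg_difference\<close>.\<close>

lemma Psi_to_mul:
  fixes n :: "'a::finite \<Rightarrow> nat"
  assumes n: "\<And>a. n a \<ge> 1" and sym: "\<And>a b. \<epsilon> a b = \<epsilon> b a"
    and \<epsilon>: "\<And>a b. a \<noteq> b \<Longrightarrow> \<bar>\<epsilon> a b\<bar> \<le> 1" and \<psi>: "\<psi> \<in> Psi n \<epsilon>"
  shows "\<exists>f\<in>mulg w (mm n \<epsilon>). \<forall>a x. UU \<epsilon> x * f a x = (\<Sum>k\<in>UNIV. \<psi> k x * gg n w k a x)"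
proof -
  note p = PsiD[OF \<psi>]
  define G where "G a x = (\<Sum>k\<in>UNIV. \<psi> k x * gg n w k a x)" for a x
  have Gp: "G a \<in> polyfun" for a unfolding G_def by (intro polyfun_sum polyfun.mult p polyfun_gg)
  have "\<forall>a. \<exists>h. h \<in> polyfun \<and> (\<forall>x. G a x = UU \<epsilon> x * h x)"
  proof
    fix a
    have "\<exists>h\<in>polyfun. \<forall>x. G a x = vand (neg \<epsilon>) (\<lambda>_. 1) x * h x"
    proof (rule vand_divides[OF _ Gp])
      fix b e assume be: "(b, e) \<in> neg \<epsilon>"
      then have ne: "b \<noteq> e" "\<epsilon> b e = - 1" using pairs_neq by (auto simp: neg_def)
      have "G a (x(b := x e)) = 0" for x
      proof -
        let ?x = "x(b := x e)"
        have "\<forall>y. (\<Sum>k | ?x k = y. real (n k) * \<psi> k ?x) = 0" using p(4)[OF ne, of ?x] ne(1) by simp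
        then show ?thesis unfolding G_def using gg_zero_iff[where n = n, OF n p(2)[of ?x], of w ?x] by blast
      qed
      then obtain h where "h \<in> polyfun" "\<And>x. G a x = (x b - x e) * h x"
        using polyfun_division[OF Gp polyfun.coord[of e]] by blast
      then show "\<exists>k\<in>polyfun. \<forall>x. G a x = (x b - x e) ^ 1 * k x" by auto
    qed (auto simp: neg_def)
    then show "\<exists>h. h \<in> polyfun \<and> (\<forall>x. G a x = UU \<epsilon> x * h x)" unfolding UU_def by blast
  qed
  then have "\<exists>f. \<forall>a. f a \<in> polyfun \<and> (\<forall>x. G a x = UU \<epsilon> x * f a x)" by (rule choice)
  then obtain f where f: "\<And>a. f a \<in> polyfun" "\<And>a x. G a x = UU \<epsilon> x * f a x" by blast
  have "f \<in> mulg w (mm n \<epsilon>)"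
  proof (rule mulgI)
    show "f a \<in> polyfun" for a by (rule f(1))
    have "UU \<epsilon> x * f w x = UU \<epsilon> x * 0" for x unfolding f(2)[symmetric] by (simp add: G_def gg_base)
    then show "f w x = 0" for x by (rule UU_cancel[OF f(1) polyfun.const])
    fix a b :: 'a assume ab: "a \<noteq> b"
    let ?N = "n a + n b + (if \<epsilon> a b = 1 then 1 else 0)"
    obtain r where r: "r \<in> polyfun" "\<forall>x. G a x - G b x =
        (x a - x b) ^ (n a + n b + 1) * r x + (\<psi> a x - \<psi> b x) * (gg n w a a x - gg n w a b x)"
      unfolding G_def using gg_difference[where n = n and w = w and \<psi> = \<psi>, OF ab n p(1)] by blast
    obtain d where d: "d \<in> polyfun" "\<forall>x. gg n w a a x - gg n w a b x = (x a - x b) ^ (n a + n b) * d x"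
      using gg_pair_le[where n = n and w = w and k = a, OF ab n] by blast
    have "\<exists>k\<in>polyfun. \<forall>x. G a x - G b x = (x a - x b) ^ ?N * k x"
    proof (cases "\<epsilon> a b = 1")
      case True
      have "(\<lambda>x. \<psi> a x - \<psi> b x) \<in> polyfun" by (intro polyfun_diff p)
      moreover have "\<psi> a (x(a := x b)) - \<psi> b (x(a := x b)) = 0" for x using p(3)[OF ab True, of "x(a := x b)"] ab by simp
      ultimately obtain t where t: "t \<in> polyfun" "\<And>x. \<psi> a x - \<psi> b x = (x a - x b) * t x"
        using polyfun_division[OF _ polyfun.coord[of b], of "\<lambda>x. \<psi> a x - \<psi> b x" a] by blast
      have "G a x - G b x = (x a - x b) ^ ?N * (r x + t x * d x)" for x
        using r(2)[rule_format, of x] d(2)[rule_format, of x] True unfolding t(2) by (simp add: algebra_simps)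
      moreover have "(\<lambda>x. r x + t x * d x) \<in> polyfun" by (intro polyfun.add polyfun.mult r d t)
      ultimately show ?thesis by (intro bexI[of _ "\<lambda>x. r x + t x * d x"] allI)
    next
      case False
      have "G a x - G b x = (x a - x b) ^ ?N * ((x a - x b) * r x + (\<psi> a x - \<psi> b x) * d x)" for x
        using r(2)[rule_format, of x] d(2)[rule_format, of x] False by (simp add: algebra_simps)
      moreover have "(\<lambda>x. (x a - x b) * r x + (\<psi> a x - \<psi> b x) * d x) \<in> polyfun"
        by (intro polyfun.add polyfun.mult polyfun_diff polyfun.coord r d p)
      ultimately show ?thesis by (intro bexI[of _ "\<lambda>x. (x a - x b) * r x + (\<psi> a x - \<psi> b x) * d x"] allI)
    qed
    then obtain k where k: "k \<in> polyfun" "\<forall>x. G a x - G b x = (x a - x b) ^ ?N * k x" by blast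
    have fk: "UU \<epsilon> x * (f a x - f b x) = (x a - x b) ^ ?N * k x" for x
      using k(2)[rule_format, of x] by (simp add: f(2) right_diff_distrib)
    have fp: "(\<lambda>x. f a x - f b x) \<in> polyfun" by (intro polyfun_diff f)
    show "\<exists>h\<in>polyfun. \<forall>x. f a x - f b x = (x a - x b) ^ mm n \<epsilon> a b * h x"
    proof (cases "\<epsilon> a b = - 1")
      case True
      obtain V x\<^sub>0 where V: "V \<in> polyfun" "V (x\<^sub>0(a := x\<^sub>0 b)) \<noteq> 0" "\<And>x. UU \<epsilon> x = (x a - x b) * V x"
        by (rule UU_split[where \<epsilon> = \<epsilon>, OF ab True]) (use True sym[of a b] in auto)
      have m: "n a + n b = Suc (mm n \<epsilon> a b)" using True n[of a] n[of b] by (simp add: mm_def)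
      have eqV: "V x * (f a x - f b x) = (x a - x b) ^ mm n \<epsilon> a b * k x" for x
      proof (rule polyfun_mult_cancel[where P = "\<lambda>x. x a - x b" and p = "\<lambda>x. V x * (f a x - f b x)"
            and q = "\<lambda>x. (x a - x b) ^ mm n \<epsilon> a b * k x" and a = "\<lambda>c. if c = a then 1 else 0"])
        show "(x a - x b) * (V x * (f a x - f b x)) = (x a - x b) * ((x a - x b) ^ mm n \<epsilon> a b * k x)" for x
          using fk[of x] True m by (simp add: V(3) mult.assoc)
      qed (use ab in \<open>auto intro!: polyfun_intros V k f\<close>)
      show ?thesis
        by (rule polyfun_divisible_coprime[OF V(1,2) polyfun.coord _ fp k(1) eqV]) (use ab in simp)
    next
      case False
      have m: "mm n \<epsilon> a b = ?N" using False \<epsilon>[OF ab] n[of a] n[of b] by (auto simp: mm_def nat_add_distrib)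
      obtain x\<^sub>0 where x0: "UU \<epsilon> (x\<^sub>0(a := x\<^sub>0 b)) \<noteq> 0"
        using UU_coprime[where \<epsilon> = \<epsilon>, OF ab False] False sym[of a b] by auto
      show ?thesis unfolding m
        by (rule polyfun_divisible_coprime[OF polyfun_UU x0 polyfun.coord _ fp k(1) fk]) (use ab in simp)
    qed
  qed
  then show ?thesis using f(2) unfolding G_def by (intro bexI[of _ f] allI) simp_all
qed

text \<open>The coefficients come from \<open>gg_solve\<close>, and the conditions are read off
  along each hyperplane. For \<open>\<epsilon> = 1\<close> the difference
  \<open>\<psi> a - \<psi> b\<close> is multiplied by an integral of exact order
  \<open>n a + n b\<close>, by \<open>gg_diag_nonzero\<close>, and must therefore itself be
  divisible. For \<open>\<epsilon> = - 1\<close> the factor \<open>UU\<close> makes all combined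
  integrals vanish, and \<open>gg_zero_iff\<close> applies.\<close>

lemma mul_to_Psi:
  fixes n :: "'a::finite \<Rightarrow> nat"
  assumes n: "\<And>a. n a \<ge> 1" and sym: "\<And>a b. \<epsilon> a b = \<epsilon> b a"
    and \<epsilon>: "\<And>a b. a \<noteq> b \<Longrightarrow> \<bar>\<epsilon> a b\<bar> \<le> 1" and f: "f \<in> mulg w (mm n \<epsilon>)"
  shows "\<exists>\<psi>\<in>Psi n \<epsilon>. \<forall>a x. UU \<epsilon> x * f a x = (\<Sum>k\<in>UNIV. \<psi> k x * gg n w k a x)"
proof -
  note fD = mulgD[OF f]
  have div: "\<exists>h\<in>polyfun. \<forall>x. UU \<epsilon> x * f a x - UU \<epsilon> x * f b x = (x a - x b) ^ (n a + n b + (if \<epsilon> a b = 1 then 1 else 0)) * h x"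
    if ab: "a \<noteq> b" for a b
  proof -
    obtain h where h: "h \<in> polyfun" "\<forall>x. f a x - f b x = (x a - x b) ^ mm n \<epsilon> a b * h x"
      using fD(3)[OF ab] by blast
    have e: "UU \<epsilon> x * f a x - UU \<epsilon> x * f b x = UU \<epsilon> x * ((x a - x b) ^ mm n \<epsilon> a b * h x)" for x
      using h(2)[rule_format, of x] by (simp only: right_diff_distrib[symmetric])
    show ?thesis
    proof (cases "\<epsilon> a b = - 1")
      case True
      obtain V x\<^sub>0 where V: "V \<in> polyfun" "V (x\<^sub>0(a := x\<^sub>0 b)) \<noteq> 0" "\<And>x. UU \<epsilon> x = (x a - x b) * V x"
        by (rule UU_split[where \<epsilon> = \<epsilon>, OF ab True]) (use True sym[of a b] in auto)
      have m: "n a + n b = Suc (mm n \<epsilon> a b)" using True n[of a] n[of b] by (simp add: mm_def)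
      have "UU \<epsilon> x * f a x - UU \<epsilon> x * f b x = (x a - x b) ^ (n a + n b + (if \<epsilon> a b = 1 then 1 else 0)) * (V x * h x)" for x
        unfolding e unfolding V(3) using True m by simp
      moreover have "(\<lambda>x. V x * h x) \<in> polyfun" by (rule polyfun.mult[OF V(1) h(1)])
      ultimately show ?thesis by (intro bexI[of _ "\<lambda>x. V x * h x"] allI)
    next
      case False
      have m: "mm n \<epsilon> a b = n a + n b + (if \<epsilon> a b = 1 then 1 else 0)"
        using False \<epsilon>[OF ab] n[of a] n[of b] by (auto simp: mm_def nat_add_distrib)
      have "UU \<epsilon> x * f a x - UU \<epsilon> x * f b x = (x a - x b) ^ mm n \<epsilon> a b * (UU \<epsilon> x * h x)" for x
        unfolding e by simp
      moreover have "(\<lambda>x. UU \<epsilon> x * h x) \<in> polyfun" by (rule polyfun.mult[OF polyfun_UU h(1)])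
      ultimately show ?thesis unfolding m by (intro bexI[of _ "\<lambda>x. UU \<epsilon> x * h x"] allI)
    qed
  qed
  have "\<exists>\<psi>. (\<forall>k. \<psi> k \<in> polyfun) \<and> (\<forall>x. (\<Sum>k\<in>UNIV. real (n k) * \<psi> k x) = 0) \<and>
    (\<forall>a x. (\<Sum>k\<in>UNIV. \<psi> k x * gg n w k a x) = (\<lambda>a x. UU \<epsilon> x * f a x) a x)"
  proof (rule gg_solve[where n = n, OF n])
    show "(\<lambda>x. UU \<epsilon> x * f a x) \<in> polyfun" for a by (intro polyfun.mult polyfun_UU fD)
    show "UU \<epsilon> x * f w x = 0" for x by (simp add: fD)
    fix a b :: 'a assume ab: "a \<noteq> b"
    obtain h where h: "h \<in> polyfun" "\<forall>x. UU \<epsilon> x * f a x - UU \<epsilon> x * f b x =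
        (x a - x b) ^ (n a + n b + (if \<epsilon> a b = 1 then 1 else 0)) * h x" using div[OF ab] by blast
    show "\<exists>h\<in>polyfun. \<forall>x. UU \<epsilon> x * f a x - UU \<epsilon> x * f b x = (x a - x b) ^ (n a + n b) * h x"
      by (rule dvd_power_mono[OF h(1) _ h(2)[rule_format]]) simp
  qed
  then obtain \<psi> where p: "\<And>k. \<psi> k \<in> polyfun" "\<And>x. (\<Sum>k\<in>UNIV. real (n k) * \<psi> k x) = 0"
    "\<And>a x. (\<Sum>k\<in>UNIV. \<psi> k x * gg n w k a x) = UU \<epsilon> x * f a x" by blast
  have "\<psi> a x = \<psi> b x" if ab: "a \<noteq> b" and one: "\<epsilon> a b = 1" and x: "x a = x b" for a b x
  proof -
    obtain h where h: "h \<in> polyfun" "\<forall>x. UU \<epsilon> x * f a x - UU \<epsilon> x * f b x =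
        (x a - x b) ^ (n a + n b + (if \<epsilon> a b = 1 then 1 else 0)) * h x" using div[OF ab] by blast
    obtain r where r: "r \<in> polyfun" "\<forall>x. UU \<epsilon> x * f a x - UU \<epsilon> x * f b x =
        (x a - x b) ^ (n a + n b + 1) * r x + (\<psi> a x - \<psi> b x) * (gg n w a a x - gg n w a b x)"
      using gg_difference[where n = n and w = w and \<psi> = \<psi>, OF ab n p(1)] unfolding p(3) by blast
    obtain d where d: "d \<in> polyfun" "\<forall>x. gg n w a a x - gg n w a b x = (x a - x b) ^ (n a + n b) * d x"
      using gg_pair_le[where n = n and w = w and k = a, OF ab n] by blast
    obtain x\<^sub>0 where x0: "d (x\<^sub>0(a := x\<^sub>0 b)) \<noteq> 0"
      using gg_diag_nonzero[where n = n and w = w and k = d, OF ab n d(1) d(2)[rule_format]] by blast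
    have "d x * (\<psi> a x - \<psi> b x) = (x a - x b) * (h x - r x)" for x
    proof (rule polyfun_mult_cancel[where P = "\<lambda>x. (x a - x b) ^ (n a + n b)" and p = "\<lambda>x. d x * (\<psi> a x - \<psi> b x)"
          and q = "\<lambda>x. (x a - x b) * (h x - r x)" and a = "\<lambda>c. if c = a then 1 else 0"])
      show "(x a - x b) ^ (n a + n b) * (d x * (\<psi> a x - \<psi> b x)) = (x a - x b) ^ (n a + n b) * ((x a - x b) * (h x - r x))" for x
        using h(2)[rule_format, of x] r(2)[rule_format, of x] d(2)[rule_format, of x] one
        by (simp add: algebra_simps)
    qed (use ab in \<open>auto intro!: polyfun_intros p d h r\<close>)
    then have "\<exists>h'\<in>polyfun. \<forall>x. \<psi> a x - \<psi> b x = (x a - x b) ^ 1 * h' x"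
      by (intro polyfun_divisible_coprime[where P = d and a = x\<^sub>0 and k = "\<lambda>x. h x - r x" and h = "\<lambda>x. \<psi> a x - \<psi> b x" and q = "\<lambda>x. x b"])
         (use x0 ab in \<open>auto intro!: polyfun_diff polyfun.coord p d h r\<close>)
    then obtain h' where "\<forall>x. \<psi> a x - \<psi> b x = (x a - x b) ^ 1 * h' x" by blast
    from this[rule_format, of x] show ?thesis using x by simp
  qed
  moreover have "(\<Sum>k | x k = y. real (n k) * \<psi> k x) = 0"
    if ab: "a \<noteq> b" and e: "\<epsilon> a b = - 1" and x: "x a = x b" for a b x y
  proof -
    obtain V x\<^sub>0 where V: "\<And>x. UU \<epsilon> x = (x a - x b) * V x"
      by (rule UU_split[where \<epsilon> = \<epsilon>, OF ab e]) (use e sym[of a b] in auto)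
    then have "\<forall>a. (\<Sum>k\<in>UNIV. \<psi> k x * gg n w k a x) = 0" unfolding p(3) using x by simp
    then show ?thesis using gg_zero_iff[where n = n, OF n p(2)[of x], of w x] by blast
  qed
  ultimately have "\<psi> \<in> Psi n \<epsilon>" using p unfolding Psi_def mem_Collect_eq by (intro conjI allI impI)
  then show ?thesis using p(3) by (intro bexI[of _ \<psi>]) auto
qed

text \<open>At distinct coordinates each sum in \<open>gg_zero_iff\<close> consists of the single
  term \<open>n k * \<psi> k\<close>.\<close>

lemma gg_injective:
  fixes n :: "'a::finite \<Rightarrow> nat"
  assumes n: "\<And>a. n a \<ge> 1" and p: "\<And>k. \<psi> k \<in> polyfun" "\<And>x. (\<Sum>k\<in>UNIV. real (n k) * \<psi> k x) = 0"
    and zero: "\<And>a x. (\<Sum>k\<in>UNIV. \<psi> k x * gg n w k a x) = 0"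
  shows "\<psi> k x = 0"
proof -
  obtain i :: "'a \<Rightarrow> real" where i: "inj i" using ex_inj_real by blast
  show ?thesis
  proof (rule polyfun_generic_zero[OF polyfun_vand[of pairs "\<lambda>_. 1"] p(1) vand_nonzero_inj[OF i subset_refl]])
    fix x :: "'a \<Rightarrow> real" assume v: "vand pairs (\<lambda>_. 1) x \<noteq> 0"
    have "x l \<noteq> x k" if "l \<noteq> k" for l
    proof
      assume eq: "x l = x k"
      have "(l, k) \<in> pairs \<or> (k, l) \<in> pairs" using pairs_swap[OF that] by blast
      then have "\<exists>q\<in>pairs. (x (fst q) - x (snd q)) ^ 1 = 0" using eq by force
      then have "vand pairs (\<lambda>_. 1) x = 0" unfolding vand_def by (intro prod_zero) auto
      with v show False by simp
    qed
    then have "{l. x l = x k} = {k}" by auto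
    moreover have "(\<Sum>l | x l = x k. real (n l) * \<psi> l x) = 0"
      using gg_zero_iff[where n = n, OF n p(2)[of x], of w x] zero by blast
    ultimately show "\<psi> k x = 0" using n[of k] by simp
  qed
qed

lemma additive_rel_sum:
  assumes lin: "R 0 0" "\<And>f g f' g'. R f g \<Longrightarrow> R f' g' \<Longrightarrow> R (f + f') (g + g')"
      "\<And>p f g. p \<in> polyfun \<Longrightarrow> R f g \<Longrightarrow> R (p \<odot> f) (p \<odot> g)"
    and "finite J" "\<forall>i\<in>J. R (f i) (g i)" "\<forall>i\<in>J. p i \<in> polyfun"
  shows "R (\<Sum>i\<in>J. p i \<odot> f i) (\<Sum>i\<in>J. p i \<odot> g i)"
  using assms(4-)
proof (induction J rule: finite_induct)
  case empty
  show ?case unfolding sum.empty by (rule lin(1))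
next
  case (insert j J)
  have "R (p j \<odot> f j) (p j \<odot> g j)" by (rule lin(3)) (use insert.prems in auto)
  moreover have "R (\<Sum>i\<in>J. p i \<odot> f i) (\<Sum>i\<in>J. p i \<odot> g i)" by (rule insert.IH) (use insert.prems in auto)
  ultimately show ?case unfolding sum.insert[OF insert.hyps] by (rule lin(2))
qed

text \<open>The linear map is given by its graph, since in the application it is known only through
  a common parameter of both sides.\<close>

lemma gens_le_transfer:
  fixes N :: "('a \<Rightarrow> ('w::finite \<Rightarrow> real) \<Rightarrow> real) set" and M :: "('b \<Rightarrow> ('w \<Rightarrow> real) \<Rightarrow> real) set"
  assumes tot: "\<And>g. g \<in> M \<Longrightarrow> \<exists>f\<in>N. R f g" "\<And>f. f \<in> N \<Longrightarrow> \<exists>g\<in>M. R f g"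
    and fnl: "\<And>f g g'. R f g \<Longrightarrow> R f g' \<Longrightarrow> g = g'"
    and lin: "R 0 0" "\<And>f g f' g'. R f g \<Longrightarrow> R f' g' \<Longrightarrow> R (f + f') (g + g')"
      "\<And>p f g. p \<in> polyfun \<Longrightarrow> R f g \<Longrightarrow> R (p \<odot> f) (p \<odot> g)"
    and gens: "gens_le r N"
  shows "gens_le r M"
proof (rule gens_leI)
  fix I :: "nat set" and w assume I: "finite I" "card I = Suc r" and w: "\<And>i. i \<in> I \<Longrightarrow> w i \<in> M"
  note Rsum = additive_rel_sum[where R = R, OF lin]
  have "\<forall>i\<in>I. \<exists>v. v \<in> N \<and> R v (w i)" using tot(1) w by blast
  then have "\<exists>v. \<forall>i\<in>I. v i \<in> N \<and> R (v i) (w i)" by (rule bchoice)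
  then obtain v where v: "\<forall>i\<in>I. v i \<in> N \<and> R (v i) (w i)" by (elim exE)
  obtain c where c: "\<exists>i\<in>I. c i \<noteq> 0" "(\<Sum>i\<in>I. (\<lambda>_. c i) \<odot> v i) \<in> coordideal UNIV N"
    by (rule gens_leD[OF gens I, of v]) (use v in auto)
  obtain m where m: "\<forall>j\<in>UNIV. m j \<in> N" "(\<Sum>i\<in>I. (\<lambda>_. c i) \<odot> v i) = (\<Sum>j\<in>UNIV. (\<lambda>x. x j) \<odot> m j)"
    by (rule coordidealE'[OF c(2)])
  have "\<forall>j\<in>UNIV. \<exists>g. g \<in> M \<and> R (m j) g" using tot(2) m(1) by blast
  then have "\<exists>m'. \<forall>j\<in>UNIV. m' j \<in> M \<and> R (m j) (m' j)" by (rule bchoice)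
  then obtain m' where m': "\<forall>j\<in>UNIV. m' j \<in> M \<and> R (m j) (m' j)" by (elim exE)
  have "R (\<Sum>j\<in>UNIV. (\<lambda>x. x j) \<odot> m j) (\<Sum>j\<in>UNIV. (\<lambda>x. x j) \<odot> m' j)"
    using m' by (intro Rsum) (auto simp: polyfun.coord)
  moreover have "R (\<Sum>i\<in>I. (\<lambda>_. c i) \<odot> v i) (\<Sum>i\<in>I. (\<lambda>_. c i) \<odot> w i)"
    using v I(1) by (intro Rsum) (auto simp: polyfun.const)
  ultimately have "(\<Sum>i\<in>I. (\<lambda>_. c i) \<odot> w i) = (\<Sum>j\<in>UNIV. (\<lambda>x. x j) \<odot> m' j)"
    unfolding m(2) by (intro fnl)
  also have "\<dots> \<in> coordideal UNIV M" using m' by (intro coordidealI) auto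
  finally show "\<exists>c. (\<exists>i\<in>I. c i \<noteq> 0) \<and> (\<Sum>i\<in>I. (\<lambda>_. c i) \<odot> w i) \<in> coordideal UNIV M"
    using c(1) by (intro exI[of _ c] conjI)
qed

text \<open>The isomorphism keeps the coefficient vector and exchanges the integrals. It changes
  degrees, to which \<open>gens_le\<close> does not refer.\<close>

lemma gens_le_scale:
  fixes n :: "'a::finite \<Rightarrow> nat"
  assumes n: "\<And>a. n a \<ge> 1" and sym: "\<And>a b. \<epsilon> a b = \<epsilon> b a"
    and \<epsilon>: "\<And>a b. a \<noteq> b \<Longrightarrow> \<bar>\<epsilon> a b\<bar> \<le> 1" and K: "K \<ge> 1"
    and gens: "gens_le r (mulg w (mm (\<lambda>a. K * n a) \<epsilon>))"
  shows "gens_le r (mulg w (mm n \<epsilon>))"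
proof -
  let ?k = "\<lambda>a. K * n a"
  have kn: "?k a \<ge> 1" for a using K n[of a] by simp
  define R where "R F f \<longleftrightarrow> (\<exists>\<psi>\<in>Psi n \<epsilon>. (\<forall>a. F a \<in> polyfun) \<and> (\<forall>a. f a \<in> polyfun) \<and>
      (\<forall>a x. UU \<epsilon> x * F a x = (\<Sum>k\<in>UNIV. \<psi> k x * gg ?k w k a x)) \<and>
      (\<forall>a x. UU \<epsilon> x * f a x = (\<Sum>k\<in>UNIV. \<psi> k x * gg n w k a x)))" for F f
  show ?thesis
  proof (rule gens_le_transfer[where R = R, OF _ _ _ _ _ _ gens])
    fix f assume f: "f \<in> mulg w (mm n \<epsilon>)"
    obtain \<psi> where p: "\<psi> \<in> Psi n \<epsilon>" "\<forall>a x. UU \<epsilon> x * f a x = (\<Sum>k\<in>UNIV. \<psi> k x * gg n w k a x)"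
      using mul_to_Psi[where n = n and \<epsilon> = \<epsilon>, OF n sym \<epsilon> f] by blast
    obtain F where F: "F \<in> mulg w (mm ?k \<epsilon>)" "\<forall>a x. UU \<epsilon> x * F a x = (\<Sum>k\<in>UNIV. \<psi> k x * gg ?k w k a x)"
      using Psi_to_mul[where n = ?k and \<epsilon> = \<epsilon> and w = w and \<psi> = \<psi>, OF kn sym \<epsilon>] p(1) unfolding Psi_scale[OF K] by blast
    have "R F f" unfolding R_def using p F(2) mulgD(1)[OF f] mulgD(1)[OF F(1)] by (intro bexI[of _ \<psi>] conjI allI) auto
    with F(1) show "\<exists>F\<in>mulg w (mm ?k \<epsilon>). R F f" by blast
  next
    fix F assume F: "F \<in> mulg w (mm ?k \<epsilon>)"
    obtain \<psi> where p: "\<psi> \<in> Psi n \<epsilon>" "\<forall>a x. UU \<epsilon> x * F a x = (\<Sum>k\<in>UNIV. \<psi> k x * gg ?k w k a x)"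
      using mul_to_Psi[where n = ?k and \<epsilon> = \<epsilon>, OF kn sym \<epsilon> F] unfolding Psi_scale[OF K] by blast
    obtain f where f: "f \<in> mulg w (mm n \<epsilon>)" "\<forall>a x. UU \<epsilon> x * f a x = (\<Sum>k\<in>UNIV. \<psi> k x * gg n w k a x)"
      using Psi_to_mul[where n = n and \<epsilon> = \<epsilon> and w = w, OF n sym \<epsilon> p(1)] by blast
    have "R F f" unfolding R_def using p f(2) mulgD(1)[OF F] mulgD(1)[OF f(1)] by (intro bexI[of _ \<psi>] conjI allI) auto
    with f(1) show "\<exists>f\<in>mulg w (mm n \<epsilon>). R F f" by blast
  next
    fix F f f' assume "R F f" "R F f'"
    then obtain \<psi> \<phi> where p: "\<psi> \<in> Psi n \<epsilon>" "\<phi> \<in> Psi n \<epsilon>" and fp: "\<forall>a. f a \<in> polyfun" "\<forall>a. f' a \<in> polyfun"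
      and e: "\<forall>a x. UU \<epsilon> x * F a x = (\<Sum>k\<in>UNIV. \<psi> k x * gg ?k w k a x)"
        "\<forall>a x. UU \<epsilon> x * F a x = (\<Sum>k\<in>UNIV. \<phi> k x * gg ?k w k a x)"
        "\<forall>a x. UU \<epsilon> x * f a x = (\<Sum>k\<in>UNIV. \<psi> k x * gg n w k a x)"
        "\<forall>a x. UU \<epsilon> x * f' a x = (\<Sum>k\<in>UNIV. \<phi> k x * gg n w k a x)"
      unfolding R_def by (elim bexE conjE) blast
    have "\<psi> k x - \<phi> k x = 0" for k x
    proof (rule gg_injective[where n = ?k and \<psi> = "\<lambda>k x. \<psi> k x - \<phi> k x" and w = w])
      show "?k a \<ge> 1" for a by (rule kn)
      show "(\<lambda>x. \<psi> k x - \<phi> k x) \<in> polyfun" for k by (intro polyfun_diff PsiD(1)[OF p(1)] PsiD(1)[OF p(2)])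
      show "(\<Sum>k\<in>UNIV. real (?k k) * (\<psi> k x - \<phi> k x)) = 0" for x
      proof -
        have "(\<Sum>k\<in>UNIV. real (?k k) * (\<psi> k x - \<phi> k x)) =
            real K * ((\<Sum>k\<in>UNIV. real (n k) * \<psi> k x) - (\<Sum>k\<in>UNIV. real (n k) * \<phi> k x))"
          by (simp add: sum_distrib_left sum_subtractf[symmetric] algebra_simps)
        then show ?thesis using PsiD(2)[OF p(1), of x] PsiD(2)[OF p(2), of x] by simp
      qed
      show "(\<Sum>k\<in>UNIV. (\<psi> k x - \<phi> k x) * gg ?k w k a x) = 0" for a x
        using e(1)[rule_format, of x a] e(2)[rule_format, of x a] by (simp add: left_diff_distrib sum_subtractf)
    qed
    then have eq: "\<psi> k x = \<phi> k x" for k x by simp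
    have "f a x = f' a x" for a x
      by (rule UU_cancel[of "f a" "f' a" \<epsilon>]) (use fp e(3,4) eq in auto)
    then show "f = f'" by (intro ext)
  next
    show "R 0 0" unfolding R_def by (intro bexI[OF _ Psi_zero]) (simp add: polyfun_zero)
  next
    fix F f F' f' assume "R F f" "R F' f'"
    then obtain \<psi> \<phi> where p: "\<psi> \<in> Psi n \<epsilon>" "\<phi> \<in> Psi n \<epsilon>" and fp: "\<forall>a. F a \<in> polyfun" "\<forall>a. f a \<in> polyfun"
        "\<forall>a. F' a \<in> polyfun" "\<forall>a. f' a \<in> polyfun"
      and e: "\<forall>a x. UU \<epsilon> x * F a x = (\<Sum>k\<in>UNIV. \<psi> k x * gg ?k w k a x)"
        "\<forall>a x. UU \<epsilon> x * F' a x = (\<Sum>k\<in>UNIV. \<phi> k x * gg ?k w k a x)"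
        "\<forall>a x. UU \<epsilon> x * f a x = (\<Sum>k\<in>UNIV. \<psi> k x * gg n w k a x)"
        "\<forall>a x. UU \<epsilon> x * f' a x = (\<Sum>k\<in>UNIV. \<phi> k x * gg n w k a x)"
      unfolding R_def by (elim bexE conjE) blast
    show "R (F + F') (f + f')" unfolding R_def
      using fp e by (intro bexI[OF _ Psi_add[OF p]])
        (simp add: polyfun_apply_add distrib_left distrib_right sum.distrib)
  next
    fix p :: "('a \<Rightarrow> real) \<Rightarrow> real" and F f assume pp: "p \<in> polyfun" and "R F f"
    then obtain \<psi> where p: "\<psi> \<in> Psi n \<epsilon>" and fp: "\<forall>a. F a \<in> polyfun" "\<forall>a. f a \<in> polyfun"
      and e: "\<forall>a x. UU \<epsilon> x * F a x = (\<Sum>k\<in>UNIV. \<psi> k x * gg ?k w k a x)"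
        "\<forall>a x. UU \<epsilon> x * f a x = (\<Sum>k\<in>UNIV. \<psi> k x * gg n w k a x)"
      unfolding R_def by (elim bexE conjE) blast
    have s: "(\<Sum>k\<in>UNIV. p x * \<psi> k x * g k) = p x * (\<Sum>k\<in>UNIV. \<psi> k x * g k)" for x and g :: "'a \<Rightarrow> real"
      by (simp add: sum_distrib_left mult.assoc)
    show "R (p \<odot> F) (p \<odot> f)" unfolding R_def
      using fp e by (intro bexI[OF _ Psi_smul[OF p pp]]) (simp add: polyfun_vsmul pp s mult.left_commute)
  qed
qed

section \<open>Independence of the weights\<close>

lemma mulg_cong: "(\<And>a b. a \<noteq> b \<Longrightarrow> m a b = m' a b) \<Longrightarrow> mulg w m = mulg w m'"
  by (auto simp: mulg_def mul_def)

lemma mm_int: "n a \<ge> 1 \<Longrightarrow> n b \<ge> 1 \<Longrightarrow> \<bar>\<epsilon> a b\<bar> \<le> 1 \<Longrightarrow> int (mm n \<epsilon> a b) = int (n a) + int (n b) + \<epsilon> a b"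
  by (simp add: mm_def)

text \<open>The extreme case is \<open>n w = 1\<close> with \<open>\<epsilon> a b = 1\<close> and
  \<open>\<epsilon> w a = \<epsilon> w b = - 1\<close>, where both sides are equal.\<close>

lemma mm_triangle:
  assumes n: "\<And>a. n a \<ge> 1" and \<epsilon>: "\<And>a b. a \<noteq> b \<Longrightarrow> \<bar>\<epsilon> a b\<bar> \<le> 1"
    and "a \<noteq> w" "b \<noteq> w" "a \<noteq> b"
  shows "mm n \<epsilon> a b \<le> mm n \<epsilon> w a + mm n \<epsilon> w b + 1"
proof -
  have e: "\<bar>\<epsilon> a b\<bar> \<le> 1" "\<bar>\<epsilon> w a\<bar> \<le> 1" "\<bar>\<epsilon> w b\<bar> \<le> 1" using \<epsilon> assms(3-5) by auto
  have "int (mm n \<epsilon> a b) \<le> int (mm n \<epsilon> w a) + int (mm n \<epsilon> w b) + 1"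
    unfolding mm_int[of n a b \<epsilon>, OF n n e(1)] mm_int[of n w a \<epsilon>, OF n n e(2)] mm_int[of n w b \<epsilon>, OF n n e(3)]
    using e n[of w] by linarith
  then show ?thesis by linarith
qed

text \<open>Raising the weight of \<open>v\<close> raises exactly the multiplicities of the pairs at
  \<open>v\<close>; for the derivative in \<open>x_v\<close> the gauge is moved to \<open>v\<close>
  and afterwards back to \<open>w\<close>.\<close>

lemma gens_le_raise_weight:
  fixes n :: "'a::finite \<Rightarrow> nat"
  assumes n: "\<And>a. n a \<ge> 1" and sym: "\<And>a b. \<epsilon> a b = \<epsilon> b a"
    and \<epsilon>: "\<And>a b. a \<noteq> b \<Longrightarrow> \<bar>\<epsilon> a b\<bar> \<le> 1"
    and gens: "gens_le (CARD('a) - 1) (mulg w (mm n \<epsilon>))"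
  shows "gens_le (CARD('a) - 1) (mulg w (mm (n(v := Suc (n v))) \<epsilon>))"
proof -
  have "gens_le (CARD('a) - 1) (mulg v (mm n \<epsilon>))"
    using gens gens_le_mulg[where r = "CARD('a) - 1" and w = w and m = "mm n \<epsilon>"]
      gens_le_mulg[where r = "CARD('a) - 1" and w = v and m = "mm n \<epsilon>"] by metis
  then have "gens_le (CARD('a) - 1) (mulg v (raise v (mm n \<epsilon>)))"
  proof (rule gens_le_raise)
    show "mm n \<epsilon> a b = mm n \<epsilon> b a" for a b using sym[of a b] by (simp add: mm_def add.commute)
    fix a b assume ab: "a \<noteq> v" "b \<noteq> v" "a \<noteq> b"
    show "mm n \<epsilon> a b \<le> mm n \<epsilon> v a + mm n \<epsilon> v b + 1"
      by (rule mm_triangle[where n = n, OF n \<epsilon> ab])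
  qed
  moreover have "raise v (mm n \<epsilon>) a b = mm (n(v := Suc (n v))) \<epsilon> a b" if "a \<noteq> b" for a b
  proof -
    have "int (raise v (mm n \<epsilon>) a b) = int (mm (n(v := Suc (n v))) \<epsilon> a b)"
      using mm_int[of n a b \<epsilon>] mm_int[of "n(v := Suc (n v))" a b \<epsilon>] n[of a] n[of b] \<epsilon>[OF that] that
      by (cases "a = v"; cases "b = v") (simp_all add: raise_def)
    then show ?thesis by simp
  qed
  then have "mulg v (raise v (mm n \<epsilon>)) = mulg v (mm (n(v := Suc (n v))) \<epsilon>)" by (rule mulg_cong)
  ultimately show ?thesis
    using gens_le_mulg[where r = "CARD('a) - 1" and w = w and m = "mm (n(v := Suc (n v))) \<epsilon>"]
      gens_le_mulg[where r = "CARD('a) - 1" and w = v and m = "mm (n(v := Suc (n v))) \<epsilon>"] by metis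
qed

lemma gens_le_raise_weights:
  fixes n n' :: "'a::finite \<Rightarrow> nat"
  assumes sym: "\<And>a b. \<epsilon> a b = \<epsilon> b a" and \<epsilon>: "\<And>a b. a \<noteq> b \<Longrightarrow> \<bar>\<epsilon> a b\<bar> \<le> 1"
  shows "(\<And>a. n a \<ge> 1) \<Longrightarrow> (\<And>a. n a \<le> n' a) \<Longrightarrow> gens_le (CARD('a) - 1) (mulg w (mm n \<epsilon>)) \<Longrightarrow>
    gens_le (CARD('a) - 1) (mulg w (mm n' \<epsilon>))"
proof (induction "\<Sum>a\<in>UNIV. n' a - n a" arbitrary: n)
  case 0
  then have "n' a = n a" for a by (simp add: le_antisym)
  then have "n' = n" by (rule ext)
  then show ?case using 0 by simp
next
  case (Suc d)
  have "\<exists>v. n' v - n v \<noteq> 0"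
  proof (rule ccontr)
    assume "\<nexists>v. n' v - n v \<noteq> 0"
    then have "(\<Sum>a\<in>UNIV. n' a - n a) = 0" by simp
    with Suc(2) show False by simp
  qed
  then obtain v where v: "n' v - n v \<noteq> 0" by blast
  let ?n = "n(v := Suc (n v))"
  have "(\<Sum>a\<in>UNIV. n' a - n a) = (n' v - n v) + (\<Sum>a\<in>UNIV - {v}. n' a - n a)" by (intro sum.remove) auto
  moreover have "(\<Sum>a\<in>UNIV. n' a - ?n a) = (n' v - ?n v) + (\<Sum>a\<in>UNIV - {v}. n' a - ?n a)" by (intro sum.remove) auto
  moreover have "(\<Sum>a\<in>UNIV - {v}. n' a - ?n a) = (\<Sum>a\<in>UNIV - {v}. n' a - n a)" by (intro sum.cong) auto
  ultimately have "d = (\<Sum>a\<in>UNIV. n' a - ?n a)" using Suc(2) v by simp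
  moreover have "?n a \<ge> 1" "?n a \<le> n' a" for a using Suc.prems(1,2)[of a] v by (auto simp: fun_upd_apply)
  ultimately show ?case
    using Suc.hyps(1)[of ?n] gens_le_raise_weight[where n = n and \<epsilon> = \<epsilon> and w = w and v = v, OF Suc.prems(1) sym \<epsilon> Suc.prems(3)] by blast
qed

theorem gens_le_weights:
  fixes n n' :: "'a::finite \<Rightarrow> nat"
  assumes sym: "\<And>a b. \<epsilon> a b = \<epsilon> b a" and \<epsilon>: "\<And>a b. a \<noteq> b \<Longrightarrow> \<bar>\<epsilon> a b\<bar> \<le> 1"
    and n: "\<And>a. n a \<ge> 1" "\<And>a. n' a \<ge> 1" and gens: "gens_le (CARD('a) - 1) (mulg w (mm n \<epsilon>))"
  shows "gens_le (CARD('a) - 1) (mulg w (mm n' \<epsilon>))"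
proof -
  \<comment> \<open>Any positive \<open>K\<close> with \<open>n a \<le> K * n' a\<close> for all
    \<open>a\<close> would do; the sum bounds every single weight.\<close>
  define K where "K = (\<Sum>a\<in>UNIV. n a)"
  have le: "n a \<le> K" for a unfolding K_def by (rule member_le_sum) auto
  have K: "K \<ge> 1" using le[of w] n(1)[of w] by simp
  have "n a \<le> K * n' a" for a
    by (rule order.trans[OF le]) (use n(2)[of a] in simp)
  then have g: "gens_le (CARD('a) - 1) (mulg w (mm (\<lambda>a. K * n' a) \<epsilon>))"
    by (intro gens_le_raise_weights[where \<epsilon> = \<epsilon> and n = n and n' = "\<lambda>a. K * n' a", OF sym \<epsilon> n(1) _ gens])
  show ?thesis by (rule gens_le_scale[where n = n' and \<epsilon> = \<epsilon> and K = K, OF n(2) sym \<epsilon> K g])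
qed

section \<open>Descent along a shift\<close>

lemma nab_at_infinity:
  assumes "p \<in> polyfun" "x None = 0"
  shows "nab (Some w) p x = pd (Some w) p x"
  using assms(1)
proof (induction rule: polyfun.induct)
  case (const c)
  have "nab (Some w) (\<lambda>x. c) = (\<lambda>x. 0)" by (rule nab_unique) (simp_all add: polyfun.const)
  then show ?case by simp
next
  case (coord j)
  have "nab (Some w) (\<lambda>x. x j) = (\<lambda>x. if j = Some w then 1 else 0)"
    by (rule nab_unique) (simp_all add: polyfun.const polyfun.coord fun_upd_apply)
  then show ?case by simp
next
  case (add p q)
  have "nab (Some w) (\<lambda>x. p x + q x) = (\<lambda>x. nab (Some w) p x + nab (Some w) q x)"
    using add nab[of p] nab[of q] by (intro nab_unique polyfun.add) (simp_all add: distrib_left)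
  then show ?case using add by (simp add: pd_add)
next
  case (mult p q)
  let ?s = "\<lambda>x :: 'a option \<Rightarrow> real. x(Some w := x (Some w) - x None)"
  have sp: "(\<lambda>x. p (?s x)) \<in> polyfun"
    by (rule polyfun_compose_upd[OF mult(1)]) (intro polyfun_intros)
  have "nab (Some w) (\<lambda>x. p x * q x) = (\<lambda>x. nab (Some w) p x * q x + p (?s x) * nab (Some w) q x)"
  proof (rule nab_unique)
    show "(\<lambda>x. nab (Some w) p x * q x + p (?s x) * nab (Some w) q x) \<in> polyfun"
      by (intro polyfun.add polyfun.mult nab mult sp)
    fix x
    have "x None * (nab (Some w) p x * q x + p (?s x) * nab (Some w) q x) =
        (x None * nab (Some w) p x) * q x + p (?s x) * (x None * nab (Some w) q x)"
      by (simp add: algebra_simps)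
    then show "x None * (nab (Some w) p x * q x + p (?s x) * nab (Some w) q x) = p x * q x - p (?s x) * q (?s x)"
      unfolding nab(2)[OF mult(1)] nab(2)[OF mult(2)] by (simp add: algebra_simps)
  qed (intro polyfun.mult mult)
  moreover have "?s x = x" using assms(2) by simp
  ultimately show ?case using mult by (simp add: pd_mult)
qed

lemma at_infinity0_nabv:
  assumes "\<And>a. F a \<in> polyfun"
  shows "at_infinity0 (nabv w F) = pdv w (at_infinity0 F)"
proof (intro ext)
  fix a x
  have "(extend0 None Some x)(Some w := t) = extend0 None Some (x(w := t))" for t
  proof
    fix i show "((extend0 None Some x)(Some w := t)) i = extend0 None Some (x(w := t)) i"
      by (cases i) (auto simp: fun_upd_apply)
  qed
  then have "pd w (\<lambda>x. F a (extend0 None Some x)) x = pd (Some w) (F a) (extend0 None Some x)"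
    using pd_eqI[of "slice (Some w) (F a) (extend0 None Some x)" "\<lambda>x. F a (extend0 None Some x)" x w]
    by (simp add: poly_slice[OF assms] pd_def)
  moreover have "restrict0 None Some F a = (\<lambda>x. F a (extend0 None Some x))" by (rule ext) simp
  ultimately show "at_infinity0 (nabv w F) a x = pdv w (at_infinity0 F) a x"
    using nab_at_infinity[OF assms, of "extend0 None Some x" w a] by (simp add: nabv_def pdv_def)
qed

text \<open>Surjectivity at infinity for \<open>l\<close>: integrate \<open>f\<close>, lift the
  result to the shifted arrangement, which is free, and apply the difference quotient, whose
  restriction is the derivative.\<close>

theorem gens_le_unshift_aff:
  fixes w :: "'a::finite"
  assumes gens: "gens_le (CARD('a) - 1) (affg w (shift_at w l))"
    and W: "gens_le (CARD('a) - 1) (mulg w (mult_of (shift_at w l))) \<Longrightarrow> gens_le (CARD('a) - 1) (mulg w (mult_of l))"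
    and le: "\<And>a. a \<noteq> w \<Longrightarrow> l w a + l a w \<le> 1"
    and range: "\<And>a b. a \<noteq> w \<Longrightarrow> b \<noteq> w \<Longrightarrow> a \<noteq> b \<Longrightarrow> mult_of l a b \<le> mult_of l w a + mult_of l w b + 1"
  shows "gens_le (CARD('a) - 1) (affg w l)"
proof -
  let ?l = "shift_at w l"
  obtain g d where B: "hbasis (CARD('a) - 1) (affg w ?l) g d"
    using ex_hbasis[OF graded_module_affg full_rank_affg gens_le_hom_if_gens_le[OF gens]] by blast
  note lift = at_infinity0_surj[OF B]
  have M: "gens_le (CARD('a) - 1) (mulg w (mult_of l))"
    by (rule W, rule gens_le_restrict_imp[OF inj_Some range_Some at_infinity0_affg lift gens])
  have "raise w (mult_of l) a b = mult_of ?l a b" if "a \<noteq> b" for a b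
    using that le[of a] le[of b] by (auto simp: raise_def mult_of_def shift_at_def)
  then have raise: "mulg w (raise w (mult_of l)) = mulg w (mult_of ?l)" by (rule mulg_cong)
  show ?thesis
  proof (rule gens_le_restrict_conv[OF inj_Some range_Some at_infinity0_affg _ graded_module_affg affg_saturated M])
    fix f assume f: "f \<in> mulg w (mult_of l)"
    have "\<exists>h\<in>mulg w (raise w (mult_of l)). pdv w h = f"
      by (rule pdv_surj[OF f _ range]) (simp add: mult_of_def)
    then obtain h where h: "h \<in> mulg w (mult_of ?l)" "pdv w h = f" unfolding raise by blast
    obtain F where F: "F \<in> affg w ?l" "at_infinity0 F = h" using lift[OF h(1)] by blast
    have "at_infinity0 (nabv w F) = f"
      using at_infinity0_nabv[of F w] gm_polyfun[OF graded_module_affg F(1)] F(2) h(2) by simp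
    then show "\<exists>F\<in>affg w l. at_infinity0 F = f" using nabv_mem[OF F(1)] by blast
  qed
qed

text \<open>The weights \<open>n\<close> place the multirestriction in the family covered by
  \<open>gens_le_weights\<close>; the shift at \<open>w\<close> raises \<open>n w\<close> by one and
  leaves \<epsilon> unchanged.\<close>

theorem gens_le_shift_iff:
  fixes w :: "'a::finite" and n :: "'a \<Rightarrow> nat"
  assumes le: "\<And>a. a \<noteq> w \<Longrightarrow> l w a + l a w \<le> 1"
    and tri: "\<And>a b. a \<noteq> w \<Longrightarrow> b \<noteq> w \<Longrightarrow> a \<noteq> b \<Longrightarrow> l a w + l w b \<le> l a b + 1"
    and n: "\<And>a. n a \<ge> 1"
    and bal: "\<And>a b. a \<noteq> b \<Longrightarrow> \<bar>1 - l a b - l b a - int (n a) - int (n b)\<bar> \<le> 1"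
  shows "gens_le (CARD('a) - 1) (affg w (shift_at w l)) \<longleftrightarrow> gens_le (CARD('a) - 1) (affg w l)"
proof
  assume g: "gens_le (CARD('a) - 1) (affg w l)"
  show "gens_le (CARD('a) - 1) (affg w (shift_at w l))"
    by (rule gens_le_shift_aff[where w = w and l = l, OF g le tri])
next
  assume gens: "gens_le (CARD('a) - 1) (affg w (shift_at w l))"
  define \<epsilon> where "\<epsilon> a b = 1 - l a b - l b a - int (n a) - int (n b)" for a b
  have sym: "\<epsilon> a b = \<epsilon> b a" for a b by (simp add: \<epsilon>_def)
  have \<epsilon>: "\<bar>\<epsilon> a b\<bar> \<le> 1" if "a \<noteq> b" for a b using bal[OF that] by (simp add: \<epsilon>_def)
  have m: "mult_of l = mm n \<epsilon>" by (intro ext) (simp add: mult_of_def mm_def \<epsilon>_def)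
  let ?n = "n(w := Suc (n w))"
  have "mult_of (shift_at w l) a b = mm ?n \<epsilon> a b" if "a \<noteq> b" for a b
    using that by (auto simp: mult_of_def mm_def \<epsilon>_def shift_at_def fun_upd_apply)
  then have m': "mulg w (mult_of (shift_at w l)) = mulg w (mm ?n \<epsilon>)" by (rule mulg_cong)
  show "gens_le (CARD('a) - 1) (affg w l)"
  proof (rule gens_le_unshift_aff[where w = w and l = l, OF gens _ le])
    assume "gens_le (CARD('a) - 1) (mulg w (mult_of (shift_at w l)))"
    then have g: "gens_le (CARD('a) - 1) (mulg w (mm ?n \<epsilon>))" unfolding m' .
    have n': "?n a \<ge> 1" for a using n[of a] by (simp add: fun_upd_apply)
    show "gens_le (CARD('a) - 1) (mulg w (mult_of l))" unfolding m
      by (rule gens_le_weights[where \<epsilon> = \<epsilon> and n = ?n and n' = n, OF sym \<epsilon> n' n g])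
  next
    fix a b assume ab: "a \<noteq> w" "b \<noteq> w" "a \<noteq> b"
    show "mult_of l a b \<le> mult_of l w a + mult_of l w b + 1" unfolding m
      by (rule mm_triangle[where n = n, OF n \<epsilon> ab])
  qed
qed

section \<open>Polynomials and derivations\<close>

text \<open>The bridge between formal polynomials and polynomial functions. It is bijective over the
  reals, so nothing is lost by computing with functions, where substitution is composition and
  identities are checked pointwise.\<close>

definition peval :: "'v::finite rpoly \<Rightarrow> ('v \<Rightarrow> real) \<Rightarrow> real" where
  "peval p x = (\<Sum>m\<in>Poly_Mapping.keys p. Poly_Mapping.lookup p m * (\<Prod>v\<in>UNIV. x v ^ Poly_Mapping.lookup m v))"

lemma peval_superset:
  assumes "finite A" "Poly_Mapping.keys p \<subseteq> A"
  shows "peval p x = (\<Sum>m\<in>A. Poly_Mapping.lookup p m * (\<Prod>v\<in>UNIV. x v ^ Poly_Mapping.lookup m v))"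
  unfolding peval_def using assms by (intro sum.mono_neutral_left) (auto simp: in_keys_iff)

lemma peval_add: "peval (p + q) x = peval p x + peval q x"
proof -
  let ?A = "Poly_Mapping.keys p \<union> Poly_Mapping.keys q"
  have "peval (p + q) x = (\<Sum>m\<in>?A. Poly_Mapping.lookup (p + q) m * (\<Prod>v\<in>UNIV. x v ^ Poly_Mapping.lookup m v))"
    by (rule peval_superset) (use Poly_Mapping.keys_add[of p q] in auto)
  then show ?thesis
    using peval_superset[of ?A p x] peval_superset[of ?A q x]
    by (simp add: lookup_add distrib_right sum.distrib)
qed

lemma peval_zero [simp]: "peval 0 x = 0"
  by (simp add: peval_def)

lemma peval_sum: "peval (\<Sum>i\<in>I. p i) x = (\<Sum>i\<in>I. peval (p i) x)"
  by (induction I rule: infinite_finite_induct) (simp_all add: peval_add)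

lemma peval_single: "peval (Poly_Mapping.single m c) x = c * (\<Prod>v\<in>UNIV. x v ^ Poly_Mapping.lookup m v)"
  using peval_superset[of "{m}" "Poly_Mapping.single m c" x] by (simp split: if_splits)

lemma sum_singles: "p = (\<Sum>m\<in>Poly_Mapping.keys p. Poly_Mapping.single m (Poly_Mapping.lookup p m))"
proof (rule poly_mapping_eqI)
  fix k
  have "Poly_Mapping.lookup (\<Sum>m\<in>Poly_Mapping.keys p. Poly_Mapping.single m (Poly_Mapping.lookup p m)) k =
      (\<Sum>m\<in>Poly_Mapping.keys p. if m = k then Poly_Mapping.lookup p m else 0)"
    by (simp add: lookup_sum lookup_single when_def)
  also have "\<dots> = Poly_Mapping.lookup p k" by (simp add: in_keys_iff)
  finally show "Poly_Mapping.lookup p k =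
      Poly_Mapping.lookup (\<Sum>m\<in>Poly_Mapping.keys p. Poly_Mapping.single m (Poly_Mapping.lookup p m)) k" by simp
qed

lemma peval_mult: "peval (p * q) x = peval p x * peval q x"
proof -
  let ?p = "\<lambda>m. Poly_Mapping.single m (Poly_Mapping.lookup p m)" and ?q = "\<lambda>m. Poly_Mapping.single m (Poly_Mapping.lookup q m)"
  have s: "peval (Poly_Mapping.single m c * Poly_Mapping.single k d) x = peval (Poly_Mapping.single m c) x * peval (Poly_Mapping.single k d) x"
    for m k c d
    by (simp add: mult_single peval_single lookup_add power_add prod.distrib)
  have "p * q = (\<Sum>m\<in>Poly_Mapping.keys p. \<Sum>k\<in>Poly_Mapping.keys q. ?p m * ?q k)"
    unfolding sum_product[symmetric] using sum_singles[of p] sum_singles[of q] by simp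
  then have "peval (p * q) x = (\<Sum>m\<in>Poly_Mapping.keys p. \<Sum>k\<in>Poly_Mapping.keys q. peval (?p m) x * peval (?q k) x)"
    by (simp only: peval_sum s)
  also have "\<dots> = (\<Sum>m\<in>Poly_Mapping.keys p. peval (?p m) x) * (\<Sum>k\<in>Poly_Mapping.keys q. peval (?q k) x)"
    by (simp only: sum_product)
  also have "\<dots> = peval p x * peval q x"
    by (simp only: peval_sum[symmetric] sum_singles[symmetric])
  finally show ?thesis .
qed

lemma peval_pconst [simp]: "peval (pconst c) x = c"
  by (simp add: pconst_def peval_single)

lemma peval_pvar [simp]: "peval (pvar v) x = x v"
proof -
  have "(\<Prod>u\<in>UNIV. x u ^ Poly_Mapping.lookup (Poly_Mapping.single v (1::nat)) u) = (\<Prod>u\<in>UNIV. if u = v then x u else 1)"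
    by (intro prod.cong) (auto simp: lookup_single when_def)
  then show ?thesis by (simp add: pvar_def peval_single)
qed

lemma polyfun_peval: "peval p \<in> polyfun"
  unfolding peval_def by (intro polyfun_intros)

lemma peval_surj: "p \<in> polyfun \<Longrightarrow> \<exists>P. peval P = p"
proof (induction rule: polyfun.induct)
  case (const c)
  show ?case by (rule exI[of _ "pconst c"]) (simp add: fun_eq_iff)
next
  case (coord i)
  show ?case by (rule exI[of _ "pvar i"]) (simp add: fun_eq_iff)
next
  case (add p q)
  then obtain P Q where "peval P = p" "peval Q = q" by blast
  then show ?case by (intro exI[of _ "P + Q"]) (simp add: fun_eq_iff peval_add)
next
  case (mult p q)
  then obtain P Q where "peval P = p" "peval Q = q" by blast
  then show ?case by (intro exI[of _ "P * Q"]) (simp add: fun_eq_iff peval_mult)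
qed

text \<open>Induction on the variables: as a polynomial in \<open>v\<close> alone, the sum has zero
  coefficients, and the one at the exponent of the monomial \<open>i\<close> is a shorter sum in the
  other variables.\<close>

lemma monomials_independent:
  fixes e :: "'i \<Rightarrow> 'v \<Rightarrow> nat"
  assumes "finite V" "finite A" "\<And>i j. i \<in> A \<Longrightarrow> j \<in> A \<Longrightarrow> i \<noteq> j \<Longrightarrow> \<exists>v\<in>V. e i v \<noteq> e j v"
    "\<And>x :: 'v \<Rightarrow> real. (\<Sum>i\<in>A. c i * (\<Prod>v\<in>V. x v ^ e i v)) = 0" "i \<in> A"
  shows "c i = 0"
  using assms
proof (induction V arbitrary: A i rule: finite_induct)
  case empty
  have "A = {i}" using empty.prems(2,4) by blast
  then show ?case using empty.prems(3) by simp
next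
  case (insert v V)
  let ?A = "{j \<in> A. e j v = e i v}"
  show ?case
  proof (rule insert.IH[of ?A])
    show "finite ?A" "i \<in> ?A" using insert.prems by auto
    show "\<exists>u\<in>V. e a u \<noteq> e b u" if "a \<in> ?A" "b \<in> ?A" "a \<noteq> b" for a b
      using insert.prems(2)[of a b] that by auto
    fix x :: "'v \<Rightarrow> real"
    define Q where "Q = (\<Sum>j\<in>A. monom (c j * (\<Prod>u\<in>V. x u ^ e j u)) (e j v))"
    have "poly Q t = 0" for t
    proof -
      have "(\<Prod>u\<in>V. (x(v := t)) u ^ e j u) = (\<Prod>u\<in>V. x u ^ e j u)" for j
        using insert.hyps by (intro prod.cong) (auto simp: fun_upd_apply)
      then have "(\<Sum>j\<in>A. c j * (\<Prod>u\<in>insert v V. (x(v := t)) u ^ e j u)) = poly Q t"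
        using insert.hyps by (simp add: Q_def poly_sum poly_monom mult_ac)
      then show ?thesis using insert.prems(3)[of "x(v := t)"] by simp
    qed
    then have "Q = 0" using poly_all_0_iff_0[of Q] by simp
    then have "coeff Q (e i v) = 0" by simp
    moreover have "coeff Q (e i v) = (\<Sum>j\<in>A. if e j v = e i v then c j * (\<Prod>u\<in>V. x u ^ e j u) else 0)"
      unfolding Q_def coeff_sum coeff_monom ..
    ultimately show "(\<Sum>j\<in>?A. c j * (\<Prod>u\<in>V. x u ^ e j u)) = 0"
      using insert.prems(1) by (simp add: sum.inter_filter)
  qed
qed

lemma peval_inj:
  assumes "\<And>x. peval p x = peval q x"
  shows "p = q"
proof -
  have z: "r = 0" if "\<And>x. peval r x = 0" for r :: "'v::finite rpoly"
  proof (rule poly_mapping_eqI)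
    fix m
    show "Poly_Mapping.lookup r m = Poly_Mapping.lookup 0 m"
    proof (cases "m \<in> Poly_Mapping.keys r")
      case True
      have "Poly_Mapping.lookup r m = 0"
      proof (rule monomials_independent[of UNIV "Poly_Mapping.keys r" Poly_Mapping.lookup "Poly_Mapping.lookup r" m])
        show "\<exists>v\<in>UNIV. Poly_Mapping.lookup i v \<noteq> Poly_Mapping.lookup j v" if "i \<noteq> j" for i j :: "'v \<Rightarrow>\<^sub>0 nat"
          using that poly_mapping_eqI[of i j] by blast
        show "(\<Sum>i\<in>Poly_Mapping.keys r. Poly_Mapping.lookup r i * (\<Prod>v\<in>UNIV. x v ^ Poly_Mapping.lookup i v)) = 0" for x
          using that[of x] by (simp add: peval_def)
      qed (use True in auto)
      then show ?thesis by simp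
    qed (simp add: in_keys_iff)
  qed
  have "peval (p + pconst (-1) * q) x = 0" for x using assms by (simp add: peval_add peval_mult)
  then have a: "p + pconst (-1) * q = 0" by (rule z)
  have b: "pconst (-1) * q + q = 0" by (rule z) (simp add: peval_add peval_mult)
  have "p = p + (pconst (-1) * q + q)" unfolding b by simp
  also have "\<dots> = (p + pconst (-1) * q) + q" by (simp only: add.assoc)
  also have "\<dots> = q" unfolding a by simp
  finally show ?thesis .
qed

definition pinv :: "(('v::finite \<Rightarrow> real) \<Rightarrow> real) \<Rightarrow> 'v rpoly" where
  "pinv f = (SOME P. peval P = f)"

lemma peval_pinv: "f \<in> polyfun \<Longrightarrow> peval (pinv f) x = f x"
proof -
  assume "f \<in> polyfun"
  then have "peval (pinv f) = f" unfolding pinv_def by (intro someI_ex[of "\<lambda>P. peval P = f"] peval_surj)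
  then show ?thesis by simp
qed

lemma peval_one [simp]: "peval 1 x = 1"
  using peval_pconst[of 1 x] by (simp add: pconst_def)

section \<open>Derivations and their component vectors\<close>

definition comps :: "('v::finite rpoly \<Rightarrow> 'v rpoly) \<Rightarrow> 'v \<Rightarrow> ('v \<Rightarrow> real) \<Rightarrow> real" where
  "comps \<theta> k = peval (\<theta> (pvar k))"

definition der :: "('v::finite \<Rightarrow> ('v \<Rightarrow> real) \<Rightarrow> real) \<Rightarrow> 'v rpoly \<Rightarrow> 'v rpoly" where
  "der f p = pinv (\<lambda>x. \<Sum>k\<in>UNIV. pd k (peval p) x * f k x)"

lemma peval_eta: "peval (p + q) = (\<lambda>x. peval p x + peval q x)" "peval (p * q) = (\<lambda>x. peval p x * peval q x)"
  by (auto simp: peval_add peval_mult)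

lemma peval_der:
  assumes "\<And>k. f k \<in> polyfun"
  shows "peval (der f p) x = (\<Sum>k\<in>UNIV. pd k (peval p) x * f k x)"
  unfolding der_def by (rule peval_pinv) (intro polyfun_sum polyfun.mult polyfun_pd polyfun_peval assms)

lemma derivation_der:
  assumes "\<And>k. f k \<in> polyfun"
  shows "derivation (der f)"
  unfolding derivation_def
proof (intro conjI allI; rule peval_inj)
  note e = peval_der[OF assms] peval_add peval_mult peval_eta
  fix p q :: "'a rpoly" and c :: real and x :: "'a \<Rightarrow> real"
  show "peval (der f (p + q)) x = peval (der f p + der f q) x"
    by (simp add: e pd_add polyfun_peval distrib_right sum.distrib)
  show "peval (der f (p * q)) x = peval (p * der f q + q * der f p) x"
    by (simp add: e pd_mult polyfun_peval sum_distrib_left sum.distrib[symmetric] algebra_simps)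
  have "peval (pconst c) = (\<lambda>x. c)" by (simp add: fun_eq_iff)
  then show "peval (der f (pconst c * p)) x = peval (pconst c * der f p) x"
    by (simp add: e pd_cmult polyfun_peval sum_distrib_left mult_ac)
qed

lemma comps_der:
  fixes f :: "'v::finite \<Rightarrow> ('v \<Rightarrow> real) \<Rightarrow> real"
  assumes f: "\<And>k. f k \<in> polyfun"
  shows "comps (der f) = f"
proof (intro ext)
  fix k :: 'v and x :: "'v \<Rightarrow> real"
  have "peval (pvar k) = (\<lambda>x. x k)" by (simp add: fun_eq_iff)
  then have "peval (der f (pvar k)) x = (\<Sum>j\<in>UNIV. (if k = j then 1 else 0) * f j x)" by (simp add: peval_der[OF f])
  also have "\<dots> = (\<Sum>j\<in>UNIV. if k = j then f j x else 0)" by (intro sum.cong) auto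
  finally show "comps (der f) k x = f k x" by (simp add: comps_def)
qed

lemma polyfun_comps: "comps \<theta> k \<in> polyfun"
  by (simp add: comps_def polyfun_peval)

lemma derivationD:
  assumes "derivation \<theta>"
  shows "\<theta> (p + q) = \<theta> p + \<theta> q" "\<theta> (pconst c * p) = pconst c * \<theta> p" "\<theta> (p * q) = p * \<theta> q + q * \<theta> p"
  using assms by (auto simp: derivation_def)

lemma derivation_pconst:
  assumes "derivation \<theta>"
  shows "peval (\<theta> (pconst c)) x = 0"
proof -
  have "peval (\<theta> 1) x = peval (\<theta> 1) x + peval (\<theta> 1) x"
    using arg_cong[OF derivationD(3)[OF assms, of 1 1], of "\<lambda>p. peval p x"] by (simp only: mult_1_left peval_add)
  then have "peval (\<theta> 1) x = 0" by simp
  then show ?thesis using derivationD(2)[OF assms, of c 1] by (simp add: peval_mult)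
qed

lemma derivation_formula:
  assumes d: "derivation \<theta>"
  shows "peval (\<theta> p) x = (\<Sum>k\<in>UNIV. pd k (peval p) x * comps \<theta> k x)"
proof -
  have "\<forall>p. peval p = g \<longrightarrow> (\<forall>x. peval (\<theta> p) x = (\<Sum>k\<in>UNIV. pd k g x * comps \<theta> k x))" if "g \<in> polyfun" for g
    using that
  proof (induction rule: polyfun.induct)
    case (const c)
    have "p = pconst c" if "peval p = (\<lambda>x. c)" for p using that by (intro peval_inj) simp
    then show ?case using derivation_pconst[OF d] by auto
  next
    case (coord i)
    have p: "p = pvar i" if "peval p = (\<lambda>x. x i)" for p using that by (intro peval_inj) simp
    have "(\<Sum>k\<in>UNIV. (if i = k then 1 else 0) * comps \<theta> k x) = comps \<theta> i x" for x
    proof -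
      have "(\<Sum>k\<in>UNIV. (if i = k then 1 else 0) * comps \<theta> k x) = (\<Sum>k\<in>UNIV. if i = k then comps \<theta> k x else 0)"
        by (intro sum.cong) auto
      then show ?thesis by simp
    qed
    then show ?case using p by (auto simp: comps_def)
  next
    case (add g h)
    obtain P Q where PQ: "peval P = g" "peval Q = h" using peval_surj add.hyps by blast
    have "p = P + Q" if "peval p = (\<lambda>x. g x + h x)" for p
      using that PQ by (intro peval_inj) (simp add: peval_add)
    moreover have "peval (\<theta> (P + Q)) x = (\<Sum>k\<in>UNIV. pd k (\<lambda>x. g x + h x) x * comps \<theta> k x)" for x
      using add.IH(1)[rule_format, OF PQ(1), of x] add.IH(2)[rule_format, OF PQ(2), of x]
      by (simp add: derivationD(1)[OF d] peval_add pd_add[OF add.hyps] distrib_right sum.distrib)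
    ultimately show ?case by blast
  next
    case (mult g h)
    obtain P Q where PQ: "peval P = g" "peval Q = h" using peval_surj mult.hyps by blast
    have "p = P * Q" if "peval p = (\<lambda>x. g x * h x)" for p
      using that PQ by (intro peval_inj) (simp add: peval_mult)
    moreover have "peval (\<theta> (P * Q)) x = (\<Sum>k\<in>UNIV. pd k (\<lambda>x. g x * h x) x * comps \<theta> k x)" for x
      using mult.IH(1)[rule_format, OF PQ(1), of x] mult.IH(2)[rule_format, OF PQ(2), of x]
      by (simp add: derivationD(3)[OF d] peval_add peval_mult PQ pd_mult[OF mult.hyps] sum_distrib_left
          sum.distrib[symmetric] algebra_simps)
    ultimately show ?case by blast
  qed
  from this[OF polyfun_peval] show ?thesis by blast
qed

lemma derivation_eqI:
  assumes "derivation \<theta>" "derivation \<eta>" "\<And>k x. comps \<theta> k x = comps \<eta> k x"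
  shows "\<theta> = \<eta>"
  by (rule ext, rule peval_inj) (simp add: derivation_formula[OF assms(1)] derivation_formula[OF assms(2)] assms(3))

lemma comps_pscale_sum: "comps (\<Sum>b\<in>B. pscale (u b) b) k x = (\<Sum>b\<in>B. peval (u b) x * comps b k x)"
proof -
  have "(\<Sum>b\<in>B. pscale (u b) b) (pvar k) = (\<Sum>b\<in>B. u b * b (pvar k))"
    by (induction B rule: infinite_finite_induct) (simp_all add: pscale_def)
  then show ?thesis by (simp add: comps_def peval_sum peval_mult)
qed

section \<open>Logarithmic vector fields\<close>

text \<open>Tangency: as \<open>H\<close> is a linear subspace, divisibility of the derivative of
  its form says that at points of \<open>H\<close> the field takes values in \<open>H\<close>. This
  needs no choice of a form.\<close>

definition logv :: "(real ^ 'v::finite) set set \<Rightarrow> ('v \<Rightarrow> ('v \<Rightarrow> real) \<Rightarrow> real) set" where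
  "logv \<A> = {f. (\<forall>k. f k \<in> polyfun) \<and> (\<forall>H\<in>\<A>. \<forall>x. (\<chi> i. x i) \<in> H \<longrightarrow> (\<chi> i. f i x) \<in> H)}"

text \<open>For the converse, solve the equation of the hyperplane for a coordinate with nonzero
  coefficient and use the factor theorem.\<close>

lemma linear_form_dvd_iff:
  fixes c :: "real ^ 'v::finite"
  assumes d: "derivation \<theta>"
  shows "linear_form c dvd \<theta> (linear_form c) \<longleftrightarrow>
    (\<forall>x. c \<bullet> (\<chi> i. x i) = 0 \<longrightarrow> c \<bullet> (\<chi> i. comps \<theta> i x) = 0)"
proof -
  have lf: "peval (linear_form c) x = (\<Sum>i\<in>UNIV. c $ i * x i)" for x
    by (simp add: linear_form_def peval_sum peval_mult)
  have add: "\<theta> (\<Sum>i\<in>I. p i) = (\<Sum>i\<in>I. \<theta> (p i))" if "finite I" for I :: "'v set" and p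
  proof -
    have z: "\<theta> 0 = 0" using derivationD(1)[OF d, of 0 0] by simp
    show ?thesis using that by (induction I rule: finite_induct) (simp_all add: derivationD(1)[OF d] z)
  qed
  have tl: "peval (\<theta> (linear_form c)) x = (\<Sum>i\<in>UNIV. c $ i * comps \<theta> i x)" for x
    by (simp add: linear_form_def add derivationD(2)[OF d] peval_sum peval_mult comps_def)
  have inner: "c \<bullet> (\<chi> i. g i) = (\<Sum>i\<in>UNIV. c $ i * g i)" for g :: "'v \<Rightarrow> real"
    by (simp add: inner_vec_def)
  show ?thesis unfolding inner
  proof
    assume "linear_form c dvd \<theta> (linear_form c)"
    then obtain q where "\<theta> (linear_form c) = linear_form c * q" by (elim dvdE)
    then have "(\<Sum>i\<in>UNIV. c $ i * comps \<theta> i x) = (\<Sum>i\<in>UNIV. c $ i * x i) * peval q x" for x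
      using tl[of x] by (simp add: peval_mult lf)
    then show "\<forall>x. (\<Sum>i\<in>UNIV. c $ i * x i) = 0 \<longrightarrow> (\<Sum>i\<in>UNIV. c $ i * comps \<theta> i x) = 0" by simp
  next
    assume van: "\<forall>x. (\<Sum>i\<in>UNIV. c $ i * x i) = 0 \<longrightarrow> (\<Sum>i\<in>UNIV. c $ i * comps \<theta> i x) = 0"
    show "linear_form c dvd \<theta> (linear_form c)"
    proof (cases "c = 0")
      case True
      have "\<theta> (linear_form c) = 0" by (rule peval_inj) (simp only: tl, simp add: True)
      then show ?thesis by simp
    next
      case False
      then obtain j where j: "c $ j \<noteq> 0" by (auto simp: vec_eq_iff)
      let ?q = "\<lambda>x. - (\<Sum>i\<in>UNIV - {j}. c $ i * x i) / c $ j"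
      have split: "(\<Sum>i\<in>UNIV. c $ i * x i) = c $ j * x j + (\<Sum>i\<in>UNIV - {j}. c $ i * x i)" for x :: "'v \<Rightarrow> real"
        by (intro sum.remove) auto
      have qp: "?q \<in> polyfun" by (intro polyfun_intros)
      have gp: "(\<lambda>x. \<Sum>i\<in>UNIV. c $ i * comps \<theta> i x) \<in> polyfun"
        by (intro polyfun_sum polyfun.mult polyfun.const polyfun_comps)
      have "(\<Sum>i\<in>UNIV. c $ i * (x(j := ?q x)) i) = 0" for x
      proof -
        have "(\<Sum>i\<in>UNIV - {j}. c $ i * (x(j := ?q x)) i) = (\<Sum>i\<in>UNIV - {j}. c $ i * x i)"
          by (intro sum.cong) auto
        then show ?thesis using split[of "x(j := ?q x)"] j by simp
      qed
      then have "(\<Sum>i\<in>UNIV. c $ i * comps \<theta> i (x(j := ?q x))) = 0" for x using van by blast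
      then obtain h where h: "h \<in> polyfun" "\<And>x. (\<Sum>i\<in>UNIV. c $ i * comps \<theta> i x) = (x j - ?q x) * h x"
        using polyfun_division[OF gp qp, of j] by blast
      have "\<theta> (linear_form c) = linear_form c * pinv (\<lambda>x. h x / c $ j)"
      proof (rule peval_inj)
        fix x
        have hp: "(\<lambda>x. h x / c $ j) \<in> polyfun" by (intro polyfun_divide_const h(1))
        have "(x j - ?q x) * h x = (\<Sum>i\<in>UNIV. c $ i * x i) * (h x / c $ j)"
          unfolding split using j by (simp add: field_simps)
        then show "peval (\<theta> (linear_form c)) x = peval (linear_form c * pinv (\<lambda>x. h x / c $ j)) x"
          unfolding peval_mult tl lf peval_pinv[OF hp] h(2) .
      qed
      then show ?thesis by simp
    qed
  qed
qed

lemma log_derivations_iff: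
  assumes "central_arrangement \<A>" and d: "derivation \<theta>"
  shows "\<theta> \<in> log_derivations \<A> \<longleftrightarrow> comps \<theta> \<in> logv \<A>"
proof -
  have "(\<forall>c. H = {x. c \<bullet> x = 0} \<longrightarrow> linear_form c dvd \<theta> (linear_form c)) \<longleftrightarrow>
      (\<forall>x. (\<chi> i. x i) \<in> H \<longrightarrow> (\<chi> i. comps \<theta> i x) \<in> H)" if H: "H \<in> \<A>" for H
  proof -
    obtain c where c: "H = {x. c \<bullet> x = 0}" using assms(1) H unfolding central_arrangement_def by blast
    have "linear_form e dvd \<theta> (linear_form e) \<longleftrightarrow> (\<forall>x. (\<chi> i. x i) \<in> H \<longrightarrow> (\<chi> i. comps \<theta> i x) \<in> H)"
      if "H = {x. e \<bullet> x = 0}" for e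
      unfolding linear_form_dvd_iff[OF d] that by simp
    then show ?thesis using c by blast
  qed
  then show ?thesis using d polyfun_comps[of \<theta>] unfolding log_derivations_def logv_def mem_Collect_eq by simp
qed

lemma free_if_hbasis:
  fixes \<A> :: "(real ^ 'v::finite) set set"
  assumes cen: "central_arrangement \<A>" and B: "hbasis r (logv \<A>) f d"
  shows "free_submodule (log_derivations \<A>)"
proof -
  note B0 = B[unfolded hbasis_def]
  note B1 = conjunct1[OF B0] and B2 = conjunct1[OF conjunct2[OF B0]] and B3 = conjunct2[OF conjunct2[OF B0]]
  have fl: "f k \<in> logv \<A>" if "k < r" for k using B1[rule_format, OF that] by (rule conjunct1)
  have fp: "f k j \<in> polyfun" if "k < r" for k j using fl[OF that] by (simp add: logv_def)
  have ind: "q k x = 0" if "\<And>k. q k \<in> polyfun" "\<And>j x. (\<Sum>k<r. q k x * f k j x) = 0" "k < r" for q k x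
  proof -
    have "(\<Sum>k<r. q k \<odot> f k) = 0" using that(2) by (intro ext) simp
    with that(1) have "(\<forall>k. q k \<in> polyfun) \<and> (\<Sum>k<r. q k \<odot> f k) = 0" by (intro conjI allI)
    then have "\<forall>k<r. \<forall>x. q k x = 0" by (rule mp[OF spec[OF B3, of q]])
    then show ?thesis using that(3) by blast
  qed
  define D where "D k = der (f k)" for k
  have der: "derivation (D k)" "comps (D k) = f k" if "k < r" for k
    using derivation_der[OF fp[OF that]] comps_der[OF fp[OF that]] by (simp_all add: D_def)
  \<comment> \<open>Dependence is a property of sets, in which repeated members would go unnoticed;
    the relation with coefficients 1 and -1 excludes them.\<close>
  have inj: "inj_on D {..<r}"
  proof (rule inj_onI, rule ccontr)
    fix k l assume kl: "k \<in> {..<r}" "l \<in> {..<r}" "D k = D l" "k \<noteq> l"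
    then have "comps (D k) = comps (D l)" by simp
    then have e: "f k = f l" using der(2)[of k] der(2)[of l] kl(1,2) by simp
    define q where "q i x = (if i = k then 1 else if i = l then -1 else 0 :: real)" for i :: nat and x :: "'v \<Rightarrow> real"
    have s0: "(\<Sum>i<r. q i x * f i j x) = 0" for j x
    proof -
      have "(\<Sum>i<r. q i x * f i j x) = (\<Sum>i<r. (if i = k then f i j x else 0) - (if i = l then f i j x else 0))"
        using kl(4) by (intro sum.cong) (auto simp: q_def)
      then show ?thesis using kl(1,2) e by (simp add: sum_subtractf)
    qed
    have qp: "q i \<in> polyfun" for i unfolding q_def by (rule polyfun.const)
    have "q k undefined = 0" by (rule ind[of q k undefined, OF qp s0]) (use kl(1) in simp)
    then show False by (simp add: q_def)
  qed
  have "\<not> poly_dependent (D ` {..<r})"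
  proof
    assume "poly_dependent (D ` {..<r})"
    then obtain t u where t: "finite t" "t \<subseteq> D ` {..<r}" "(\<Sum>v\<in>t. pscale (u v) v) = 0" "\<exists>v\<in>t. u v \<noteq> 0"
      unfolding poly_fun.dependent_explicit by (elim exE conjE)
    define q where "q k = (if D k \<in> t then peval (u (D k)) else (\<lambda>x. 0))" for k
    have s0: "(\<Sum>k<r. q k x * f k j x) = 0" for j x
    proof -
      have "(\<Sum>k<r. q k x * f k j x) = (\<Sum>k<r. if D k \<in> t then peval (u (D k)) x * comps (D k) j x else 0)"
        using der by (intro sum.cong) (auto simp: q_def)
      also have "\<dots> = (\<Sum>v\<in>D ` {..<r}. if v \<in> t then peval (u v) x * comps v j x else 0)"
        by (simp add: sum.reindex[OF inj])
      also have "\<dots> = (\<Sum>v\<in>t. peval (u v) x * comps v j x)"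
        using t(1,2) by (intro sum.mono_neutral_cong_right) auto
      also have "\<dots> = 0" unfolding comps_pscale_sum[symmetric] t(3) by (simp add: comps_def)
      finally show ?thesis .
    qed
    have qp: "q k \<in> polyfun" for k by (simp add: q_def polyfun_peval polyfun.const)
    have q0: "q k x = 0" if "k < r" for k x by (rule ind[of q k x, OF qp s0 that])
    have "u v = 0" if v: "v \<in> t" for v
    proof (rule peval_inj)
      fix x
      obtain k where k: "k < r" "v = D k" using t(2) v by auto
      show "peval (u v) x = peval 0 x" using q0[OF k(1), of x] k v by (simp add: q_def)
    qed
    then show False using t(4) by blast
  qed
  moreover have "poly_span (D ` {..<r}) = log_derivations \<A>"
  proof
    have "D ` {..<r} \<subseteq> log_derivations \<A>"
    proof
      fix \<theta> assume "\<theta> \<in> D ` {..<r}"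
      then obtain k where k: "k < r" "\<theta> = D k" by auto
      show "\<theta> \<in> log_derivations \<A>"
        unfolding k(2) log_derivations_iff[OF cen der(1)[OF k(1)]] der(2)[OF k(1)] by (rule fl[OF k(1)])
    qed
    then show "poly_span (D ` {..<r}) \<subseteq> log_derivations \<A>"
      by (rule poly_fun.span_minimal[OF _ subspace_log_derivations])
    show "log_derivations \<A> \<subseteq> poly_span (D ` {..<r})"
    proof
      fix \<theta> assume \<theta>: "\<theta> \<in> log_derivations \<A>"
      then have d: "derivation \<theta>" by (simp add: log_derivations_def)
      then have mem: "comps \<theta> \<in> logv \<A>" using \<theta> log_derivations_iff[OF cen d] by simp
      obtain q where q0: "\<forall>k. q k \<in> polyfun" "comps \<theta> = (\<Sum>k<r. q k \<odot> f k)"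
        using bspec[OF B2 mem] by (elim exE conjE)
      note q = q0(1)[rule_format] q0(2)
      let ?\<eta> = "\<Sum>k<r. pscale (pinv (q k)) (D k)"
      have sp: "?\<eta> \<in> poly_span (D ` {..<r})"
        by (intro poly_fun.span_sum poly_fun.span_scale poly_fun.span_base) auto
      then have "?\<eta> \<in> log_derivations \<A>" using \<open>poly_span (D ` {..<r}) \<subseteq> log_derivations \<A>\<close> by blast
      then have d': "derivation ?\<eta>" by (simp add: log_derivations_def)
      have "\<theta> = ?\<eta>"
      proof (rule derivation_eqI[OF d d'])
        fix j x
        have "?\<eta> (pvar j) = (\<Sum>k<r. pinv (q k) * D k (pvar j))"
          by (induction r) (simp_all add: pscale_def)
        then have "comps ?\<eta> j x = (\<Sum>k<r. q k x * comps (D k) j x)"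
          by (simp add: comps_def peval_sum peval_mult peval_pinv[OF q(1)])
        also have "\<dots> = (\<Sum>k<r. q k x * f k j x)" using der by (intro sum.cong) auto
        finally show "comps \<theta> j x = comps ?\<eta> j x" unfolding q(2) by simp
      qed
      then show "\<theta> \<in> poly_span (D ` {..<r})" using sp by simp
    qed
  qed
  ultimately show ?thesis unfolding free_submodule_def by blast
qed

text \<open>The basis is an arbitrary set, not known to be finite or homogeneous. More members than
  variables would be dependent, their components being vectors over a domain; so the basis is small,
  and it spans the fibre through the values of the coefficients at the origin.\<close>

lemma gens_le_if_free:
  fixes \<A> :: "(real ^ 'v::finite) set set"
  assumes cen: "central_arrangement \<A>" and gm: "graded_module (logv \<A>)"
    and free: "free_submodule (log_derivations \<A>)"
  shows "gens_le (CARD('v)) (logv \<A>)"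
proof -
  obtain B where B: "\<not> poly_dependent B" "poly_span B = log_derivations \<A>"
    using free unfolding free_submodule_def by blast
  have BL: "B \<subseteq> log_derivations \<A>" using poly_fun.span_superset[of B] B(2) by simp
  have small: "card t \<le> CARD('v)" if t: "finite t" "t \<subseteq> B" for t
  proof (rule ccontr)
    assume "\<not> card t \<le> CARD('v)"
    then have lt: "card (UNIV :: 'v set) < card t" by simp
    have zero: "p = 0 \<or> q = 0" if "p \<in> polyfun" "q \<in> polyfun" "p * q = 0" for p q :: "('v \<Rightarrow> real) \<Rightarrow> real"
    proof (rule ccontr)
      assume n: "\<not> (p = 0 \<or> q = 0)"
      then obtain a where "p a \<noteq> 0" by (auto simp: fun_eq_iff)
      then have "q x = 0" for x
        by (rule polyfun_mult_eq_0[OF that(1,2), rotated]) (use fun_cong[OF that(3)] in simp)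
      then show False using n by (auto simp: fun_eq_iff)
    qed
    have "\<exists>c. (\<forall>b\<in>t. c b \<in> polyfun) \<and> (\<exists>b\<in>t. c b \<noteq> 0) \<and> (\<forall>j\<in>UNIV. (\<Sum>b\<in>t. c b * comps b j) = 0)"
    proof (rule domain_dependent[where P = polyfun])
      show "(1 :: ('v \<Rightarrow> real) \<Rightarrow> real) \<in> polyfun" using polyfun.const[of 1] by (simp add: one_fun_def)
      show "p * q \<in> polyfun" "p + q \<in> polyfun" if "p \<in> polyfun" "q \<in> polyfun" for p q :: "('v \<Rightarrow> real) \<Rightarrow> real"
        using polyfun.mult[OF that] polyfun.add[OF that] by (simp_all add: times_fun_def plus_fun_def)
      show "- p \<in> polyfun" if "p \<in> polyfun" for p :: "('v \<Rightarrow> real) \<Rightarrow> real"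
        using polyfun_uminus[OF that] by (simp add: fun_Compl_def)
    qed (rule polyfun_zero zero lt t(1) finite polyfun_comps | assumption)+
    then obtain c where c: "\<forall>b\<in>t. c b \<in> polyfun" "\<exists>b\<in>t. c b \<noteq> 0" "\<forall>j\<in>UNIV. (\<Sum>b\<in>t. c b * comps b j) = 0"
      by (elim exE conjE)
    let ?\<eta> = "\<Sum>b\<in>t. pscale (pinv (c b)) b"
    have "?\<eta> \<in> poly_span B" using t by (intro poly_fun.span_sum poly_fun.span_scale poly_fun.span_base) auto
    then have d: "derivation ?\<eta>" using B(2) by (simp add: log_derivations_def)
    have "peval (?\<eta> p) x = 0" for p x
    proof -
      have "comps ?\<eta> j x = 0" for j
      proof -
        have "comps ?\<eta> j x = (\<Sum>b\<in>t. c b x * comps b j x)"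
          unfolding comps_pscale_sum using c(1) by (intro sum.cong) (simp_all add: peval_pinv)
        also have "\<dots> = (\<Sum>b\<in>t. c b * comps b j) x"
          by (induction t rule: infinite_finite_induct) simp_all
        finally show ?thesis using c(3) by simp
      qed
      then show ?thesis unfolding derivation_formula[OF d] by simp
    qed
    then have "?\<eta> = 0" by (intro ext peval_inj) simp
    moreover have "\<exists>b\<in>t. pinv (c b) \<noteq> 0"
    proof -
      obtain b where b: "b \<in> t" "c b \<noteq> 0" using c(2) by blast
      have "pinv (c b) \<noteq> 0"
      proof
        assume "pinv (c b) = 0"
        then have "c b x = 0" for x using peval_pinv[of "c b" x] c(1) b(1) by simp
        then show False using b(2) by (simp add: fun_eq_iff)
      qed
      then show ?thesis using b(1) by blast
    qed
    ultimately have "poly_dependent B" unfolding poly_fun.dependent_explicit using t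
      by (intro exI[of _ t] exI[of _ "\<lambda>b. pinv (c b)"] conjI)
    then show False using B(1) by simp
  qed
  have fin: "finite B"
  proof (rule ccontr)
    assume "infinite B"
    then obtain t where "t \<subseteq> B" "finite t" "card t = Suc (CARD('v))" using infinite_arbitrarily_large by blast
    then show False using small[of t] by simp
  qed
  obtain b where b: "bij_betw b {..<card B} B" using ex_bij_betw_nat_finite[OF fin] by (auto simp: atLeast0LessThan)
  \<comment> \<open>Padding by 0, since at this point \<open>card B\<close> is only known to be at
    most the number of variables.\<close>
  define F where "F k = (if k < card B then comps (b k) else 0)" for k
  show ?thesis
  proof (rule gens_leI_span[OF gm])
    fix g assume g: "g \<in> logv \<A>"
    then have gp: "g k \<in> polyfun" for k by (simp add: logv_def)
    have "der g \<in> log_derivations \<A>" using g log_derivations_iff[OF cen derivation_der[OF gp]] comps_der[OF gp] by simp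
    then have "der g \<in> range (\<lambda>u. \<Sum>v\<in>B. pscale (u v) v)"
      using poly_fun.span_finite[OF fin] B(2) by simp
    then obtain u where u: "der g = (\<Sum>v\<in>B. pscale (u v) v)" by (elim imageE)
    define c where "c k = (if k < card B then peval (u (b k)) (\<lambda>_. 0) else 0)" for k
    define q where "q v x = peval (u v) x - peval (u v) (\<lambda>_. 0)" for v x
    have qp: "q v \<in> polyfun" for v unfolding q_def by (intro polyfun_diff polyfun_peval polyfun.const)
    have mem: "comps v \<in> logv \<A>" if "v \<in> B" for v
    proof -
      have v: "v \<in> log_derivations \<A>" using that BL by blast
      then have "derivation v" by (simp add: log_derivations_def)
      then show ?thesis using v log_derivations_iff[OF cen] by simp
    qed
    have "g - (\<Sum>k<CARD('v). (\<lambda>_. c k) \<odot> F k) = (\<Sum>v\<in>B. q v \<odot> comps v)"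
    proof (intro ext)
      fix j x
      have "(\<Sum>k<CARD('v). c k * F k j x) = (\<Sum>k<card B. c k * F k j x)"
        using small[OF fin subset_refl] by (intro sum.mono_neutral_right) (auto simp: F_def)
      also have "\<dots> = (\<Sum>k<card B. peval (u (b k)) (\<lambda>_. 0) * comps (b k) j x)"
        by (intro sum.cong) (auto simp: F_def c_def)
      also have "\<dots> = (\<Sum>v\<in>B. peval (u v) (\<lambda>_. 0) * comps v j x)"
        by (rule sum.reindex_bij_betw[OF b])
      finally have 1: "(\<Sum>k<CARD('v). c k * F k j x) = (\<Sum>v\<in>B. peval (u v) (\<lambda>_. 0) * comps v j x)" .
      have "g j x = comps (der g) j x" using comps_der[OF gp] by simp
      also have "\<dots> = (\<Sum>v\<in>B. peval (u v) x * comps v j x)" unfolding u comps_pscale_sum ..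
      finally show "(g - (\<Sum>k<CARD('v). (\<lambda>_. c k) \<odot> F k)) j x = (\<Sum>v\<in>B. q v \<odot> comps v) j x"
        using 1 by (simp add: q_def left_diff_distrib sum_subtractf)
    qed
    also have "\<dots> \<in> coordideal UNIV (logv \<A>)"
    proof (intro coordideal_sum[OF gm])
      fix v assume v: "v \<in> B"
      show "q v \<odot> comps v \<in> coordideal UNIV (logv \<A>)"
      proof (rule coordideal_ideal_smul[OF gm qp _ mem[OF v]])
        fix x :: "'v \<Rightarrow> real" assume "\<And>i. i \<in> UNIV \<Longrightarrow> x i = 0"
        then have "x = (\<lambda>_. 0)" by auto
        then show "q v x = 0" by (simp add: q_def)
      qed
    qed
    finally show "\<exists>c. g - (\<Sum>k<CARD('v). (\<lambda>_. c k) \<odot> F k) \<in> coordideal UNIV (logv \<A>)" by blast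
  qed
qed

lemma central_mem:
  fixes \<A> :: "(real ^ 'v::finite) set set"
  assumes "central_arrangement \<A>" "H \<in> \<A>"
  shows "\<exists>c. c \<noteq> 0 \<and> (\<forall>g. (\<chi> i. g i) \<in> H \<longleftrightarrow> (\<Sum>i\<in>UNIV. c $ i * g i) = 0)"
proof -
  obtain c where c: "c \<noteq> 0" "H = {x. c \<bullet> x = 0}"
    using assms unfolding central_arrangement_def by blast
  have "(\<chi> i. g i) \<in> H \<longleftrightarrow> (\<Sum>i\<in>UNIV. c $ i * g i) = 0" for g unfolding c(2) by (simp add: inner_vec_def)
  then show ?thesis using c(1) by (intro exI[of _ c] conjI allI)
qed

lemma graded_module_logv:
  fixes \<A> :: "(real ^ 'v::finite) set set"
  assumes cen: "central_arrangement \<A>"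
  shows "graded_module (logv \<A>)"
proof -
  have D: "(\<chi> i. f i x) \<in> H" if "f \<in> logv \<A>" "H \<in> \<A>" "(\<chi> i. x i) \<in> H" for f H x
    using that unfolding logv_def by blast
  have P: "f k \<in> polyfun" if "f \<in> logv \<A>" for f k using that unfolding logv_def by blast
  show ?thesis unfolding graded_module_def
  proof (intro conjI ballI allI)
    show "f k \<in> polyfun" if "f \<in> logv \<A>" for f k by (rule P[OF that])
    show "0 \<in> logv \<A>" unfolding logv_def mem_Collect_eq
    proof (intro conjI allI ballI impI)
      fix H and x :: "'v \<Rightarrow> real" assume H: "H \<in> \<A>"
      obtain c where c0: "c \<noteq> 0 \<and> (\<forall>g. (\<chi> i. g i) \<in> H \<longleftrightarrow> (\<Sum>i\<in>UNIV. c $ i * g i) = 0)"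
        using central_mem[OF cen H] by (elim exE)
      note c = conjunct1[OF c0] conjunct2[OF c0, rule_format]
      show "(\<chi> i. 0 i x) \<in> H" unfolding c(2) by simp
    qed (simp add: polyfun_zero)
    show "f + g \<in> logv \<A>" if fg: "f \<in> logv \<A>" "g \<in> logv \<A>" for f g
      unfolding logv_def mem_Collect_eq
    proof (intro conjI allI ballI impI)
      fix H and x :: "'v \<Rightarrow> real" assume H: "H \<in> \<A>" and x: "(\<chi> i. x i) \<in> H"
      obtain c where c0: "c \<noteq> 0 \<and> (\<forall>g. (\<chi> i. g i) \<in> H \<longleftrightarrow> (\<Sum>i\<in>UNIV. c $ i * g i) = 0)"
        using central_mem[OF cen H] by (elim exE)
      note c = conjunct1[OF c0] conjunct2[OF c0, rule_format]
      show "(\<chi> i. (f + g) i x) \<in> H"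
        using D[OF fg(1) H x] D[OF fg(2) H x] unfolding c(2) by (simp add: distrib_left sum.distrib)
    qed (simp add: polyfun_apply_add P[OF fg(1)] P[OF fg(2)])
    show "p \<odot> f \<in> logv \<A>" if p: "p \<in> polyfun" and f: "f \<in> logv \<A>" for p f
      unfolding logv_def mem_Collect_eq
    proof (intro conjI allI ballI impI)
      fix H and x :: "'v \<Rightarrow> real" assume H: "H \<in> \<A>" and x: "(\<chi> i. x i) \<in> H"
      obtain c where c0: "c \<noteq> 0 \<and> (\<forall>g. (\<chi> i. g i) \<in> H \<longleftrightarrow> (\<Sum>i\<in>UNIV. c $ i * g i) = 0)"
        using central_mem[OF cen H] by (elim exE)
      note c = conjunct1[OF c0] conjunct2[OF c0, rule_format]
      have "(\<Sum>i\<in>UNIV. c $ i * (p x * f i x)) = p x * (\<Sum>i\<in>UNIV. c $ i * f i x)"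
        by (simp add: sum_distrib_left mult.left_commute)
      then show "(\<chi> i. (p \<odot> f) i x) \<in> H" using D[OF f H x] unfolding c(2) by simp
    qed (simp add: polyfun_vsmul p P[OF f])
    show "(\<lambda>a x. f a (\<lambda>i. t * x i)) \<in> logv \<A>" if f: "f \<in> logv \<A>" for f t
      unfolding logv_def mem_Collect_eq
    proof (intro conjI allI ballI impI)
      fix H and x :: "'v \<Rightarrow> real" assume H: "H \<in> \<A>" and x: "(\<chi> i. x i) \<in> H"
      obtain c where c0: "c \<noteq> 0 \<and> (\<forall>g. (\<chi> i. g i) \<in> H \<longleftrightarrow> (\<Sum>i\<in>UNIV. c $ i * g i) = 0)"
        using central_mem[OF cen H] by (elim exE)
      note c = conjunct1[OF c0] conjunct2[OF c0, rule_format]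
      have "(\<Sum>i\<in>UNIV. c $ i * (t * x i)) = t * (\<Sum>i\<in>UNIV. c $ i * x i)"
        by (simp add: sum_distrib_left mult.left_commute)
      then have "(\<chi> i. t * x i) \<in> H" using x unfolding c(2) by simp
      then show "(\<chi> i. f i (\<lambda>i. t * x i)) \<in> H" by (rule D[OF f H])
    qed (rule polyfun_dilate[OF P[OF f]])
  qed
qed

lemma full_rank_logv:
  fixes \<A> :: "(real ^ 'v::finite) set set"
  assumes cen: "central_arrangement \<A>"
  shows "full_rank (CARD('v)) (logv \<A>)"
proof -
  have "\<forall>H\<in>\<A>. \<exists>c. c \<noteq> 0 \<and> (\<forall>g. (\<chi> i. g i) \<in> H \<longleftrightarrow> (\<Sum>i\<in>UNIV. c $ i * g i) = 0)"
    using central_mem[OF cen] by (intro ballI)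
  then have "\<exists>c. \<forall>H\<in>\<A>. c H \<noteq> 0 \<and> (\<forall>g. (\<chi> i. g i) \<in> H \<longleftrightarrow> (\<Sum>i\<in>UNIV. c H $ i * g i) = 0)" by (rule bchoice)
  then obtain c where c: "\<forall>H\<in>\<A>. c H \<noteq> 0 \<and> (\<forall>g. (\<chi> i. g i) \<in> H \<longleftrightarrow> (\<Sum>i\<in>UNIV. c H $ i * g i) = 0)" by (elim exE)
  have fin: "finite \<A>" using cen by (simp add: central_arrangement_def)
  define p where "p x = (\<Prod>H\<in>\<A>. \<Sum>i\<in>UNIV. c H $ i * x i)" for x :: "'v \<Rightarrow> real"
  have lp: "(\<lambda>x. \<Sum>i\<in>UNIV. c H $ i * x i) \<in> polyfun" for H by (intro polyfun_intros)
  have pp: "p \<in> polyfun" unfolding p_def by (intro polyfun_prod lp)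
  have nz: "\<exists>x. (\<Sum>i\<in>UNIV. c H $ i * x i) \<noteq> 0" if "H \<in> \<A>" for H
  proof -
    have "c H \<bullet> c H \<noteq> 0" using c that by simp
    then show ?thesis by (intro exI[of _ "\<lambda>i. c H $ i"]) (simp add: inner_vec_def)
  qed
  have "\<exists>x. (\<Prod>H\<in>\<A>. \<Sum>i\<in>UNIV. c H $ i * x i) \<noteq> 0"
    by (rule polyfun_prod_nonzero[OF fin], rule lp, rule nz)
  then obtain x\<^sub>0 where "p x\<^sub>0 \<noteq> 0" unfolding p_def by (elim exE)
  moreover have "(\<lambda>b x. if b = a then p x else 0) \<in> logv \<A>" for a :: 'v
    unfolding logv_def mem_Collect_eq
  proof (intro conjI allI ballI impI)
    show "(\<lambda>x. if k = a then p x else 0) \<in> polyfun" for k by (intro polyfun_if pp polyfun.const)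
    fix H and x :: "'v \<Rightarrow> real" assume H: "H \<in> \<A>" and x: "(\<chi> i. x i) \<in> H"
    have "(\<Sum>i\<in>UNIV. c H $ i * x i) = 0" using bspec[OF c H] x by blast
    then have "p x = 0" unfolding p_def using fin H by (intro prod_zero) auto
    then have "(\<Sum>i\<in>UNIV. c H $ i * (if i = a then p x else 0)) = 0" by (intro sum.neutral) auto
    then show "(\<chi> i. if i = a then p x else 0) \<in> H"
      by (rule iffD2[OF spec[OF conjunct2[OF bspec[OF c H]], of "\<lambda>i. if i = a then p x else 0"]])
  qed
  ultimately show ?thesis unfolding full_rank_def using pp
    by (intro exI[of _ UNIV] exI[of _ p] exI[of _ x\<^sub>0]) simp
qed

theorem free_arrangement_iff:
  fixes \<A> :: "(real ^ 'v::finite) set set"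
  assumes cen: "central_arrangement \<A>"
  shows "free_arrangement \<A> \<longleftrightarrow> gens_le (CARD('v)) (logv \<A>)"
proof
  assume "free_arrangement \<A>"
  then show "gens_le (CARD('v)) (logv \<A>)"
    using gens_le_if_free[OF cen graded_module_logv[OF cen]] by (simp add: free_arrangement_def)
next
  assume "gens_le (CARD('v)) (logv \<A>)"
  then obtain f d where "hbasis (CARD('v)) (logv \<A>) f d"
    using ex_hbasis[OF graded_module_logv[OF cen] full_rank_logv[OF cen] gens_le_hom_if_gens_le] by blast
  then show "free_arrangement \<A>" using free_if_hbasis[OF cen] cen by (simp add: free_arrangement_def)
qed

section \<open>The cone of a weighted digraph\<close>

lemma logv_cone:
  fixes G :: "'n::finite wdigraph"
  shows "f \<in> logv (cone_arrangement G) \<longleftrightarrow> (\<forall>k. f k \<in> polyfun) \<and> (\<forall>x. x None = 0 \<longrightarrow> f None x = 0) \<and>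
    (\<forall>i j. i \<noteq> j \<longrightarrow> (\<forall>x. x (Some i) = x (Some j) \<longrightarrow> f (Some i) x = f (Some j) x)) \<and>
    (\<forall>i j. (i, j) \<in> edges G \<longrightarrow> (\<forall>x. x (Some i) - x (Some j) = x None \<longrightarrow> f (Some i) x - f (Some j) x = f None x)) \<and>
    (\<forall>i c. c \<in> weight G i \<longrightarrow> (\<forall>x. x (Some i) = of_int c * x None \<longrightarrow> f (Some i) x = of_int c * f None x))"
proof -
  let ?A = "{p :: real ^ 'n option. p $ None = 0}" and ?B = "\<lambda>i j. {p :: real ^ 'n option. p $ Some i - p $ Some j = 0}"
    and ?C = "\<lambda>i j. {p :: real ^ 'n option. p $ Some i - p $ Some j = p $ None}"
    and ?D = "\<lambda>i c. {p :: real ^ 'n option. p $ Some i = of_int c * p $ None}"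
  have m1: "?A \<in> cone_arrangement G" unfolding cone_arrangement_def by simp
  have m2: "?B i j \<in> cone_arrangement G" if "i \<noteq> j" for i j unfolding cone_arrangement_def
    by (rule UnI1, rule UnI1, rule UnI2, rule CollectI, rule exI[of _ i], rule exI[of _ j], rule conjI, rule refl, rule that)
  have m3: "?C i j \<in> cone_arrangement G" if "(i, j) \<in> edges G" for i j unfolding cone_arrangement_def
    by (rule UnI1, rule UnI2, rule CollectI, rule exI[of _ i], rule exI[of _ j], rule conjI, rule refl, rule that)
  have m4: "?D i c \<in> cone_arrangement G" if "c \<in> weight G i" for i c unfolding cone_arrangement_def
    by (rule UnI2, rule CollectI, rule exI[of _ i], rule exI[of _ c], rule conjI, rule refl, rule that)
  have iff: "(\<forall>H\<in>cone_arrangement G. Q H) \<longleftrightarrow> Q ?A \<and> (\<forall>i j. i \<noteq> j \<longrightarrow> Q (?B i j)) \<and>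
      (\<forall>i j. (i, j) \<in> edges G \<longrightarrow> Q (?C i j)) \<and> (\<forall>i c. c \<in> weight G i \<longrightarrow> Q (?D i c))" for Q
  proof
    assume L: "\<forall>H\<in>cone_arrangement G. Q H"
    show "Q ?A \<and> (\<forall>i j. i \<noteq> j \<longrightarrow> Q (?B i j)) \<and>
      (\<forall>i j. (i, j) \<in> edges G \<longrightarrow> Q (?C i j)) \<and> (\<forall>i c. c \<in> weight G i \<longrightarrow> Q (?D i c))"
    proof (intro conjI allI impI)
      show "Q ?A" by (rule bspec[OF L m1])
      show "Q (?B i j)" if "i \<noteq> j" for i j by (rule bspec[OF L m2[OF that]])
      show "Q (?C i j)" if "(i, j) \<in> edges G" for i j by (rule bspec[OF L m3[OF that]])
      show "Q (?D i c)" if "c \<in> weight G i" for i c by (rule bspec[OF L m4[OF that]])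
    qed
  next
    assume R: "Q ?A \<and> (\<forall>i j. i \<noteq> j \<longrightarrow> Q (?B i j)) \<and>
      (\<forall>i j. (i, j) \<in> edges G \<longrightarrow> Q (?C i j)) \<and> (\<forall>i c. c \<in> weight G i \<longrightarrow> Q (?D i c))"
    show "\<forall>H\<in>cone_arrangement G. Q H"
    proof
      fix H assume H: "H \<in> cone_arrangement G"
      consider "H = ?A" | i j where "i \<noteq> j" "H = ?B i j" | i j where "(i, j) \<in> edges G" "H = ?C i j"
        | i c where "c \<in> weight G i" "H = ?D i c"
        using H unfolding cone_arrangement_def Un_iff mem_Collect_eq singleton_iff
        by (elim disjE exE conjE) simp_all
      then show "Q H"
      proof cases
        case 1
        show ?thesis unfolding 1 by (rule conjunct1[OF R])
      next
        case (2 i j)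
        show ?thesis unfolding 2(2) by (rule mp[OF spec[OF spec[OF conjunct1[OF conjunct2[OF R]], of i], of j] 2(1)])
      next
        case (3 i j)
        show ?thesis unfolding 3(2)
          by (rule mp[OF spec[OF spec[OF conjunct1[OF conjunct2[OF conjunct2[OF R]]], of i], of j] 3(1)])
      next
        case (4 i c)
        show ?thesis unfolding 4(2)
          by (rule mp[OF spec[OF spec[OF conjunct2[OF conjunct2[OF conjunct2[OF R]]], of i], of c] 4(1)])
      qed
    qed
  qed
  show ?thesis unfolding logv_def mem_Collect_eq iff vec_lambda_beta right_minus_eq ..
qed

section \<open>Splitting off the Euler field, and the additional vertex\<close>

definition zquot :: "('n option \<Rightarrow> ('n option \<Rightarrow> real) \<Rightarrow> real) \<Rightarrow> ('n option \<Rightarrow> real) \<Rightarrow> real" where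
  "zquot f = (SOME h. h \<in> polyfun \<and> (\<forall>x. f None x = x None * h x))"

lemma zquot:
  assumes "f None \<in> polyfun" "\<And>x. x None = 0 \<Longrightarrow> f None x = 0"
  shows "zquot f \<in> polyfun" "f None x = x None * zquot f x"
proof -
  obtain h where "h \<in> polyfun" "\<And>x. f None x = (x None - 0) * h x"
    using polyfun_division[OF assms(1) polyfun.const[of 0], of None] assms(2) by auto
  then have "\<exists>h. h \<in> polyfun \<and> (\<forall>x. f None x = x None * h x)" by auto
  then have "zquot f \<in> polyfun \<and> (\<forall>x. f None x = x None * zquot f x)" unfolding zquot_def by (rule someI_ex)
  then show "zquot f \<in> polyfun" "f None x = x None * zquot f x" by auto
qed

lemma coord_cancel:
  assumes "p \<in> polyfun" "q \<in> polyfun" "\<And>x. x i * p x = x i * q x"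
  shows "p = q"
  by (rule ext, rule polyfun_mult_cancel[OF polyfun.coord[of i] assms(1,2), of "\<lambda>_. 1"]) (simp_all add: assms(3))

text \<open>The identity field is the Euler field, logarithmic because all hyperplanes are linear.
  Its coefficient in \<open>f\<close> is the \<open>z\<close>-component divided by \<open>z\<close>,
  possible because \<open>z = 0\<close> belongs to the cone.\<close>

lemma gens_le_logv_cone:
  fixes G :: "'n::finite wdigraph"
  assumes gm: "graded_module (logv (cone_arrangement G))"
  shows "gens_le (Suc r) (logv (cone_arrangement G)) \<longleftrightarrow> gens_le r {f \<in> logv (cone_arrangement G). f None = 0}"
proof (rule gens_le_split[where e = "\<lambda>k x. x k" and s = zquot, OF gm])
  let ?N = "logv (cone_arrangement G)"
  have nf: "f None \<in> polyfun" if f: "f \<in> ?N" for f using conjunct1[OF f[unfolded logv_cone]] by (rule spec)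
  have nz: "f None x = 0" if f: "f \<in> ?N" and x: "x None = 0" for f x
    by (rule mp[OF spec[OF conjunct1[OF conjunct2[OF f[unfolded logv_cone]]], of x] x])
  have z: "zquot f \<in> polyfun" "f None x = x None * zquot f x" if f: "f \<in> ?N" for f x
  proof -
    have a1: "f None \<in> polyfun" by (rule nf[OF f])
    have a2: "f None x = 0" if "x None = 0" for x by (rule nz[OF f, of x]) (rule that)
    show "zquot f \<in> polyfun" by (rule zquot(1)[of f, OF a1 a2])
    show "f None x = x None * zquot f x" by (rule zquot(2)[of f, OF a1 a2])
  qed
  show e: "(\<lambda>k x. x k) \<in> ?N" unfolding logv_cone by (simp add: polyfun.coord)
  show "zquot f \<in> polyfun" if "f \<in> ?N" for f by (rule z(1)[OF that])
  show "zquot (f + g) = zquot f + zquot g" if fg: "f \<in> ?N" "g \<in> ?N" for f g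
  proof (rule coord_cancel[where i = None])
    show "zquot (f + g) \<in> polyfun" by (rule z(1)[OF gm_add[OF gm fg]])
    show "zquot f + zquot g \<in> polyfun" by (rule polyfun_apply_add[OF z(1)[OF fg(1)] z(1)[OF fg(2)]])
    show "x None * zquot (f + g) x = x None * (zquot f + zquot g) x" for x
      using z(2)[OF gm_add[OF gm fg], of x] z(2)[OF fg(1), of x] z(2)[OF fg(2), of x] by (simp add: distrib_left)
  qed
  show "zquot (p \<odot> f) = p * zquot f" if p: "p \<in> polyfun" and f: "f \<in> ?N" for p f
  proof (rule coord_cancel[where i = None])
    show "zquot (p \<odot> f) \<in> polyfun" by (rule z(1)[OF gm_smul[OF gm p f]])
    show "p * zquot f \<in> polyfun" using polyfun.mult[OF p z(1)[OF f]] by (simp add: times_fun_def)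
    show "x None * zquot (p \<odot> f) x = x None * (p * zquot f) x" for x
      using z(2)[OF gm_smul[OF gm p f], of x] z(2)[OF f, of x] by (auto simp: mult.left_commute)
  qed
  let ?e = "\<lambda>(k :: 'n option) (x :: 'n option \<Rightarrow> real). x k"
  have z1: "zquot ?e \<in> polyfun" by (rule z(1)[OF e])
  have o1: "(1 :: ('n option \<Rightarrow> real) \<Rightarrow> real) \<in> polyfun" using polyfun.const[of 1] by (simp add: one_fun_def)
  have "x None * zquot ?e x = x None * (1 :: ('n option \<Rightarrow> real) \<Rightarrow> real) x" for x
    using z(2)[OF e, of x] by auto
  then show "zquot ?e = 1" by (rule coord_cancel[where i = None, OF z1 o1])
  show "{f \<in> ?N. f None = 0} = {f \<in> ?N. zquot f = 0}"
  proof -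
    have "f None = 0 \<longleftrightarrow> zquot f = 0" if f: "f \<in> ?N" for f
    proof
      assume a: "f None = 0"
      show "zquot f = 0"
      proof (rule coord_cancel[where i = None, OF z(1)[OF f] polyfun_zero])
        fix x show "x None * zquot f x = x None * 0 x" using z(2)[OF f, of x] a by auto
      qed
    next
      assume a: "zquot f = 0"
      show "f None = 0"
      proof
        fix x show "f None x = 0 x" using z(2)[OF f, of x] a by auto
      qed
    qed
    then show ?thesis by blast
  qed
qed

text \<open>The vertices are \<open>'n option\<close>, where \<open>None\<close> is an additional vertex whose coordinate is
  normalised to \<open>0\<close>; the hyperplanes \<open>x\<^sub>i = c z\<close> become \<open>x\<^sub>i - x\<^sub>0 = c z\<close>.\<close>

definition lG :: "'n wdigraph \<Rightarrow> 'n option \<Rightarrow> 'n option \<Rightarrow> int" where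
  "lG G a b = (case a of None \<Rightarrow> (case b of None \<Rightarrow> 0 | Some i \<Rightarrow> - hi G i)
     | Some i \<Rightarrow> (case b of None \<Rightarrow> lo G i | Some j \<Rightarrow> if (j, i) \<in> edges G then - 1 else 0))"

lemma lG_simps [simp]:
  "lG G None (Some i) = - hi G i" "lG G (Some i) None = lo G i"
  "lG G (Some i) (Some j) = (if (j, i) \<in> edges G then - 1 else 0)" "lG G None None = 0"
  by (simp_all add: lG_def)

lemma affgI:
  assumes "\<And>a. f a \<in> polyfun" and "\<And>a b c x. a \<noteq> b \<Longrightarrow> l a b \<le> c \<Longrightarrow> c \<le> - l b a \<Longrightarrow>
      x (Some a) - x (Some b) = of_int c * x None \<Longrightarrow> f a x = f b x" and "f w = 0"
  shows "f \<in> affg w l"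
  unfolding affg_def aff_def mem_Collect_eq
  by (intro conjI allI impI) (rule assms(1), rule assms(2), assumption+, rule assms(3))

text \<open>The affine module has one variable more, the coordinate of the vertex 0. Restriction to
  the hyperplane where it vanishes is onto by translation invariance.\<close>

lemma gens_le_cone_aff:
  fixes G :: "'n::finite wdigraph"
  shows "gens_le r {f \<in> logv (cone_arrangement G). f None = 0} \<longleftrightarrow> gens_le r (affg None (lG G))"
proof -
  let ?N = "{f \<in> logv (cone_arrangement G). f None = 0}" and ?M = "affg None (lG G)"
  let ?\<tau> = "map_option Some :: 'n option \<Rightarrow> 'n option option" and ?v = "Some None :: 'n option option"
  have \<tau>: "inj ?\<tau>" by (rule option.inj_map[OF inj_Some])
  have rng: "range ?\<tau> = - {?v}"
  proof (rule set_eqI)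
    fix y :: "'n option option"
    show "y \<in> range ?\<tau> \<longleftrightarrow> y \<in> - {?v}"
    proof (cases y)
      case None
      then have "y = ?\<tau> None" by simp
      then show ?thesis using None by blast
    next
      case (Some z)
      show ?thesis
      proof (cases z)
        case None
        have "?v \<noteq> ?\<tau> u" for u by (cases u) auto
        then show ?thesis using Some None by (auto simp: image_iff)
      next
        case (Some i)
        then have y: "y = ?\<tau> (Some i)" using \<open>y = Some z\<close> by simp
        then have "y \<in> range ?\<tau>" by (rule range_eqI)
        moreover have "y \<noteq> ?v" using y by simp
        ultimately show ?thesis by simp
      qed
    qed
  qed
  have e0: "extend0 ?v ?\<tau> x None = x None" "extend0 ?v ?\<tau> x (Some (Some i)) = x (Some i)" for x i
    using extend0_other[OF \<tau> rng, of x None] extend0_other[OF \<tau> rng, of x "Some i"] by simp_all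
  have res: "restrict0 ?v ?\<tau> f \<in> ?N" if f: "f \<in> ?M" for f
  proof -
    have fa: "f \<in> aff (lG G)" and f0: "f None x = 0" for x using f by (auto simp: affg_def)
    have fp: "f k \<in> polyfun" for k using fa by (simp add: aff_def)
    have rp: "restrict0 ?v ?\<tau> f k \<in> polyfun" for k
      using polyfun_extend0[OF fp[of k], of ?v ?\<tau>] by (simp add: restrict0_def)
    have 1: "f (Some i) (extend0 ?v ?\<tau> x) = f (Some j) (extend0 ?v ?\<tau> x)" if "i \<noteq> j" "x (Some i) = x (Some j)" for i j x
      using that by (intro affD[OF fa, of "Some i" "Some j" 0]) (auto simp: e0)
    have 2: "f (Some i) (extend0 ?v ?\<tau> x) = f (Some j) (extend0 ?v ?\<tau> x)"
      if "(i, j) \<in> edges G" "x (Some i) - x (Some j) = x None" for i j x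
      using that by (cases "i = j") (auto intro!: affD[OF fa, of "Some i" "Some j" 1] simp: e0)
    have 3: "f (Some i) (extend0 ?v ?\<tau> x) = 0" if "c \<in> weight G i" "x (Some i) = of_int c * x None" for i c x
      using that f0 affD[OF fa, of "Some i" None c "extend0 ?v ?\<tau> x"] by (simp add: e0 weight_def)
    show ?thesis unfolding mem_Collect_eq logv_cone
    proof (intro conjI allI impI)
      show "restrict0 ?v ?\<tau> f k \<in> polyfun" for k by (rule rp)
      show "restrict0 ?v ?\<tau> f None x = 0" for x using f0 by simp
      show "restrict0 ?v ?\<tau> f (Some i) x = restrict0 ?v ?\<tau> f (Some j) x" if "i \<noteq> j" "x (Some i) = x (Some j)" for i j x
        using 1[OF that] by simp
      show "restrict0 ?v ?\<tau> f (Some i) x - restrict0 ?v ?\<tau> f (Some j) x = restrict0 ?v ?\<tau> f None x"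
        if "(i, j) \<in> edges G" "x (Some i) - x (Some j) = x None" for i j x using 2[OF that] f0 by simp
      show "restrict0 ?v ?\<tau> f (Some i) x = of_int c * restrict0 ?v ?\<tau> f None x"
        if "c \<in> weight G i" "x (Some i) = of_int c * x None" for i c x using 3[OF that] f0 by simp
      show "restrict0 ?v ?\<tau> f None = 0" using f0 by (intro ext) simp
    qed
  qed
  have surj: "\<exists>F\<in>?M. restrict0 ?v ?\<tau> F = g" if g: "g \<in> ?N" for g
  proof -
    \<comment> \<open>The lift evaluates \<open>g\<close> at the differences with the coordinate of
      the vertex 0.\<close>
    let ?s = "\<lambda>(y :: 'n option option \<Rightarrow> real) k. case k of None \<Rightarrow> y None | Some i \<Rightarrow> y (Some (Some i)) - y ?v"
    have gl: "g \<in> logv (cone_arrangement G)" and g0: "g None x = 0" for x using g by auto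
    note c0 = gl[unfolded logv_cone]
    note k1 = conjunct1[OF conjunct2[OF conjunct2[OF c0]]] and k2 = conjunct1[OF conjunct2[OF conjunct2[OF conjunct2[OF c0]]]]
      and k3 = conjunct2[OF conjunct2[OF conjunct2[OF conjunct2[OF c0]]]]
    have gp: "g k \<in> polyfun" for k using conjunct1[OF c0] by (rule spec)
    have c1: "g (Some i) x = g (Some j) x" if "i \<noteq> j" "x (Some i) = x (Some j)" for i j x
      by (rule mp[OF spec[OF mp[OF spec[OF spec[OF k1, of i], of j] that(1)], of x] that(2)])
    have c2: "g (Some i) x = g (Some j) x" if "(i, j) \<in> edges G" "x (Some i) - x (Some j) = x None" for i j x
    proof -
      have "g (Some i) x - g (Some j) x = g None x" 
        by (rule mp[OF spec[OF mp[OF spec[OF spec[OF k2, of i], of j] that(1)], of x] that(2)])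
      then show ?thesis using g0 by simp
    qed
    have c3: "g (Some i) x = 0" if "c \<in> weight G i" "x (Some i) = of_int c * x None" for i c x
    proof -
      have "g (Some i) x = of_int c * g None x" 
        by (rule mp[OF spec[OF mp[OF spec[OF spec[OF k3, of i], of c] that(1)], of x] that(2)])
      then show ?thesis using g0 by simp
    qed
    define F where "F a y = g a (?s y)" for a y
    have Fp: "F a \<in> polyfun" for a
    proof -
      have "(\<lambda>y. g a (\<lambda>k. (\<lambda>y. ?s y k) y)) \<in> polyfun"
      proof (rule polyfun_compose[OF gp])
        fix k show "(\<lambda>y. ?s y k) \<in> polyfun" by (cases k) (auto intro!: polyfun_diff polyfun.coord)
      qed
      then show ?thesis unfolding F_def .
    qed
    have Fe: "F a y = F b y" if ab: "a \<noteq> b" "lG G a b \<le> c" "c \<le> - lG G b a" "y (Some a) - y (Some b) = of_int c * y None" for a b c y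
    proof (cases a)
      case None
      then obtain i where i: "b = Some i" using ab(1) by (cases b) auto
      have "g (Some i) (?s y) = 0"
        by (rule c3[of "- c"]) (use ab None i in \<open>auto simp: weight_def\<close>)
      then show ?thesis using None i g0 by (simp add: F_def)
    next
      case a: (Some i)
      show ?thesis
      proof (cases b)
        case None
        have "g (Some i) (?s y) = 0" by (rule c3[of c]) (use ab None a in \<open>auto simp: weight_def\<close>)
        then show ?thesis using None a g0 by (simp add: F_def)
      next
        case b: (Some j)
        have ij: "i \<noteq> j" using ab(1) a b by simp
        consider "c = 0" | "c = 1" "(i, j) \<in> edges G" | "c = - 1" "(j, i) \<in> edges G"
        proof -
          assume h: "c = 0 \<Longrightarrow> thesis" "c = 1 \<Longrightarrow> (i, j) \<in> edges G \<Longrightarrow> thesis" "c = - 1 \<Longrightarrow> (j, i) \<in> edges G \<Longrightarrow> thesis"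
          have l: "(if (j, i) \<in> edges G then - 1 else 0) \<le> c" "c \<le> (if (i, j) \<in> edges G then 1 else 0)"
            using ab(2,3) a b by auto
          have "- 1 \<le> c" "c \<le> 1" using l by (auto split: if_splits)
          then have "c = 0 \<or> c = 1 \<or> c = - 1" by presburger
          then show thesis using h l by (elim disjE) (auto split: if_splits)
        qed
        then have "g (Some i) (?s y) = g (Some j) (?s y)"
        proof cases
          case 1
          then show ?thesis using ab(4) a b by (intro c1[OF ij]) simp
        next
          case 2
          then show ?thesis using ab(4) a b by (intro c2) simp_all
        next
          case 3
          then show ?thesis using ab(4) a b by (intro c2[symmetric]) simp_all
        qed
        then show ?thesis using a b by (simp add: F_def)
      qed
    qed
    have F0: "F None = 0" using g0 by (intro ext) (simp add: F_def)
    have "F \<in> ?M" by (rule affgI) (rule Fp, rule Fe, assumption+, rule F0)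
    have s_ext: "?s (extend0 ?v ?\<tau> x) = x" for x
      by (rule ext) (auto simp: e0 split: option.split)
    have "restrict0 ?v ?\<tau> F a x = g a x" for a x by (simp only: restrict0_apply F_def s_ext)
    then have "restrict0 ?v ?\<tau> F = g" by (intro ext)
    with \<open>F \<in> ?M\<close> show ?thesis by (intro bexI[of _ F])
  qed
  have sat: "h \<in> ?M" if hp: "\<And>a. h a \<in> polyfun" and h: "(\<lambda>x. x ?v) \<odot> h \<in> ?M" for h
  proof -
    have ha: "(\<lambda>x. x ?v) \<odot> h \<in> aff (lG G)" and h0: "x ?v * h None x = 0" for x
      using h by (auto simp: affg_def fun_eq_iff)
    \<comment> \<open>The equation is solved for \<open>x_a\<close> with \<open>a\<close> different
      from the vertex 0, so that the factor \<open>x_0\<close> stays a free variable and can be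
      cancelled; the other case follows by exchanging \<open>a\<close> and \<open>b\<close>.\<close>
    have one: "h a x = h b x" if ab: "a \<noteq> b" "a \<noteq> None" "lG G a b \<le> c" "c \<le> - lG G b a"
      and x: "x (Some a) - x (Some b) = of_int c * x None" for a b c x
    proof -
      let ?u = "\<lambda>y :: 'n option option \<Rightarrow> real. y(Some a := y (Some b) + of_int c * y None)"
      have up: "(\<lambda>y. p (?u y)) \<in> polyfun" if "p \<in> polyfun" for p
        by (rule polyfun_compose_upd[OF that]) (intro polyfun_intros)
      define D where "D y = h a (?u y) - h b (?u y)" for y
      have Dp: "D \<in> polyfun" unfolding D_def by (intro polyfun_diff up hp)
      have z: "y ?v * D y = 0" for y
      proof -
        have "((\<lambda>x. x ?v) \<odot> h) a (?u y) = ((\<lambda>x. x ?v) \<odot> h) b (?u y)"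
          by (rule affD[OF ha ab(1,3,4)]) (use ab(1) in simp)
        then show ?thesis using ab(2) by (simp add: D_def right_diff_distrib)
      qed
      have "D x = 0" by (rule polyfun_mult_eq_0[OF polyfun.coord[of ?v] Dp z, of "\<lambda>_. 1"]) simp
      moreover have "?u x = x" using x by (intro fun_upd_idem) simp
      ultimately show ?thesis by (simp add: D_def)
    qed
    have he: "h a x = h b x" if ab: "a \<noteq> b" "lG G a b \<le> c" "c \<le> - lG G b a"
      and x: "x (Some a) - x (Some b) = of_int c * x None" for a b c x
    proof (cases "a = None")
      case True
      have "h b x = h a x" by (rule one[of b a "- c"]) (use ab x True in auto)
      then show ?thesis by simp
    next
      case False
      show ?thesis by (rule one[OF ab(1) False ab(2,3) x])
    qed
    have hN: "h None = 0"
      by (rule coord_cancel[where i = ?v]) (use h0 hp in \<open>auto simp: polyfun_zero\<close>)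
    show ?thesis by (rule affgI) (rule hp, rule he, assumption+, rule hN)
  qed
  show ?thesis
  proof
    assume M: "gens_le r ?M"
    show "gens_le r ?N"
    proof (rule gens_le_restrict_imp[where N = ?M and M = ?N and v = ?v and \<tau> = ?\<tau>, OF \<tau> rng])
      show "restrict0 ?v ?\<tau> f \<in> ?N" if "f \<in> ?M" for f by (rule res[OF that])
      show "\<exists>F\<in>?M. restrict0 ?v ?\<tau> F = g" if "g \<in> ?N" for g by (rule surj[OF that])
      show "gens_le r ?M" by (rule M)
    qed
  next
    assume N: "gens_le r ?N"
    show "gens_le r ?M"
    proof (rule gens_le_restrict_conv[where N = ?M and M = ?N and v = ?v and \<tau> = ?\<tau>, OF \<tau> rng])
      show "restrict0 ?v ?\<tau> f \<in> ?N" if "f \<in> ?M" for f by (rule res[OF that])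
      show "\<exists>F\<in>?M. restrict0 ?v ?\<tau> F = g" if "g \<in> ?N" for g by (rule surj[OF that])
      show "graded_module ?M" by (rule graded_module_affg)
      show "h \<in> ?M" if "\<And>a. h a \<in> polyfun" "(\<lambda>x. x ?v) \<odot> h \<in> ?M" for h by (rule sat[OF that])
      show "gens_le r ?N" by (rule N)
    qed
  qed
qed

theorem free_cone_iff:
  fixes G :: "'n::finite wdigraph"
  assumes "vertex_weighted_digraph G"
  shows "free_arrangement (cone_arrangement G) \<longleftrightarrow> gens_le (Suc (CARD('n))) (aff (lG G))"
proof -
  note cen = central_arrangement_cone_arrangement[OF assms]
  have "free_arrangement (cone_arrangement G) \<longleftrightarrow> gens_le (Suc (CARD('n))) (logv (cone_arrangement G))"
    using free_arrangement_iff[OF cen] by simp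
  also have "\<dots> \<longleftrightarrow> gens_le (CARD('n)) (affg None (lG G))"
    unfolding gens_le_logv_cone[OF graded_module_logv[OF cen]] gens_le_cone_aff ..
  also have "\<dots> \<longleftrightarrow> gens_le (Suc (CARD('n))) (aff (lG G))" by (rule gens_le_affg[symmetric])
  finally show ?thesis .
qed

lemma aff_cong: "(\<And>a b. a \<noteq> b \<Longrightarrow> l a b = l' a b) \<Longrightarrow> aff l = aff l'"
  by (auto simp: aff_def)

section \<open>The two shifts from the common arrangement\<close>

lemma gens_le_coking:
  fixes G :: "'n::finite wdigraph"
  assumes G: "vertex_weighted_digraph G" and Z: "condition_Z G v" and ck: "coking G v"
    and zero: "\<And>i. 0 \<in> weight G i" and sub: "\<And>i. i \<noteq> v \<Longrightarrow> {lo G i..hi G i - 1} \<subseteq> weight G v"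
  shows "gens_le (Suc (CARD('n))) (aff (lG G)) \<longleftrightarrow> gens_le (Suc (CARD('n))) (aff (lG (coking_elimination v G)))"
proof -
  have z: "lo G i \<le> 0" "0 \<le> hi G i" for i using zero[of i] by (auto simp: weight_def)
  have e: "(u, v) \<in> edges G" if "u \<noteq> v" for u using ck that by (simp add: coking_def)
  have lov: "lo G v \<le> lo G i" "hi G i - 1 \<le> hi G v" if i: "i \<noteq> v" for i
  proof -
    have "lo G v \<le> lo G i \<and> hi G i - 1 \<le> hi G v"
    proof (cases "lo G i \<le> hi G i - 1")
      case True
      then have "lo G i \<in> {lo G i..hi G i - 1}" "hi G i - 1 \<in> {lo G i..hi G i - 1}" by auto
      then have "lo G i \<in> weight G v" "hi G i - 1 \<in> weight G v" using sub[OF i] by blast+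
      then show ?thesis by (simp add: weight_def)
    next
      \<comment> \<open>An empty interval forces \<open>lo G i = hi G i = 0\<close>, because 0 is a
        weight of \<open>i\<close>; both bounds then follow from 0 being a weight of
        \<open>v\<close>.\<close>
      case False
      then show ?thesis using z[of i] z[of v] by linarith
    qed
    then show "lo G v \<le> lo G i" "hi G i - 1 \<le> hi G v" by auto
  qed
  obtain n\<^sub>0 :: nat where n0: "n\<^sub>0 + 2 \<le> card (weight G v)" "card (weight G v) \<le> n\<^sub>0 + 3"
    "\<And>i. i \<noteq> v \<Longrightarrow> n\<^sub>0 + 1 \<le> card (weight G i) \<and> card (weight G i) \<le> n\<^sub>0 + 3"
    using Z unfolding condition_Z_def by blast
  have card: "int (card (weight G i)) = hi G i - lo G i + 1" for i using z[of i] by (simp add: weight_def)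
  have cv: "int n\<^sub>0 + 2 \<le> hi G v - lo G v + 1" "hi G v - lo G v + 1 \<le> int n\<^sub>0 + 3"
    using n0(1,2) card[of v] by linarith+
  have ci: "int n\<^sub>0 + 1 \<le> hi G i - lo G i + 1" "hi G i - lo G i + 1 \<le> int n\<^sub>0 + 3" if "i \<noteq> v" for i
    using n0(3)[OF that] card[of i] by linarith+
  \<comment> \<open>The common arrangement: adding 1 in the row of \<open>v\<close> deletes the
    hyperplane \<open>x_i - x_v = z\<close> of every edge into \<open>v\<close> and the hyperplane
    of the lowest weight of \<open>v\<close>.\<close>
  define l where "l a b = lG G a b + (if a = Some v then 1 else 0)" for a b
  \<comment> \<open>Two vertices of \<open>G\<close> have multiplicity 1 to 3, within one of 1 + 1.
    The pair (0, i) has \<open>card (weight G i)\<close>, for \<open>v\<close> diminished by one,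
    within one of (n0 + 1) + 1.\<close>
  define n :: "'n option \<Rightarrow> nat" where "n a = (if a = None then n\<^sub>0 + 1 else 1)" for a
  have n: "n a \<ge> 1" for a by (simp add: n_def)
  have bal: "\<bar>1 - l a b - l b a - int (n a) - int (n b)\<bar> \<le> 1" if "a \<noteq> b" for a b
  proof -
    have Ni: "\<bar>1 - l None (Some i) - l (Some i) None - int (n None) - int (n (Some i))\<bar> \<le> 1" for i
      using cv ci[of i] by (cases "i = v") (simp_all add: l_def n_def)
    have ij: "\<bar>1 - l (Some i) (Some j) - l (Some j) (Some i) - int (n (Some i)) - int (n (Some j))\<bar> \<le> 1" if "i \<noteq> j" for i j
      using that e[of i] e[of j] by (cases "i = v"; cases "j = v") (simp_all add: l_def n_def)
    show ?thesis
    proof (cases a)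
      case None
      then show ?thesis using that Ni by (cases b) auto
    next
      case a: (Some i)
      show ?thesis
      proof (cases b)
        case None
        then show ?thesis using Ni[of i] a by (simp add: algebra_simps)
      next
        case (Some j)
        then show ?thesis using ij[of i j] a that by simp
      qed
    qed
  qed
  have CARD: "CARD('n option) - 1 = CARD('n)" by simp
  have "gens_le (CARD('n option) - 1) (affg (Some v) (shift_at (Some v) l)) \<longleftrightarrow>
      gens_le (CARD('n option) - 1) (affg (Some v) l)"
  proof (rule gens_le_shift_iff[where n = n, OF _ _ n bal])
    fix a assume a: "a \<noteq> Some v"
    show "l (Some v) a + l a (Some v) \<le> 1" using a z[of v] cv e by (cases a) (auto simp: l_def)
    fix b assume b: "b \<noteq> Some v" "a \<noteq> b"
    \<comment> \<open>With \<open>a\<close> the vertex 0 this is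
      \<open>hi G j - 1 \<le> hi G v\<close>, and with \<open>b\<close> the vertex 0 it follows from
      \<open>lo G v \<le> lo G i\<close>: this is where the interval inclusions enter.\<close>
    show "l a (Some v) + l (Some v) b \<le> l a b + 1"
    proof (cases a)
      case None
      then obtain j where j: "b = Some j" using b by (cases b) auto
      then show ?thesis using None b lov(2)[of j] e[of j] by (simp add: l_def)
    next
      case ai: (Some i)
      then show ?thesis using a b lov(1)[of i] e by (cases b) (auto simp: l_def)
    qed
  qed
  moreover have "shift_at (Some v) l = lG G" by (intro ext) (simp add: shift_at_def l_def)
  ultimately have 1: "gens_le (CARD('n)) (affg (Some v) (lG G)) \<longleftrightarrow> gens_le (CARD('n)) (affg (Some v) l)"
    unfolding CARD by simp
  \<comment> \<open>The elimination lowers the entries \<open>l b None\<close>, a column of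
    \<open>l\<close>, whereas \<open>shift_at\<close> acts on a row; hence the transpose.\<close>
  let ?l = "\<lambda>a b. l b a"
  have "gens_le (CARD('n option) - 1) (affg None (shift_at None ?l)) \<longleftrightarrow> gens_le (CARD('n option) - 1) (affg None ?l)"
  proof (rule gens_le_shift_iff[where n = n, OF _ _ n])
    show "\<bar>1 - l b a - l a b - int (n a) - int (n b)\<bar> \<le> 1" if "a \<noteq> b" for a b
      using bal[of b a] that by (simp add: algebra_simps)
    fix a :: "'n option" assume "a \<noteq> None"
    then obtain i where i: "a = Some i" by auto
    show "l a None + l None a \<le> 1" using i z[of i] cv by (cases "i = v") (simp_all add: l_def)
    fix b assume "b \<noteq> None" "a \<noteq> b"
    then obtain j where j: "b = Some j" "i \<noteq> j" using i by auto
    \<comment> \<open>Here the triangle inequality comes from 0 being a weight of every vertex, so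
      that lower ends are at most 0 and upper ends at least 0.\<close>
    show "l None a + l b None \<le> l b a + 1"
      using i j z(2)[of i] z(1)[of j] e[of i] by (cases "j = v") (simp_all add: l_def)
  qed
  then have 2: "gens_le (CARD('n)) (affg None (shift_at None ?l)) \<longleftrightarrow> gens_le (CARD('n)) (affg None ?l)"
    unfolding CARD .
  have "shift_at None ?l a b = (\<lambda>a b. lG (coking_elimination v G) b a) a b" if "a \<noteq> b" for a b
    using that by (cases a; cases b) (auto simp: shift_at_def l_def coking_elimination_def e)
  then have 3: "aff (shift_at None ?l) = aff (\<lambda>a b. lG (coking_elimination v G) b a)" by (rule aff_cong)
  have "gens_le (Suc (CARD('n))) (aff (lG G)) \<longleftrightarrow> gens_le (CARD('n)) (affg (Some v) (lG G))" by (rule gens_le_affg)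
  also note 1
  also have "gens_le (CARD('n)) (affg (Some v) l) \<longleftrightarrow> gens_le (Suc (CARD('n))) (aff l)" by (rule gens_le_affg[symmetric])
  also have "\<dots> \<longleftrightarrow> gens_le (Suc (CARD('n))) (aff ?l)" by (rule gens_le_aff_transpose[symmetric])
  also have "\<dots> \<longleftrightarrow> gens_le (CARD('n)) (affg None ?l)" by (rule gens_le_affg)
  also note 2[symmetric]
  also have "gens_le (CARD('n)) (affg None (shift_at None ?l)) \<longleftrightarrow> gens_le (Suc (CARD('n))) (aff (shift_at None ?l))"
    by (rule gens_le_affg[symmetric])
  also have "\<dots> \<longleftrightarrow> gens_le (Suc (CARD('n))) (aff (lG (coking_elimination v G)))"
    unfolding 3 by (rule gens_le_aff_transpose)
  finally show ?thesis .
qed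

lemma free_coking:
  fixes G :: "'n::finite wdigraph"
  assumes G: "vertex_weighted_digraph G" and "condition_Z G v" "coking G v"
    "\<And>i. 0 \<in> weight G i" "\<And>i. i \<noteq> v \<Longrightarrow> {lo G i..hi G i - 1} \<subseteq> weight G v"
  shows "free_arrangement (cone_arrangement G) \<longleftrightarrow> free_arrangement (cone_arrangement (coking_elimination v G))"
proof -
  have "lo G i \<le> hi G i" for i using G by (simp add: vertex_weighted_digraph_def)
  then have "lo G i - 1 \<le> hi G i" for i by (simp add: order.trans[of "lo G i - 1" "lo G i"])
  then have "vertex_weighted_digraph (coking_elimination v G)"
    using G by (auto simp: vertex_weighted_digraph_def coking_elimination_def)
  from free_cone_iff[OF this] gens_le_coking[OF assms] show ?thesis unfolding free_cone_iff[OF G] by simp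
qed

section \<open>Reversal, which exchanges kings and cokings\<close>

text \<open>The effect of replacing \<open>z\<close> by \<open>- z\<close> on the digraph; on the
  data \<open>lG\<close> it is the transposition.\<close>

definition reversed :: "'n wdigraph \<Rightarrow> 'n wdigraph" where
  "reversed G = \<lparr> edges = (edges G)\<inverse>, lo = (\<lambda>i. - hi G i), hi = (\<lambda>i. - lo G i) \<rparr>"

lemma vertex_weighted_digraph_reversed: "vertex_weighted_digraph G \<Longrightarrow> vertex_weighted_digraph (reversed G)"
  by (auto simp: vertex_weighted_digraph_def reversed_def)

lemma free_reversed:
  fixes G :: "'n::finite wdigraph"
  assumes "vertex_weighted_digraph G"
  shows "free_arrangement (cone_arrangement (reversed G)) \<longleftrightarrow> free_arrangement (cone_arrangement G)"
proof -
  have eq: "lG (reversed G) = (\<lambda>a b. lG G b a)"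
  proof (intro ext)
    fix a b show "lG (reversed G) a b = lG G b a" by (cases a; cases b) (simp_all add: reversed_def)
  qed
  show ?thesis
    unfolding free_cone_iff[OF assms] free_cone_iff[OF vertex_weighted_digraph_reversed[OF assms]] eq
    by (rule gens_le_aff_transpose)
qed

lemma reversed_king: "reversed (king_elimination v G) = coking_elimination v (reversed G)"
  by (auto simp: reversed_def king_elimination_def coking_elimination_def)

lemma card_weight_reversed: "card (weight (reversed G) i) = card (weight G i)"
  by (simp add: weight_def reversed_def algebra_simps)

theorem theorem4p1:
  fixes G :: "'n::finite wdigraph" and v :: 'n
  assumes "vertex_weighted_digraph G"
    and "condition_Z G v"
  shows "(coking G v \<and> (\<forall>i. 0 \<in> weight G i) \<and>
            (\<forall>i. i \<noteq> v \<longrightarrow> {lo G i..hi G i - 1} \<subseteq> weight G v) \<longrightarrow>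
          (free_arrangement (cone_arrangement G) \<longleftrightarrow> free_arrangement (cone_arrangement (coking_elimination v G)))) \<and>
         (king G v \<and> (\<forall>i. 0 \<in> weight G i) \<and>
            (\<forall>i. i \<noteq> v \<longrightarrow> {lo G i + 1..hi G i} \<subseteq> weight G v) \<longrightarrow>
          (free_arrangement (cone_arrangement G) \<longleftrightarrow> free_arrangement (cone_arrangement (king_elimination v G))))"
proof (intro conjI impI)
  assume "coking G v \<and> (\<forall>i. 0 \<in> weight G i) \<and> (\<forall>i. i \<noteq> v \<longrightarrow> {lo G i..hi G i - 1} \<subseteq> weight G v)"
  then show "free_arrangement (cone_arrangement G) \<longleftrightarrow> free_arrangement (cone_arrangement (coking_elimination v G))"
    by (intro free_coking[OF assms]) auto
next
  assume k: "king G v \<and> (\<forall>i. 0 \<in> weight G i) \<and> (\<forall>i. i \<noteq> v \<longrightarrow> {lo G i + 1..hi G i} \<subseteq> weight G v)"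
  have "lo G i \<le> hi G i" for i using assms(1) by (simp add: vertex_weighted_digraph_def)
  then have "lo G i \<le> hi G i + 1" for i by (simp add: add_increasing2)
  then have wf: "vertex_weighted_digraph (king_elimination v G)"
    using assms(1) by (auto simp: vertex_weighted_digraph_def king_elimination_def)
  \<comment> \<open>The king case is the coking case of the reversed digraph.\<close>
  have "free_arrangement (cone_arrangement (reversed G)) \<longleftrightarrow>
      free_arrangement (cone_arrangement (coking_elimination v (reversed G)))"
  proof (rule free_coking[OF vertex_weighted_digraph_reversed[OF assms(1)]])
    show "condition_Z (reversed G) v" using assms(2) by (simp add: condition_Z_def card_weight_reversed)
    show "coking (reversed G) v" using k by (auto simp: coking_def king_def reversed_def)
    show "0 \<in> weight (reversed G) i" for i
    proof -
      have "0 \<in> weight G i" using k by blast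
      then show ?thesis by (simp add: weight_def reversed_def)
    qed
    show "{lo (reversed G) i..hi (reversed G) i - 1} \<subseteq> weight (reversed G) v" if i: "i \<noteq> v" for i
    proof
      fix c assume "c \<in> {lo (reversed G) i..hi (reversed G) i - 1}"
      then have "- c \<in> {lo G i + 1..hi G i}" by (simp add: reversed_def)
      then have "- c \<in> weight G v" using k i by blast
      then show "c \<in> weight (reversed G) v" by (simp add: weight_def reversed_def)
    qed
  qed
  then show "free_arrangement (cone_arrangement G) \<longleftrightarrow> free_arrangement (cone_arrangement (king_elimination v G))"
    unfolding reversed_king[symmetric] free_reversed[OF assms(1)] free_reversed[OF wf] .
qed

end
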